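(* Let $I\subset\mathbb R$ be an open interval containing $0$, and let $V_\varepsilon$, $\varepsilon\in I$, be compactly supported real-valued radial functions in $L^\infty(\mathbb R^2)$ such that $\varepsilon\mapsto V_\varepsilon$ is smooth from $I$ to $L^\infty(\mathbb R^2)$ and its derivative at $\varepsilon=0$ is a nonnegative function which is not identically zero. Let $P_\varepsilon=-\Delta+V_\varepsilon$. Suppose that for $\varepsilon<0$ there are $\psi_\varepsilon\in L^2(\mathbb R^2)$ with $\|\psi_\varepsilon\|=1$, $P_\varepsilon\psi_\varepsilon=E_\varepsilon\psi_\varepsilon$, $\partial_\theta\psi_\varepsilon=i\ell\psi_\varepsilon$ (with $\ell\in\mathbb Z$), and $E_\varepsilon\uparrow0$ as $\varepsilon\uparrow0$. (1) If $|\ell|>1$, then $P_0$ has a zero eigenvalue and there are a constant $\alpha_0(\ell)>0$ and an $\varepsilon_0>0$ so that for $0<\varepsilon<\varepsilon_0$, $P_\varepsilon$ has a resonance in the fourth quadrant satisfying $$\lambda_\varepsilon=\sqrt{\alpha_0(\ell)\varepsilon}+O\big(\varepsilon^{3/2}(1+\delta_{|\ell|,2}\log\varepsilon)\big).$$ Counting with multiplicity, there is a resonance for each $\ell$ satisfying these conditions. (2) If $|\ell|=1$, then $P_0$ has a $p$-resonance and there are constants $\alpha_0>0$, $b=\operatorname{Re}b+i\pi/2$ and an $\varepsilon_0>0$ so that for $0<\varepsilon<\varepsilon_0$, $P_\varepsilon$ has a resonance in the fourth quadrant satisfying $$\lambda_\varepsilon=\exp\Big(b+\tfrac12W_{-1}\big(2\varepsilon\alpha_0e^{-2\operatorname{Re}b}\big)\Big)(1+O(\varepsilon)).$$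 Counting with multiplicity, there is a resonance for each $\ell$ satisfying these conditions.
   Context: Let $V\in L^\infty(\mathbb R^2)$ be compactly supported and real-valued, $P=-\Delta+V$, $(r,\theta)$ polar coordinates, $H^{(1)}_\ell$ the Hankel function of the first kind, taken on $\{\lambda\neq 0:-\pi/2\le\arg\lambda<3\pi/2\}$ (the plane cut along the negative imaginary axis) with its natural continuous branch. For such $\lambda$, a solution $u$ of $(P-\lambda^2)u=0$ is outgoing if for large $r$ it has the form $u=\sum_{\ell\in\mathbb Z}c_\ell H_\ell^{(1)}(\lambda r)e^{i\ell\theta}$; $\lambda$ is a resonance of $P$ if there is an outgoing $u\not\equiv0$ with $(P-\lambda^2)u=0$. A solution of $Pu=0$ is outgoing if for large $r$ it has the form $u=\sum_{\ell}c_\ell r^{-|\ell|}e^{i\ell\theta}$. $P$ has a $p$-resonance if there is an outgoing solution of $Pu=0$ with $c_0=0$, $|c_1|+|c_{-1}|>0$; $P$ has a zero eigenvalue if there is an outgoing solution $u\not\equiv0$ of $Pu=0$ with $c_0=c_1=c_{-1}=0$. $W_n$, $n\in\mathbb Z$, are the branches of the Lambert $W$ function (solutions of $we^w=x$, standard numbering of Corless et al.): for $n\ne0$, $W_n(x)=L_n(x)-\log L_n(x)+o(1)$ as $x\to0$, with $L_n(x)=\log x+2\pi in$ and $\operatorname{Im}\log\in(-\pi,\pi]$. $\delta_{j,k}$ is the Kronecker delta.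
   Formalization: The supports of the potentials V_ε are assumed to lie in one common ball for all ε near 0; if supports may escape to infinity as ε↑0, shallow and very wide wells give eigenvalues rising to 0 although P_0 = −Δ has neither a zero eigenvalue nor a p-resonance. *)

theory Defs
  imports
    "HOL-Analysis.Analysis"
    "HOL-Probability.Essential_Supremum"
    "HOL-Library.Landau_Symbols"
    "HOL-Library.Extended_Nat"
begin

section \<open>The space of bounded functions on the plane\<close>

text \<open>Elements of Lebesgue spaces are represented by functions; every notion below is invariant under
  changing a function on a Lebesgue null set.\<close>

definition Linf :: "(real^2 \<Rightarrow> real) set" where
  "Linf = {f \<in> borel_measurable lebesgue. \<exists>C. AE x in lebesgue. \<bar>f x\<bar> \<le> C}"

definition Linf_norm :: "(real^2 \<Rightarrow> real) \<Rightarrow> ereal" where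
  "Linf_norm f = esssup lebesgue (\<lambda>x. ereal \<bar>f x\<bar>)"

definition Linf_has_derivative_at ::
    "(real \<Rightarrow> real^2 \<Rightarrow> real) \<Rightarrow> (real^2 \<Rightarrow> real) \<Rightarrow> real \<Rightarrow> bool" where
  "Linf_has_derivative_at F D t \<longleftrightarrow>
     D \<in> Linf \<and> ((\<lambda>h. Linf_norm (\<lambda>x. (F (t + h) x - F t x) / h - D x)) \<longlongrightarrow> 0) (at 0)"

definition Linf_smooth_on :: "real set \<Rightarrow> (real \<Rightarrow> real^2 \<Rightarrow> real) \<Rightarrow> bool" where
  "Linf_smooth_on I F \<longleftrightarrow>
     (\<exists>D :: nat \<Rightarrow> real \<Rightarrow> real^2 \<Rightarrow> real.
        D 0 = F \<and> (\<forall>t\<in>I. F t \<in> Linf) \<and>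
        (\<forall>k. \<forall>t\<in>I. Linf_has_derivative_at (D k) (D (Suc k) t) t))"

definition supported_in_radius :: "real \<Rightarrow> (real^2 \<Rightarrow> real) \<Rightarrow> bool" where
  "supported_in_radius R V \<longleftrightarrow> (AE x in lebesgue. norm x > R \<longrightarrow> V x = 0)"

definition is_radial :: "(real^2 \<Rightarrow> real) \<Rightarrow> bool" where
  "is_radial V \<longleftrightarrow> (\<exists>v. AE x in lebesgue. V x = v (norm x))"

section \<open>Solutions of the Schroedinger equation\<close>

definition partial :: "2 \<Rightarrow> (real^2 \<Rightarrow> complex) \<Rightarrow> real^2 \<Rightarrow> complex" where
  "partial i f x = frechet_derivative f (at x) (axis i 1)"

definition test_functions :: "(real^2 \<Rightarrow> complex) set" where
  "test_functions = {f. (\<forall>js x. (foldr partial js f) differentiable (at x)) \<and>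
                        (\<exists>R. \<forall>x. norm x > R \<longrightarrow> f x = 0)}"

definition laplacian :: "(real^2 \<Rightarrow> complex) \<Rightarrow> real^2 \<Rightarrow> complex" where
  "laplacian f x = (\<Sum>i\<in>UNIV. partial i (partial i f) x)"

definition d_theta :: "(real^2 \<Rightarrow> complex) \<Rightarrow> real^2 \<Rightarrow> complex" where
  "d_theta f x = of_real (x $ 1) * partial 2 f x - of_real (x $ 2) * partial 1 f x"

definition L2 :: "(real^2 \<Rightarrow> complex) set" where
  "L2 = {u \<in> borel_measurable lebesgue. integrable lebesgue (\<lambda>x. (norm (u x))\<^sup>2)}"

definition L2_norm :: "(real^2 \<Rightarrow> complex) \<Rightarrow> real" where
  "L2_norm u = sqrt (\<integral>x. (norm (u x))\<^sup>2 \<partial>lebesgue)"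

definition L2_loc :: "(real^2 \<Rightarrow> complex) set" where
  "L2_loc = {u \<in> borel_measurable lebesgue.
               \<forall>R. set_integrable lebesgue (cball 0 R) (\<lambda>x. (norm (u x))\<^sup>2)}"

text \<open>Distributional solutions of \<open>(- \<Delta> + V - z) u = 0\<close>. For bounded \<open>V\<close> these are
  automatically in the local Sobolev space of order 2, by elliptic regularity.\<close>

definition schroedinger_solution ::
    "(real^2 \<Rightarrow> real) \<Rightarrow> complex \<Rightarrow> (real^2 \<Rightarrow> complex) \<Rightarrow> bool" where
  "schroedinger_solution V z u \<longleftrightarrow> u \<in> L2_loc \<and>
     (\<forall>f\<in>test_functions.
        (\<integral>x. u x * (- laplacian f x + (of_real (V x) - z) * f x) \<partial>lebesgue) = 0)"

text \<open>\<open>\<partial>\<^sub>\<theta> u = i \<ell> u\<close> in the sense of distributions; the sign comes from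
  \<open>\<integral> (\<partial>\<^sub>\<theta> u) f = - \<integral> u \<partial>\<^sub>\<theta> f\<close>.\<close>

definition has_angular_momentum :: "int \<Rightarrow> (real^2 \<Rightarrow> complex) \<Rightarrow> bool" where
  "has_angular_momentum l u \<longleftrightarrow>
     (\<forall>f\<in>test_functions.
        - (\<integral>x. u x * d_theta f x \<partial>lebesgue) = (\<integral>x. \<i> * of_int l * u x * f x \<partial>lebesgue))"

section \<open>Hankel functions\<close>

text \<open>The branch of the argument with values in \<open>[-\<pi>/2, 3\<pi>/2)\<close>, and the corresponding logarithm.\<close>

definition arg_cut :: "complex \<Rightarrow> real" where
  "arg_cut z = (if Arg z < - pi / 2 then Arg z + 2 * pi else Arg z)"

definition log_cut :: "complex \<Rightarrow> complex" where
  "log_cut z = Complex (ln (norm z)) (arg_cut z)"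

definition bessel_J :: "nat \<Rightarrow> complex \<Rightarrow> complex" where
  "bessel_J n z = (\<Sum>k. (-1) ^ k / (fact k * fact (n + k)) * (z / 2) ^ (n + 2 * k))"

definition bessel_Y :: "nat \<Rightarrow> complex \<Rightarrow> complex" where
  "bessel_Y n z =
     2 / of_real pi * log_cut (z / 2) * bessel_J n z
     - 1 / of_real pi * (\<Sum>k<n. fact (n - k - 1) / fact k * (z / 2) powi (2 * int k - int n))
     - 1 / of_real pi *
         (\<Sum>k. (Digamma (of_nat (k + 1)) + Digamma (of_nat (n + k + 1))) *
              ((-1) ^ k / (fact k * fact (n + k)) * (z / 2) ^ (n + 2 * k)))"

text \<open>For negative orders, \<open>H\<^sub>-\<^sub>n = (-1)\<^sup>n H\<^sub>n\<close>.\<close>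

definition hankel1 :: "int \<Rightarrow> complex \<Rightarrow> complex" where
  "hankel1 l z = (let n = nat \<bar>l\<bar> in
     (if l < 0 then (-1) ^ n else 1) * (bessel_J n z + \<i> * bessel_Y n z))"

section \<open>Outgoing solutions, resonances and zero-energy states\<close>

definition polar_angle :: "real^2 \<Rightarrow> real" where
  "polar_angle x = Arg (Complex (x $ 1) (x $ 2))"

definition outgoing :: "complex \<Rightarrow> (real^2 \<Rightarrow> complex) \<Rightarrow> bool" where
  "outgoing lam u \<longleftrightarrow>
     (\<exists>c :: int \<Rightarrow> complex. \<exists>R. AE x in lebesgue. norm x > R \<longrightarrow>
        ((\<lambda>l. c l * hankel1 l (lam * of_real (norm x)) * cis (of_int l * polar_angle x))
           has_sum u x) UNIV)"

definition outgoing_at_zero :: "(int \<Rightarrow> complex) \<Rightarrow> (real^2 \<Rightarrow> complex) \<Rightarrow> bool" where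
  "outgoing_at_zero c u \<longleftrightarrow>
     (\<exists>R. AE x in lebesgue. norm x > R \<longrightarrow>
        ((\<lambda>l. c l * of_real (norm x powi (- \<bar>l\<bar>)) * cis (of_int l * polar_angle x))
           has_sum u x) UNIV)"

definition is_resonance :: "(real^2 \<Rightarrow> real) \<Rightarrow> complex \<Rightarrow> bool" where
  "is_resonance V lam \<longleftrightarrow> lam \<noteq> 0 \<and>
     (\<exists>u. schroedinger_solution V (lam\<^sup>2) u \<and> outgoing lam u \<and> \<not> (AE x in lebesgue. u x = 0))"

text \<open>The complex dimension of the space of outgoing solutions, functions that agree almost
  everywhere being identified.\<close>

definition resonance_multiplicity :: "(real^2 \<Rightarrow> real) \<Rightarrow> complex \<Rightarrow> enat" where
  "resonance_multiplicity V lam =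
     Sup {enat n | n. \<exists>u :: nat \<Rightarrow> real^2 \<Rightarrow> complex.
            (\<forall>k<n. schroedinger_solution V (lam\<^sup>2) (u k) \<and> outgoing lam (u k)) \<and>
            (\<forall>a :: nat \<Rightarrow> complex.
               (AE x in lebesgue. (\<Sum>k<n. a k * u k x) = 0) \<longrightarrow> (\<forall>k<n. a k = 0))}"

text \<open>The family \<open>(lam l)\<close>, \<open>l \<in> L\<close>, consists of resonances counted with multiplicity: no
  number \<open>m\<close> occurs in it more often than its multiplicity as a resonance. The quantification over
  finite \<open>F\<close> avoids the convention that infinite sets have cardinality \<open>0\<close>.\<close>

definition resonances_with_multiplicity ::
    "(real^2 \<Rightarrow> real) \<Rightarrow> int set \<Rightarrow> (int \<Rightarrow> complex) \<Rightarrow> bool" where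
  "resonances_with_multiplicity V L lam \<longleftrightarrow>
     (\<forall>m F. finite F \<longrightarrow> F \<subseteq> {l \<in> L. lam l = m} \<longrightarrow>
        enat (card F) \<le> resonance_multiplicity V m)"

definition in_fourth_quadrant :: "complex \<Rightarrow> bool" where
  "in_fourth_quadrant z \<longleftrightarrow> Re z > 0 \<and> Im z < 0"

definition has_p_resonance :: "(real^2 \<Rightarrow> real) \<Rightarrow> bool" where
  "has_p_resonance V \<longleftrightarrow>
     (\<exists>u c. schroedinger_solution V 0 u \<and> outgoing_at_zero c u \<and>
        c 0 = 0 \<and> norm (c 1) + norm (c (-1)) > 0)"

definition has_zero_eigenvalue :: "(real^2 \<Rightarrow> real) \<Rightarrow> bool" where
  "has_zero_eigenvalue V \<longleftrightarrow>
     (\<exists>u c. schroedinger_solution V 0 u \<and> outgoing_at_zero c u \<and>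
        \<not> (AE x in lebesgue. u x = 0) \<and> c 0 = 0 \<and> c 1 = 0 \<and> c (-1) = 0)"

section \<open>Lambert W function\<close>

text \<open>The range of the \<open>n\<close>-th branch, following Corless, Gonnet, Hare, Jeffrey and Knuth. Their
  boundary curves \<open>{-\<eta> cot \<eta> + i \<eta>}\<close> are the level sets of \<open>Im w + Arg w\<close> at odd multiples of
  \<open>\<pi>\<close>, which are mapped to the negative axis by \<open>w exp w\<close>; the upper boundary belongs to the range
  (counterclockwise continuity). The half-line \<open>(-\<infinity>, -1)\<close> separates branches 1 and -1 and
  belongs to branch -1.\<close>

definition lambert_range :: "int \<Rightarrow> complex set" where
  "lambert_range n =
     (let S = {w. w \<noteq> 0 \<and> of_int (2 * n - 1) * pi < Im w + Arg w \<and>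
                  Im w + Arg w \<le> of_int (2 * n + 1) * pi}
      in if n = 0 then insert 0 S - complex_of_real ` {..< -1}
         else if n = -1 then S \<union> complex_of_real ` {.. -1}
         else S)"

definition lambert_W :: "int \<Rightarrow> complex \<Rightarrow> complex" where
  "lambert_W n x = (THE w. w \<in> lambert_range n \<and> w * exp w = x)"

section \<open>Eigenvalues approaching zero\<close>

text \<open>\<open>E \<up> 0\<close> as \<open>\<epsilon> \<up> 0\<close> is rendered as one-sided convergence: \<open>E\<close> tends to 0 through
  negative values as \<open>\<epsilon>\<close> does.\<close>

definition has_eigenvalue_rising_to_zero ::
    "real set \<Rightarrow> (real \<Rightarrow> real^2 \<Rightarrow> real) \<Rightarrow> int \<Rightarrow> bool" where
  "has_eigenvalue_rising_to_zero I V l \<longleftrightarrow>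
     (\<exists>(\<psi> :: real \<Rightarrow> real^2 \<Rightarrow> complex) (E :: real \<Rightarrow> real).
        (\<forall>\<epsilon>\<in>I. \<epsilon> < 0 \<longrightarrow>
           \<psi> \<epsilon> \<in> L2 \<and> L2_norm (\<psi> \<epsilon>) = 1 \<and>
           schroedinger_solution (V \<epsilon>) (of_real (E \<epsilon>)) (\<psi> \<epsilon>) \<and>
           has_angular_momentum l (\<psi> \<epsilon>)) \<and>
        filterlim E (at_left 0) (at_left 0))"

end

theory Submission
 imports Defs "HOL-Analysis.Analysis" "HOL-Probability.Probability"
begin

text \<open>By rotational symmetry everything reduces to one radial equation. Put s = |x|^2, n =
  |l|, V(x) = q(|x|^2), and let zeta be x_1 + i x_2 or its conjugate. Then zeta^n G(s) solves
  (-Delta + V - z) u = 0 when (s^(n+1) G')' = s^n (q - z)/4 G. For bounded measurable q a solution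
  regular at the origin with G(0) = 1 comes from a Volterra equation
  (\<open>volterra_exists\<close>). It depends in a Lipschitz way on the coefficient
  (\<open>volterra_perturbation\<close>) and never vanishes together with its derivative at a point
  s > 0 (\<open>volterra_backward_unique\<close>).

  Threshold behaviour. Let g be the real regular solution at an energy E <= 0. Beyond the support of
  q the quantity s^n (s g' + n g) g is nondecreasing; once it is positive, s^n g^2 stays bounded
  below and zeta^n g is not square integrable (\<open>growth_of_regular_solution\<close>). An
  eigenfunction pairs with radial test functions like a multiple of zeta^n g
  (\<open>kernel_orthogonal\<close>), so the existence of eigenfunctions for eps < 0 gives (s g' + n
  g) g <= 0 beyond the support (\<open>eigenfunction_no_growth\<close>). This closed condition
  survives the limit in which eps and E rise to 0. At zero energy the exterior solutions are a + b
  s^(-n), for which s G' + n G = n a, and the inequality forces a = 0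
  (\<open>zero_energy_boundary_condition\<close>, \<open>boundary_state\<close>). Hence zeta^n G0
  decays like r^(-n): a zero eigenvalue if n > 1 and a p-resonance if n = 1
  (\<open>zero_energy_states\<close>).

  Matching. For eps > 0 write lambda^2 = 4 x/s1, where q vanishes for s >= s1. The outgoing exterior
  solution is s^(-n) Q(x s/s1), with Q a power series plus a power series times log x coming from
  the Hankel function (\<open>hankel1_eq_hQ\<close>). Joining it to the regular solution at s1
  (\<open>resonant_state_exists\<close>) amounts to the scalar equation x Q'(x)/Q(x) = s1
  G'(s1)/G(s1) + n. The right side vanishes at x = eps = 0 by the threshold condition, and the
  Wronskian with G0 expands it as B eps - A x + O((|eps| + |x|)^2)
  (\<open>matching_function\<close>). Here A >= 0 is a multiple of the integral of s^n G0^2, and B >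
  0 because the derivative of the family is nonnegative and not zero while G0 has only countably
  many positive zeros (\<open>integral_expansion\<close>).

  The left side is x/(n-1) plus smaller terms if n > 1 and x (i pi - 2 gamma - Ln x) plus smaller
  terms if n = 1, gamma being the Euler-Mascheroni constant (\<open>hq_expansion\<close>,
  \<open>hq_expansion_1\<close>). In the first case the leading equation is linear with root
  proportional to eps, in the second it is solved by the branch W_(-1)
  (\<open>lambert_W_minus_1\<close>). Brouwer's theorem turns the approximate root into an exact one
  within the asserted error (\<open>matching_solution_ge_2\<close>,
  \<open>matching_solution_1\<close>).

  Quadrant and multiplicity. In the right half plane near 0, if Im x >= 0 then the left side has
  positive imaginary part (\<open>hq_properties\<close>) and the right side a nonpositive one
  (\<open>reg_Im_logarithmic_derivative\<close>). So the root has Im x < 0, and the square root with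
  positive real part lies in the fourth quadrant. States built for distinct l are linearly
  independent (\<open>partial_waves_independent\<close>), which gives the count with
  multiplicity.\<close>

abbreviation "cor == complex_of_real"

section \<open>Bounded polynomial approximation and polynomials as separating test functions\<close>

section \<open>Approximation by polynomials\<close>

text \<open>Measurability gives continuous \<open>f n\<close> converging almost everywhere.
  Projecting their values onto the disc of radius C bounds them without disturbing the limit, and
  Stone-Weierstrass then replaces them on K by polynomials with error below 1/(n+1).\<close>

lemma bounded_measurable_polynomial_approx:
 fixes p :: "'a::euclidean_space => complex"
 assumes p: "p \<in> borel_measurable lebesgue" and C: "!!x. norm (p x) <= C" and K: "compact K"
 obtains g where "!!k. polynomial_function (g k)" "!!k x. x \<in> K ==> norm (g k x) <= C + 1"
 "AE x in lebesgue. x \<in> K --> (%k. g k x) \<longlonglongrightarrow> p x"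
proof -
 have "0 <= C" using C[of undefined] norm_ge_zero order_trans by blast
 then have ne: "cball (0::complex) C ~= {}" by simp
 have "p measurable_on UNIV" using p by (rule lebesgue_measurable_imp_measurable_on) auto
 then obtain N f where N: "negligible N" and f: "!!n::nat. continuous_on UNIV (f n)"
 and lim: "!!x. x \<notin> N ==> (%n. f n x) \<longlonglongrightarrow> p x"
 unfolding measurable_on_def by auto
 define c where "c = closest_point (cball (0::complex) C)"
 have cc: "continuous_on UNIV c"
 unfolding c_def using continuous_on_closest_point[OF _ _ ne] by auto
 have cf: "continuous_on K (%x. c (f n x))" for n
 using continuous_on_compose2[OF cc f[of n]] continuous_on_subset by blast
 have "\<exists>g. polynomial_function g & (\<forall>x\<in>K. norm (c (f n x) - g x) < 1/real (Suc n))" for n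
 by (rule Stone_Weierstrass_polynomial_function[OF K cf]) auto
 then obtain g where g: "!!n. polynomial_function (g n)"
 "!!n x. x \<in> K ==> norm (c (f n x) - g n x) < 1/real (Suc n)" by metis
 have cle: "norm (c w) <= C" for w
 using closest_point_in_set[OF _ ne, of w] by (auto simp: c_def)
 show thesis
 proof (rule that[OF g(1)])
 fix k x assume x: "x \<in> K"
 have "norm (g k x) <= norm (c (f k x)) + norm (c (f k x) - g k x)"
 using norm_triangle_sub[of "g k x" "c (f k x)"] by (simp add: norm_minus_commute)
 also have "... <= C + 1/real (Suc k)" using cle[of "f k x"] g(2)[OF x, of k] by linarith
 also have "... <= C + 1" by (simp add: field_simps)
 finally show "norm (g k x) <= C + 1" .
 next
 have "(%k. g k x) \<longlonglongrightarrow> p x" if x: "x \<in> K" "x \<notin> N" for x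
 proof -
 have "(%n. c (f n x)) \<longlonglongrightarrow> c (p x)"
 by (rule continuous_on_tendsto_compose[OF cc lim[OF x(2)]]) auto
 also have "c (p x) = p x" unfolding c_def by (rule closest_point_self) (use C in auto)
 finally have 1: "(%n. c (f n x)) \<longlonglongrightarrow> p x" .
 have "(%n. c (f n x) - g n x) \<longlonglongrightarrow> 0"
 by (rule Lim_null_comparison[OF _ LIMSEQ_inverse_real_of_nat])
 (use g(2)[OF x(1)] in "auto simp: inverse_eq_divide less_imp_le")
 from tendsto_diff[OF 1 this] show ?thesis by simp
 qed
 then show "AE x in lebesgue. x \<in> K --> (%k. g k x) \<longlonglongrightarrow> p x"
 by (intro AE_I'[of N]) (use N in "auto simp: negligible_iff_null_sets")
 qed
qed

lemma polynomial_function_complex_sum: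
 fixes f :: "real => complex"
 assumes "polynomial_function f"
 obtains a :: "nat => complex" and N where "f = (%x. \<Sum>i\<le>N. a i*cor x^i)"
proof -
 have "real_polynomial_function (%x. Re (f x))" "real_polynomial_function (%x. Im (f x))"
 using assms unfolding polynomial_function_def
 by (auto simp: o_def intro: bounded_linear_Re bounded_linear_Im)
 then obtain a n b m where ab: "(%x. Re (f x)) = (%x. \<Sum>i\<le>n. a i*x^i)"
 "(%x. Im (f x)) = (%x. \<Sum>i\<le>m. b i*x^i)"
 unfolding real_polynomial_function_iff_sum by blast
 define N where "N = max n m"
 define c where "c i = Complex (if i <= n then a i else 0) (if i <= m then b i else 0)" for i
 have "f x = (\<Sum>i\<le>N. c i*cor x^i)" for x
 proof (rule complex_eqI)
 have "Re (\<Sum>i\<le>N. c i*cor x^i) = (\<Sum>i\<le>N. (if i <= n then a i else 0)*x^i)"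
 by (simp add: c_def flip: of_real_power)
 also have "... = (\<Sum>i\<le>n. a i*x^i)"
 by (rule sum.mono_neutral_cong_right) (auto simp: N_def)
 finally show "Re (f x) = Re (\<Sum>i\<le>N. c i*cor x^i)" using fun_cong[OF ab(1), of x] by simp
 have "Im (\<Sum>i\<le>N. c i*cor x^i) = (\<Sum>i\<le>N. (if i <= m then b i else 0)*x^i)"
 by (simp add: c_def flip: of_real_power)
 also have "... = (\<Sum>i\<le>m. b i*x^i)"
 by (rule sum.mono_neutral_cong_right) (auto simp: N_def)
 finally show "Im (f x) = Im (\<Sum>i\<le>N. c i*cor x^i)" using fun_cong[OF ab(2), of x] by simp
 qed
 then show thesis using that by blast
qed

text \<open>Test with polynomials that converge boundedly to the conjugate sign of
  \<open>Psi\<close>: dominated convergence turns orthogonality into the vanishing of the integral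
  of |Psi|.\<close>

lemma AE_zero_if_orthogonal_polynomials:
 fixes Psi :: "'a::euclidean_space => complex"
 assumes int: "integrable lebesgue Psi" and K: "compact K" "!!x. x \<notin> K ==> Psi x = 0"
 and orth: "!!P. polynomial_function P ==> (LINT x|lebesgue. Psi x*P x) = 0"
 shows "AE x in lebesgue. Psi x = 0"
proof -
 have m: "Psi \<in> borel_measurable lebesgue" using int by auto
 define p where "p x = cnj (sgn (Psi x))" for x
 have p: "p \<in> borel_measurable lebesgue"
 proof -
 have "(%x. cor (norm (Psi x))) \<in> borel_measurable lebesgue"
 by (rule borel_measurable_continuous_on[OF _ m, of "%z. cor (norm z)"])
 (intro continuous_intros)
 then have "(%x. Psi x/cor (norm (Psi x))) \<in> borel_measurable lebesgue"
 using m by (rule borel_measurable_divide[rotated])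
 then have "(%x. cnj (Psi x/cor (norm (Psi x)))) \<in> borel_measurable lebesgue"
 by (rule borel_measurable_continuous_on[rotated]) (intro continuous_intros)
 then show ?thesis by (simp add: p_def[abs_def] sgn_eq)
 qed
 obtain g where g: "!!k. polynomial_function (g k)" "!!k x. x \<in> K ==> norm (g k x) <= 1 + 1"
 "AE x in lebesgue. x \<in> K --> (%k. g k x) \<longlonglongrightarrow> p x"
 by (rule bounded_measurable_polynomial_approx[OF p _ K(1), of 1]) (auto simp: p_def norm_sgn)
 have gm: "g k \<in> borel_measurable lebesgue" for k
 using borel_measurable_continuous_onI[OF continuous_on_polymonial_function[OF g(1)]]
 by (intro measurable_completion) simp
 have "(%k. \<integral>x. Psi x*g k x \<partial>lebesgue) \<longlonglongrightarrow> (LINT x|lebesgue. Psi x*p x)"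
 proof (rule integral_dominated_convergence[where w="%x. 2*norm (Psi x)"])
 show "AE x in lebesgue. (%k. Psi x*g k x) \<longlonglongrightarrow> Psi x*p x"
 using g(3)
 proof eventually_elim
 case (elim x) then show ?case by (cases "x \<in> K") (auto intro: tendsto_mult K(2) simp: K(2))
 qed
 show "AE x in lebesgue. norm (Psi x*g k x) <= 2*norm (Psi x)" for k
 proof (rule AE_I2)
 fix x show "norm (Psi x*g k x) <= 2*norm (Psi x)"
 using g(2)[of x k] K(2)[of x]
 using mult_right_mono[of "norm (g k x)" 2 "norm (Psi x)"]
 by (cases "x \<in> K") (auto simp: norm_mult mult.commute)
 qed
 qed (use int m p gm in auto)
 then have 0: "(LINT x|lebesgue. Psi x*p x) = 0" using orth[OF g(1)] by (simp add: LIMSEQ_const_iff)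
 have "Psi x*p x = cor (norm (Psi x))" for x
 using complex_norm_square[of "Psi x"] by (cases "Psi x = 0") (simp_all add: p_def sgn_eq field_simps power2_eq_square)
 then have "(LINT x|lebesgue. norm (Psi x)) = 0" using 0
 by (simp add: integral_complex_of_real)
 then have "AE x in lebesgue. norm (Psi x) = 0"
 using integral_nonneg_eq_0_iff_AE[of lebesgue "%x. norm (Psi x)"] int by auto
 then show ?thesis by auto
qed

section \<open>The radial variable s = |x|^2 and measurable radial profiles\<close>

section \<open>Radial functions on the plane\<close>

text \<open>The squared norm is preferred to the norm as radial variable: it is a polynomial in x,
  and it sends planar Lebesgue measure to a constant multiple of linear measure on the
  half-line.\<close>

definition sq :: "real^2 => real" where "sq x = (x $ 1)^2 + (x $ 2)^2"

lemma sq_eq_norm: "sq x = (norm x)^2"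
 by (simp add: sq_def norm_vec_def L2_set_def sum_2)

lemma sq_nonneg [simp]: "0 <= sq x" by (simp add: sq_def)

lemma sq_zero_iff [simp]: "sq x = 0 \<longleftrightarrow> x = 0" by (simp add: sq_eq_norm)

lemma continuous_on_sq [continuous_intros]: "continuous_on S sq"
 unfolding sq_def[abs_def] by (intro continuous_intros)

lemma measurable_sq [measurable]: "sq \<in> borel_measurable borel"
 by (intro borel_measurable_continuous_onI continuous_on_sq)

lemma measurable_sq_lebesgue [measurable]: "sq \<in> borel_measurable lebesgue"
 using measurable_sq by (simp add: measurable_completion)

lemma emeasure_sq_le: "emeasure lborel {x. sq x <= a} = ennreal (pi*max 0 a)"
proof (cases "a \<ge> 0")
 case True
 have "{x. sq x <= a} = cball 0 (sqrt a)"
 proof (rule set_eqI)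
 fix x show "x \<in> {x. sq x <= a} \<longleftrightarrow> x \<in> cball 0 (sqrt a)"
 using real_sqrt_le_iff[of "(norm x)^2" a] by (simp add: sq_eq_norm del: real_sqrt_le_iff)
 qed
 then show ?thesis using True
 by (simp add: emeasure_cball unit_ball_vol_2)
next
 case False
 then have "{x. sq x <= a} = {}" by (auto simp: not_le intro: less_le_trans[OF _ sq_nonneg])
 then show ?thesis using False by simp
qed

text \<open>A disc of squared radius a has area pi a, so the two measures agree on the half-lines
  that generate the Borel sets.\<close>

lemma distr_sq: "distr lborel borel sq = density lborel (%s::real. ennreal (pi*indicator {0..} s))"
proof (rule measure_eqI_generator_eq[where E="range atMost" and \<Omega>=UNIV and A="%i::nat. {..real i}"])
 show "Int_stable (range (atMost :: real => _))"
 by (auto simp: Int_stable_def intro!: image_eqI[where x="min _ _"])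
 have sb: "sets (borel :: real measure) = sigma_sets UNIV (range atMost)"
 unfolding borel_eq_atMost[where 'a=real] by (rule sets_measure_of) simp
 show "sets (distr lborel borel sq) = sigma_sets UNIV (range atMost)"
 by (rule trans[OF sets_distr sb])
 show "sets (density lborel (%s::real. ennreal (pi*indicator {0..} s))) = sigma_sets UNIV (range atMost)"
 by (rule trans[OF sets_density trans[OF sets_lborel sb]])
 show "(\<Union>i::nat. {..real i}) = UNIV" by (auto simp: real_arch_simple)
 have eq: "emeasure (distr lborel borel sq) {..a} = ennreal (pi*max 0 a)" for a
 using emeasure_sq_le[of a] by (simp add: emeasure_distr vimage_def)
 show "emeasure (distr lborel borel sq) {..real i} ~= \<infinity>" for i by (simp add: eq)
 show "emeasure (distr lborel borel sq) X
 = emeasure (density lborel (%s::real. ennreal (pi*indicator {0..} s))) X" if "X \<in> range atMost" for X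
 proof -
 from that obtain a where X: "X = {..a}" by auto
 have "emeasure (density lborel (%s::real. ennreal (pi*indicator {0..} s))) X
 = (\<integral>\<^sup>+ s. ennreal (pi*indicator {0..} s)*indicator {..a} s \<partial>lborel)"
 unfolding X by (rule emeasure_density) auto
 also have "... = (\<integral>\<^sup>+ s. ennreal pi*indicator {0..a} s \<partial>lborel)"
 by (intro nn_integral_cong) (auto split: split_indicator)
 also have "... = ennreal (pi*max 0 a)"
 by (simp add: nn_integral_cmult ennreal_mult' max_def)
 finally show ?thesis using eq X by simp
 qed
qed auto

lemma AE_sq_iff:
 assumes "Measurable.pred borel P"
 shows "(AE x in lebesgue. P (sq x)) \<longleftrightarrow> (AE s in lborel. 0 <= s --> P s)"
proof -
 have "(AE x in lebesgue. P (sq x)) \<longleftrightarrow> (AE x in lborel. P (sq x))"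
 by (rule AE_completion_iff) 
 also have "... \<longleftrightarrow> (AE s in distr lborel borel sq. P s)"
 using assms by (subst AE_distr_iff) auto
 also have "... \<longleftrightarrow> (AE s in lborel. 0 <= s --> P s)"
 unfolding distr_sq using assms by (subst AE_density) (auto simp: indicator_def)
 finally show ?thesis .
qed

text \<open>Here P is arbitrary, so its exceptional set is first enclosed in a Borel null
  set.\<close>

lemma AE_sqI:
 assumes "AE s in lborel. 0 <= s --> P s"
 shows "AE x in lebesgue. P (sq x)"
proof -
 obtain N where N: "N \<in> null_sets lborel" "{s. \<not> (0 <= s --> P s)} \<subseteq> N"
 using assms by (auto simp: eventually_ae_filter)
 have "AE s in lborel. 0 <= s --> s \<notin> N" using AE_not_in[OF N(1)] by auto
 then have "AE x in lebesgue. sq x \<notin> N"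
 using N(1) by (subst AE_sq_iff) auto
 then show ?thesis by eventually_elim (use N(2) sq_nonneg in blast)
qed

lemma integral_sq:
 fixes f :: "real => 'b::{banach,second_countable_topology}"
 assumes [measurable]: "f \<in> borel_measurable borel"
 shows "(LINT x|lebesgue. f (sq x)) = pi *\<^sub>R (\<integral>s. indicator {0..} s *\<^sub>R f s \<partial>lborel)"
 and "integrable lebesgue (%x. f (sq x)) \<longleftrightarrow> integrable lborel (%s. indicator {0..} s *\<^sub>R f s)"
proof -
 have m: "(%x. f (sq x)) \<in> borel_measurable lborel" by measurable
 have "(LINT x|lebesgue. f (sq x)) = (\<integral>s. f s \<partial>(distr lborel borel sq))"
 using m by (simp add: integral_completion integral_distr)
 also have "... = (\<integral>s. (pi*indicator {0..} s) *\<^sub>R f s \<partial>lborel)"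
 unfolding distr_sq by (rule integral_density) auto
 also have "... = pi *\<^sub>R (\<integral>s. indicator {0..} s *\<^sub>R f s \<partial>lborel)"
 by (simp flip: scaleR_scaleR)
 finally show "(LINT x|lebesgue. f (sq x)) = pi *\<^sub>R (\<integral>s. indicator {0..} s *\<^sub>R f s \<partial>lborel)" .
 have "integrable lebesgue (%x. f (sq x)) \<longleftrightarrow> integrable (distr lborel borel sq) f"
 using m by (simp add: integrable_completion integrable_distr_eq)
 also have "... \<longleftrightarrow> integrable lborel (%s. (pi*indicator {0..} s) *\<^sub>R f s)"
 unfolding distr_sq by (rule integrable_density) auto
 also have "... \<longleftrightarrow> integrable lborel (%s. indicator {0..} s *\<^sub>R f s)"
 using integrable_scaleR_right[of pi lborel "%s. indicator {0..} s *\<^sub>R f s"]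
 integrable_scaleR_right[of "1/pi" lborel "%s. (pi*indicator {0..} s) *\<^sub>R f s"] by auto
 finally show "integrable lebesgue (%x. f (sq x)) \<longleftrightarrow> integrable lborel (%s. indicator {0..} s *\<^sub>R f s)" .
qed

definition vec2 :: "real => real => real^2" where "vec2 a b = (\<chi> i. if i = 1 then a else b)"

lemma vec2_nth [simp]: "vec2 a b $ 1 = a" "vec2 a b $ 2 = b"
 by (simp_all add: vec2_def)

lemma vec2_eta [simp]: "vec2 (x $ 1) (x $ 2) = x"
 by (simp add: vec_eq_iff forall_2)

lemma sq_vec2 [simp]: "sq (vec2 a b) = a^2 + b^2" by (simp add: sq_def)

lemma continuous_on_vec2 [continuous_intros]:
 "continuous_on S f ==> continuous_on S g ==> continuous_on S (%x. vec2 (f x) (g x))"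
 unfolding vec2_def
proof (rule continuous_on_vec_lambda)
 fix i :: 2
 assume "continuous_on S f" "continuous_on S g"
 then show "continuous_on S (%x. if i = 1 then f x else g x)" by (cases "i = 1") auto
qed

lemma measurable_vec2 [measurable]: "(%p. vec2 (fst p) (snd p)) \<in> borel_measurable borel"
 by (intro borel_measurable_continuous_onI continuous_intros)

text \<open>Identifies the plane with a product of two lines, which opens the way to Fubini's
  theorem.\<close>

lemma lborel_vec2: "(lborel :: (real^2) measure) = distr lborel borel (%p. vec2 (fst p) (snd p))"
proof (rule lborel_eqI)
 fix l u :: "real^2" assume le: "!!b. b \<in> Basis ==> l \<bullet> b <= u \<bullet> b"
 have B: "(Basis :: (real^2) set) = {axis 1 1, axis 2 1}"
 by (auto simp: Basis_vec_def UNIV_2)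
 have "axis 1 1 ~= (axis 2 1 :: real^2)" by (simp add: axis_eq_axis)
 then have P: "prod ((\<bullet>) (u - l)) Basis = (u $ 1 - l $ 1)*(u $ 2 - l $ 2)"
 by (simp add: B inner_axis)
 have l: "l $ 1 <= u $ 1" "l $ 2 <= u $ 2"
 using le[of "axis 1 1"] le[of "axis 2 1"] by (auto simp: B inner_axis)
 have eq: "(%p. vec2 (fst p) (snd p)) -` box l u = box (l $ 1, l $ 2) (u $ 1, u $ 2)"
 by (auto simp: mem_box_cart forall_2 box_prod)
 have "emeasure (distr lborel borel (%p. vec2 (fst p) (snd p))) (box l u)
 = emeasure lborel ({l $ 1<..<u $ 1} \<times> {l $ 2<..<u $ 2})"
 by (subst emeasure_distr) (auto simp: eq box_prod)
 also have "... = ennreal (u $ 1 - l $ 1)*ennreal (u $ 2 - l $ 2)"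
 using l by (simp flip: lborel_prod add: lborel.emeasure_pair_measure_Times)
 finally show "emeasure (distr lborel borel (%p. vec2 (fst p) (snd p))) (box l u)
 = ennreal (prod ((\<bullet>) (u - l)) Basis)"
 using l by (simp add: P ennreal_mult')
qed simp

text \<open>The profile in \<open>is_radial\<close> is an arbitrary function, so a measurable one is
  read off V along vertical lines. By Fubini almost every line x_1 = a meets the exceptional set in
  a null set, and on it s = a^2 + b^2 recovers the profile for almost every s > a^2. Lines with a
  tending to 0 together reach every s > 0.\<close>

lemma radial_borel_representative:
 assumes V: "V \<in> borel_measurable lebesgue" and rad: "is_radial V"
 obtains q where "q \<in> borel_measurable borel" "AE x in lebesgue. V x = q (sq x)"
proof -
 obtain U where U[measurable]: "U \<in> borel_measurable borel" and VU: "AE x in lborel. V x = U x"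
 using completion_ex_borel_measurable_real[OF V] by auto
 obtain v where v: "AE x in lebesgue. V x = v (norm x)" using rad by (auto simp: is_radial_def)
 define w where "w s = v (sqrt s)" for s
 have Uw: "AE x in lborel. U x = w (sq x)"
 using v VU unfolding AE_completion_iff by eventually_elim (simp add: w_def sq_eq_norm)
 then obtain N where N: "N \<in> null_sets lborel" "{x. U x ~= w (sq x)} \<subseteq> N"
 by (auto simp: eventually_ae_filter)
 then have [measurable]: "N \<in> sets borel" by auto
 have "AE p in lborel. vec2 (fst p) (snd p) \<notin> N"
 proof -
 have "AE x in distr lborel borel (%p. vec2 (fst p) (snd p)). x \<notin> N"
 unfolding lborel_vec2[symmetric] using AE_not_in[OF N(1)] .
 then show ?thesis by (subst (asm) AE_distr_iff) auto
 qed
 then have "AE a in lborel. AE b in lborel. vec2 a b \<notin> N"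
 unfolding lborel_prod[symmetric] by (drule_tac lborel_pair.AE_pair) simp
 then obtain M0 where "{a \<in> space lborel. \<not> (AE b in lborel. vec2 a b \<notin> N)} \<subseteq> M0"
 "emeasure lborel M0 = 0" "M0 \<in> sets lborel" by (rule AE_E)
 then have M0: "M0 \<in> null_sets lborel" "!!a. a \<notin> M0 ==> AE b in lborel. vec2 a b \<notin> N"
 by (auto simp: null_sets_def)
 \<comment> \<open>The bad abscissae lie in a null set, which cannot contain the interval (0,
   1/(k+1)).\<close>
 have "\<exists>a. 0 < a & a < 1/real (Suc k) & (AE b in lborel. vec2 a b \<notin> N)" for k
 proof (rule ccontr)
 assume "\<not> ?thesis"
 then have "{0<..<1/real (Suc k)} \<subseteq> M0" using M0(2) by fastforce
 then have "emeasure lborel {0<..<1/real (Suc k)} <= emeasure lborel M0"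
 by (intro emeasure_mono) (use M0(1) in auto)
 then show False using M0(1) by (simp add: null_sets_def)
 qed
 then obtain a where a: "!!k. 0 < a k" "!!k. a k < 1/real (Suc k)"
 "!!k. AE b in lborel. vec2 (a k) b \<notin> N" by metis
 define Q where "Q k s = U (vec2 (a k) (sqrt (s - (a k)\<^sup>2)))" for k s
 have Qm: "Q k \<in> borel_measurable borel" for k
 unfolding Q_def[abs_def]
 by (rule measurable_compose[OF _ U], rule borel_measurable_continuous_onI) (intro continuous_intros)
 have Qw: "AE s in lborel. (a k)^2 < s --> Q k s = w s" for k
 proof -
 obtain M where M: "M \<in> null_sets lborel" "{b. vec2 (a k) b \<in> N} \<subseteq> M"
 using a(3)[of k] by (auto simp: eventually_ae_filter)
 define f where "f b = (a k)^2 + b*b" for b :: real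
 \<comment> \<open>The differentiable map b -> a^2 + b^2 carries a null set of heights to a null set
   of values of s.\<close>
 have "f differentiable_on M" unfolding f_def[abs_def]
 by (intro derivative_intros) 
 then have "negligible (f ` M)"
 by (intro negligible_differentiable_image_negligible)
 (use M(1) in "auto simp: negligible_iff_null_sets intro: null_sets_completionI")
 moreover have "Q k s = w s" if "(a k)^2 < s" "s \<notin> f ` M" for s
 proof -
 have s: "s = f (sqrt (s - (a k)\<^sup>2))" using that by (simp add: f_def flip: power2_eq_square)
 then have "sqrt (s - (a k)\<^sup>2) \<notin> M" using that(2) by blast
 then have "vec2 (a k) (sqrt (s - (a k)\<^sup>2)) \<notin> N" using M(2) by auto
 then have "U (vec2 (a k) (sqrt (s - (a k)\<^sup>2))) = w (sq (vec2 (a k) (sqrt (s - (a k)\<^sup>2))))"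
 using N(2) by blast
 then show ?thesis using that by (simp add: Q_def)
 qed
 ultimately have "AE s in lebesgue. (a k)^2 < s --> Q k s = w s"
 by (intro AE_I'[of "f ` M"]) (auto simp: negligible_iff_null_sets)
 then show ?thesis by (simp add: AE_completion_iff)
 qed
 define q where "q s = lim (%k. Q k s)" for s
 have q: "q \<in> borel_measurable borel"
 unfolding q_def[abs_def] using Qm by (rule borel_measurable_lim_metric)
 have "AE s in lborel. 0 <= s --> q s = w s"
 proof -
 have "AE s in lborel. \<forall>k. (a k)^2 < s --> Q k s = w s"
 using Qw by (simp add: AE_all_countable)
 moreover have "AE s in lborel. s ~= (0::real)" by (rule AE_lborel_singleton)
 ultimately show ?thesis
 proof eventually_elim
 case (elim s)
 show ?case
 proof
 assume "0 <= s"
 then have s: "0 < s" using elim by simp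
 have "(%k. (a k)^2) \<longlonglongrightarrow> 0"
 proof (rule tendsto_null_power)
 show "a \<longlonglongrightarrow> 0"
 by (rule real_tendsto_sandwich[OF _ _ tendsto_const LIMSEQ_inverse_real_of_nat])
 (use a in "auto simp: less_imp_le inverse_eq_divide")
 qed simp
 then have "\<forall>\<^sub>F k in sequentially. (a k)^2 < s" using s by (rule order_tendstoD(2))
 then have "\<forall>\<^sub>F k in sequentially. Q k s = w s" by eventually_elim (use elim in auto)
 then have "(%k. Q k s) \<longlonglongrightarrow> w s" by (rule tendsto_eventually)
 then show "q s = w s" unfolding q_def by (rule limI)
 qed
 qed
 qed
 from AE_sqI[OF this] have "AE x in lebesgue. q (sq x) = w (sq x)" .
 moreover have "AE x in lebesgue. V x = w (sq x)"
 using v by eventually_elim (simp add: w_def sq_eq_norm)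
 ultimately have "AE x in lebesgue. V x = q (sq x)" by eventually_elim simp
 with q show thesis using that by blast
qed

section \<open>Families differentiable in the essential supremum norm, paired with integrable
  weights\<close>

section \<open>Smooth families of bounded functions\<close>

lemma Linf_norm_AE_le:
 assumes "Linf_norm f <= ereal C"
 shows "AE x in lebesgue. abs (f x) <= C"
proof -
 have "AE x in lebesgue. ereal (abs (f x)) <= Linf_norm f" unfolding Linf_norm_def by (rule esssup_AE)
 then show ?thesis by eventually_elim (use assms in "auto dest: order_trans")
qed

lemma Linf_has_derivative_atD:
 assumes "Linf_has_derivative_at F D t" "0 < e"
 obtains d where "0 < d"
 "!!h. h ~= 0 ==> abs h < d ==> AE x in lebesgue. abs (F (t + h) x - F t x - h*D x) <= e*abs h"
proof -
 have "((%h. Linf_norm (%x. (F (t + h) x - F t x)/h - D x)) \<longlongrightarrow> 0) (at 0)"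
 using assms(1) by (simp add: Linf_has_derivative_at_def)
 then have "\<forall>\<^sub>F h in at 0. Linf_norm (%x. (F (t + h) x - F t x)/h - D x) < ereal e"
 using assms(2) by (intro order_tendstoD(2)) auto
 then obtain d where d: "0 < d" "!!h. h ~= 0 ==> abs h < d ==>
 Linf_norm (%x. (F (t + h) x - F t x)/h - D x) < ereal e"
 by (auto simp: eventually_at dist_real_def)
 show thesis
 proof (rule that[OF d(1)])
 fix h :: real assume h: "h ~= 0" "abs h < d"
 have "AE x in lebesgue. abs ((F (t + h) x - F t x)/h - D x) <= e"
 using d(2)[OF h] by (intro Linf_norm_AE_le) auto
 then show "AE x in lebesgue. abs (F (t + h) x - F t x - h*D x) <= e*abs h"
 proof eventually_elim
 case (elim x)
 have "F (t + h) x - F t x - h*D x = h*((F (t + h) x - F t x)/h - D x)"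
 using h by (simp add: field_simps)
 then have "abs (F (t + h) x - F t x - h*D x) = abs h*abs ((F (t + h) x - F t x)/h - D x)"
 by (simp add: abs_mult)
 also have "... <= abs h*e" using elim by (intro mult_left_mono) auto
 finally show ?case by (simp add: mult.commute)
 qed
 qed
qed

text \<open>Serves to identify the given derivative V' with the first derivative in the sequence
  hidden in \<open>Linf_smooth_on\<close>; the two agree only almost everywhere.\<close>

lemma Linf_has_derivative_at_unique:
 assumes "Linf_has_derivative_at F D t" "Linf_has_derivative_at F D' t"
 shows "AE x in lebesgue. D x = D' x"
proof -
 have "AE x in lebesgue. abs (D x - D' x) <= 2/real (Suc n)" for n
 proof -
 have e: "0 < 1/real (Suc n)" by simp
 obtain d where d: "0 < d" "!!h. h ~= 0 ==> abs h < d ==>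
 AE x in lebesgue. abs (F (t + h) x - F t x - h*D x) <= 1/real (Suc n)*abs h"
 using Linf_has_derivative_atD[OF assms(1) e] by blast
 obtain d' where d': "0 < d'" "!!h. h ~= 0 ==> abs h < d' ==>
 AE x in lebesgue. abs (F (t + h) x - F t x - h*D' x) <= 1/real (Suc n)*abs h"
 using Linf_has_derivative_atD[OF assms(2) e] by blast
 define h where "h = min d d'/2"
 have h: "h ~= 0" "abs h < d" "abs h < d'" "0 < h" using d(1) d'(1) by (auto simp: h_def)
 from d(2)[OF h(1,2)] d'(2)[OF h(1,3)] show ?thesis
 proof eventually_elim
 case (elim x)
 have "h*abs (D x - D' x) = abs (h*D x - h*D' x)" using h(4) by (simp add: abs_mult flip: right_diff_distrib)
 also have "... <= abs (F (t + h) x - F t x - h*D x) + abs (F (t + h) x - F t x - h*D' x)" by linarith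
 also have "... <= 1/real (Suc n)*abs h + 1/real (Suc n)*abs h" using elim by linarith
 also have "... = h*(2/real (Suc n))" using h(4) by simp
 finally show ?case using h(4) mult_le_cancel_left_pos by blast
 qed
 qed
 then have "AE x in lebesgue. \<forall>n. abs (D x - D' x) <= 2/real (Suc n)" by (simp add: AE_all_countable)
 then show ?thesis
 proof eventually_elim
 case (elim x)
 have "(%n. 2*inverse (real (Suc n))) \<longlonglongrightarrow> 2*0"
 by (intro tendsto_mult tendsto_const LIMSEQ_inverse_real_of_nat)
 then have "abs (D x - D' x) <= 0"
 using LIMSEQ_le_const[of "%n. 2*inverse (real (Suc n))" "2*0" "abs (D x - D' x)"] elim
 unfolding divide_inverse by simp
 then show ?case by simp
 qed
qed

lemma Linf_integrable_mult:
 assumes "f \<in> Linf" "integrable lebesgue w"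
 shows "integrable lebesgue (%x. f x*w x)"
proof -
 obtain C where C: "AE x in lebesgue. abs (f x) <= C" and m: "f \<in> borel_measurable lebesgue"
 using assms(1) by (auto simp: Linf_def)
 show ?thesis
 proof (rule Bochner_Integration.integrable_bound)
 show "integrable lebesgue (%x. C*w x)" using assms(2) by simp
 show "(%x. f x*w x) \<in> borel_measurable lebesgue" using m assms(2) by auto
 show "AE x in lebesgue. norm (f x*w x) <= norm (C*w x)"
 using C
 proof eventually_elim
 case (elim x) then show ?case
 using mult_right_mono[of "abs (f x)" "abs C" "abs (w x)"] by (auto simp: abs_mult)
 qed
 qed
qed

text \<open>Pairing with an integrable weight is a bounded linear functional for the essential
  supremum norm, so it commutes with differentiation.\<close>

lemma Linf_has_derivative_imp_integral:
 assumes D: "Linf_has_derivative_at F D t" and w: "integrable lebesgue w"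
 and F: "\<forall>\<^sub>F s in nhds t. F s \<in> Linf"
 shows "((%s. \<integral>x. F s x*w x \<partial>lebesgue) has_real_derivative (LINT x|lebesgue. D x*w x)) (at t)"
proof -
 define J where "J = (LINT x|lebesgue. norm (w x))"
 have J: "0 <= J" unfolding J_def by simp
 have DL: "D \<in> Linf" using D by (simp add: Linf_has_derivative_at_def)
 have Ft: "F t \<in> Linf" using eventually_nhds_x_imp_x[OF F] .
 obtain r where r: "0 < r" "!!s. abs (s - t) < r ==> F s \<in> Linf"
 using F by (auto simp: eventually_nhds_metric dist_real_def)
 have "(%h. ((LINT x|lebesgue. F (t + h) x*w x) - (LINT x|lebesgue. F t x*w x))/h) \<midarrow>0\<rightarrow> (LINT x|lebesgue. D x*w x)"
 unfolding LIM_def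
 proof (intro allI impI)
 fix e :: real assume e: "0 < e"
 \<comment> \<open>J + 1 in place of J keeps the quotient meaningful when w vanishes almost
   everywhere.\<close>
 have "0 < e/(J + 1)" using e J by simp
 from Linf_has_derivative_atD[OF D this] obtain d where d: "0 < d"
 "!!h. h ~= 0 ==> abs h < d ==> AE x in lebesgue. abs (F (t + h) x - F t x - h*D x) <= e/(J + 1)*abs h"
 by blast
 show "\<exists>s>0. \<forall>h. h ~= 0 & dist h 0 < s --> dist (((LINT x|lebesgue. F (t + h) x*w x) - (LINT x|lebesgue. F t x*w x))/h) (LINT x|lebesgue. D x*w x) < e"
 proof (intro exI[of _ "min d r"] conjI allI impI)
 show "0 < min d r" using d r by simp
 fix h :: real assume h': "h ~= 0 & dist h 0 < min d r"
 then have h: "h ~= 0" "abs h < d" "abs h < r" by auto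
 have i: "integrable lebesgue (%x. F (t + h) x*w x)" "integrable lebesgue (%x. F t x*w x)"
 "integrable lebesgue (%x. D x*w x)"
 using Linf_integrable_mult[OF _ w] r(2)[of "t + h"] h(3) Ft DL by auto
 have "\<bar>(LINT x|lebesgue. F (t + h) x*w x) - (LINT x|lebesgue. F t x*w x) - h*(LINT x|lebesgue. D x*w x)\<bar>
 = \<bar>\<integral>x. (F (t + h) x - F t x - h*D x)*w x \<partial>lebesgue\<bar>"
 using i by (simp add: left_diff_distrib mult.assoc)
 also have "... <= (LINT x|lebesgue. abs ((F (t + h) x - F t x - h*D x)*w x))"
 by (rule integral_abs_bound)
 also have "... <= (LINT x|lebesgue. e/(J + 1)*abs h*norm (w x))"
 proof (rule integral_mono_AE)
 show "integrable lebesgue (%x. abs ((F (t + h) x - F t x - h*D x)*w x))"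
 using i by (intro integrable_abs) (simp add: left_diff_distrib mult.assoc)
 show "AE x in lebesgue. abs ((F (t + h) x - F t x - h*D x)*w x) <= e/(J + 1)*abs h*norm (w x)"
 using d(2)[OF h(1,2)]
 proof eventually_elim
 case (elim x) from mult_right_mono[OF this, of "abs (w x)"] show ?case by (simp add: abs_mult)
 qed
 qed (use w in auto)
 also have "... = e/(J + 1)*abs h*J" by (simp add: J_def)
 also have "... < e*abs h"
 proof -
 have "e/(J + 1)*J < e" using e J by (simp add: field_simps)
 then show ?thesis using h(1) mult_strict_right_mono[of "e/(J + 1)*J" e "abs h"] by (simp add: mult_ac)
 qed
 finally have *: "\<bar>(LINT x|lebesgue. F (t + h) x*w x) - (LINT x|lebesgue. F t x*w x) - h*(LINT x|lebesgue. D x*w x)\<bar> < e*abs h" .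
 have "((LINT x|lebesgue. F (t + h) x*w x) - (LINT x|lebesgue. F t x*w x))/h - (LINT x|lebesgue. D x*w x)
 = ((LINT x|lebesgue. F (t + h) x*w x) - (LINT x|lebesgue. F t x*w x) - h*(LINT x|lebesgue. D x*w x))/h"
 using h(1) by (simp add: field_simps)
 then show "dist (((LINT x|lebesgue. F (t + h) x*w x) - (LINT x|lebesgue. F t x*w x))/h) (LINT x|lebesgue. D x*w x) < e"
 using*h(1) by (simp add: dist_real_def abs_divide divide_less_eq)
 qed
 qed
 then show ?thesis by (simp add: DERIV_def)
qed

text \<open>The pairing with w is a scalar function with derivatives \<open>be k\<close> of every
  order. Taylor's formula of order two applies to it, and C bounds the continuous second derivative
  on a compact interval.\<close>

lemma Linf_smooth_integral_second_order:
 assumes I: "open I" "0 \<in> I" and sm: "Linf_smooth_on I V" and V': "Linf_has_derivative_at V V' 0"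
 and w: "integrable lebesgue w"
 obtains C r where "0 < r" "!!t. abs t < r ==>
 \<bar>(LINT x|lebesgue. V t x*w x) - (LINT x|lebesgue. V 0 x*w x) - t*(LINT x|lebesgue. V' x*w x)\<bar> <= C*t^2"
proof -
 obtain D where D: "D 0 = V" "!!t. t \<in> I ==> V t \<in> Linf"
 "!!k t. t \<in> I ==> Linf_has_derivative_at (D k) (D (Suc k) t) t"
 using sm by (auto simp: Linf_smooth_on_def)
 have DL: "D k t \<in> Linf" if "t \<in> I" for k t
 using D(1,2) D(3)[OF that] that by (cases k) (auto simp: Linf_has_derivative_at_def)
 define be where "be k t = (LINT x|lebesgue. D k t x*w x)" for k t
 have der: "(be k has_real_derivative be (Suc k) t) (at t)" if "t \<in> I" for k t
 unfolding be_def[abs_def]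
 proof (rule Linf_has_derivative_imp_integral[OF D(3)[OF that] w])
 show "\<forall>\<^sub>F s in nhds t. D k s \<in> Linf"
 using eventually_nhds_in_open[OF I(1) that] by eventually_elim (rule DL)
 qed
 obtain r where r: "0 < r" "cball 0 r \<subseteq> I" using I open_contains_cball by blast
 have "continuous_on {-r..r} (be 2)"
 proof (rule continuous_at_imp_continuous_on, rule ballI)
 fix t assume "t \<in> {-r..r}"
 then have "t \<in> I" using r(2) by (auto simp: subset_eq dist_real_def)
 from der[OF this, of 2] show "isCont (be 2) t" by (rule DERIV_isCont)
 qed
 then have "bounded (be 2 ` {-r..r})" by (intro compact_imp_bounded compact_continuous_image) auto
 then obtain C where C: "\<forall>t\<in>{-r..r}. abs (be 2 t) <= C" by (auto simp: bounded_iff)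
 have b1: "be (Suc 0) 0 = (LINT x|lebesgue. V' x*w x)"
 proof -
 have "AE x in lebesgue. D (Suc 0) 0 x = V' x"
 using Linf_has_derivative_at_unique[OF _ V'] D(3)[OF I(2), of 0] D(1) by simp
 then show ?thesis unfolding be_def
 by (intro integral_cong_AE borel_measurable_times borel_measurable_integrable[OF w])
 (use DL[OF I(2)] V' in "auto simp: Linf_def Linf_has_derivative_at_def")
 qed
 show thesis
 proof (rule that[OF r(1)])
 fix t :: real assume t: "abs t < r"
 show "\<bar>(LINT x|lebesgue. V t x*w x) - (LINT x|lebesgue. V 0 x*w x) - t*(LINT x|lebesgue. V' x*w x)\<bar> <= C*t^2"
 proof (cases "t = 0")
 case False
 have "\<exists>u. (if t < 0 then t < u & u < 0 else 0 < u & u < t) &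
 be 0 t = (\<Sum>m<2. be m 0/fact m*(t - 0)^m) + be 2 u/fact 2*(t - 0)^2"
 by (rule Taylor[of 2 be "be 0" "-r" r]) (use t r False in "auto intro!: der simp: subset_eq dist_real_def")
 then obtain u where "if t < 0 then t < u & u < 0 else 0 < u & u < t"
 and u2: "be 0 t = (\<Sum>m<2. be m 0/fact m*(t - 0)^m) + be 2 u/fact 2*(t - 0)^2" by blast
 then have u: "abs u <= r" "be 0 t = (\<Sum>m<2. be m 0/fact m*t^m) + be 2 u/fact 2*t^2"
 using t by (auto split: if_splits)
 have "be 0 t - be 0 0 - t*be (Suc 0) 0 = be 2 u/2*t^2"
 unfolding u(2) by (simp add: numeral_2_eq_2)
 moreover have "abs (be 2 u/2*t^2) <= C*t^2"
 proof -
 have "u \<in> {-r..r}" using u(1) by auto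
 then have "abs (be 2 u)*t^2 <= C*t^2" using C by (intro mult_right_mono) auto
 moreover have "0 <= abs (be 2 u)*t^2" by simp
 moreover have "abs (be 2 u/2*t^2) = abs (be 2 u)*t^2/2" by (simp add: abs_mult)
 ultimately show ?thesis by linarith
 qed
 ultimately show ?thesis unfolding b1[symmetric] by (simp add: be_def D(1))
 qed simp
 qed
qed

section \<open>Smooth functions on the plane and on the line\<close>

section \<open>Smooth functions\<close>

lemma partial_eq:
 assumes "(f has_derivative D) (at x)"
 shows "partial i f x = D (axis i 1)"
 unfolding partial_def by (simp add: frechet_derivative_at[OF assms, symmetric])

definition smooth2 :: "(real^2 => complex) => bool" where
 "smooth2 f \<longleftrightarrow> (\<forall>js x. (foldr partial js f) differentiable (at x))"

text \<open>Coinduction: a set of differentiable functions that is stable under partial derivatives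
  consists of smooth functions. Closure properties below reduce to finding such a set.\<close>

lemma smooth2_coinduct:
 assumes "f \<in> S" "!!g x. g \<in> S ==> g differentiable (at x)" "!!g i. g \<in> S ==> partial i g \<in> S"
 shows "smooth2 f"
proof -
 have "foldr partial js f \<in> S" for js by (induction js) (auto intro: assms)
 then show ?thesis unfolding smooth2_def using assms(2) by blast
qed

lemma smooth2_differentiable: "smooth2 f ==> f differentiable (at x)"
 unfolding smooth2_def by (drule spec[of _ "[]"]) simp

lemma smooth2_partial: "smooth2 f ==> smooth2 (partial i f)"
 unfolding smooth2_def
proof (intro allI)
 fix js x assume "\<forall>js x. foldr partial js f differentiable at x"
 then have "foldr partial (js @ [i]) f differentiable at x" by blast
 then show "foldr partial js (partial i f) differentiable at x" by simp
qed

lemma smooth2_has_derivative: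
 "smooth2 f ==> (f has_derivative frechet_derivative f (at x)) (at x)"
 using smooth2_differentiable frechet_derivative_works by blast

lemma smooth2_continuous_on: "smooth2 f ==> continuous_on S f"
 by (rule continuous_at_imp_continuous_on)
 (blast intro: differentiable_imp_continuous_within smooth2_differentiable)

lemma partial_add:
 assumes "f differentiable (at x)" "g differentiable (at x)"
 shows "partial i (%x. f x + g x) x = partial i f x + partial i g x"
proof -
 from assms have "(f has_derivative frechet_derivative f (at x)) (at x)"
 "(g has_derivative frechet_derivative g (at x)) (at x)"
 by (simp_all add: frechet_derivative_works)
 then have "((%x. f x + g x) has_derivative (%h. frechet_derivative f (at x) h + frechet_derivative g (at x) h)) (at x)"
 by (rule has_derivative_add)
 from partial_eq[OF this] show ?thesis by (simp add: partial_def)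
qed

lemma partial_mult:
 assumes "f differentiable (at x)" "g differentiable (at x)"
 shows "partial i (%x. f x*g x) x = partial i f x*g x + f x*partial i g x"
proof -
 from assms have "(f has_derivative frechet_derivative f (at x)) (at x)"
 "(g has_derivative frechet_derivative g (at x)) (at x)"
 by (simp_all add: frechet_derivative_works)
 then have "((%x. f x*g x) has_derivative (%h. f x*frechet_derivative g (at x) h + frechet_derivative f (at x) h*g x)) (at x)"
 by (rule has_derivative_mult)
 from partial_eq[OF this] show ?thesis by (simp add: partial_def)
qed

lemma smooth2_add: assumes "smooth2 f" "smooth2 g" shows "smooth2 (%x. f x + g x)"
proof (rule smooth2_coinduct[where S="{%x. f x + g x | f g. smooth2 f & smooth2 g}"])
 show "(%x. f x + g x) \<in> {%x. f x + g x |f g. smooth2 f & smooth2 g}" using assms by blast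
next
 fix h x assume "h \<in> {%x. f x + g x |f g. smooth2 f & smooth2 g}"
 then show "h differentiable (at x)"
 by (auto intro: differentiable_add[OF smooth2_differentiable smooth2_differentiable])
next
 fix h i assume "h \<in> {%x. f x + g x |f g. smooth2 f & smooth2 g}"
 then obtain f g where h: "h = (%x. f x + g x)" "smooth2 f" "smooth2 g" by blast
 then have "partial i h = (%x. partial i f x + partial i g x)"
 unfolding h(1) by (intro ext partial_add smooth2_differentiable)
 then show "partial i h \<in> {%x. f x + g x |f g. smooth2 f & smooth2 g}"
 using smooth2_partial h by blast
qed

text \<open>Products alone are not stable under differentiation; sums of products are.\<close>

inductive_set smooth2_products :: "(real^2 => complex) set" where
 prod: "smooth2 f ==> smooth2 g ==> (%x. f x*g x) \<in> smooth2_products"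
| add: "a \<in> smooth2_products ==> b \<in> smooth2_products ==> (%x. a x + b x) \<in> smooth2_products"

lemma smooth2_products_differentiable: "h \<in> smooth2_products ==> h differentiable (at x)"
 by (induction rule: smooth2_products.induct)
 (auto intro: differentiable_add differentiable_mult[OF smooth2_differentiable smooth2_differentiable])

lemma smooth2_mult: assumes "smooth2 f" "smooth2 g" shows "smooth2 (%x. f x*g x)"
proof (rule smooth2_coinduct[where S=smooth2_products])
 show "(%x. f x*g x) \<in> smooth2_products" using assms by (rule smooth2_products.prod)
 show "h differentiable (at x)" if "h \<in> smooth2_products" for h x
 using that by (rule smooth2_products_differentiable)
 show "partial i h \<in> smooth2_products" if "h \<in> smooth2_products" for h i
 using that
 proof (induction rule: smooth2_products.induct)
 case (prod f g)
 then have "partial i (%x. f x*g x) = (%x. partial i f x*g x + f x*partial i g x)"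
 by (auto simp: fun_eq_iff intro!: partial_mult smooth2_differentiable)
 then show ?case using prod by (auto intro!: smooth2_products.intros smooth2_partial)
 next
 case (add a b)
 then have "partial i (%x. a x + b x) = (%x. partial i a x + partial i b x)"
 by (auto simp: fun_eq_iff intro!: partial_add smooth2_products_differentiable)
 then show ?case using add by (auto intro!: smooth2_products.intros)
 qed
qed

lemma smooth2_const: "smooth2 (%x. c)"
proof (rule smooth2_coinduct[where S="range (%c x. c)"])
 fix g :: "real^2 => complex" and i assume "g \<in> range (%c x. c)"
 then obtain c where g: "g = (%x. c)" by auto
 have "partial i g x = 0" for x unfolding g by (subst partial_eq[OF has_derivative_const]) simp
 then show "partial i g \<in> range (%c x. c)" by (auto simp: fun_eq_iff)
qed auto

lemma has_derivative_of_real_nth: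
 "((%x. cor (x $ j)) has_derivative (%h. cor (h $ j))) (at x)"
 by (intro has_derivative_of_real bounded_linear_imp_has_derivative bounded_linear_vec_nth)

lemma smooth2_coordinate: "smooth2 (%x. cor (x $ j))"
proof (rule smooth2_coinduct[where S="insert (%x. cor (x $ j)) {f. smooth2 f}"])
 fix g i and x :: "real^2" assume g: "g \<in> insert (%x. cor (x $ j)) {f. smooth2 f}"
 show "g differentiable (at x)"
 using g has_derivative_of_real_nth by (auto intro: smooth2_differentiable differentiableI)
 have "partial i (%x. cor (x $ j)) = (%x. cor (axis i 1 $ j))"
 by (auto simp: fun_eq_iff partial_eq[OF has_derivative_of_real_nth])
 then show "partial i g \<in> insert (%x. cor (x $ j)) {f. smooth2 f}"
 using g smooth2_const smooth2_partial by auto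
qed auto

lemma smooth2_power: "smooth2 f ==> smooth2 (%x. f x^n)"
 by (induction n) (auto intro: smooth2_const smooth2_mult)

definition smooth1 :: "(real => complex) => bool" where
 "smooth1 c \<longleftrightarrow> (\<exists>d. d 0 = c & (\<forall>k s. (d k has_vector_derivative d (Suc k) s) (at s)))"

lemma smooth1_coinduct:
 assumes "c \<in> S" "!!g. g \<in> S ==> \<exists>g'\<in>S. \<forall>s. (g has_vector_derivative g' s) (at s)"
 shows "smooth1 c"
proof -
 obtain D where D: "!!g. g \<in> S ==> D g \<in> S" "!!g s. g \<in> S ==> (g has_vector_derivative D g s) (at s)"
 using assms(2) by metis
 define d where "d k = (D ^^ k) c" for k
 have "d k \<in> S" for k by (induction k) (auto simp: d_def assms(1) D(1))
 then show ?thesis unfolding smooth1_def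
 by (intro exI[of _ d]) (auto simp: d_def intro!: D(2))
qed

lemma smooth1E:
 assumes "smooth1 c"
 obtains c' where "smooth1 c'" "!!s. (c has_vector_derivative c' s) (at s)"
proof -
 obtain d where d: "d 0 = c" "!!k s. (d k has_vector_derivative d (Suc k) s) (at s)"
 using assms by (auto simp: smooth1_def)
 show thesis
 proof
 show "smooth1 (d (Suc 0))" unfolding smooth1_def by (rule exI[of _ "%k. d (Suc k)"]) (use d in auto)
 show "(c has_vector_derivative d (Suc 0) s) (at s)" for s using d(2)[of 0] d(1) by simp
 qed
qed

lemma smooth1_continuous_on: "smooth1 c ==> continuous_on S c"
 by (rule continuous_at_imp_continuous_on)
 (blast intro: has_vector_derivative_continuous elim: smooth1E)

lemma smooth1_const: "smooth1 (%s. a)"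
 by (rule smooth1_coinduct[where S="range (%a s. a)"]) (auto intro!: derivative_eq_intros)

lemma smooth1_add: assumes "smooth1 f" "smooth1 g" shows "smooth1 (%s. f s + g s)"
proof (rule smooth1_coinduct[where S="{%s. f s + g s | f g. smooth1 f & smooth1 g}"])
 fix h assume "h \<in> {%s. f s + g s | f g. smooth1 f & smooth1 g}"
 then obtain f g where h: "h = (%s. f s + g s)" "smooth1 f" "smooth1 g" by blast
 obtain f' where f': "smooth1 f'" "!!s. (f has_vector_derivative f' s) (at s)" using smooth1E[OF h(2)] by blast
 obtain g' where g': "smooth1 g'" "!!s. (g has_vector_derivative g' s) (at s)" using smooth1E[OF h(3)] by blast
 show "\<exists>g'\<in>{%s. f s + g s | f g. smooth1 f & smooth1 g}. \<forall>s. (h has_vector_derivative g' s) (at s)"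
 by (rule bexI[of _ "%s. f' s + g' s"]) (use f' g' h in "auto intro: has_vector_derivative_add")
qed (use assms in blast)

inductive_set smooth1_products :: "(real => complex) set" where
 prod: "smooth1 f ==> smooth1 g ==> (%x. f x*g x) \<in> smooth1_products"
| add: "a \<in> smooth1_products ==> b \<in> smooth1_products ==> (%x. a x + b x) \<in> smooth1_products"

lemma smooth1_mult: assumes "smooth1 f" "smooth1 g" shows "smooth1 (%s. f s*g s)"
proof (rule smooth1_coinduct[where S=smooth1_products])
 show "(%s. f s*g s) \<in> smooth1_products" using assms by (rule smooth1_products.prod)
 show "\<exists>h'\<in>smooth1_products. \<forall>s. (h has_vector_derivative h' s) (at s)" if "h \<in> smooth1_products" for h
 using that
 proof (induction rule: smooth1_products.induct)
 case (prod f g)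
 obtain f' where f': "smooth1 f'" "!!s. (f has_vector_derivative f' s) (at s)" using smooth1E[OF prod(1)] by blast
 obtain g' where g': "smooth1 g'" "!!s. (g has_vector_derivative g' s) (at s)" using smooth1E[OF prod(2)] by blast
 show ?case
 by (rule bexI[of _ "%s. f s*g' s + f' s*g s"])
 (use f' g' prod in "auto intro!: has_vector_derivative_mult smooth1_products.intros")
 next
 case (add a b)
 then obtain a' b' where ab: "a' \<in> smooth1_products" "b' \<in> smooth1_products"
 "!!s. (a has_vector_derivative a' s) (at s)" "!!s. (b has_vector_derivative b' s) (at s)" by blast
 then show ?case
 by (intro bexI[of _ "%s. a' s + b' s"] allI has_vector_derivative_add smooth1_products.add)
 qed
qed

lemma smooth1_of_real: "smooth1 (%s. cor s)"
proof (rule smooth1_coinduct[where S="{%s. cor s, %s. 1, %s. 0}"])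
 fix g :: "real => complex" assume "g \<in> {%s. cor s, %s. 1, %s. 0}"
 moreover have "((%s. cor s) has_vector_derivative 1) (at s)" for s :: real
 by (auto simp: has_vector_derivative_def scaleR_conv_of_real intro!: derivative_eq_intros)
 ultimately show "\<exists>g'\<in>{%s. cor s, %s. 1, %s. 0}. \<forall>s. (g has_vector_derivative g' s) (at s)"
 by (auto intro: has_vector_derivative_const)
qed simp

lemma smooth1_power: "smooth1 f ==> smooth1 (%x. f x^n)"
 by (induction n) (auto intro: smooth1_const smooth1_mult)

lemma smooth1_sum: "finite A ==> (!!i. i \<in> A ==> smooth1 (f i)) ==> smooth1 (%x. \<Sum>i\<in>A. f i x)"
 by (induction A rule: finite_induct) (auto intro: smooth1_const smooth1_add)

lemma smooth1_affine: assumes "smooth1 c" shows "smooth1 (%s. c (a * s + b))"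
proof (rule smooth1_coinduct[where S="{%s. cor k*c (a * s + b) | k c. smooth1 c}"])
 show "(%s. c (a * s + b)) \<in> {%s. cor k*c (a * s + b) | k c. smooth1 c}"
 using assms by (auto intro!: exI[of _ 1] exI[of _ c])
 fix h assume "h \<in> {%s. cor k*c (a * s + b) | k c. smooth1 c}"
 then obtain k c where h: "h = (%s. cor k*c (a * s + b))" "smooth1 c" by blast
 obtain c' where c': "smooth1 c'" "!!s. (c has_vector_derivative c' s) (at s)" using smooth1E[OF h(2)] by blast
 have "((%s. c (a * s + b)) has_vector_derivative (a *\<^sub>R c' (a * s + b))) (at s)" for s
 proof -
 have "((%s. a * s + b) has_vector_derivative a) (at s)" by (auto intro!: derivative_eq_intros)
 from vector_diff_chain_at[OF this c'(2)] show ?thesis by (simp add: o_def)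
 qed
 then have "(h has_vector_derivative cor (k*a)*c' (a * s + b)) (at s)" for s
 unfolding h(1) using has_vector_derivative_mult_right[of "%s. c (a * s + b)" "a *\<^sub>R c' (a * s + b)" "at s" "cor k"]
 by (simp add: scaleR_conv_of_real mult.assoc)
 moreover have "(%s. cor (k*a)*c' (a * s + b)) \<in> {%s. cor k*c (a * s + b) | k c. smooth1 c}"
 using c'(1) by (intro CollectI exI[of _ "k*a"] exI[of _ c']) auto
 ultimately show "\<exists>g'\<in>{%s. cor k*c (a * s + b) | k c. smooth1 c}. \<forall>s. (h has_vector_derivative g' s) (at s)"
 by (intro bexI[of _ "%s. cor (k*a)*c' (a * s + b)"] allI)
qed

lemma has_derivative_sq: "(sq has_derivative (%h. 2*x $ 1*h $ 1 + 2*x $ 2*h $ 2)) (at x)"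
proof -
 have nth: "((%x. x $ j) has_derivative (%h. h $ j)) (at x)" for j :: 2
 by (intro bounded_linear_imp_has_derivative bounded_linear_vec_nth)
 show ?thesis unfolding sq_def[abs_def]
 by (auto intro!: derivative_eq_intros nth simp: fun_eq_iff)
qed

lemma has_derivative_comp_sq:
 assumes "(c has_vector_derivative c') (at (sq x))"
 shows "((%x. c (sq x)) has_derivative (%h. cor (2*x $ 1*h $ 1 + 2*x $ 2*h $ 2)*c')) (at x)"
 using has_derivative_compose[OF has_derivative_sq assms[unfolded has_vector_derivative_def]]
 by (simp add: scaleR_conv_of_real)

lemma partial_comp_sq:
 assumes "(c has_vector_derivative c') (at (sq x))"
 shows "partial i (%x. c (sq x)) x = 2*cor (x $ i)*c'"
 by (subst partial_eq[OF has_derivative_comp_sq[OF assms]]) (use exhaust_2[of i] in "auto simp: axis_def")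

text \<open>The stable set for composition with \<open>sq\<close>: a partial derivative of c(|x|^2)
  is 2 x_i c'(|x|^2), a smooth factor times a composition of the same kind.\<close>

inductive_set smooth2_radial :: "(real^2 => complex) set" where
 prod: "smooth2 f ==> smooth1 c ==> (%x. f x*c (sq x)) \<in> smooth2_radial"
| add: "a \<in> smooth2_radial ==> b \<in> smooth2_radial ==> (%x. a x + b x) \<in> smooth2_radial"

lemma smooth2_radial_differentiable: "h \<in> smooth2_radial ==> h differentiable (at x)"
proof (induction rule: smooth2_radial.induct)
 case (prod f c)
 then obtain c' where "!!s. (c has_vector_derivative c' s) (at s)" using smooth1E by blast
 then have "(%x. c (sq x)) differentiable (at x)" using has_derivative_comp_sq differentiableI by blast
 then show ?case using prod by (auto intro: differentiable_mult[OF smooth2_differentiable])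
qed (auto intro: differentiable_add)

lemma smooth2_comp_sq: assumes "smooth1 c" shows "smooth2 (%x. c (sq x))"
proof (rule smooth2_coinduct[where S=smooth2_radial])
 show "(%x. c (sq x)) \<in> smooth2_radial"
 using smooth2_radial.prod[OF smooth2_const[of 1] assms] by simp
 show "h differentiable (at x)" if "h \<in> smooth2_radial" for h x
 using that by (rule smooth2_radial_differentiable)
 show "partial i h \<in> smooth2_radial" if "h \<in> smooth2_radial" for h i
 using that
 proof (induction rule: smooth2_radial.induct)
 case (prod f c)
 obtain c' where c': "smooth1 c'" "!!s. (c has_vector_derivative c' s) (at s)" using smooth1E[OF prod(2)] by blast
 have d: "(%x. c (sq x)) differentiable (at x)" for x using has_derivative_comp_sq[OF c'(2)] differentiableI by blast
 have "partial i (%x. f x*c (sq x)) = (%x. partial i f x*c (sq x) + (f x*(2*cor (x $ i)))*c' (sq x))"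
 by (rule ext) (subst partial_mult[OF smooth2_differentiable[OF prod(1)] d], simp add: partial_comp_sq[OF c'(2)] mult_ac)
 then show ?case using prod c'(1)
 by (auto intro!: smooth2_radial.intros smooth2_partial smooth2_mult smooth2_const smooth2_coordinate)
 next
 case (add a b)
 then have "partial i (%x. a x + b x) = (%x. partial i a x + partial i b x)"
 by (auto simp: fun_eq_iff intro!: partial_add smooth2_radial_differentiable)
 then show ?case using add by (auto intro!: smooth2_radial.intros)
 qed
qed

section \<open>Flat functions and smooth cutoffs\<close>

subsection \<open>Cutoff functions\<close>

definition flat :: "real => real" where "flat x = (if x > 0 then exp (- (1/x)) else 0)"

lemma poly_div_exp_tendsto_0: "((%y. poly p y/exp y) \<longlongrightarrow> 0) (at_top :: real filter)"
proof -
 have "((%y. \<Sum>i\<le>degree p. coeff p i*(y^i/exp y)) \<longlongrightarrow> (\<Sum>i\<le>degree p. coeff p i*0)) (at_top :: real filter)"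
 by (intro tendsto_sum tendsto_mult tendsto_const tendsto_power_div_exp_0)
 then show ?thesis by (simp add: poly_altdef sum_divide_distrib)
qed

text \<open>In y = 1/x the derivative of p(y) exp(-y) is y^2 (p - p')(y) exp(-y), which has the same
  form. At 0 the difference quotient is y p(y) exp(-y) from the right and tends to 0 as y grows. So
  the whole class is stable under differentiation.\<close>

lemma flat_poly_derivative:
 fixes p :: "real poly"
 defines "f \<equiv> (%x. if x > 0 then poly p (1/x)*exp (- (1/x)) else 0)"
 shows "(f has_real_derivative (if x > 0 then poly ([:0,0,1:]*(p - pderiv p)) (1/x)*exp (- (1/x)) else 0)) (at x)"
proof -
 consider "x > 0" | "x < 0" | "x = 0" by linarith
 then show ?thesis
 proof cases
 case 1
 have "((%x. poly p (1/x)*exp (- (1/x))) has_real_derivative poly ([:0,0,1:]*(p - pderiv p)) (1/x)*exp (- (1/x))) (at x)"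
 using 1 by (auto intro!: derivative_eq_intros DERIV_chain2[OF poly_DERIV] simp: field_simps power2_eq_square)
 moreover have "\<forall>\<^sub>F y in nhds x. poly p (1/y)*exp (- (1/y)) = f y"
 using eventually_nhds_in_open[of "{0<..}" x] 1 by (auto elim!: eventually_mono simp: f_def)
 ultimately show ?thesis using 1 by (subst DERIV_cong_ev[OF refl _ refl, of f]) (auto elim: eventually_mono)
 next
 case 2
 have "\<forall>\<^sub>F y in nhds x. f y = 0"
 using eventually_nhds_in_open[of "{..<0}" x] 2 by (auto elim!: eventually_mono simp: f_def)
 then show ?thesis using 2 by (subst DERIV_cong_ev[OF refl _ refl, of f "%_. 0"]) auto
 next
 case 3
 have "((%h. f h/h) \<longlongrightarrow> 0) (at 0)"
 proof (rule filterlim_split_at)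
 show "((%h. f h/h) \<longlongrightarrow> 0) (at_left 0)"
 by (rule tendsto_eventually) (auto simp: f_def eventually_at_filter)
 have "((%y. poly ([:0,1:]*p) y/exp y) \<longlongrightarrow> 0) (at_top :: real filter)" by (rule poly_div_exp_tendsto_0)
 then have "((%h. poly ([:0,1:]*p) (inverse h)/exp (inverse h)) \<longlongrightarrow> 0) (at_right 0)"
 by (rule filterlim_compose[OF _ filterlim_inverse_at_top_right])
 moreover have "\<forall>\<^sub>F h in at_right 0. poly ([:0,1:]*p) (inverse h)/exp (inverse h) = f h/h"
 by (auto simp: eventually_at_filter f_def exp_minus field_simps)
 ultimately show "((%h. f h/h) \<longlongrightarrow> 0) (at_right 0)" by (rule Lim_transform_eventually)
 qed
 then show ?thesis unfolding 3 DERIV_def by (simp add: f_def)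
 qed
qed

lemma smooth1_flat: "smooth1 (%x. cor (flat x))"
proof (rule smooth1_coinduct[where S="range (%p x. cor (if x > 0 then poly p (1/x)*exp (- (1/x)) else 0))"])
 show "(%x. cor (flat x)) \<in> range (%p x. cor (if x > 0 then poly p (1/x)*exp (- (1/x)) else 0))"
 by (rule image_eqI[of _ _ "[:1:]"]) (auto simp: flat_def fun_eq_iff)
 fix g :: "real => complex" assume "g \<in> range (%p x. cor (if x > 0 then poly p (1/x)*exp (- (1/x)) else 0))"
 then obtain p where g: "g = (%x. cor (if x > 0 then poly p (1/x)*exp (- (1/x)) else 0))" by auto
 have "(g has_vector_derivative cor (if s > 0 then poly ([:0,0,1:]*(p - pderiv p)) (1/s)*exp (- (1/s)) else 0)) (at s)" for s
 unfolding g using has_derivative_of_real[OF flat_poly_derivative[of p s, unfolded has_field_derivative_def], where 'a=complex]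
 by (simp add: has_vector_derivative_def scaleR_conv_of_real mult_ac)
 then show "\<exists>g'\<in>range (%p x. cor (if x > 0 then poly p (1/x)*exp (- (1/x)) else 0)). \<forall>s. (g has_vector_derivative g' s) (at s)"
 by (intro bexI[of _ "%x. cor (if x > 0 then poly ([:0,0,1:]*(p - pderiv p)) (1/x)*exp (- (1/x)) else 0)"] rangeI) auto
qed

lemma flat_pos: "0 < flat x \<longleftrightarrow> 0 < x" by (auto simp: flat_def)
lemma flat_nonneg: "0 <= flat x" by (auto simp: flat_def)
lemma flat_eq_0: "flat x = 0 \<longleftrightarrow> x <= 0" by (auto simp: flat_def)

text \<open>The quotients f/D^k with all powers k form a set stable under differentiation.\<close>

lemma smooth1_divide:
 assumes f: "smooth1 f" and D: "smooth1 D" "!!s. D s ~= 0"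
 shows "smooth1 (%s. f s/D s)"
proof (rule smooth1_coinduct[where S="{%s. f s/D s^k | f k. smooth1 f}"])
 show "(%s. f s/D s) \<in> {%s. f s/D s^k | f k. smooth1 f}"
 using f by (auto intro!: exI[of _ f] exI[of _ "1::nat"])
 fix h assume "h \<in> {%s. f s/D s^k | f k. smooth1 f}"
 then obtain f k where h: "h = (%s. f s/D s^k)" "smooth1 f" by blast
 obtain f' where f': "smooth1 f'" "!!s. (f has_vector_derivative f' s) (at s)" using smooth1E[OF h(2)] by blast
 obtain D' where D': "smooth1 D'" "!!s. (D has_vector_derivative D' s) (at s)" using smooth1E[OF D(1)] by blast
 have "(h has_vector_derivative (f' s*D s + (- of_nat k)*f s*D' s)/D s^Suc k) (at s)" for s
 proof -
 have f1: "(f has_derivative (%h. cor h*f' s)) (at s)" and D1: "(D has_derivative (%h. cor h*D' s)) (at s)"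
 using f'(2)[of s] D'(2)[of s] by (simp_all add: has_vector_derivative_def scaleR_conv_of_real)
 have P1: "((%s. D s^k) has_derivative (%h. of_nat k*(cor h*D' s)*D s^(k - 1))) (at s)"
 by (rule has_derivative_power[OF D1])
 have "((%s. f s/D s^k) has_derivative (%h. (cor h*f' s*D s^k - f s*(of_nat k*(cor h*D' s)*D s^(k - 1)))/(D s^k*D s^k))) (at s)"
 by (rule has_derivative_divide'[OF f1 P1]) (simp add: D(2))
 moreover have "(cor h*f' s*D s^k - f s*(of_nat k*(cor h*D' s)*D s^(k - 1)))/(D s^k*D s^k)
 = h *\<^sub>R ((f' s*D s + (- of_nat k)*f s*D' s)/D s^Suc k)" for h
 using D(2)[of s] by (cases k) (auto simp: scaleR_conv_of_real field_simps)
 ultimately show ?thesis unfolding has_vector_derivative_def h(1)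
 by (rule has_derivative_eq_rhs[OF _ ext])
 qed
 moreover have "(%s. (f' s*D s + (- of_nat k)*f s*D' s)/D s^Suc k) \<in> {%s. f s/D s^k | f k. smooth1 f}"
 by (intro CollectI exI[of _ "%s. f' s*D s + (- of_nat k)*f s*D' s"] exI[of _ "Suc k"] conjI refl
 smooth1_add smooth1_mult smooth1_const f'(1) D'(1) h(2) D(1))
 ultimately show "\<exists>g'\<in>{%s. f s/D s^k | f k. smooth1 f}. \<forall>s. (h has_vector_derivative g' s) (at s)"
 by (intro bexI[of _ "%s. (f' s*D s + (- of_nat k)*f s*D' s)/D s^Suc k"] allI)
qed

lemma smooth_cutoff:
 fixes a b :: real assumes "a < b"
 obtains ch where "smooth1 ch" "!!s. s <= a ==> ch s = 1" "!!s. b <= s ==> ch s = 0" "!!s. norm (ch s) <= 1"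
proof -
 define D where "D s = flat (b - s) + flat (s - a)" for s
 have D: "D s > 0" for s
 using assms flat_pos[of "b - s"] flat_pos[of "s - a"] flat_nonneg[of "b - s"] flat_nonneg[of "s - a"]
 unfolding D_def by linarith
 define ch where "ch s = cor (flat (b - s))/cor (D s)" for s
 have 1: "smooth1 (%s. cor (flat (b - s)))"
 using smooth1_affine[OF smooth1_flat, of "-1" b] by simp
 have 2: "smooth1 (%s. cor (flat (s - a)))"
 using smooth1_affine[OF smooth1_flat, of "1" "-a"] by simp
 have "smooth1 (%s. cor (D s))" unfolding D_def using smooth1_add[OF 1 2] by simp
 then have c1: "smooth1 ch" unfolding ch_def[abs_def] using 1 D by (intro smooth1_divide) (auto simp: less_imp_neq[symmetric])
 have c2: "ch s = 1" if "s <= a" for s using that D[of s] flat_eq_0[of "s - a"] by (simp add: ch_def D_def)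
 have c3: "ch s = 0" if "b <= s" for s using that flat_eq_0[of "b - s"] by (simp add: ch_def)
 have c4: "norm (ch s) <= 1" for s
 proof -
 have "norm (ch s) = flat (b - s)/D s"
 using D[of s] flat_nonneg[of "b - s"] by (simp add: ch_def norm_divide)
 also have "... <= 1" using D[of s] flat_nonneg[of "s - a"] by (simp add: divide_le_eq D_def)
 finally show ?thesis .
 qed
 from c1 c2 c3 c4 show thesis by (rule that)
qed

section \<open>Integral calculus for coefficients that are merely bounded and measurable\<close>

section \<open>Primitives of locally bounded functions\<close>

text \<open>The class of coefficients and sources: potentials are only bounded and measurable, so
  the radial equation is treated in integrated form.\<close>

definition lbm :: "(real => complex) => bool" where
 "lbm f \<longleftrightarrow> f \<in> borel_measurable borel & (\<forall>M. \<exists>C. \<forall>s\<in>{0..M}. norm (f s) <= C)"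

definition prim :: "(real => complex) => real => complex" where
 "prim f s = (LBINT t:{0..s}. f t)"

lemma lbm_measurable: "lbm f ==> f \<in> borel_measurable borel" by (simp add: lbm_def)

lemma lbmI: "f \<in> borel_measurable borel ==> (!!M. \<exists>C. \<forall>s\<in>{0..M}. norm (f s) <= C) ==> lbm f"
 by (simp add: lbm_def)

lemma lbm_bound:
 assumes "lbm f" obtains C where "0 <= C" "!!s. 0 <= s ==> s <= M ==> norm (f s) <= C"
proof -
 obtain C where "\<forall>s\<in>{0..M}. norm (f s) <= C" using assms by (auto simp: lbm_def)
 then show thesis by (intro that[of "max 0 C"]) (auto simp: le_max_iff_disj)
qed

lemma lbm_continuous: "continuous_on UNIV f ==> lbm f"
proof (rule lbmI)
 fix M :: real assume c: "continuous_on UNIV f"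
 have "bounded (f ` {0..M})"
 by (intro compact_imp_bounded compact_continuous_image continuous_on_subset[OF c]) auto
 then show "\<exists>C. \<forall>s\<in>{0..M}. norm (f s) <= C" by (auto simp: bounded_iff)
qed (rule borel_measurable_continuous_onI)

lemma lbm_mult: assumes "lbm f" "lbm g" shows "lbm (%s. f s*g s)"
proof (rule lbmI)
 show "(%s. f s*g s) \<in> borel_measurable borel" using assms[THEN lbm_measurable] by measurable
 fix M
 obtain C where C: "0 <= C" "!!s. 0 <= s ==> s <= M ==> norm (f s) <= C" using lbm_bound[OF assms(1)] by blast
 obtain D where D: "0 <= D" "!!s. 0 <= s ==> s <= M ==> norm (g s) <= D" using lbm_bound[OF assms(2)] by blast
 show "\<exists>C. \<forall>s\<in>{0..M}. norm (f s*g s) <= C"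
 by (rule exI[of _ "C*D"]) (use C D in "auto simp: norm_mult intro!: mult_mono")
qed

lemma lbm_add: assumes "lbm f" "lbm g" shows "lbm (%s. f s + g s)"
proof (rule lbmI)
 show "(%s. f s + g s) \<in> borel_measurable borel" using assms[THEN lbm_measurable] by measurable
 fix M
 obtain C where C: "0 <= C" "!!s. 0 <= s ==> s <= M ==> norm (f s) <= C" using lbm_bound[OF assms(1)] by blast
 obtain D where D: "0 <= D" "!!s. 0 <= s ==> s <= M ==> norm (g s) <= D" using lbm_bound[OF assms(2)] by blast
 show "\<exists>C. \<forall>s\<in>{0..M}. norm (f s + g s) <= C"
 by (rule exI[of _ "C + D"]) (use C D in "auto intro!: norm_triangle_mono")
qed

lemma lbm_const: "lbm (%s. c)" by (intro lbm_continuous continuous_intros)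
lemma lbm_of_real_power: "lbm (%s. cor s^n)" by (intro lbm_continuous continuous_intros)
lemma lbm_cmult: "lbm f ==> lbm (%s. c*f s)" by (intro lbm_mult lbm_const)
lemma lbm_uminus: "lbm f ==> lbm (%s. - f s)" using lbm_cmult[of f "-1"] by simp
lemma lbm_diff: "lbm f ==> lbm g ==> lbm (%s. f s - g s)"
 using lbm_add[OF _ lbm_uminus, of f g] by simp

lemma lbm_cnj: assumes "lbm f" shows "lbm (%s. cnj (f s))"
proof (rule lbmI)
 show "(%s. cnj (f s)) \<in> borel_measurable borel"
 by (rule borel_measurable_continuous_on[OF _ lbm_measurable[OF assms]]) (intro continuous_intros)
qed (use assms in "auto simp: lbm_def")

lemma lbm_set_integrable: assumes "lbm f" "0 <= a" shows "set_integrable lborel {a..b} f"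
proof -
 obtain C where C: "!!s. 0 <= s ==> s <= b ==> norm (f s) <= C" using lbm_bound[OF assms(1)] by blast
 show ?thesis unfolding set_integrable_def
 proof (rule integrableI_bounded_set_indicator[where B=C])
 show "AE x\<in>{a..b} in lborel. norm (f x) <= C" using C assms(2) by auto
 qed (use assms(1) in "auto dest: lbm_measurable simp: emeasure_lborel_Icc_eq")
qed

lemma prim_eq_integral: "lbm f ==> prim f s = integral {0..s} f"
 unfolding prim_def by (rule set_borel_integral_eq_integral(2)[OF lbm_set_integrable]) auto

lemma lbm_integrable_on: "lbm f ==> 0 <= a ==> f integrable_on {a..b}"
 by (rule set_borel_integral_eq_integral(1)[OF lbm_set_integrable])

lemma prim_0 [simp]: "s <= 0 ==> prim f s = 0"
proof -
 assume "s <= 0"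
 then consider "{0..s} = {}" | "s = 0" by fastforce
 then show ?thesis
 proof cases
 case 2
 have "(LBINT t:{0}. f t) = 0" unfolding set_lebesgue_integral_def
 by (rule integral_eq_zero_AE) (use AE_lborel_singleton[of "0::real"] in "auto elim!: eventually_mono")
 then show ?thesis using 2 by (simp add: prim_def)
 qed (auto simp: prim_def set_lebesgue_integral_def)
qed

lemma prim_add: "lbm f ==> lbm g ==> prim (%t. f t + g t) s = prim f s + prim g s"
 unfolding prim_def by (rule set_integral_add) (auto intro: lbm_set_integrable)

lemma prim_cmult: "prim (%t. c*f t) s = c*prim f s"
 unfolding prim_def by simp

lemma prim_uminus: "prim (%t. - f t) s = - prim f s"
 using prim_cmult[of "-1" f s] by simp

lemma prim_minus: "lbm f ==> lbm g ==> prim (%t. f t - g t) s = prim f s - prim g s"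
 using prim_add[OF _ lbm_uminus, of f g s] by (simp add: prim_uminus)

lemma prim_cong: "(!!t. 0 < t ==> t <= s ==> f t = g t) ==> f \<in> borel_measurable borel ==> g \<in> borel_measurable borel ==> prim f s = prim g s"
 unfolding prim_def set_lebesgue_integral_def
proof (rule integral_cong_AE)
 assume *: "!!t. 0 < t ==> t <= s ==> f t = g t"
 show "AE x in lborel. indicat_real {0..s} x *\<^sub>R f x = indicat_real {0..s} x *\<^sub>R g x"
 using AE_lborel_singleton[of "0::real"]
 by eventually_elim (auto simp: indicator_def intro!: *)
qed auto

lemma prim_cnj: "lbm f ==> prim (%t. cnj (f t)) s = cnj (prim f s)"
 by (simp add: prim_eq_integral lbm_cnj integral_cnj)

lemma prim_ftc:
 assumes f: "lbm f" and s: "0 <= s" and F: "continuous_on {0..s} F"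
 "!!t. 0 < t ==> t < s ==> (F has_vector_derivative f t) (at t)"
 shows "prim f s = F s - F 0"
proof -
 have "(f has_integral (F s - F 0)) {0..s}"
 by (rule fundamental_theorem_of_calculus_interior) (use s F in auto)
 then show ?thesis using prim_eq_integral[OF f] by (simp add: integral_unique)
qed

text \<open>The pointwise bound is required only for t > a, because several estimates are available
  only away from the left endpoint; redefining both integrands at a leaves the integrals
  unchanged.\<close>

lemma norm_integral_le_primitive:
 fixes f :: "real => complex"
 assumes f: "f integrable_on {a..b}" and ab: "a <= b"
 and g: "!!t. a < t ==> t <= b ==> norm (f t) <= g' t"
 and d: "!!t. a <= t ==> t <= b ==> (g has_real_derivative g' t) (at t)"
 shows "norm (integral {a..b} f) <= g b - g a"
proof -
 define f0 where "f0 t = (if t = a then 0 else f t)" for t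
 define g0 where "g0 t = (if t = a then 0 else g' t)" for t
 have "(g' has_integral (g b - g a)) {a..b}"
 by (rule fundamental_theorem_of_calculus)
 (use ab d in "auto simp: has_real_derivative_iff_has_vector_derivative intro: has_vector_derivative_at_within")
 then have g': "(g0 has_integral (g b - g a)) {a..b}"
 by (rule has_integral_spike_finite[of "{a}", rotated 2]) (auto simp: g0_def)
 have f': "(f0 has_integral integral {a..b} f) {a..b}"
 by (rule has_integral_spike_finite[of "{a}", OF _ _ integrable_integral[OF f]]) (auto simp: f0_def)
 have "norm (integral {a..b} f0) <= integral {a..b} g0"
 by (rule integral_norm_bound_integral) (use f' g' g in "auto simp: integrable_on_def f0_def g0_def")
 then show ?thesis using f' g' by (simp add: integral_unique)
qed

lemma norm_prim_le:
 assumes f: "lbm f" and s: "0 <= s"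
 and g: "!!t. 0 < t ==> t <= s ==> norm (f t) <= g' t"
 and d: "!!t. 0 <= t ==> t <= s ==> (g has_real_derivative g' t) (at t)"
 shows "norm (prim f s) <= g s - g 0"
 unfolding prim_eq_integral[OF f] by (rule norm_integral_le_primitive[OF lbm_integrable_on[OF f] s g d]) auto

lemma norm_prim_le_const:
 assumes "lbm f" "0 <= s" "!!t. 0 < t ==> t <= s ==> norm (f t) <= C"
 shows "norm (prim f s) <= C * s"
 using norm_prim_le[OF assms(1,2,3), of "%t. C*t"] by (auto intro!: derivative_eq_intros)

lemma prim_diff_bound:
 assumes f: "lbm f" and ab: "0 <= a" "a <= b" and C: "!!t. a <= t ==> t <= b ==> norm (f t) <= C"
 shows "norm (prim f b - prim f a) <= C*(b - a)"
proof -
 have "integral {0..a} f + integral {a..b} f = integral {0..b} f"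
 by (rule Henstock_Kurzweil_Integration.integral_combine) (use ab lbm_integrable_on[OF f] in auto)
 then have "prim f b - prim f a = integral {a..b} f"
 by (simp add: prim_eq_integral[OF f] algebra_simps)
 moreover have "norm (integral {a..b} f) <= C*(b - a)"
 using norm_integral_le_primitive[OF lbm_integrable_on[OF f ab(1), of b] ab(2), of "%_. C" "%t. C*t"] C
 by (auto intro!: derivative_eq_intros simp: right_diff_distrib)
 ultimately show ?thesis by simp
qed

lemma prim_continuous: assumes f: "lbm f" shows "continuous_on S (prim f)"
proof -
 have "isCont (prim f) x" for x
 proof -
 define M where "M = abs x + 1"
 have "continuous_on {0..M} (%s. integral {0..s} f)"
 by (rule indefinite_integral_continuous_1[OF lbm_integrable_on[OF f]]) simp
 then have "continuous_on {-M<..<M} (%s. integral {0..max 0 s} f)"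
 by (rule continuous_on_compose2) (auto intro!: continuous_intros simp: M_def)
 moreover have "integral {0..max 0 s} f = prim f s" for s
 using prim_eq_integral[OF f, of "max 0 s"] by (cases "0 <= s") (auto simp: max_def)
 ultimately have "continuous_on {-M<..<M} (prim f)" by simp
 then show ?thesis by (rule continuous_on_interior) (auto simp: M_def)
 qed
 then show ?thesis by (simp add: continuous_at_imp_continuous_on)
qed

lemma lbm_prim: "lbm f ==> lbm (prim f)"
 by (rule lbm_continuous[OF prim_continuous])

lemma prim_has_vector_derivative:
 assumes f: "lbm f" and s: "0 < s" and c: "isCont f s"
 shows "(prim f has_vector_derivative f s) (at s)"
proof -
 have "((%u. integral {0..u} f) has_vector_derivative f s) (at s within {0..s + 1} - {})"
 by (rule integral_has_vector_derivative_continuous_at[OF lbm_integrable_on[OF f]])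
 (use s c in "auto intro: continuous_at_imp_continuous_within")
 then have "((%u. integral {0..u} f) has_vector_derivative f s) (at s within {0..s + 1})" by simp
 moreover have "at s within {0..s + 1} = at s" by (rule at_within_Icc_at) (use s in auto)
 moreover have "prim f = (%u. integral {0..u} f)" by (rule ext) (rule prim_eq_integral[OF f])
 ultimately show ?thesis by simp
qed

lemma prim_tendsto:
 assumes f: "!!k. f k \<in> borel_measurable borel" "g \<in> borel_measurable borel"
 and lim: "AE t in lborel. 0 <= t & t <= s --> (%k. f k t) \<longlonglongrightarrow> g t"
 and C: "!!k t. 0 < t ==> t <= s ==> norm (f k t) <= C"
 shows "(%k. prim (f k) s) \<longlonglongrightarrow> prim g s"
 unfolding prim_def set_lebesgue_integral_def
proof (rule integral_dominated_convergence[where w="%t. indicat_real {0..s} t *\<^sub>R C"])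
 show "AE x in lborel. (%k. indicat_real {0..s} x *\<^sub>R f k x) \<longlonglongrightarrow> indicat_real {0..s} x *\<^sub>R g x"
 using lim by eventually_elim (auto simp: indicator_def)
 show "AE x in lborel. norm (indicat_real {0..s} x *\<^sub>R f k x) <= indicat_real {0..s} x *\<^sub>R C" for k
 using AE_lborel_singleton[of "0::real"]
 proof eventually_elim
 case (elim x)
 then show ?case using C[of x k] by (auto simp: indicator_def)
 qed
 show "integrable lborel (%t. indicat_real {0..s} t *\<^sub>R C)"
 using borel_integrable_compact[of "{0..s}" "%t. C"] by simp
qed (use f in auto)

lemma lbm_polynomial_approx:
 assumes f: "lbm f"
 obtains g C where "!!k. polynomial_function (g k)" "!!k t. 0 <= t ==> t <= M ==> norm (g k t) <= C"
 "AE t in lborel. 0 <= t & t <= M --> (%k. g k t) \<longlonglongrightarrow> f t"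
proof -
 obtain C where C: "0 <= C" "!!s. 0 <= s ==> s <= M ==> norm (f s) <= C" using lbm_bound[OF f] by blast
 define p where "p t = (if t \<in> {0..M} then f t else 0)" for t
 have p: "p \<in> borel_measurable lebesgue"
 unfolding p_def[abs_def] using lbm_measurable[OF f]
 by (intro measurable_completion) (auto intro!: measurable_If)
 obtain g where g: "!!k. polynomial_function (g k)" "!!k x. x \<in> {0..M} ==> norm (g k x) <= C + 1"
 "AE x in lebesgue. x \<in> {0..M} --> (%k. g k x) \<longlonglongrightarrow> p x"
 by (rule bounded_measurable_polynomial_approx[OF p, of C "{0..M}"]) (use C in "auto simp: p_def")
 show thesis
 proof (rule that[OF g(1)])
 show "norm (g k t) <= C + 1" if "0 <= t" "t <= M" for k t using g(2) that by auto
 show "AE t in lborel. 0 <= t & t <= M --> (%k. g k t) \<longlonglongrightarrow> f t"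
 using g(3) unfolding AE_completion_iff by eventually_elim (auto simp: p_def)
 qed
qed

lemma polynomial_function_lbm: "polynomial_function (g :: real => complex) ==> lbm g"
 by (intro lbm_continuous continuous_on_polymonial_function)

text \<open>Integration by parts for primitives of bounded functions, which may fail to be
  differentiable at some points. It holds for polynomials by the fundamental theorem of calculus and
  passes to bounded limits almost everywhere.\<close>

lemma prim_mult:
 assumes f: "lbm f" and h: "lbm h"
 shows "prim f s*prim h s = prim (%t. f t*prim h t + prim f t*h t) s"
proof (cases "0 <= s")
 case True
 obtain fk C where fk: "!!k. polynomial_function (fk k)" "!!k t. 0 <= t ==> t <= s ==> norm (fk k t) <= C"
 "AE t in lborel. 0 <= t & t <= s --> (%k. fk k t) \<longlonglongrightarrow> f t"
 using lbm_polynomial_approx[OF f] by blast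
 obtain hk D where hk: "!!k. polynomial_function (hk k)" "!!k t. 0 <= t ==> t <= s ==> norm (hk k t) <= D"
 "AE t in lborel. 0 <= t & t <= s --> (%k. hk k t) \<longlonglongrightarrow> h t"
 using lbm_polynomial_approx[OF h] by blast
 note lf = polynomial_function_lbm[OF fk(1)] and lh = polynomial_function_lbm[OF hk(1)]
 have CD: "0 <= C" "0 <= D" using fk(2)[of 0 0] hk(2)[of 0 0] True by (auto intro: order_trans[OF norm_ge_zero])
 have pf: "(%k. prim (fk k) t) \<longlonglongrightarrow> prim f t" if "0 <= t" "t <= s" for t
 proof (rule prim_tendsto[where C=C])
 show "AE u in lborel. 0 <= u & u <= t --> (%k. fk k u) \<longlonglongrightarrow> f u"
 using fk(3) by eventually_elim (use that in auto)
 qed (use lf f fk(2) that in "auto dest: lbm_measurable")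
 have ph: "(%k. prim (hk k) t) \<longlonglongrightarrow> prim h t" if "0 <= t" "t <= s" for t
 proof (rule prim_tendsto[where C=D])
 show "AE u in lborel. 0 <= u & u <= t --> (%k. hk k u) \<longlonglongrightarrow> h u"
 using hk(3) by eventually_elim (use that in auto)
 qed (use lh h hk(2) that in "auto dest: lbm_measurable")
 have bf: "norm (prim (fk k) t) <= C * s" if "0 <= t" "t <= s" for k t
 proof -
 have "norm (prim (fk k) t) <= C*t" by (rule norm_prim_le_const[OF lf]) (use that fk(2) in auto)
 also have "... <= C * s" using that CD by (intro mult_left_mono) auto
 finally show ?thesis .
 qed
 have bh: "norm (prim (hk k) t) <= D * s" if "0 <= t" "t <= s" for k t
 proof -
 have "norm (prim (hk k) t) <= D*t" by (rule norm_prim_le_const[OF lh]) (use that hk(2) in auto)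
 also have "... <= D * s" using that CD by (intro mult_left_mono) auto
 finally show ?thesis .
 qed
 have lp: "lbm (%t. fk k t*prim (hk k) t + prim (fk k) t*hk k t)" for k
 by (intro lbm_add lbm_mult lf lh lbm_prim)
 have eq: "prim (fk k) s*prim (hk k) s = prim (%t. fk k t*prim (hk k) t + prim (fk k) t*hk k t) s" for k
 proof -
 have c: "isCont (fk k) t" "isCont (hk k) t" for t
 using continuous_on_polymonial_function[OF fk(1), of UNIV] continuous_on_polymonial_function[OF hk(1), of UNIV]
 by (auto simp: continuous_on_eq_continuous_at)
 have "prim (%t. fk k t*prim (hk k) t + prim (fk k) t*hk k t) s
 = prim (fk k) s*prim (hk k) s - prim (fk k) 0*prim (hk k) 0"
 proof (rule prim_ftc[OF lp True, where F="%t. prim (fk k) t*prim (hk k) t"])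
 show "continuous_on {0..s} (%t. prim (fk k) t*prim (hk k) t)"
 by (intro continuous_intros prim_continuous lf lh)
 fix t :: real assume "0 < t"
 then have "((%t. prim (fk k) t*prim (hk k) t) has_vector_derivative prim (fk k) t*hk k t + fk k t*prim (hk k) t) (at t)"
 by (intro has_vector_derivative_mult prim_has_vector_derivative lf lh c)
 then show "((%t. prim (fk k) t*prim (hk k) t) has_vector_derivative fk k t*prim (hk k) t + prim (fk k) t*hk k t) (at t)"
 by (simp add: add.commute)
 qed
 then show ?thesis by simp
 qed
 have "(%k. prim (fk k) s*prim (hk k) s) \<longlonglongrightarrow> prim (%t. f t*prim h t + prim f t*h t) s"
 unfolding eq
 proof (rule prim_tendsto[where C="C*(D * s) + C * s*D"])
 show "AE t in lborel. 0 <= t & t <= s --> (%k. fk k t*prim (hk k) t + prim (fk k) t*hk k t)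
 \<longlonglongrightarrow> f t*prim h t + prim f t*h t"
 using fk(3) hk(3) by eventually_elim (auto intro!: tendsto_intros pf ph)
 show "norm (fk k t*prim (hk k) t + prim (fk k) t*hk k t) <= C*(D * s) + C * s*D"
 if "0 < t" "t <= s" for k t
 using fk(2)[of t k] hk(2)[of t k] bf[of t k] bh[of t k] that CD True
 by (intro norm_triangle_mono) (auto simp: norm_mult intro!: mult_mono)
 show "(%t. fk k t*prim (hk k) t + prim (fk k) t*hk k t) \<in> borel_measurable borel" for k
 using lbm_measurable[OF lp] .
 show "(%t. f t*prim h t + prim f t*h t) \<in> borel_measurable borel"
 by (intro lbm_measurable lbm_add lbm_mult f h lbm_prim)
 qed
 moreover have "(%k. prim (fk k) s*prim (hk k) s) \<longlonglongrightarrow> prim f s*prim h s"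
 by (intro tendsto_mult pf ph) (use True in auto)
 ultimately show ?thesis using LIMSEQ_unique by blast
qed simp

section \<open>Divergence form of the radial operator at the origin\<close>

section \<open>Regular radial functions\<close>

text \<open>With \<open>s = |x|\<^sup>2\<close> and \<open>\<zeta> = x\<^sub>1 \<plusminus> i x\<^sub>2\<close>, the Laplacian of \<open>\<zeta>\<^sup>n G(s)\<close> is \<open>4 \<zeta>\<^sup>n p(s)\<close> for
  \<open>s\<^sup>n p = (s\<^sup>n\<^sup>+\<^sup>1 G')'\<close>. For \<open>s \<le> 0\<close> the quotient is \<open>0/0 = 0\<close>, which is harmless.\<close>

definition reg :: "nat => (real => complex) => (real => complex) => (real => complex) => bool" where
 "reg n G G1 p \<longleftrightarrow> lbm p &
 (\<forall>s. G1 s = prim (%t. cor t^n*p t) s/cor s^Suc n) &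
 (\<forall>s. G s = G 0 + prim G1 s)"

text \<open>The integral of t^n over [0,s] is s^(n+1)/(n+1), so the singular quotient is controlled
  by the bound of p uniformly down to s = 0. This makes the origin harmless.\<close>

lemma flux_bound:
 assumes p: "lbm p" and s: "0 <= s" and C0: "0 <= C" and C: "!!t. 0 < t ==> t <= s ==> norm (p t) <= C"
 shows "norm (prim (%t. cor t^n*p t) s/cor s^Suc n) <= C"
proof (cases "s = 0")
 case True
 then show ?thesis using C0 by simp
next
 case False
 then have s: "0 < s" using s by simp
 have "norm (prim (%t. cor t^n*p t) s) <= C * s^Suc n/Suc n - C*0^Suc n/Suc n"
 proof (rule norm_prim_le)
 show "lbm (%t. cor t^n*p t)" by (intro lbm_mult lbm_of_real_power p)
 fix t assume t: "0 < t" "t <= s"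
 then show "norm (cor t^n*p t) <= C*t^n"
 using C[OF t] by (simp add: norm_mult norm_power mult.commute mult_right_mono)
 next
 fix t :: real
 show "((%t. C*t^Suc n/Suc n) has_real_derivative C*t^n) (at t)"
 by (rule derivative_eq_intros refl | simp)+
 qed (use s in auto)
 also have "... = C * s^Suc n/Suc n" by simp
 also have "... <= C * s^Suc n/1" using C0 s by (intro divide_left_mono) auto
 finally show ?thesis using s by (simp add: norm_divide norm_mult norm_power divide_le_eq)
qed

lemma lbm_flux:
 assumes p: "lbm p"
 shows "lbm (%s. prim (%t. cor t^n*p t) s/cor s^Suc n)"
proof (rule lbmI)
 have l: "lbm (%t. cor t^n*p t)" by (intro lbm_mult lbm_of_real_power p)
 show "(%s. prim (%t. cor t^n*p t) s/cor s^Suc n) \<in> borel_measurable borel"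
 by (intro borel_measurable_divide lbm_measurable lbm_prim l lbm_of_real_power)
 fix M
 obtain C where C: "0 <= C" "!!s. 0 <= s ==> s <= M ==> norm (p s) <= C" using lbm_bound[OF p] by blast
 show "\<exists>C. \<forall>s\<in>{0..M}. norm (prim (%t. cor t^n*p t) s/cor s^Suc n) <= C"
 by (rule exI[of _ C], rule ballI, rule flux_bound[OF p]) (use C in auto)
qed

lemma regD:
 assumes "reg n G G1 p"
 shows "lbm p" "G1 s = prim (%t. cor t^n*p t) s/cor s^Suc n" "G s = G 0 + prim G1 s"
 "lbm G1" "lbm (%t. cor t^n*p t)"
proof -
 note a = assms[unfolded reg_def]
 show p: "lbm p" by (rule conjunct1[OF a])
 show G1: "G1 s = prim (%t. cor t^n*p t) s/cor s^Suc n" for s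
 by (rule spec[OF conjunct1[OF conjunct2[OF a]]])
 show "G s = G 0 + prim G1 s" by (rule spec[OF conjunct2[OF conjunct2[OF a]]])
 have "G1 = (%s. prim (%t. cor t^n*p t) s/cor s^Suc n)" by (rule ext) (rule G1)
 then show "lbm G1" using lbm_flux[OF p] by simp
 show "lbm (%t. cor t^n*p t)" by (intro lbm_mult lbm_of_real_power p)
qed

lemma reg_continuous: "reg n G G1 p ==> continuous_on S G"
proof -
 assume r: "reg n G G1 p"
 have "continuous_on S (%s. G 0 + prim G1 s)" by (intro continuous_intros prim_continuous regD(4)[OF r])
 also have "(%s. G 0 + prim G1 s) = G" by (rule ext) (rule regD(3)[OF r, symmetric])
 finally show ?thesis .
qed

lemma reg_lbm: "reg n G G1 p ==> lbm G" by (intro lbm_continuous reg_continuous)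

lemma reg_flux: "reg n G G1 p ==> 0 < s ==> cor s^Suc n*G1 s = prim (%t. cor t^n*p t) s"
 using regD(2)[of n G G1 p s] by simp

lemma reg_flux_bound:
 assumes "reg n G G1 p" "!!t. 0 < t ==> t <= s ==> norm (p t) <= C" "0 < s"
 shows "norm (G1 s) <= C"
proof -
 have "0 <= C" using assms(2)[OF assms(3) order_refl] norm_ge_zero order_trans by blast
 then show ?thesis
 unfolding regD(2)[OF assms(1), of s] by (intro flux_bound[OF regD(1)[OF assms(1)]]) (use assms in auto)
qed

lemma reg_isCont_G1:
 assumes "reg n G G1 p" "0 < s" shows "isCont G1 s"
proof -
 have "isCont (%s. prim (%t. cor t^n*p t) s/cor s^Suc n) s"
 using prim_continuous[OF regD(5)[OF assms(1)], of UNIV] assms(2)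
 by (intro continuous_intros) (auto simp: continuous_on_eq_continuous_at)
 also have "(%s. prim (%t. cor t^n*p t) s/cor s^Suc n) = G1"
 by (rule ext) (rule regD(2)[OF assms(1), symmetric])
 finally show ?thesis .
qed

lemma reg_derivative:
 assumes "reg n G G1 p" "0 < s" shows "(G has_vector_derivative G1 s) (at s)"
proof -
 note D = prim_has_vector_derivative[OF regD(4)[OF assms(1)] assms(2) reg_isCont_G1[OF assms]]
 have "((%s. G 0 + prim G1 s) has_vector_derivative 0 + G1 s) (at s)"
 by (rule has_vector_derivative_add[OF has_vector_derivative_const D])
 also have "(%s. G 0 + prim G1 s) = G" by (rule ext) (rule regD(3)[OF assms(1), symmetric])
 finally show ?thesis unfolding add_0_left .
qed

lemma reg_add:
 assumes "reg n G G1 p" "reg n H H1 r"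
 shows "reg n (%s. G s + H s) (%s. G1 s + H1 s) (%s. p s + r s)"
 unfolding reg_def
proof (intro conjI allI)
 show "lbm (%s. p s + r s)" by (intro lbm_add regD(1)[OF assms(1)] regD(1)[OF assms(2)])
 fix s
 have "prim (%t. cor t^n*(p t + r t)) s = prim (%t. cor t^n*p t + cor t^n*r t) s"
 by (simp add: distrib_left)
 also have "... = prim (%t. cor t^n*p t) s + prim (%t. cor t^n*r t) s"
 by (rule prim_add) (intro regD(5)[OF assms(1)] regD(5)[OF assms(2)])+
 finally show "G1 s + H1 s = prim (%t. cor t^n*(p t + r t)) s/cor s^Suc n"
 unfolding regD(2)[OF assms(1), of s] regD(2)[OF assms(2), of s] by (simp only: add_divide_distrib)
 show "G s + H s = G 0 + H 0 + prim (%s. G1 s + H1 s) s"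
 proof -
 have "G s + H s = (G 0 + prim G1 s) + (H 0 + prim H1 s)"
 by (rule arg_cong2[where f="(+)", OF regD(3)[OF assms(1)] regD(3)[OF assms(2)]])
 also have "... = G 0 + H 0 + (prim G1 s + prim H1 s)" by (simp only: add_ac)
 also have "prim G1 s + prim H1 s = prim (%s. G1 s + H1 s) s"
 by (rule prim_add[OF regD(4)[OF assms(1)] regD(4)[OF assms(2)], symmetric])
 finally show ?thesis .
 qed
qed

lemma reg_cmult:
 assumes "reg n G G1 p"
 shows "reg n (%s. c*G s) (%s. c*G1 s) (%s. c*p s)"
 unfolding reg_def
proof (intro conjI allI)
 show "lbm (%s. c*p s)" by (intro lbm_cmult regD(1)[OF assms(1)])
 fix s
 have e: "(%t. cor t^n*(c*p t)) = (%t. c*(cor t^n*p t))"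
 by (rule ext) (rule mult.left_commute)
 show "c*G1 s = prim (%t. cor t^n*(c*p t)) s/cor s^Suc n"
 unfolding e prim_cmult[of c "%t. cor t^n*p t"] regD(2)[OF assms(1), of s]
 by (rule times_divide_eq_right)
 have "c*G s = c*(G 0 + prim G1 s)" by (rule arg_cong[OF regD(3)[OF assms(1)]])
 also have "... = c*G 0 + c*prim G1 s" by (rule distrib_left)
 also have "c*prim G1 s = prim (%s. c*G1 s) s" by (rule prim_cmult[symmetric])
 finally show "c*G s = c*G 0 + prim (%s. c*G1 s) s" .
qed

section \<open>Laplacian and rotation field on products of zeta-powers and radial functions\<close>

section \<open>Calculus of the functions \<open>\<zeta>\<^sup>n C(|x|\<^sup>2)\<close>\<close>

text \<open>For \<open>sig\<close> = 1 this is the complex coordinate, for \<open>sig\<close> = -1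
  its conjugate, so the n-th power carries angular momentum n or -n.\<close>

definition zeta :: "real => real^2 => complex" where
 "zeta sig x = cor (x $ 1) + \<i>*cor sig*cor (x $ 2)"

lemma zeta_mult: "sig^2 = 1 ==> zeta sig x*zeta (- sig) x = cor (sq x)"
 by (simp add: zeta_def sq_def complex_eq_iff power2_eq_square algebra_simps)

lemma norm_zeta: "sig^2 = 1 ==> norm (zeta sig x) = sqrt (sq x)"
 by (simp add: cmod_def zeta_def sq_def power_mult_distrib)

lemma norm_zeta_power_le:
 assumes "sig^2 = 1" "sq x <= M" shows "norm (zeta sig x^n) <= sqrt M^n"
 using assms by (simp add: norm_power norm_zeta power_mono)

lemma smooth2_zeta: "smooth2 (zeta sig)"
 unfolding zeta_def[abs_def] by (intro smooth2_add smooth2_mult smooth2_const smooth2_coordinate)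

lemma has_derivative_zeta: "(zeta sig has_derivative zeta sig) (at x)"
proof -
 have "((%x. cor (x $ 1) + \<i>*cor sig*cor (x $ 2)) has_derivative
 (%h. cor (h $ 1) + \<i>*cor sig*cor (h $ 2))) (at x)"
 by (intro has_derivative_add has_derivative_mult_right has_derivative_of_real_nth)
 then show ?thesis by (simp add: zeta_def[abs_def])
qed

lemma zeta_measurable [measurable]: "zeta sig \<in> borel_measurable borel"
 by (intro borel_measurable_continuous_onI smooth2_continuous_on smooth2_zeta)

lemma partial_zeta_power:
 "partial i (%x. zeta sig x^n) x = of_nat n*zeta sig x^(n - 1)*zeta sig (axis i 1)"
 by (subst partial_eq[OF has_derivative_power[OF has_derivative_zeta]]) (simp add: mult_ac)

lemma zeta_axis: "zeta sig (axis 1 1) = 1" "zeta sig (axis 2 1) = \<i>*cor sig"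
 by (simp_all add: zeta_def axis_def)

lemma differentiable_comp_sq:
 fixes c :: "real => complex"
 assumes "!!s. (c has_vector_derivative c' s) (at s)"
 shows "(%x. c (sq x)) differentiable (at x)"
 by (rule differentiableI[OF has_derivative_comp_sq[where x=x, OF assms]])

lemma partial_zeta_radial:
 assumes c: "!!s. (c has_vector_derivative c' s) (at s)"
 shows "partial i (%x. zeta sig x^n*c (sq x)) x =
 of_nat n*zeta sig (axis i 1)*(zeta sig x^(n - 1)*c (sq x)) + 2*(cor (x $ i)*(zeta sig x^n*c' (sq x)))"
 by (subst partial_mult[OF smooth2_differentiable[OF smooth2_power[OF smooth2_zeta]] differentiable_comp_sq[OF c]])
 (simp add: partial_zeta_power partial_comp_sq[OF c] algebra_simps)

lemma partial_coordinate: "partial i (%x. cor (x $ i)) x = 1"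
 by (subst partial_eq[OF has_derivative_of_real_nth]) (simp add: axis_def)

lemma partial_cmult: "f differentiable (at x) ==> partial i (%x. k*f x) x = k*partial i f x"
proof -
 assume f: "f differentiable (at x)"
 then have "(f has_derivative frechet_derivative f (at x)) (at x)" by (simp add: frechet_derivative_works)
 from partial_eq[OF has_derivative_mult_right[OF this, of k], of i] show ?thesis by (simp add: partial_def)
qed

lemma laplacian_alt: "laplacian f x = partial 1 (partial 1 f) x + partial 2 (partial 2 f) x"
 by (simp add: laplacian_def UNIV_2)

lemma partial_combination:
 assumes A: "!!x. A differentiable (at x)" and B: "!!x. B differentiable (at x)"
 shows "partial i (%x. k*A x + 2*(cor (x $ i)*B x)) x
 = k*partial i A x + 2*(B x + cor (x $ i)*partial i B x)"
proof -
 have co: "(%x. cor (x $ i)) differentiable (at x)" for x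
 by (rule smooth2_differentiable[OF smooth2_coordinate])
 have cB: "(%x. cor (x $ i)*B x) differentiable (at x)" by (rule differentiable_mult[OF co B])
 have "(%x. k*A x) differentiable (at x)" "(%x. 2*(cor (x $ i)*B x)) differentiable (at x)"
 by (rule differentiable_mult[OF differentiable_const A], rule differentiable_mult[OF differentiable_const cB])
 from partial_add[OF this, of i] show ?thesis
 unfolding partial_cmult[OF A] partial_cmult[OF cB] partial_mult[OF co B] partial_coordinate by simp
qed

text \<open>Powers of zeta are harmonic because 1 + (i sig)^2 = 0. Only the radial second
  derivatives and the cross term remain, which combine to the operator s c'' + (n+1) c'.\<close>

lemma laplacian_zeta_radial:
 assumes s: "sig^2 = 1" and c: "!!s. (c has_vector_derivative c' s) (at s)"
 and c': "!!s. (c' has_vector_derivative c'' s) (at s)"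
 shows "laplacian (%x. zeta sig x^n*c (sq x)) x =
 4*(zeta sig x^n*(cor (sq x)*c'' (sq x) + of_nat (n + 1)*c' (sq x)))"
proof -
 let ?e = "%i. zeta sig (axis i 1)"
 have d1: "(%x. zeta sig x^m) differentiable (at x)" for m x
 by (rule smooth2_differentiable[OF smooth2_power[OF smooth2_zeta]])
 have P: "partial i (%x. zeta sig x^n*c (sq x)) = (%x. of_nat n * ?e i*(zeta sig x^(n - 1)*c (sq x)) + 2*(cor (x $ i)*(zeta sig x^n*c' (sq x))))" for i
 by (rule ext) (rule partial_zeta_radial[OF c])
 have PP: "partial i (partial i (%x. zeta sig x^n*c (sq x))) x =
 of_nat n * ?e i*(of_nat (n - 1) * ?e i*(zeta sig x^(n - 1 - 1)*c (sq x)) + 2*(cor (x $ i)*(zeta sig x^(n - 1)*c' (sq x))))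
 + 2*(zeta sig x^n*c' (sq x) + cor (x $ i)*(of_nat n * ?e i*(zeta sig x^(n - 1)*c' (sq x)) + 2*(cor (x $ i)*(zeta sig x^n*c'' (sq x)))))" for i
 unfolding P
 unfolding partial_combination[OF differentiable_mult[OF d1 differentiable_comp_sq[OF c]] differentiable_mult[OF d1 differentiable_comp_sq[OF c']]]
 partial_zeta_radial[OF c] partial_zeta_radial[OF c'] by (rule refl)
 have e: "?e 1 = 1" "?e 2 = \<i>*cor sig" by (rule zeta_axis)+
 have zn: "of_nat n*(zeta sig x^(n - 1)*zeta sig x) = of_nat n*zeta sig x^n"
 by (cases n) (auto simp: mult.commute)
 have ee: "(\<i>*cor sig)*(\<i>*cor sig) = -1"
 proof -
 have "(\<i>*cor sig)*(\<i>*cor sig) = (\<i> * \<i>)*cor (sig^2)"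
 by (simp only: of_real_mult power2_eq_square mult_ac)
 then show ?thesis using s by simp
 qed
 have "laplacian (%x. zeta sig x^n*c (sq x)) x
 = of_nat n * of_nat (n - 1)*(zeta sig x^(n - 1 - 1)*c (sq x))*(1 + (\<i>*cor sig)*(\<i>*cor sig))
 + 4*(of_nat n*(zeta sig x^(n - 1)*(cor (x $ 1) + \<i>*cor sig*cor (x $ 2))))*c' (sq x)
 + 4*zeta sig x^n*c' (sq x) + 4*zeta sig x^n*cor ((x $ 1)^2 + (x $ 2)^2)*c'' (sq x)"
 unfolding laplacian_alt PP e by (simp add: power2_eq_square algebra_simps)
 also have "of_nat n*(zeta sig x^(n - 1)*(cor (x $ 1) + \<i>*cor sig*cor (x $ 2))) = of_nat n*zeta sig x^n"
 using zn by (simp add: zeta_def)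
 finally show ?thesis unfolding ee by (simp add: sq_def algebra_simps)
qed

lemma d_theta_mult:
 assumes "f differentiable (at x)" "g differentiable (at x)"
 shows "d_theta (%x. f x*g x) x = d_theta f x*g x + f x*d_theta g x"
 unfolding d_theta_def by (simp add: partial_mult[OF assms] algebra_simps)

lemma d_theta_zeta_power: "d_theta (%x. zeta 1 x^a) x = \<i> * of_nat a*zeta 1 x^a"
 "d_theta (%x. zeta (-1) x^a) x = - \<i> * of_nat a*zeta (-1) x^a"
proof -
 show "d_theta (%x. zeta 1 x^a) x = \<i> * of_nat a*zeta 1 x^a"
 unfolding d_theta_def partial_zeta_power zeta_axis
 by (cases a) (auto simp: zeta_def algebra_simps)
 show "d_theta (%x. zeta (-1) x^a) x = - \<i> * of_nat a*zeta (-1) x^a"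
 unfolding d_theta_def partial_zeta_power zeta_axis
 by (cases a) (auto simp: zeta_def algebra_simps)
qed

lemma d_theta_radial:
 assumes c: "!!s. (c has_vector_derivative c' s) (at s)"
 shows "d_theta (%x. c (sq x)) x = 0"
 unfolding d_theta_def partial_comp_sq[OF c] by simp

text \<open>Each factor zeta contributes i, each conjugate factor -i, and radial factors are
  annihilated by the rotation field.\<close>

lemma d_theta_monomial:
 assumes c: "smooth1 c"
 shows "d_theta (%x. zeta 1 x^a*zeta (-1) x^b*c (sq x)) x
 = \<i>*(of_nat a - of_nat b)*(zeta 1 x^a*zeta (-1) x^b*c (sq x))"
proof -
 obtain c' where c': "!!s. (c has_vector_derivative c' s) (at s)" using smooth1E[OF c] by blast
 have d: "(%x. zeta sig x^m) differentiable (at x)" for m sig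
 by (rule smooth2_differentiable[OF smooth2_power[OF smooth2_zeta]])
 show ?thesis
 by (subst d_theta_mult[OF differentiable_mult[OF d d] differentiable_comp_sq[OF c']], subst d_theta_mult[OF d d])
 (simp add: d_theta_zeta_power d_theta_radial[OF c'] algebra_simps)
qed

section \<open>Green's formula for compactly supported test functions\<close>

section \<open>Integration by parts in the plane\<close>

lemma integrable_continuous_compact_support:
 fixes f :: "real^2 => complex"
 assumes "continuous_on UNIV f" "!!x. norm x > R ==> f x = 0"
 shows "integrable lborel f" "integrable lebesgue f"
proof -
 have "integrable lborel (%x. indicator (cball 0 R) x *\<^sub>R f x)"
 by (rule borel_integrable_compact) (auto intro: continuous_on_subset[OF assms(1)])
 moreover have "(%x. indicat_real (cball 0 R) x *\<^sub>R f x) = f"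
 using assms(2) by (auto simp: indicator_def fun_eq_iff not_le)
 ultimately show 1: "integrable lborel f" by simp
 then show "integrable lebesgue f" by (subst integrable_completion) auto
qed

lemma partial_outside:
 assumes "!!x. norm x > R ==> f x = 0" "norm x > R"
 shows "partial i f x = 0"
proof -
 have "open {x::real^2. R < norm x}" by (intro open_Collect_less continuous_intros)
 then have "(f has_derivative (%h. 0)) (at x)"
 by (rule has_derivative_transform_within_open[OF has_derivative_const[of 0]]) (use assms in auto)
 from partial_eq[OF this] show ?thesis by simp
qed

lemma vec2_add_scaleR: "vec2 (a + h) b = vec2 a b + h *\<^sub>R axis 1 1" "vec2 a (b + h) = vec2 a b + h *\<^sub>R axis 2 1"
 by (auto simp: vec_eq_iff forall_2 axis_def)

lemma has_vector_derivative_vec2: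
 assumes "smooth2 F"
 shows "((%a. F (vec2 a b)) has_vector_derivative partial 1 F (vec2 a b)) (at a)"
 "((%b. F (vec2 a b)) has_vector_derivative partial 2 F (vec2 a b)) (at b)"
proof -
 have D: "(F has_derivative frechet_derivative F (at (vec2 a b))) (at (vec2 a b))"
 by (rule smooth2_has_derivative[OF assms])
 have lin: "frechet_derivative F (at (vec2 a b)) (h *\<^sub>R v) = h *\<^sub>R frechet_derivative F (at (vec2 a b)) v" for h v
 using linear_cmul[OF has_derivative_linear[OF D]] .
 have 1: "((%a. vec2 a b) has_derivative (%h. h *\<^sub>R axis 1 1)) (at a)"
 proof -
 have "((%t. vec2 0 b + t *\<^sub>R axis 1 1) has_derivative (%h. h *\<^sub>R (axis 1 1 :: real^2))) (at a)"
 by (auto intro!: derivative_eq_intros)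
 then show ?thesis by (simp flip: vec2_add_scaleR)
 qed
 have 2: "((%b. vec2 a b) has_derivative (%h. h *\<^sub>R axis 2 1)) (at b)"
 proof -
 have "((%t. vec2 a 0 + t *\<^sub>R axis 2 1) has_derivative (%h. h *\<^sub>R (axis 2 1 :: real^2))) (at b)"
 by (auto intro!: derivative_eq_intros)
 then show ?thesis by (simp flip: vec2_add_scaleR)
 qed
 show "((%a. F (vec2 a b)) has_vector_derivative partial 1 F (vec2 a b)) (at a)"
 using has_derivative_compose[OF 1 D] by (simp add: has_vector_derivative_def partial_def lin)
 show "((%b. F (vec2 a b)) has_vector_derivative partial 2 F (vec2 a b)) (at b)"
 using has_derivative_compose[OF 2 D] by (simp add: has_vector_derivative_def partial_def lin)
qed

lemma lborel_integral_derivative_eq_0: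
 fixes F :: "real => complex"
 assumes "!!t. (F has_vector_derivative f t) (at t)" "continuous_on UNIV f"
 and z: "!!t. abs t > R ==> F t = 0" "!!t. abs t > R ==> f t = 0"
 shows "(\<integral>t. f t \<partial>lborel) = 0"
proof -
 define M where "M = max R 0 + 1"
 have "has_bochner_integral lborel (%x. indicator {-M..M} x *\<^sub>R f x) (F M - F (-M))"
 by (rule has_bochner_integral_FTC_Icc)
 (use assms in "auto simp: M_def intro: has_vector_derivative_at_within continuous_on_subset")
 moreover have "(%x. indicator {-M..M} x *\<^sub>R f x) = f"
 using z(2) by (auto simp: fun_eq_iff indicator_def M_def)
 moreover have "F M = 0" "F (-M) = 0" using z(1) by (auto simp: M_def)
 ultimately show ?thesis by (simp add: has_bochner_integral_integral_eq)
qed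

text \<open>Fubini, integrating first in the direction of the derivative, and the fundamental
  theorem of calculus on each line.\<close>

lemma integral_partial_eq_0:
 assumes F: "smooth2 F" and z: "!!x. norm x > R ==> F x = 0"
 shows "(LINT x|lebesgue. partial i F x) = 0"
proof -
 define f where "f = partial i F"
 have c: "continuous_on UNIV f" unfolding f_def by (intro smooth2_continuous_on smooth2_partial F)
 have fz: "f x = 0" if "norm x > R" for x unfolding f_def by (rule partial_outside[OF z that])
 have fm: "f \<in> borel_measurable borel" by (rule borel_measurable_continuous_onI[OF c])
 have nv: "abs a <= norm (vec2 a b)" "abs b <= norm (vec2 a b)" for a b
 using component_le_norm_cart[of "vec2 a b" 1] component_le_norm_cart[of "vec2 a b" 2] by simp_all
 have zz: "F (vec2 a b) = 0" "f (vec2 a b) = 0" if "R < abs a \<or> R < abs b" for a b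
 proof -
 have "R < norm (vec2 a b)" using that nv(1)[of a b] nv(2)[of b a] by linarith
 then show "F (vec2 a b) = 0" "f (vec2 a b) = 0" by (rule z, rule fz)
 qed
 have ig: "integrable (lborel \<Otimes>\<^sub>M lborel) (%(a, b). f (vec2 a b))"
 proof -
 have "integrable (distr lborel borel (%p. vec2 (fst p) (snd p))) f"
 unfolding lborel_vec2[symmetric] by (rule integrable_continuous_compact_support[OF c fz])
 then have "integrable lborel (%p. f (vec2 (fst p) (snd p)))"
 by (subst (asm) integrable_distr_eq) (use fm in auto)
 then show ?thesis by (simp add: lborel_prod case_prod_beta')
 qed
 have cc: "continuous_on UNIV (%a. f (vec2 a b))" "continuous_on UNIV (%b. f (vec2 a b))" for a b
 by (intro continuous_on_compose2[OF c] continuous_intros; simp)+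
 have "(LINT x|lebesgue. f x) = (LINT x|lborel. f x)" using fm by (simp add: integral_completion)
 also have "... = (\<integral>x. f x \<partial>(distr lborel borel (%p. vec2 (fst p) (snd p))))" by (simp only: lborel_vec2[symmetric])
 also have "... = (\<integral>p. f (vec2 (fst p) (snd p)) \<partial>lborel)" by (rule integral_distr) (use fm in auto)
 also have "... = (\<integral>(a, b). f (vec2 a b) \<partial>(lborel \<Otimes>\<^sub>M lborel))" by (simp add: lborel_prod case_prod_beta')
 also have "... = 0"
 proof (cases "i = 1")
 case True
 have "(\<integral>a. f (vec2 a b) \<partial>lborel) = 0" for b
 by (rule lborel_integral_derivative_eq_0[where F="%a. F (vec2 a b)" and R=R])
 (use has_vector_derivative_vec2(1)[OF F] cc True zz in "auto simp: f_def")
 then show ?thesis using lborel_pair.integral_snd[OF ig] by simp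
 next
 case False
 then have "i = 2" using exhaust_2 by blast
 then have "(\<integral>b. f (vec2 a b) \<partial>lborel) = 0" for a
 by (intro lborel_integral_derivative_eq_0[where F="%b. F (vec2 a b)" and R=R])
 (use has_vector_derivative_vec2(2)[OF F] cc zz in "auto simp: f_def")
 then show ?thesis using lborel_pair.integral_fst[OF ig] by simp
 qed
 finally show ?thesis by (simp add: f_def)
qed

lemma test_functionsD:
 assumes "f \<in> test_functions"
 obtains R where "smooth2 f" "0 <= R" "!!x. norm x > R ==> f x = 0"
proof -
 obtain R where "smooth2 f" "\<forall>x. norm x > R --> f x = 0"
 using assms by (auto simp: test_functions_def smooth2_def)
 then show thesis by (intro that[of "max 0 R"]) auto
qed

lemma test_functionsI: "smooth2 f ==> (!!x. sq x \<ge> M ==> f x = 0) ==> f \<in> test_functions"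
proof -
 assume s: "smooth2 f" and z: "!!x. sq x \<ge> M ==> f x = 0"
 have "f x = 0" if "norm x > max 1 M" for x
 proof (rule z)
 have "M*1 <= norm x*norm x" using that by (intro mult_mono) auto
 then show "M <= sq x" by (simp add: sq_eq_norm power2_eq_square)
 qed
 then show ?thesis using s unfolding test_functions_def smooth2_def by blast
qed

lemma green_smooth:
 assumes u: "smooth2 u" and phi: "phi \<in> test_functions"
 shows "(LINT x|lebesgue. u x*laplacian phi x) = (LINT x|lebesgue. laplacian u x*phi x)"
proof -
 obtain R where f: "smooth2 phi" "!!x. norm x > R ==> phi x = 0" using test_functionsD[OF phi] by blast
 have fz: "partial i phi x = 0" "partial i (partial i phi) x = 0" if "norm x > R" for i x
 using partial_outside[OF f(2) that] partial_outside[OF partial_outside[OF f(2)] that] by auto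
 note sm = smooth2_mult smooth2_partial u f(1)
 have int: "integrable lebesgue (%x. u x*partial i (partial i phi) x)"
 "integrable lebesgue (%x. partial i (partial i u) x*phi x)"
 "integrable lebesgue (%x. partial i u x*partial i phi x)" for i
 by (rule integrable_continuous_compact_support(2)[of _ R], intro smooth2_continuous_on sm, simp add: fz f(2))+
 have eq: "(LINT x|lebesgue. u x*partial i (partial i phi) x) = (LINT x|lebesgue. partial i (partial i u) x*phi x)" for i
 proof -
 have "(LINT x|lebesgue. partial i (%x. u x*partial i phi x) x) = 0"
 by (rule integral_partial_eq_0[of _ R]) (auto intro!: sm simp: fz)
 moreover have "partial i (%x. u x*partial i phi x) x = partial i u x*partial i phi x + u x*partial i (partial i phi) x" for x
 by (intro partial_mult smooth2_differentiable sm)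
 ultimately have 1: "(LINT x|lebesgue. partial i u x*partial i phi x) + (LINT x|lebesgue. u x*partial i (partial i phi) x) = 0"
 using int by simp
 have "(LINT x|lebesgue. partial i (%x. partial i u x*phi x) x) = 0"
 by (rule integral_partial_eq_0[of _ R]) (auto intro!: sm simp: f(2))
 moreover have "partial i (%x. partial i u x*phi x) x = partial i (partial i u) x*phi x + partial i u x*partial i phi x" for x
 by (intro partial_mult smooth2_differentiable sm)
 ultimately have 2: "(LINT x|lebesgue. partial i (partial i u) x*phi x) + (LINT x|lebesgue. partial i u x*partial i phi x) = 0"
 using int by simp
 from 1 2 show ?thesis by (simp add: add_eq_0_iff)
 qed
 have "(LINT x|lebesgue. u x*laplacian phi x) = (\<Sum>i\<in>UNIV. \<integral>x. u x*partial i (partial i phi) x \<partial>lebesgue)"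
 unfolding laplacian_def sum_distrib_left by (rule Bochner_Integration.integral_sum) (rule int)
 also have "... = (\<Sum>i\<in>UNIV. \<integral>x. partial i (partial i u) x*phi x \<partial>lebesgue)" by (simp only: eq)
 also have "... = (LINT x|lebesgue. laplacian u x*phi x)"
 unfolding laplacian_def sum_distrib_right by (rule Bochner_Integration.integral_sum[symmetric]) (rule int)
 finally show ?thesis .
qed

section \<open>Smooth approximation of regular radial functions\<close>

section \<open>Regular radial functions as weak solutions\<close>

lemma polynomial_has_vector_derivative:
 fixes a :: "nat => complex"
 shows "((%s. \<Sum>i\<le>N. a i*cor s^i) has_vector_derivative (\<Sum>i\<le>N. a i*(of_nat i*cor s^(i - 1)))) (at s)"
proof -
 have "((%z. \<Sum>i\<le>N. a i*z^i) has_field_derivative (\<Sum>i\<le>N. a i*(of_nat i*(cor s)^(i - 1)))) (at (cor s))"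
 by (auto intro!: derivative_eq_intros sum.cong)
 from has_vector_derivative_real_field[OF this] show ?thesis by simp
qed

lemma monomials_has_vector_derivative:
 fixes a :: "nat => complex"
 shows "((%s. \<Sum>i\<le>N. a i/of_nat (m + i + 1)*cor s^(m + i + 1)) has_vector_derivative
 (\<Sum>i\<le>N. a i*cor s^(m + i))) (at s)"
proof -
 have D: "((%z. z^(k + 1)) has_field_derivative of_nat (k + 1)*w^k) (at w)" for k and w :: complex
 using DERIV_power[OF DERIV_ident, where n="k + 1"] by simp
 have "((%z. \<Sum>i\<le>N. a i/of_nat (m + i + 1)*z^(m + i + 1)) has_field_derivative
 (\<Sum>i\<le>N. a i/of_nat (m + i + 1)*(of_nat (m + i + 1)*cor s^(m + i)))) (at (cor s))"
 by (intro DERIV_sum DERIV_cmult D)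
 moreover have "(\<Sum>i\<le>N. a i/of_nat (m + i + 1)*(of_nat (m + i + 1)*cor s^(m + i))) = (\<Sum>i\<le>N. a i*cor s^(m + i))"
 by (intro sum.cong refl) (simp del: of_nat_add of_nat_Suc)
 ultimately have "((%z. \<Sum>i\<le>N. a i/of_nat (m + i + 1)*z^(m + i + 1)) has_field_derivative
 (\<Sum>i\<le>N. a i*cor s^(m + i))) (at (cor s))" by (simp only:)
 from has_vector_derivative_real_field[OF this] show ?thesis .
qed

lemma smooth1_polynomial: "smooth1 (%s. \<Sum>i\<le>(N::nat). a i*cor s^i)"
 by (intro smooth1_sum smooth1_mult smooth1_const smooth1_power smooth1_of_real) auto

text \<open>Approximate p boundedly by polynomials g and solve s H'' + (n+1) H' = g exactly: a
  monomial a s^i yields H' = a/(n+i+1) s^i. The solutions H are polynomials, so they become smooth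
  on the plane after composition with \<open>sq\<close>. They converge together with H' because both
  arise from g by integration.\<close>

lemma reg_polynomial_approx:
 assumes r: "reg n G G1 p" and M: "0 < M"
 obtains H H1 H2 :: "nat => real => complex" and C where
 "!!k. smooth1 (H k)" "!!k s. (H k has_vector_derivative H1 k s) (at s)"
 "!!k s. (H1 k has_vector_derivative H2 k s) (at s)"
 "!!k s. 0 <= s ==> s <= M ==> norm (H k s) <= C & norm (H1 k s) <= C & norm (cor s*H2 k s + of_nat (n + 1)*H1 k s) <= C"
 "!!s. 0 < s ==> s <= M ==> (%k. H k s) \<longlonglongrightarrow> G s" "!!s. 0 < s ==> s <= M ==> (%k. H1 k s) \<longlonglongrightarrow> G1 s"
 "AE s in lborel. 0 <= s & s <= M --> (%k. cor s*H2 k s + of_nat (n + 1)*H1 k s) \<longlonglongrightarrow> p s"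
proof -
 obtain g C where g: "!!k. polynomial_function (g k)" "!!k t. 0 <= t ==> t <= M ==> norm (g k t) <= C"
 "AE t in lborel. 0 <= t & t <= M --> (%k. g k t) \<longlonglongrightarrow> p t"
 using lbm_polynomial_approx[OF regD(1)[OF r]] by blast
 have "\<forall>k. \<exists>q. g k = (%x. \<Sum>i\<le>snd q. fst q i*cor x^i)"
 proof
 fix k
 obtain a :: "nat => complex" and N where "g k = (%x. \<Sum>i\<le>N. a i*cor x^i)"
 by (rule polynomial_function_complex_sum[OF g(1)[of k]])
 then show "\<exists>q. g k = (%x. \<Sum>i\<le>snd q. fst q i*cor x^i)" by (intro exI[of _ "(a, N)"]) simp
 qed
 from choice[OF this] obtain q where q: "\<forall>k. g k = (%x. \<Sum>i\<le>snd (q k). fst (q k) i*cor x^i)" ..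
 define a where "a k = fst (q k)" for k
 define N where "N k = snd (q k)" for k
 have a: "g k = (%x. \<Sum>i\<le>N k. a k i*cor x^i)" for k using spec[OF q, of k] by (simp only: a_def N_def)
 define H1 where "H1 k s = (\<Sum>i\<le>N k. a k i/of_nat (n + i + 1)*cor s^i)" for k and s :: real
 define H2 where "H2 k s = (\<Sum>i\<le>N k. a k i/of_nat (n + i + 1)*(of_nat i*cor s^(i - 1)))" for k and s :: real
 define H where "H k s = G 0 + (\<Sum>i\<le>N k. a k i/of_nat (n + i + 1)/of_nat (0 + i + 1)*cor s^(0 + i + 1))" for k and s :: real
 have C0: "0 <= C" using g(2)[of 0 0] M norm_ge_zero order_trans less_imp_le by blast
 have Hd: "(H k has_vector_derivative H1 k s) (at s)" for k s
 unfolding H_def[abs_def] H1_def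
 using has_vector_derivative_add[OF has_vector_derivative_const monomials_has_vector_derivative[where m=0]]
 by (simp only: add_0_left)
 have H1d: "(H1 k has_vector_derivative H2 k s) (at s)" for k s
 unfolding H1_def[abs_def] H2_def by (rule polynomial_has_vector_derivative)
 have alg: "s*(A*(i*X)) + m*(A*Y) = A*Y*(i + m)" if "s*(i*X) = i*Y" for s A i X m Y :: complex
 proof -
 have "s*(A*(i*X)) = A*(i*Y)" by (simp only: mult.left_commute[of s A] that)
 then show ?thesis by (simp add: algebra_simps)
 qed
 have gH: "cor s*H2 k s + of_nat (n + 1)*H1 k s = g k s" for k s
 proof -
 have "cor s*(a k i/of_nat (n + i + 1)*(of_nat i*cor s^(i - 1))) + of_nat (n + 1)*(a k i/of_nat (n + i + 1)*cor s^i)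
 = a k i*cor s^i" for i
 proof -
 have "cor s*(of_nat i*cor s^(i - 1)) = of_nat i*(cor s^i :: complex)"
 by (cases i) auto
 then have "cor s*(a k i/of_nat (n + i + 1)*(of_nat i*cor s^(i - 1))) + of_nat (n + 1)*(a k i/of_nat (n + i + 1)*cor s^i)
 = a k i/of_nat (n + i + 1)*cor s^i*(of_nat i + of_nat (n + 1))"
 by (rule alg)
 also have "of_nat i + of_nat (n + 1) = (of_nat (n + i + 1) :: complex)" by simp
 finally show ?thesis by (simp del: of_nat_add of_nat_Suc)
 qed
 then show ?thesis
 unfolding H2_def H1_def a sum_distrib_left sum.distrib[symmetric] by simp
 qed
 have lg: "lbm (g k)" for k by (rule polynomial_function_lbm[OF g(1)])
 have smH1: "smooth1 (H1 k)" for k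
 unfolding H1_def[abs_def] by (rule smooth1_polynomial)
 have lH1: "lbm (H1 k)" for k by (rule lbm_continuous[OF smooth1_continuous_on[OF smH1]])
 have flux: "prim (%t. cor t^n*g k t) s = cor s^Suc n*H1 k s" if "0 <= s" for k s
 proof -
 define F where "F s = (\<Sum>i\<le>N k. a k i/of_nat (n + i + 1)*cor s^(n + i + 1))" for s :: real
 have d: "(F has_vector_derivative cor t^n*g k t) (at t)" for t
 unfolding F_def[abs_def] using monomials_has_vector_derivative[where m=n and a="a k" and N="N k"]
 by (simp add: a sum_distrib_left power_add mult_ac)
 have "prim (%t. cor t^n*g k t) s = F s - F 0"
 by (rule prim_ftc) (use that d in "auto intro!: lbm_mult lbm_of_real_power lg continuous_at_imp_continuous_on has_vector_derivative_continuous")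
 also have "... = cor s^Suc n*H1 k s"
 by (simp add: F_def H1_def sum_distrib_left power_add mult_ac)
 finally show ?thesis .
 qed
 have H1b: "norm (H1 k s) <= C" if s: "0 <= s" "s <= M" for k s
 proof (cases "s = 0")
 case True
 have "norm (of_nat (n + 1)*H1 k 0) <= C" using gH[of 0 k] g(2)[of 0 k] M by simp
 then have "real (n + 1)*norm (H1 k 0) <= C" by (simp only: norm_mult norm_of_nat)
 moreover have "1*norm (H1 k 0) <= real (n + 1)*norm (H1 k 0)" by (intro mult_right_mono) auto
 ultimately show ?thesis using True by simp
 next
 case False
 then have "H1 k s = prim (%t. cor t^n*g k t) s/cor s^Suc n" using flux[OF s(1)] by simp
 then show ?thesis using flux_bound[OF lg s(1) C0, of k n] g(2) s by auto
 qed
 have H1c: "(%k. H1 k s) \<longlonglongrightarrow> G1 s" if s: "0 < s" "s <= M" for s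
 proof -
 have "(%k. prim (%t. cor t^n*g k t) s) \<longlonglongrightarrow> prim (%t. cor t^n*p t) s"
 proof (rule prim_tendsto[where C="s^n*C"])
 show "AE t in lborel. 0 <= t & t <= s --> (%k. cor t^n*g k t) \<longlonglongrightarrow> cor t^n*p t"
 using g(3) by eventually_elim (use s in "auto intro!: tendsto_intros")
 show "norm (cor t^n*g k t) <= s^n*C" if "0 < t" "t <= s" for k t
 using that s g(2)[of t k] by (auto simp: norm_mult norm_power intro!: mult_mono power_mono)
 qed (intro lbm_measurable lbm_mult lbm_of_real_power lg regD(1)[OF r])+
 then have "(%k. prim (%t. cor t^n*g k t) s/cor s^Suc n) \<longlonglongrightarrow> prim (%t. cor t^n*p t) s/cor s^Suc n"
 by (intro tendsto_divide tendsto_const) (use s in auto)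
 then show ?thesis unfolding regD(2)[OF r, of s] using flux[of s] s by simp
 qed
 have Hp: "H k s = G 0 + prim (H1 k) s" if "0 <= s" for k s
 proof -
 have "prim (H1 k) s = H k s - H k 0"
 by (rule prim_ftc[OF lH1 that]) (use Hd in "auto intro!: continuous_at_imp_continuous_on has_vector_derivative_continuous")
 moreover have "H k 0 = G 0" by (simp add: H_def)
 ultimately show ?thesis by simp
 qed
 have Hb: "norm (H k s) <= norm (G 0) + C*M" if s: "0 <= s" "s <= M" for k s
 proof -
 have "norm (prim (H1 k) s) <= C * s" by (rule norm_prim_le_const[OF lH1 s(1)]) (use H1b s in auto)
 also have "... <= C*M" using s C0 by (intro mult_left_mono) auto
 finally show ?thesis unfolding Hp[OF s(1)] by (rule norm_triangle_le[OF add_left_mono])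
 qed
 have Hc: "(%k. H k s) \<longlonglongrightarrow> G s" if s: "0 < s" "s <= M" for s
 proof -
 have "(%k. prim (H1 k) s) \<longlonglongrightarrow> prim G1 s"
 proof (rule prim_tendsto[where C=C])
 show "AE t in lborel. 0 <= t & t <= s --> (%k. H1 k t) \<longlonglongrightarrow> G1 t"
 using AE_lborel_singleton[of "0::real"] by eventually_elim (use s in "auto intro!: H1c")
 show "norm (H1 k t) <= C" if "0 < t" "t <= s" for k t using H1b[of t k] that s by auto
 qed (intro lbm_measurable lH1 regD(4)[OF r])+
 then have "(%k. G 0 + prim (H1 k) s) \<longlonglongrightarrow> G 0 + prim G1 s" by (intro tendsto_intros)
 then show ?thesis unfolding regD(3)[OF r, of s] using Hp[of s] s by simp
 qed
 show thesis
 proof (rule that[of H H1 H2 "norm (G 0) + C*M + C"])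
 show "smooth1 (H k)" for k
 unfolding H_def[abs_def] by (intro smooth1_add smooth1_sum smooth1_mult smooth1_const smooth1_power smooth1_of_real) auto
 show "norm (H k s) <= norm (G 0) + C*M + C & norm (H1 k s) <= norm (G 0) + C*M + C &
 norm (cor s*H2 k s + of_nat (n + 1)*H1 k s) <= norm (G 0) + C*M + C" if "0 <= s" "s <= M" for k s
 proof -
 have "0 <= norm (G 0)" "0 <= C*M" using C0 M by auto
 then show ?thesis unfolding gH using Hb[OF that, of k] H1b[OF that, of k] g(2)[OF that, of k] C0 by linarith
 qed
 show "AE s in lborel. 0 <= s & s <= M --> (%k. cor s*H2 k s + of_nat (n + 1)*H1 k s) \<longlonglongrightarrow> p s"
 unfolding gH by (rule g(3))
 qed (fact Hd H1d Hc H1c)+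
qed

section \<open>Existence, bounds and backward uniqueness for the radial equation\<close>

section \<open>The radial equation as a Volterra equation\<close>

lemma exp_weight_bound:
 fixes a s :: real assumes "0 < a" "0 <= s" shows "s*exp (- a * s) <= 1/a"
proof -
 have "a * s <= exp (a * s)" using exp_ge_add_one_self[of "a * s"] by linarith
 then have "a * s*exp (- a * s) <= exp (a * s)*exp (- a * s)" by (intro mult_right_mono) auto
 also have "... = 1" by (simp flip: exp_add)
 finally show ?thesis using assms(1) by (simp add: field_simps)
qed

text \<open>Measuring p against the weight exp(a t) makes the double integral gain a factor 1/a; the
  contraction below rests on this gain.\<close>

lemma volterra_weighted_bound:
 assumes p: "lbm p" and s: "0 <= s" and a: "0 < a" and N: "0 <= N" "0 <= D"
 and b: "!!t. 0 < t ==> t <= s ==> norm (p t) <= N*exp (a*t) + D"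
 shows "norm (prim (%s. prim (%t. cor t^n*p t) s/cor s^Suc n) s) <= N/a*(exp (a * s) - 1) + D * s"
proof -
 have "norm (prim (%s. prim (%t. cor t^n*p t) s/cor s^Suc n) s)
 <= (N/a*exp (a * s) + D * s) - (N/a*exp (a*0) + D*0)"
 proof (rule norm_prim_le[OF lbm_flux[OF p] s, where g'="%t. N*exp (a*t) + D"])
 fix t assume t: "0 < t" "t <= s"
 show "norm (prim (%u. cor u^n*p u) t/cor t^Suc n) <= N*exp (a*t) + D"
 proof (rule flux_bound[OF p])
 fix u assume u: "0 < u" "u <= t"
 have "norm (p u) <= N*exp (a*u) + D" using b u t by auto
 also have "... <= N*exp (a*t) + D" using u a N(1) by (intro add_right_mono mult_left_mono) auto
 finally show "norm (p u) <= N*exp (a*t) + D" .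
 qed (use t N in auto)
 next
 fix t
 show "((%s. N/a*exp (a * s) + D * s) has_real_derivative N*exp (a*t) + D) (at t)"
 using a by (auto intro!: derivative_eq_intros)
 qed
 then show ?thesis by (simp add: right_diff_distrib)
qed

text \<open>Banach's fixed point theorem in the space of bounded continuous functions. The unknown
  is exp(-a s) G(s), and a = 2B + 1 makes the Lipschitz constant B/a at most 1/2.\<close>

lemma volterra_exists:
 assumes P: "lbm P" and g: "lbm g" and B: "!!s. norm (P s) <= B" and D: "!!s. norm (g s) <= D"
 obtains G G1 where "reg n G G1 (%s. P s*G s + g s)" "G 0 = c"
proof -
 have B0: "0 <= B" "0 <= D" using B[of 0] D[of 0] by (auto intro: order_trans[OF norm_ge_zero])
 define a where "a = 2*B + 1"
 have a: "0 < a" "B/a <= 1/2" using B0 by (auto simp: a_def field_simps)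
 \<comment> \<open>The weight is frozen at 1 for negative s, so that bounded functions on the whole
   line can serve as the complete space.\<close>
 define ex where "ex H s = cor (exp (a*max 0 s))*apply_bcontfun H s" for H :: "real \<Rightarrow>\<^sub>C complex" and s
 have exl: "lbm (ex H)" for H
 unfolding ex_def[abs_def] by (intro lbm_continuous continuous_intros) (simp_all add: continuous_on_apply_bcontfun)
 define pp where "pp H s = P s*ex H s + g s" for H s
 have ppl: "lbm (pp H)" for H unfolding pp_def[abs_def] by (intro lbm_add lbm_mult P g exl)
 define K where "K H s = prim (%s. prim (%t. cor t^n*pp H t) s/cor s^Suc n) s" for H s
 have Kl: "lbm (%s. prim (%t. cor t^n*pp H t) s/cor s^Suc n)" for H by (rule lbm_flux[OF ppl])
 define T where "T H s = cor (exp (- a*max 0 s))*(c + K H s)" for H s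
 have Tc: "continuous_on UNIV (T H)" for H
 unfolding T_def[abs_def] K_def by (intro continuous_intros prim_continuous Kl)
 have nb: "norm (apply_bcontfun H s) <= norm H" for H :: "real \<Rightarrow>\<^sub>C complex" and s by (rule norm_bounded)
 have Kz: "K H s = 0" if "s <= 0" for H s using that by (simp add: K_def)
 have Kb: "norm (K H s) <= B*norm H/a*(exp (a * s) - 1) + D * s" if s: "0 <= s" for H s
 unfolding K_def
 proof (rule volterra_weighted_bound[OF ppl s a(1)])
 fix t assume t: "0 < t" "t <= s"
 have "norm (P t*ex H t) <= B*(exp (a*t)*norm H)"
 unfolding norm_mult ex_def using t B[of t] nb[of H t] B0 by (intro mult_mono) auto
 then show "norm (pp H t) <= B*norm H*exp (a*t) + D"
 unfolding pp_def using D[of t] by (intro norm_triangle_le) (simp add: mult_ac)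
 qed (use B0 in auto)
 have Tb: "T H \<in> bcontfun" for H
 proof -
 have "norm (T H s) <= norm c + (B*norm H/a + D/a)" for s
 proof (cases "0 <= s")
 case True
 have e1: "exp (- a * s) <= 1" using True a by simp
 have "norm (T H s) = exp (- a * s)*norm (c + K H s)" using True by (simp add: T_def norm_mult)
 also have "... <= exp (- a * s)*(norm c + (B*norm H/a*exp (a * s) + D * s))"
 proof (intro mult_left_mono)
 have "B*norm H/a*(exp (a * s) - 1) <= B*norm H/a*exp (a * s)" using B0 a by (intro mult_left_mono) auto
 then show "norm (c + K H s) <= norm c + (B*norm H/a*exp (a * s) + D * s)"
 using Kb[OF True, of H] by (intro norm_triangle_le) linarith
 qed auto
 also have "... = exp (- a * s)*norm c + B*norm H/a*(exp (- a * s)*exp (a * s)) + D*(s*exp (- a * s))"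
 by (simp add: algebra_simps)
 also have "exp (- a * s)*exp (a * s) = 1" by (simp flip: exp_add)
 also have "exp (- a * s)*norm c + B*norm H/a*1 + D*(s*exp (- a * s)) <= 1*norm c + B*norm H/a*1 + D*(1/a)"
 by (intro add_mono mult_mono order_refl exp_weight_bound e1) (use a True B0 in auto)
 finally show ?thesis by simp
 next
 case False
 then have "T H s = c" by (simp add: T_def Kz)
 moreover have "0 <= B*norm H/a + D/a" using B0 a by auto
 ultimately show ?thesis by simp
 qed
 then have "bounded (range (T H))" unfolding bounded_iff by blast
 then show ?thesis using Tc by (simp add: bcontfun_def)
 qed
 define TT where "TT H = Bcontfun (T H)" for H
 have TT: "apply_bcontfun (TT H) = T H" for H unfolding TT_def by (rule Bcontfun_inverse[OF Tb])
 have contr: "dist (TT H) (TT J) <= 1/2*dist H J" for H J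
 proof (rule dist_bound)
 fix s
 show "dist (apply_bcontfun (TT H) s) (apply_bcontfun (TT J) s) <= 1/2*dist H J"
 proof (cases "0 <= s")
 case True
 define d where "d = dist H J"
 have d0: "0 <= d" by (simp add: d_def)
 have "K H s - K J s = prim (%s. prim (%t. cor t^n*(pp H t - pp J t)) s/cor s^Suc n) s"
 proof -
 have l: "lbm (%t. cor t^n*pp H t)" for H by (intro lbm_mult lbm_of_real_power ppl)
 have "prim (%t. cor t^n*(pp H t - pp J t)) s/cor s^Suc n
 = prim (%t. cor t^n*pp H t) s/cor s^Suc n - prim (%t. cor t^n*pp J t) s/cor s^Suc n" for s
 unfolding right_diff_distrib prim_minus[OF l l] by (rule diff_divide_distrib)
 then show ?thesis unfolding K_def using prim_minus[OF Kl Kl, of H J s] by simp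
 qed
 moreover have "norm (prim (%s. prim (%t. cor t^n*(pp H t - pp J t)) s/cor s^Suc n) s)
 <= B*d/a*(exp (a * s) - 1) + 0 * s"
 proof (rule volterra_weighted_bound[OF lbm_diff[OF ppl ppl] True a(1)])
 fix t assume t: "0 < t" "t <= s"
 have "pp H t - pp J t = P t*(cor (exp (a*t))*(apply_bcontfun H t - apply_bcontfun J t))"
 using t by (simp add: pp_def ex_def algebra_simps)
 then have "norm (pp H t - pp J t) = norm (P t)*(exp (a*t)*dist (apply_bcontfun H t) (apply_bcontfun J t))"
 by (simp add: norm_mult dist_norm)
 also have "... <= B*(exp (a*t)*d)"
 using B[of t] B0 dist_bounded[of H t J] by (intro mult_mono) (auto simp: d_def)
 finally show "norm (pp H t - pp J t) <= B*d*exp (a*t) + 0" by (simp add: mult_ac)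
 qed (use B0 d0 in auto)
 ultimately have Kd: "norm (K H s - K J s) <= B/a*d*(exp (a * s) - 1)" by (simp add: mult_ac)
 have "dist (T H s) (T J s) = exp (- a * s)*norm (K H s - K J s)"
 using True by (simp add: T_def dist_norm norm_mult flip: right_diff_distrib)
 also have "... <= exp (- a * s)*(B/a*d*exp (a * s))"
 proof -
 have "0 <= B/a*d" using B0 a d0 by (intro mult_nonneg_nonneg divide_nonneg_pos)
 then have "B/a*d*(exp (a * s) - 1) <= B/a*d*exp (a * s)" by (intro mult_left_mono) auto
 with Kd have "norm (K H s - K J s) <= B/a*d*exp (a * s)" by linarith
 then show ?thesis by (rule mult_left_mono) simp
 qed
 also have "... = B/a*d*(exp (- a * s)*exp (a * s))" by (simp add: mult_ac)
 also have "exp (- a * s)*exp (a * s) = 1" by (simp flip: exp_add)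
 also have "B/a*d*1 <= 1/2*d"
 unfolding mult_1_right by (rule mult_right_mono[OF a(2) d0])
 finally show ?thesis by (simp add: TT d_def)
 next
 case False
 then show ?thesis by (simp add: TT T_def Kz)
 qed
 qed
 have "\<exists>!H. TT H = H" by (rule banach_fix_type[of "1/2"]) (use contr in auto)
 then obtain H where H: "TT H = H" by blast
 have Hs: "apply_bcontfun H s = T H s" for s using TT[of H] H by simp
 have ee: "cor (exp (a*m))*cor (exp (- a*m)) = 1" for m
 by (simp flip: of_real_mult exp_add)
 have G: "ex H s = c + K H s" for s
 unfolding ex_def Hs T_def using ee[of "max 0 s"] by (simp add: mult.assoc[symmetric])
 have G0: "ex H 0 = c" using G[of 0] Kz[of 0 H] by simp
 have "reg n (ex H) (%s. prim (%t. cor t^n*pp H t) s/cor s^Suc n) (pp H)"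
 unfolding reg_def using ppl G G0 by (auto simp: K_def)
 then show thesis using that G0 unfolding pp_def[abs_def] by blast
qed

text \<open>The maximum M of |G| exp(-a s) on [0,S] satisfies M <= |G(0)| + D S + M/2.\<close>

lemma volterra_bound:
 assumes r: "reg n G G1 (%s. P s*G s + g s)" and B: "0 <= B" "0 <= D"
 "!!s. 0 < s ==> s <= S ==> norm (P s) <= B" "!!s. 0 < s ==> s <= S ==> norm (g s) <= D"
 and s: "0 <= s" "s <= S"
 shows "norm (G s) <= 2*(norm (G 0) + D*S)*exp ((2*B + 1) * s)"
proof -
 define a where "a = 2*B + 1"
 have a: "0 < a" "B/a <= 1/2" using B by (auto simp: a_def field_simps)
 define f where "f s = norm (G s)*exp (- a * s)" for s
 have S: "0 <= S" using s by simp
 have "continuous_on {0..S} f" unfolding f_def[abs_def] by (intro continuous_intros reg_continuous[OF r])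
 then obtain s1 where s1: "s1 \<in> {0..S}" "!!t. t \<in> {0..S} ==> f t <= f s1"
 using continuous_attains_sup[of "{0..S}" f] S by auto
 define M where "M = f s1"
 have M0: "0 <= M" by (simp add: M_def f_def)
 have GM: "norm (G t) <= M*exp (a*t)" if "0 <= t" "t <= S" for t
 proof -
 have "norm (G t)*exp (- a*t) <= M" using s1(2)[of t] that by (simp add: f_def M_def)
 then have "norm (G t)*exp (- a*t)*exp (a*t) <= M*exp (a*t)" by (intro mult_right_mono) auto
 moreover have "norm (G t)*exp (- a*t)*exp (a*t) = norm (G t)" by (simp add: mult.assoc flip: exp_add)
 ultimately show ?thesis by linarith
 qed
 have G1e: "G1 = (%s. prim (%t. cor t^n*(P t*G t + g t)) s/cor s^Suc n)"
 by (rule ext) (rule regD(2)[OF r])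
 have "norm (prim G1 s1) <= B*M/a*(exp (a * s1) - 1) + D * s1"
 unfolding G1e
 proof (rule volterra_weighted_bound[OF regD(1)[OF r] _ a(1)])
 fix t assume t: "0 < t" "t <= s1"
 have "norm (P t*G t) <= B*(M*exp (a*t))"
 unfolding norm_mult using t s1(1) B GM[of t] by (intro mult_mono) auto
 then show "norm (P t*G t + g t) <= B*M*exp (a*t) + D"
 using B(4)[of t] t s1(1) by (intro norm_triangle_le) (auto simp: mult_ac)
 qed (use s1 M0 B in auto)
 then have "norm (G s1) <= norm (G 0) + (B*M/a*(exp (a * s1) - 1) + D * s1)"
 by (subst regD(3)[OF r]) (intro norm_triangle_le add_left_mono)
 also have "... <= norm (G 0) + (B*M/a*exp (a * s1) + D*S)"
 using B M0 a s1 by (intro add_left_mono add_mono mult_left_mono) auto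
 finally have "norm (G s1) <= norm (G 0) + (B*M/a*exp (a * s1) + D*S)" .
 then have "M <= (norm (G 0) + (B*M/a*exp (a * s1) + D*S))*exp (- a * s1)"
 unfolding M_def f_def by (intro mult_right_mono) auto
 also have "... = (norm (G 0) + D*S)*exp (- a * s1) + B/a*M*(exp (a * s1)*exp (- a * s1))"
 by (simp add: algebra_simps)
 also have "exp (a * s1)*exp (- a * s1) = 1" by (simp flip: exp_add)
 also have "(norm (G 0) + D*S)*exp (- a * s1) + B/a*M*1 <= (norm (G 0) + D*S)*1 + 1/2*M*1"
 by (intro add_mono mult_mono mult_right_mono a(2)) (use a s1 M0 B S in auto)
 finally have "M <= 2*(norm (G 0) + D*S)" by simp
 then have "M*exp (a * s) <= 2*(norm (G 0) + D*S)*exp (a * s)" by (intro mult_right_mono) auto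
 from order_trans[OF GM[OF s] this] show ?thesis by (simp only: a_def)
qed

text \<open>On [eta,T] the equation is regular. Integrating twice backwards from zero data at T with
  the weight exp(a s) gives M <= (kap/a^2) M with kap < a^2, so G vanishes there; eta tending to 0
  reaches the origin. Consequently a solution with nonzero value at 0 never has G and G1 vanishing
  at the same T > 0.\<close>

lemma volterra_backward_unique:
 assumes r: "reg n G G1 (%s. P s*G s)" and P: "lbm P" and T: "0 < T" "G T = 0" "G1 T = 0"
 shows "G 0 = 0"
proof -
 have zero: "G eta = 0" if eta: "0 < eta" "eta <= T" for eta
 proof -
 obtain B where B: "0 <= B" "!!s. 0 <= s ==> s <= T ==> norm (P s) <= B" using lbm_bound[OF P] by blast
 define F where "F = prim (%t. cor t^n*(P t*G t))"
 have lF: "lbm (%t. cor t^n*(P t*G t))" using regD(5)[OF r] .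
 have FT: "F T = 0" using reg_flux[OF r T(1)] T(3) by (simp add: F_def)
 \<comment> \<open>Bounds |t^n P(t)|/u^(n+1) for t and u in [eta,T].\<close>
 define kap where "kap = T^n*B/eta^Suc n"
 have kap0: "0 <= kap" using B T eta by (simp add: kap_def)
 define a where "a = kap + 1"
 have a: "0 < a" "kap/a^2 < 1"
 proof -
 show "0 < a" using kap0 by (simp add: a_def)
 have "0 <= kap * kap" by simp
 then have "kap < a^2" using kap0 unfolding a_def power2_eq_square distrib_left distrib_right by linarith
 then show "kap/a^2 < 1" using \<open>0 < a\<close> by simp
 qed
 define f where "f s = norm (G s)*exp (a * s)" for s
 have "continuous_on {eta..T} f" unfolding f_def[abs_def] by (intro continuous_intros reg_continuous[OF r])
 then obtain s1 where s1: "s1 \<in> {eta..T}" "!!t. t \<in> {eta..T} ==> f t <= f s1"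
 using continuous_attains_sup[of "{eta..T}" f] eta by auto
 define M where "M = f s1"
 have M0: "0 <= M" by (simp add: M_def f_def)
 have ee: "exp (a*t)*exp (- a*t) = 1" for t by (simp flip: exp_add)
 have GM: "norm (G t) <= M*exp (- a*t)" if "eta <= t" "t <= T" for t
 proof -
 have "norm (G t)*exp (a*t) <= M" using s1(2)[of t] that by (simp add: f_def M_def)
 then have "norm (G t)*exp (a*t)*exp (- a*t) <= M*exp (- a*t)" by (intro mult_right_mono) auto
 moreover have "norm (G t)*exp (a*t)*exp (- a*t) = norm (G t)" by (simp add: mult.assoc flip: exp_add)
 ultimately show ?thesis by linarith
 qed
 have seg: "prim h T - prim h u = integral {u..T} h" if "lbm h" "0 <= u" "u <= T" for h u
 proof -
 have "integral {0..u} h + integral {u..T} h = integral {0..T} h"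
 by (rule Henstock_Kurzweil_Integration.integral_combine) (use that lbm_integrable_on[OF that(1)] in auto)
 then show ?thesis by (simp add: prim_eq_integral[OF that(1)] algebra_simps)
 qed
 have FM: "norm (F u) <= T^n*B*M/a*exp (- a*u)" if u: "eta <= u" "u <= T" for u
 proof -
 have "norm (integral {u..T} (%t. cor t^n*(P t*G t))) <= - (T^n*B*M/a)*exp (- a*T) - - (T^n*B*M/a)*exp (- a*u)"
 proof (rule norm_integral_le_primitive[where g'="%t. T^n*B*M*exp (- a*t)"])
 show "(%t. cor t^n*(P t*G t)) integrable_on {u..T}" by (rule lbm_integrable_on[OF lF]) (use u eta in auto)
 fix t assume t: "u < t" "t <= T"
 have "norm (cor t^n)*(norm (P t)*norm (G t)) <= T^n*(B*(M*exp (- a*t)))"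
 using t u eta B GM[of t] by (intro mult_mono) (auto simp: norm_power intro!: power_mono)
 then show "norm (cor t^n*(P t*G t)) <= T^n*B*M*exp (- a*t)" by (simp add: norm_mult mult_ac)
 next
 fix t show "((%s. - (T^n*B*M/a)*exp (- a * s)) has_real_derivative T^n*B*M*exp (- a*t)) (at t)"
 using a(1) by (auto intro!: derivative_eq_intros)
 qed (use u in auto)
 moreover have "F u = - integral {u..T} (%t. cor t^n*(P t*G t))"
 proof -
 have "F T - F u = integral {u..T} (%t. cor t^n*(P t*G t))"
 unfolding F_def by (rule seg[OF lF]) (use u eta in auto)
 then show ?thesis unfolding FT by (simp add: eq_neg_iff_add_eq_0 minus_equation_iff[of "F u"])
 qed
 moreover have "0 <= T^n*B*M/a*exp (- a*T)" using T B M0 a(1) by simp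
 ultimately show ?thesis by simp
 qed
 have G1M: "norm (G1 u) <= kap*M/a*exp (- a*u)" if u: "eta <= u" "u <= T" for u
 proof -
 have "cor u^Suc n*G1 u = F u" using reg_flux[OF r, of u] u eta by (simp add: F_def)
 then have "norm (G1 u)*u^Suc n = norm (F u)"
 using u eta by (metis (no_types, lifting) abs_of_nonneg less_imp_le mult.commute norm_mult norm_of_real norm_power order_trans)
 moreover have "norm (G1 u)*eta^Suc n <= norm (G1 u)*u^Suc n"
 using u eta by (intro mult_left_mono power_mono) auto
 ultimately have "norm (G1 u)*eta^Suc n <= T^n*B*M/a*exp (- a*u)" using FM[OF u] by linarith
 then have "norm (G1 u) <= (T^n*B*M/a*exp (- a*u))/eta^Suc n"
 using eta(1) by (simp only: pos_le_divide_eq zero_less_power)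
 also have "... = kap*M/a*exp (- a*u)" by (simp only: kap_def divide_inverse mult_ac)
 finally show ?thesis .
 qed
 have "norm (G s1) <= kap*M/a^2*exp (- a * s1)"
 proof -
 have "norm (integral {s1..T} G1) <= - (kap*M/a^2)*exp (- a*T) - - (kap*M/a^2)*exp (- a * s1)"
 proof (rule norm_integral_le_primitive[where g'="%t. kap*M/a*exp (- a*t)"])
 show "G1 integrable_on {s1..T}" by (rule lbm_integrable_on[OF regD(4)[OF r]]) (use s1 eta in auto)
 fix t assume t: "s1 < t" "t <= T"
 then show "norm (G1 t) <= kap*M/a*exp (- a*t)" using s1 by (intro G1M) auto
 next
 fix t show "((%s. - (kap*M/a^2)*exp (- a * s)) has_real_derivative kap*M/a*exp (- a*t)) (at t)"
 using a(1) by (auto intro!: derivative_eq_intros simp: power2_eq_square)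
 qed (use s1 in auto)
 moreover have "G s1 = - integral {s1..T} G1"
 proof -
 have "G T = G 0 + prim G1 T" "G s1 = G 0 + prim G1 s1" by (rule regD(3)[OF r])+
 then show ?thesis using seg[OF regD(4)[OF r], of s1] s1 eta T(2) by (simp add: eq_neg_iff_add_eq_0 algebra_simps)
 qed
 moreover have "0 <= kap*M/a^2*exp (- a*T)" using kap0 M0 by simp
 ultimately show ?thesis by simp
 qed
 then have "norm (G s1)*exp (a * s1) <= kap*M/a^2*exp (- a * s1)*exp (a * s1)" by (intro mult_right_mono) auto
 then have "M <= kap/a^2*M" using ee[of s1] by (simp add: M_def f_def mult_ac)
 then have "M = 0" using a(2) M0 by (metis less_eq_real_def mult_less_cancel_right2 not_le)
 then show ?thesis using GM[of eta] eta by simp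
 qed
 have "((%k. G (T/real (Suc k))) \<longlonglongrightarrow> G 0)"
 proof (rule continuous_on_tendsto_compose[of UNIV G])
 show "(%k. T/real (Suc k)) \<longlonglongrightarrow> 0"
 using tendsto_mult[OF tendsto_const[of T] LIMSEQ_inverse_real_of_nat] by (simp add: divide_inverse)
 qed (use reg_continuous[OF r] in auto)
 moreover have "G (T/real (Suc k)) = 0" for k using T(1) by (intro zero) (auto simp: field_simps)
 ultimately show ?thesis by (simp add: LIMSEQ_const_iff)
qed

section \<open>Weak solutions tested against regular radial functions\<close>

lemma L2_loc_mult_integrable:
 assumes psi: "psi \<in> L2_loc" and h: "h \<in> borel_measurable lebesgue"
 and C: "AE x in lebesgue. norm (h x) <= C" and z: "!!x. sq x > M ==> h x = 0"
 shows "integrable lebesgue (%x. psi x*h x)"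
proof (rule Bochner_Integration.integrable_bound)
 let ?K = "cball (0::real^2) (sqrt (max 0 M))"
 have pm: "psi \<in> borel_measurable lebesgue" and pi: "set_integrable lebesgue ?K (%x. (norm (psi x))^2)"
 using psi by (auto simp: L2_loc_def)
 have "integrable lebesgue (indicat_real ?K)"
 using emeasure_lborel_cball_finite[of "0::real^2" "sqrt (max 0 M)"]
 by (intro integrable_real_indicator) auto
 then have "integrable lebesgue (%x. abs C*(indicator ?K x *\<^sub>R (norm (psi x))\<^sup>2 + indicator ?K x))"
 using pi unfolding set_integrable_def by (intro integrable_mult_right Bochner_Integration.integrable_add)
 then show "integrable lebesgue (%x. abs C*(indicator ?K x *\<^sub>R (norm (psi x))\<^sup>2 + indicator ?K x))" .
 show "(%x. psi x*h x) \<in> borel_measurable lebesgue" using pm h by (rule borel_measurable_times)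
 show "AE x in lebesgue. norm (psi x*h x) <= norm (abs C*(indicator ?K x *\<^sub>R (norm (psi x))\<^sup>2 + indicat_real ?K x))"
 using C
 proof eventually_elim
 case (elim x)
 show ?case
 proof (cases "x \<in> ?K")
 case True
 have "norm (psi x) <= (norm (psi x))^2 + 1"
 proof -
 have "0 <= (norm (psi x) - 1/2)^2" by simp
 then show ?thesis by (simp add: power2_eq_square algebra_simps)
 qed
 then have "norm (psi x)*norm (h x) <= ((norm (psi x))^2 + 1)*abs C"
 using elim by (intro mult_mono) auto
 then show ?thesis using True by (simp add: norm_mult abs_mult mult.commute)
 next
 case False
 then have "max 0 M < (norm x)^2" using power_strict_mono[of "sqrt (max 0 M)" "norm x" 2] by simp
 then have "h x = 0" by (intro z) (simp add: sq_eq_norm)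
 then show ?thesis by simp
 qed
 qed
qed

lemma comp_sq_measurable: "f \<in> borel_measurable borel ==> (%x. f (sq x)) \<in> borel_measurable lebesgue"
 by (rule measurable_compose[OF measurable_sq_lebesgue])

lemma smooth2_measurable: "smooth2 f ==> f \<in> borel_measurable lebesgue"
 using borel_measurable_continuous_onI[OF smooth2_continuous_on] by (intro measurable_completion) simp

lemma AE_sq_pos: "AE x in lebesgue. 0 < sq x"
proof -
 have "AE x in lborel. x ~= (0::real^2)" by (rule AE_lborel_singleton)
 then show ?thesis unfolding AE_completion_iff by eventually_elim (simp add: less_le)
qed

lemma smooth1_derivative:
 assumes "smooth1 c" "!!s. (c has_vector_derivative c' s) (at s)" shows "smooth1 c'"
proof -
 obtain d where d: "smooth1 d" "!!s. (c has_vector_derivative d s) (at s)" by (rule smooth1E[OF assms(1)]) blast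
 have "d = c'" by (rule ext) (rule vector_derivative_unique_at[OF d(2) assms(2)])
 then show ?thesis using d(1) by simp
qed

lemma smooth1_borel_measurable: "smooth1 c ==> c \<in> borel_measurable borel"
 by (intro borel_measurable_continuous_onI smooth1_continuous_on)

text \<open>The weight w is abstract so that the statement serves both for test functions and for a
  weak solution multiplied by the potential.\<close>

lemma disc_dominated_convergence:
 fixes F :: "nat => real => complex"
 assumes sig: "sig^2 = 1" and wm: "w \<in> borel_measurable lebesgue"
 and wi: "integrable lebesgue (%x. w x*cor (indicator {..M} (sq x)))"
 and Fm: "!!k. F k \<in> borel_measurable borel" "F' \<in> borel_measurable borel"
 and C: "!!k s. 0 <= s ==> s <= M ==> norm (F k s) <= C"
 and lim: "AE s in lborel. 0 <= s & s <= M --> (%k. F k s) \<longlonglongrightarrow> F' s"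
 and out: "!!x k. M < sq x ==> w x*F k (sq x) = 0" "!!x. M < sq x ==> w x*F' (sq x) = 0"
 shows "(%k. \<integral>x. w x*(zeta sig x^n*F k (sq x)) \<partial>lebesgue) \<longlonglongrightarrow> (LINT x|lebesgue. w x*(zeta sig x^n*F' (sq x)))"
 and "integrable lebesgue (%x. w x*(zeta sig x^n*F k (sq x)))"
 and "integrable lebesgue (%x. w x*(zeta sig x^n*F' (sq x)))"
proof -
 let ?W = "%x. norm (w x*cor (indicator {..M} (sq x)))*(sqrt M^n*C)"
 have W: "integrable lebesgue ?W" by (intro integrable_mult_left integrable_norm wi)
 have zn: "(%x. zeta sig x^n) \<in> borel_measurable lebesgue" by (intro smooth2_measurable smooth2_power smooth2_zeta)
 have m: "(%x. w x*(zeta sig x^n*F k (sq x))) \<in> borel_measurable lebesgue"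
 "(%x. w x*(zeta sig x^n*F' (sq x))) \<in> borel_measurable lebesgue" for k
 by (intro borel_measurable_times wm zn comp_sq_measurable Fm)+
 have b: "norm (w x*(zeta sig x^n*F k (sq x))) <= ?W x" for k x
 proof (cases "sq x <= M")
 case True
 have "norm (zeta sig x^n*F k (sq x)) <= sqrt M^n*C"
 unfolding norm_mult using norm_zeta_power_le[OF sig True] C[of "sq x" k] True order_trans[OF sq_nonneg True]
 by (intro mult_mono zero_le_power) auto
 then show ?thesis using True by (simp add: norm_mult[of "w x"] mult_left_mono)
 next
 case False
 then have "w x*(zeta sig x^n*F k (sq x)) = 0" using out(1)[of x k] by auto
 then show ?thesis using False by simp
 qed
 show "integrable lebesgue (%x. w x*(zeta sig x^n*F k (sq x)))"
 proof (rule Bochner_Integration.integrable_bound[OF W m(1)], rule AE_I2)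
 fix x show "norm (w x*(zeta sig x^n*F k (sq x))) <= norm (?W x)" using b[of x k] by (rule order_trans) simp
 qed
 have "AE x in lebesgue. sq x <= M --> (%k. F k (sq x)) \<longlonglongrightarrow> F' (sq x)"
 by (rule AE_sqI) (use lim in "auto elim!: eventually_mono")
 then have l: "AE x in lebesgue. (%k. w x*(zeta sig x^n*F k (sq x))) \<longlonglongrightarrow> w x*(zeta sig x^n*F' (sq x))"
 proof eventually_elim
 case (elim x)
 show ?case
 proof (cases "sq x <= M")
 case True
 then show ?thesis using elim by (intro tendsto_intros) auto
 next
 case False
 then have "w x*(zeta sig x^n*F k (sq x)) = 0" "w x*(zeta sig x^n*F' (sq x)) = 0" for k
 using out(1)[of x k] out(2)[of x] by auto
 then show ?thesis by (simp only: tendsto_const)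
 qed
 qed
 show "(%k. \<integral>x. w x*(zeta sig x^n*F k (sq x)) \<partial>lebesgue) \<longlonglongrightarrow> (LINT x|lebesgue. w x*(zeta sig x^n*F' (sq x)))"
 by (rule integral_dominated_convergence[OF m(2) m(1) W l]) (use b in auto)
 show "integrable lebesgue (%x. w x*(zeta sig x^n*F' (sq x)))"
 by (rule integrable_dominated_convergence[OF m(2) m(1) W l]) (use b in auto)
qed

text \<open>Green's formula holds for the smooth approximants of
  \<open>reg_polynomial_approx\<close>, and both sides converge because the approximants and their
  reduced Laplacians are uniformly bounded on the support of the test function.\<close>

lemma weak_laplacian_reg:
 assumes r: "reg n G G1 p" and sig: "sig^2 = 1" and phi: "phi \<in> test_functions"
 shows "(LINT x|lebesgue. zeta sig x^n*G (sq x)*laplacian phi x) = (LINT x|lebesgue. 4*(zeta sig x^n*p (sq x))*phi x)"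
proof -
 obtain R where f: "smooth2 phi" "0 <= R" "!!x. norm x > R ==> phi x = 0" using test_functionsD[OF phi] by blast
 define M where "M = R^2 + 1"
 have M: "0 < M" by (simp add: M_def add_nonneg_pos)
 have out: "phi x = 0" "laplacian phi x = 0" if "M < sq x" for x
 proof -
 have "R^2 < (norm x)^2" using that by (simp add: M_def sq_eq_norm)
 then have "R < norm x" using power2_less_imp_less by fastforce
 then show "phi x = 0" "laplacian phi x = 0"
 using f(3) partial_outside[OF partial_outside[OF f(3)]] by (auto simp: laplacian_alt)
 qed
 obtain H H1 H2 C where H: "!!k. smooth1 (H k)" "!!k s. (H k has_vector_derivative H1 k s) (at s)"
 "!!k s. (H1 k has_vector_derivative H2 k s) (at s)"
 "!!k s. 0 <= s ==> s <= M ==> norm (H k s) <= C & norm (H1 k s) <= C & norm (cor s*H2 k s + of_nat (n + 1)*H1 k s) <= C"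
 "!!s. 0 < s ==> s <= M ==> (%k. H k s) \<longlonglongrightarrow> G s" "!!s. 0 < s ==> s <= M ==> (%k. H1 k s) \<longlonglongrightarrow> G1 s"
 "AE s in lborel. 0 <= s & s <= M --> (%k. cor s*H2 k s + of_nat (n + 1)*H1 k s) \<longlonglongrightarrow> p s"
 using reg_polynomial_approx[OF r M] by blast
 define P where "P k s = cor s*H2 k s + of_nat (n + 1)*H1 k s" for k s
 note sH1 = smooth1_derivative[OF H(1,2)]
 note sH2 = smooth1_derivative[OF sH1 H(3)]
 have sP: "smooth1 (P k)" for k
 unfolding P_def[abs_def] by (intro smooth1_add smooth1_mult smooth1_const smooth1_of_real sH1 sH2)
 have su: "smooth2 (%x. zeta sig x^n*H k (sq x))" for k
 by (intro smooth2_mult smooth2_power smooth2_zeta smooth2_comp_sq H(1))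
 have cl: "continuous_on UNIV (laplacian phi)" "continuous_on UNIV phi"
 unfolding laplacian_alt[abs_def] by (intro continuous_intros smooth2_continuous_on smooth2_partial f(1))+
 have i: "w \<in> borel_measurable lebesgue" "integrable lebesgue (%x. w x*cor (indicator {..M} (sq x)))"
 if w: "continuous_on UNIV w" "!!x. M < sq x ==> w x = 0" for w :: "real^2 => complex"
 proof -
 show "w \<in> borel_measurable lebesgue" using borel_measurable_continuous_onI[OF w(1)] by (intro measurable_completion) simp
 have "integrable lebesgue w"
 proof (rule integrable_continuous_compact_support(2)[OF w(1), of "sqrt M"])
 fix x :: "real^2" assume "sqrt M < norm x"
 then have "(sqrt M)^2 < (norm x)^2" using M by (intro power_strict_mono) auto
 then show "w x = 0" using M by (intro w(2)) (simp add: sq_eq_norm)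
 qed
 moreover have "(%x. w x*cor (indicator {..M} (sq x))) = w" using w(2) by (auto simp: fun_eq_iff indicator_def)
 ultimately show "integrable lebesgue (%x. w x*cor (indicator {..M} (sq x)))" by simp
 qed
 have eq: "(LINT x|lebesgue. laplacian phi x*(zeta sig x^n*H k (sq x))) = 4*(LINT x|lebesgue. phi x*(zeta sig x^n*P k (sq x)))" for k
 proof -
 have "(LINT x|lebesgue. zeta sig x^n*H k (sq x)*laplacian phi x) = (LINT x|lebesgue. 4*(phi x*(zeta sig x^n*P k (sq x))))"
 using green_smooth[OF su[of k] phi] unfolding laplacian_zeta_radial[OF sig H(2) H(3)] P_def by (simp only: mult_ac)
 also have "... = 4*(LINT x|lebesgue. phi x*(zeta sig x^n*P k (sq x)))" by (rule integral_mult_right_zero)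
 finally show ?thesis by (simp only: mult.commute[of "laplacian phi _"])
 qed
 have L1: "(%k. \<integral>x. laplacian phi x*(zeta sig x^n*H k (sq x)) \<partial>lebesgue) \<longlonglongrightarrow> (LINT x|lebesgue. laplacian phi x*(zeta sig x^n*G (sq x)))"
 proof (rule disc_dominated_convergence(1)[OF sig i[OF cl(1) out(2)]])
 show "AE s in lborel. 0 <= s & s <= M --> (%k. H k s) \<longlonglongrightarrow> G s"
 using AE_lborel_singleton[of "0::real"] by eventually_elim (use H(5) in auto)
 qed (use H(4) out in "auto intro: smooth1_borel_measurable H(1) lbm_measurable[OF reg_lbm[OF r]]")
 have L2: "(%k. \<integral>x. phi x*(zeta sig x^n*P k (sq x)) \<partial>lebesgue) \<longlonglongrightarrow> (LINT x|lebesgue. phi x*(zeta sig x^n*p (sq x)))"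
 by (rule disc_dominated_convergence(1)[OF sig i[OF cl(2) out(1)] smooth1_borel_measurable[OF sP] lbm_measurable[OF regD(1)[OF r]], where C=C])
 (use H(4,7) out in "auto simp: P_def")
 have "(LINT x|lebesgue. laplacian phi x*(zeta sig x^n*G (sq x))) = 4*(LINT x|lebesgue. phi x*(zeta sig x^n*p (sq x)))"
 by (rule LIMSEQ_unique[OF L1]) (simp only: eq, rule tendsto_mult[OF tendsto_const L2])
 also have "... = (LINT x|lebesgue. 4*(phi x*(zeta sig x^n*p (sq x))))" by (rule integral_mult_right_zero[symmetric])
 finally show ?thesis by (simp only: mult_ac)
qed

lemma vector_derivative_eq_0:
 fixes c :: "real => complex"
 assumes "(c has_vector_derivative c') (at s)" "open S" "s \<in> S" "!!t. t \<in> S ==> c t = k"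
 shows "c' = 0"
proof -
 have "(c has_vector_derivative 0) (at s)"
 by (rule has_vector_derivative_transform_within_open[OF has_vector_derivative_const[of k] assms(2,3)]) (use assms in auto)
 then show ?thesis by (rule vector_derivative_unique_at[OF assms(1)])
qed

text \<open>Enlarges the admissible tests to zeta^n G(|x|^2) with G regular and zero beyond b.
  Smooth approximants times a cutoff that equals 1 up to b + 1 are genuine test functions; in the
  limit the terms with derivatives of the cutoff drop out, because G and G1 vanish where those
  derivatives are nonzero.\<close>

lemma weak_solution_test_reg:
 assumes psi: "psi \<in> L2_loc" and V: "V \<in> Linf" and sol: "schroedinger_solution V z psi"
 and r: "reg n G G1 p" and sig: "sig^2 = 1" and b: "0 < b" "!!s. b < s ==> G s = 0 & G1 s = 0 & p s = 0"
 shows "(LINT x|lebesgue. psi x*(zeta sig x^n*((cor (V x) - z)*G (sq x) - 4*p (sq x)))) = 0"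
proof -
 define M where "M = b + 2"
 have M: "0 < M" using b by (simp add: M_def)
 obtain ch where ch: "smooth1 ch" "!!s. s <= b + 1 ==> ch s = 1" "!!s. b + 2 <= s ==> ch s = 0"
 by (rule smooth_cutoff[of "b + 1" "b + 2"]) auto
 obtain ch1 where ch1: "smooth1 ch1" "!!s. (ch has_vector_derivative ch1 s) (at s)" by (rule smooth1E[OF ch(1)]) blast
 obtain ch2 where ch2: "smooth1 ch2" "!!s. (ch1 has_vector_derivative ch2 s) (at s)" by (rule smooth1E[OF ch1(1)]) blast
 have z1: "ch1 s = 0" if "s < b + 1 \<or> M < s" for s
 using vector_derivative_eq_0[OF ch1(2), of "{..<b+1}"] vector_derivative_eq_0[OF ch1(2), of "{M<..}"] that ch(2,3)
 by (auto simp: M_def)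
 have z2: "ch2 s = 0" if "s < b + 1 \<or> M < s" for s
 using vector_derivative_eq_0[OF ch2(2), of "{..<b+1}"] vector_derivative_eq_0[OF ch2(2), of "{M<..}"] that z1 by auto
 obtain H H1 H2 C where H: "!!k. smooth1 (H k)" "!!k s. (H k has_vector_derivative H1 k s) (at s)"
 "!!k s. (H1 k has_vector_derivative H2 k s) (at s)"
 "!!k s. 0 <= s ==> s <= M ==> norm (H k s) <= C & norm (H1 k s) <= C & norm (cor s*H2 k s + of_nat (n + 1)*H1 k s) <= C"
 "!!s. 0 < s ==> s <= M ==> (%k. H k s) \<longlonglongrightarrow> G s" "!!s. 0 < s ==> s <= M ==> (%k. H1 k s) \<longlonglongrightarrow> G1 s"
 "AE s in lborel. 0 <= s & s <= M --> (%k. cor s*H2 k s + of_nat (n + 1)*H1 k s) \<longlonglongrightarrow> p s"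
 using reg_polynomial_approx[OF r M] by blast
 define A where "A k s = ch s*H k s" for k s
 \<comment> \<open>The reduced Laplacian s A'' + (n+1) A' of the truncated approximant A = ch
   H.\<close>
 define B where "B k s = ch s*(cor s*H2 k s + of_nat (n + 1)*H1 k s) + 2*cor s*ch1 s*H1 k s
 + cor s*ch2 s*H k s + of_nat (n + 1)*ch1 s*H k s" for k s
 note sH1 = smooth1_derivative[OF H(1,2)]
 note sH2 = smooth1_derivative[OF sH1 H(3)]
 have sA: "smooth1 (A k)" and sB: "smooth1 (B k)" for k unfolding A_def[abs_def] B_def[abs_def]
 by (intro smooth1_add smooth1_mult smooth1_const smooth1_of_real ch ch1 ch2 H(1) sH1 sH2)+
 have AB0: "A k s = 0" "B k s = 0" if "M < s" for k s using that z1[of s] z2[of s] ch(3)[of s] by (auto simp: A_def B_def M_def)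
 define phi where "phi k x = zeta sig x^n*A k (sq x)" for k x
 have phit: "phi k \<in> test_functions" for k
 by (rule test_functionsI[of _ "M + 1"])
 (auto simp: phi_def[abs_def] AB0 intro!: smooth2_mult smooth2_power smooth2_zeta smooth2_comp_sq sA)
 have lap: "laplacian (phi k) x = 4*(zeta sig x^n*B k (sq x))" for k x
 proof -
 have d1: "(A k has_vector_derivative ch s*H1 k s + ch1 s*H k s) (at s)" for s
 unfolding A_def[abs_def] by (rule has_vector_derivative_mult[OF ch1(2) H(2)])
 have d2: "((%s. ch s*H1 k s + ch1 s*H k s) has_vector_derivative
 (ch s*H2 k s + ch1 s*H1 k s) + (ch1 s*H1 k s + ch2 s*H k s)) (at s)" for s
 by (intro has_vector_derivative_add has_vector_derivative_mult ch1(2) ch2(2) H(2,3))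
 show ?thesis unfolding phi_def laplacian_zeta_radial[OF sig d1 d2] B_def by (simp add: algebra_simps)
 qed
 obtain CV where CV: "AE x in lebesgue. abs (V x) <= CV" and Vm: "V \<in> borel_measurable lebesgue" using V by (auto simp: Linf_def)
 have Vcm: "(%x. cor (V x) - z) \<in> borel_measurable lebesgue" using Vm by measurable
 have pm: "psi \<in> borel_measurable lebesgue" using psi by (auto simp: L2_loc_def)
 have im: "(%x. cor (indicator {..M} (sq x))) \<in> borel_measurable lebesgue" by (rule comp_sq_measurable) measurable
 have w1: "(%x. psi x*(cor (V x) - z)) \<in> borel_measurable lebesgue" by (intro borel_measurable_times pm Vcm)
 have i1: "integrable lebesgue (%x. psi x*(cor (V x) - z)*cor (indicator {..M} (sq x)))"
 unfolding mult.assoc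
 proof (rule L2_loc_mult_integrable[OF psi])
 show "AE x in lebesgue. norm ((cor (V x) - z)*cor (indicator {..M} (sq x))) <= abs CV + norm z"
 using CV
 proof eventually_elim
 case (elim x)
 have "norm (cor (V x) - z) <= abs CV + norm z" using elim by (intro norm_triangle_le_diff) auto
 then show ?case by (auto simp: indicator_def)
 qed
 show "(cor (V x) - z)*cor (indicator {..M} (sq x)) = 0" if "M < sq x" for x using that by simp
 qed (rule borel_measurable_times[OF Vcm im])
 have i2: "integrable lebesgue (%x. psi x*cor (indicator {..M} (sq x)))"
 by (rule L2_loc_mult_integrable[OF psi im, of 1 M]) (auto simp: indicator_def)
 obtain D where D: "!!s. 0 <= s ==> s <= M ==> norm (ch s) <= D"
 using lbm_bound[OF lbm_continuous[OF smooth1_continuous_on[OF ch(1)]]] by blast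
 obtain D1 where D1: "!!s. 0 <= s ==> s <= M ==> norm (ch1 s) <= D1"
 using lbm_bound[OF lbm_continuous[OF smooth1_continuous_on[OF ch1(1)]]] by blast
 obtain D2 where D2: "!!s. 0 <= s ==> s <= M ==> norm (ch2 s) <= D2"
 using lbm_bound[OF lbm_continuous[OF smooth1_continuous_on[OF ch2(1)]]] by blast
 have mn: "norm (u * v) <= x*y" if "norm u <= x" "norm v <= y" for u v :: complex and x y
 unfolding norm_mult using that order_trans[OF norm_ge_zero that(1)] by (intro mult_mono) auto
 have bA: "norm (A k s) <= D*C" if "0 <= s" "s <= M" for k s unfolding A_def using D H(4) that by (intro mn) auto
 have bB: "norm (B k s) <= D*C + 2*M*D1*C + M*D2*C + real (n + 1)*D1*C" if "0 <= s" "s <= M" for k s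
 unfolding B_def using D D1 D2 H(4)[of s k] that norm_of_nat[of "n + 1", where 'a=complex]
 by (intro norm_triangle_mono mn) (auto simp: norm_mult simp del: of_nat_add of_nat_Suc)
 have lA: "AE s in lborel. 0 <= s & s <= M --> (%k. A k s) \<longlonglongrightarrow> G s"
 using AE_lborel_singleton[of "0::real"]
 proof eventually_elim
 case (elim s)
 have "ch s*G s = G s" using ch(2)[of s] b(2)[of s] by (cases "s <= b") auto
 then show ?case unfolding A_def using H(5)[of s] elim tendsto_mult[OF tendsto_const[of "ch s"], of "%k. H k s" "G s" sequentially] by auto
 qed
 have lB: "AE s in lborel. 0 <= s & s <= M --> (%k. B k s) \<longlonglongrightarrow> p s"
 using H(7) AE_lborel_singleton[of "0::real"]
 proof eventually_elim
 case (elim s)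
 show ?case
 proof
 assume s: "0 <= s & s <= M"
 have "(%k. B k s) \<longlonglongrightarrow> ch s*p s + 2*cor s*ch1 s*G1 s + cor s*ch2 s*G s + of_nat (n + 1)*ch1 s*G s"
 unfolding B_def using s elim H(5,6)[of s] by (intro tendsto_intros) auto
 moreover have "ch s*p s + 2*cor s*ch1 s*G1 s + cor s*ch2 s*G s + of_nat (n + 1)*ch1 s*G s = p s"
 using ch(2)[of s] z1[of s] z2[of s] b(2)[of s] by (cases "s <= b") auto
 ultimately show "(%k. B k s) \<longlonglongrightarrow> p s" by simp
 qed
 qed
 have Gm: "G \<in> borel_measurable borel" "p \<in> borel_measurable borel"
 by (intro lbm_measurable reg_lbm[OF r] regD(1)[OF r])+
 have oG: "G s = 0" "p s = 0" if "M < s" for s using b(2)[of s] that by (auto simp: M_def)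
 let ?a = "%F. \<integral>x. psi x*(cor (V x) - z)*(zeta sig x^n*F (sq x)) \<partial>lebesgue"
 let ?b = "%F. \<integral>x. psi x*(zeta sig x^n*F (sq x)) \<partial>lebesgue"
 have split: "(LINT x|lebesgue. psi x*(zeta sig x^n*((cor (V x) - z)*F (sq x) - 4*J (sq x)))) = ?a F - 4 * ?b J"
 if "integrable lebesgue (%x. psi x*(cor (V x) - z)*(zeta sig x^n*F (sq x)))"
 "integrable lebesgue (%x. psi x*(zeta sig x^n*J (sq x)))" for F J
 proof -
 have "(%x. psi x*(zeta sig x^n*((cor (V x) - z)*F (sq x) - 4*J (sq x))))
 = (%x. psi x*(cor (V x) - z)*(zeta sig x^n*F (sq x)) - 4*(psi x*(zeta sig x^n*J (sq x))))"
 by (simp add: fun_eq_iff algebra_simps)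
 then show ?thesis using that by (simp add: Bochner_Integration.integral_diff)
 qed
 have oA: "w x*A k (sq x) = 0" "w x*G (sq x) = 0" "w x*B k (sq x) = 0" "w x*p (sq x) = 0" if "M < sq x" for x k and w :: "real^2 => complex"
 using AB0[OF that] oG[OF that] by auto
 note A = disc_dominated_convergence[where n=n and F=A and F'=G and w="%x. psi x*(cor (V x) - z)", OF sig w1 i1 smooth1_borel_measurable[OF sA] Gm(1) bA lA oA(1,2)[where w="%x. psi x*(cor (V x) - z)"]]
 note B = disc_dominated_convergence[where n=n and F=B and F'=p and w=psi, OF sig pm i2 smooth1_borel_measurable[OF sB] Gm(2) bB lB oA(3,4)[where w=psi]]
 have "?a (A k) - 4 * ?b (B k) = 0" for k
 proof -
 have "- (4*(Z*X)) + w*(Z*Y) = Z*(w*Y - 4*X)" for Z X w Y :: complex by (simp add: algebra_simps)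
 then have "- laplacian (phi k) x + (cor (V x) - z)*phi k x = zeta sig x^n*((cor (V x) - z)*A k (sq x) - 4*B k (sq x))" for x
 unfolding lap phi_def .
 note e = this
 have "(LINT x|lebesgue. psi x*(- laplacian (phi k) x + (cor (V x) - z)*phi k x)) = 0"
 using sol phit[of k] unfolding schroedinger_solution_def by blast
 then have "(LINT x|lebesgue. psi x*(zeta sig x^n*((cor (V x) - z)*A k (sq x) - 4*B k (sq x)))) = 0" unfolding e .
 then show ?thesis using split[of "A k" "B k", OF A(2) B(2)] by (simp only:)
 qed
 moreover have "(%k. ?a (A k) - 4 * ?b (B k)) \<longlonglongrightarrow> ?a G - 4 * ?b p"
 by (rule tendsto_diff[OF A(1) tendsto_mult[OF tendsto_const[of 4] B(1)]])
 ultimately have e: "?a G - 4 * ?b p = 0" by (simp add: LIMSEQ_const_iff)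
 show ?thesis using split[of G p, OF A(3) B(3)] e by (simp only:)
qed

section \<open>Functions of fixed angular momentum are determined by radial pairings\<close>

section \<open>Functions of a fixed angular momentum\<close>

text \<open>Polynomials written in zeta and its conjugate, the form adapted to angular momentum;
  every polynomial has this form.\<close>

inductive_set zpoly :: "(real^2 => complex) set" where
 mono: "(%x. c*zeta 1 x^i*zeta (-1) x^j) \<in> zpoly"
| add: "a \<in> zpoly ==> b \<in> zpoly ==> (%x. a x + b x) \<in> zpoly"

lemma zpoly_mult_mono: "b \<in> zpoly ==> (%x. (c*zeta 1 x^i*zeta (-1) x^j)*b x) \<in> zpoly"
proof (induction rule: zpoly.induct)
 case (mono d k m)
 show ?case using zpoly.mono[of "c*d" "i + k" "j + m"] by (simp add: power_add mult_ac)
next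
 case (add a b)
 from zpoly.add[OF add.IH] show ?case by (simp add: distrib_left)
qed

lemma zpoly_mult: "a \<in> zpoly ==> b \<in> zpoly ==> (%x. a x*b x) \<in> zpoly"
proof (induction rule: zpoly.induct)
 case (mono c i j) then show ?case by (rule zpoly_mult_mono)
next
 case (add a a')
 from zpoly.add[OF add.IH(1)[OF add.prems] add.IH(2)[OF add.prems]] show ?case by (simp add: distrib_right)
qed

lemma zpoly_const: "(%x. c) \<in> zpoly" using zpoly.mono[of c 0 0] by simp

lemma zpoly_real_polynomial: "real_polynomial_function P ==> (%x::real^2. cor (P x)) \<in> zpoly"
proof (induction rule: real_polynomial_function.induct)
 case (linear f)
 have lin: "linear f" using linear by (rule bounded_linear.linear)
 have f: "f x = x $ 1*f (axis 1 1) + x $ 2*f (axis 2 1)" for x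
 proof -
 have "x = x $ 1 *\<^sub>R axis 1 1 + x $ 2 *\<^sub>R axis 2 1" by (simp add: vec_eq_iff forall_2 axis_def)
 then have "f x = f (x $ 1 *\<^sub>R axis 1 1 + x $ 2 *\<^sub>R axis 2 1)" by (rule arg_cong)
 then show ?thesis by (simp add: linear_add[OF lin] linear_cmul[OF lin])
 qed
 define A B where "A = (cor (f (axis 1 1)) - \<i>*cor (f (axis 2 1)))/2"
 and "B = (cor (f (axis 1 1)) + \<i>*cor (f (axis 2 1)))/(2 :: complex)"
 have "cor (f x) = A*zeta 1 x^1*zeta (-1) x^0 + B*zeta 1 x^0*zeta (-1) x^1" for x
 unfolding f[of x] A_def B_def zeta_def by (simp add: complex_eq_iff field_simps)
 then show ?case using zpoly.add[OF zpoly.mono[of A 1 0] zpoly.mono[of B 0 1]] by presburger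
next
 case (const c) show ?case by (rule zpoly_const)
next
 case (add f g) then show ?case using zpoly.add by force
next
 case (mult f g) then show ?case using zpoly_mult by force
qed

lemma zpoly_polynomial_function:
 fixes P :: "real^2 => complex"
 assumes "polynomial_function P" shows "P \<in> zpoly"
proof -
 have "real_polynomial_function (%x. Re (P x))" "real_polynomial_function (%x. Im (P x))"
 using assms unfolding polynomial_function_def
 by (auto simp: o_def intro: bounded_linear_Re bounded_linear_Im)
 then have "(%x. cor (Re (P x)) + \<i>*cor (Im (P x))) \<in> zpoly"
 by (intro zpoly.add zpoly_mult[OF zpoly_const] zpoly_real_polynomial)
 then show ?thesis by (simp flip: complex_eq)
qed

text \<open>Multiply psi by a bump in |x|^2 and pair with zeta^i times the j-th power of the
  conjugate. The angular equation kills the pairing unless i - j = -l, and then the monomial is the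
  power occurring in \<open>orth\<close> times a power of |x|^2, so the assumption applies. The
  pairing is bilinear, which explains the conjugate power of zeta. Vanishing against all polynomials
  finishes the argument.\<close>

lemma angular_momentum_AE_eq_0:
 assumes psi: "psi \<in> L2_loc" and ang: "has_angular_momentum l psi" and ab: "a < b"
 and orth: "!!C. smooth1 C ==> (!!s. s <= a \<or> b <= s ==> C s = 0) ==>
 (LINT x|lebesgue. psi x*(zeta (if 0 <= l then -1 else 1) x^nat (abs l)*C (sq x))) = 0"
 shows "AE x in lebesgue. a < sq x & sq x < b --> psi x = 0"
proof -
 define C0 where "C0 s = cor (flat (s - a))*cor (flat (b - s))" for s
 have C0: "smooth1 C0" unfolding C0_def[abs_def]
 using smooth1_affine[OF smooth1_flat, of 1 "-a"] smooth1_affine[OF smooth1_flat, of "-1" b]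
 by (intro smooth1_mult) simp_all
 have C0z: "C0 s = 0" if "s <= a \<or> b <= s" for s using that by (auto simp: C0_def flat_eq_0)
 define Psi where "Psi x = psi x*C0 (sq x)" for x
 have int: "integrable lebesgue (%x. psi x*(Q x*C0 (sq x)))" if Q: "smooth2 Q" for Q
 proof -
 have s: "smooth2 (%x. Q x*C0 (sq x))" by (intro smooth2_mult Q smooth2_comp_sq C0)
 have "bounded ((%x. Q x*C0 (sq x)) ` cball 0 (sqrt (max 0 b)))"
 by (intro compact_imp_bounded compact_continuous_image smooth2_continuous_on s) auto
 then obtain K where K: "\<forall>x\<in>cball 0 (sqrt (max 0 b)). norm (Q x*C0 (sq x)) <= K" by (auto simp: bounded_iff)
 show ?thesis
 proof (rule L2_loc_mult_integrable[OF psi smooth2_measurable[OF s], of "max 0 K" b])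
 show "AE x in lebesgue. norm (Q x*C0 (sq x)) <= max 0 K"
 proof (rule AE_I2)
 fix x show "norm (Q x*C0 (sq x)) <= max 0 K"
 proof (cases "x \<in> cball 0 (sqrt (max 0 b))")
 case True then show ?thesis using K by (meson le_max_iff_disj)
 next
 case False
 have "b <= sq x"
 proof (rule ccontr)
 assume "\<not> b <= sq x"
 then have "sqrt ((norm x)^2) <= sqrt (max 0 b)" by (intro real_sqrt_le_mono) (simp add: sq_eq_norm)
 then show False using False by simp
 qed
 then show ?thesis using C0z by simp
 qed
 qed
 qed (use C0z in auto)
 qed
 have "(LINT x|lebesgue. Psi x*P x) = 0 & smooth2 P" if "P \<in> zpoly" for P
 using that
 proof (induction rule: zpoly.induct)
 case (mono c i j)
 define f where "f x = zeta 1 x^i*zeta (-1) x^j*C0 (sq x)" for x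
 have fs: "smooth2 f" unfolding f_def[abs_def] by (intro smooth2_mult smooth2_power smooth2_zeta smooth2_comp_sq C0)
 have ft: "f \<in> test_functions" by (rule test_functionsI[OF fs, of b]) (simp add: f_def C0z)
 have f0: "(LINT x|lebesgue. psi x*f x) = 0"
 proof (cases "int i - int j = - l")
 case False
 have "- (LINT x|lebesgue. psi x*d_theta f x) = (LINT x|lebesgue. \<i> * of_int l*psi x*f x)"
 using ang ft by (auto simp: has_angular_momentum_def)
 moreover have "d_theta f x = \<i>*(of_nat i - of_nat j)*f x" for x
 unfolding f_def by (rule d_theta_monomial[OF C0])
 ultimately have "- (LINT x|lebesgue. \<i>*(of_nat i - of_nat j)*(psi x*f x)) = (LINT x|lebesgue. \<i> * of_int l*(psi x*f x))"
 by (simp add: mult_ac)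
 then have "- (\<i>*(of_nat i - of_nat j)*(LINT x|lebesgue. psi x*f x)) = \<i> * of_int l*(LINT x|lebesgue. psi x*f x)"
 by (simp only: integral_mult_right_zero)
 then have "\<i>*(of_int (int i - int j + l))*(LINT x|lebesgue. psi x*f x) = 0"
 by (simp add: algebra_simps)
 moreover have "int i - int j + l ~= 0" using False by simp
 ultimately show ?thesis by (simp del: of_int_add of_int_diff)
 next
 case True
 define tau :: real where "tau = (if 0 <= l then -1 else 1)"
 have t2: "tau^2 = 1" by (simp add: tau_def)
 have m: "zeta 1 x*zeta (-1) x = cor (sq x)" for x using zeta_mult[of 1 x] by simp
 have "zeta 1 x^i*zeta (-1) x^j = zeta tau x^nat (abs l)*cor (sq x)^min i j" for x
 proof (cases "0 <= l")
 case t: True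
 then have j: "j = i + nat (abs l)" using True by simp
 have "zeta 1 x^i*zeta (-1) x^j = (zeta 1 x*zeta (-1) x)^i*zeta (-1) x^nat (abs l)"
 unfolding j by (simp add: power_add power_mult_distrib mult_ac)
 then show ?thesis unfolding m using t j by (simp add: tau_def)
 next
 case t: False
 then have i: "i = j + nat (abs l)" using True by simp
 have "zeta 1 x^i*zeta (-1) x^j = (zeta 1 x*zeta (-1) x)^j*zeta 1 x^nat (abs l)"
 unfolding i by (simp add: power_add power_mult_distrib mult_ac)
 then show ?thesis unfolding m using t i by (simp add: tau_def)
 qed
 then have "f x = zeta tau x^nat (abs l)*(cor (sq x)^min i j*C0 (sq x))" for x
 unfolding f_def by (simp add: mult_ac)
 moreover have "(LINT x|lebesgue. psi x*(zeta tau x^nat (abs l)*(cor (sq x)^min i j*C0 (sq x)))) = 0"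
 unfolding tau_def
 by (rule orth[of "%s. cor s^min i j*C0 s"]) (auto intro!: smooth1_mult smooth1_power smooth1_of_real C0 simp: C0z)
 ultimately show ?thesis by simp
 qed
 have "(LINT x|lebesgue. Psi x*(c*zeta 1 x^i*zeta (-1) x^j)) = (LINT x|lebesgue. c*(psi x*f x))"
 by (simp add: Psi_def f_def mult_ac)
 then show ?case using f0 by (auto intro!: smooth2_mult smooth2_power smooth2_zeta smooth2_const)
 next
 case (add P Q)
 have i: "integrable lebesgue (%x. Psi x*P x)" "integrable lebesgue (%x. Psi x*Q x)"
 using int[of P] int[of Q] add.IH by (simp_all add: Psi_def mult_ac)
 have "(LINT x|lebesgue. Psi x*(P x + Q x)) = (LINT x|lebesgue. Psi x*P x) + (LINT x|lebesgue. Psi x*Q x)"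
 unfolding distrib_left by (rule Bochner_Integration.integral_add[OF i])
 then show ?case using add.IH smooth2_add by auto
 qed
 then have "AE x in lebesgue. Psi x = 0"
 proof (intro AE_zero_if_orthogonal_polynomials[of _ "cball 0 (sqrt (max 0 b))"])
 show "integrable lebesgue Psi" using int[OF smooth2_const[of 1]] by (simp add: Psi_def[abs_def])
 fix x :: "real^2" assume "x \<notin> cball 0 (sqrt (max 0 b))"
 have "b <= sq x"
 proof (rule ccontr)
 assume "\<not> b <= sq x"
 then have "sqrt ((norm x)^2) <= sqrt (max 0 b)" by (intro real_sqrt_le_mono) (simp add: sq_eq_norm)
 then show False using \<open>x \<notin> cball 0 (sqrt (max 0 b))\<close> by simp
 qed
 then show "Psi x = 0" by (simp add: Psi_def C0z)
 qed (use zpoly_polynomial_function in auto)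
 then show ?thesis
 proof eventually_elim
 case (elim x)
 show ?case
 proof
 assume "a < sq x & sq x < b"
 then have "0 < flat (sq x - a)" "0 < flat (b - sq x)" by (simp_all add: flat_pos)
 then have "C0 (sq x) ~= 0" by (simp add: C0_def)
 then show "psi x = 0" using elim by (simp add: Psi_def)
 qed
 qed
qed

section \<open>Calculus of entire power series\<close>

section \<open>Entire power series\<close>

definition ps :: "(nat => complex) => complex => complex" where "ps c x = (\<Sum>j. c j*x^j)"
definition ent :: "(nat => complex) => bool" where "ent c \<longleftrightarrow> (\<forall>x. summable (%j. c j*x^j))"

lemma ent_diffs: "ent c ==> ent (diffs c)"
 unfolding ent_def by (intro allI termdiff_converges_all) blast

lemma ps_has_field_derivative: "ent c ==> (ps c has_field_derivative ps (diffs c) x) (at x)"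
 unfolding ps_def[abs_def] ent_def by (rule termdiffs_strong_converges_everywhere) blast

lemma ps_continuous: "ent c ==> continuous_on A (ps c)"
 by (rule continuous_at_imp_continuous_on) (use ps_has_field_derivative DERIV_isCont in blast)

lemma ent_add: "ent a ==> ent b ==> ent (%j. a j + b j)"
 unfolding ent_def by (simp add: distrib_right summable_add)
lemma ps_add: "ent a ==> ent b ==> ps (%j. a j + b j) x = ps a x + ps b x"
 unfolding ent_def ps_def by (simp add: distrib_right suminf_add)
lemma ent_cmult: "ent a ==> ent (%j. k*a j)"
 unfolding ent_def by (simp add: mult.assoc summable_mult)
lemma ps_cmult: "ent a ==> ps (%j. k*a j) x = k*ps a x"
 unfolding ent_def ps_def by (simp add: mult.assoc suminf_mult)
lemma ent_shift: "ent c ==> ent (%j. c (j + m))"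
 unfolding ent_def
proof
 fix x assume c: "\<forall>x. summable (%j. c j*x^j)"
 show "summable (%j. c (j + m)*x^j)"
 proof (cases "x = 0")
 case False
 have "summable (%j. c (j + m)*x^(j + m))" using c summable_ignore_initial_segment[of "%j. c j*x^j" m] by blast
 then have "summable (%j. (c (j + m)*x^(j + m))*inverse (x^m))" by (rule summable_mult2)
 moreover have "(c (j + m)*x^(j + m))*inverse (x^m) = c (j + m)*x^j" for j
 using False by (simp add: power_add)
 ultimately show ?thesis by (simp only:)
 qed simp
qed

lemma ps_split: "ent c ==> ps c x = (\<Sum>j<m. c j*x^j) + x^m*ps (%j. c (j + m)) x"
proof -
 assume c: "ent c"
 have "ps c x = (\<Sum>j. c (j + m)*x^(j + m)) + (\<Sum>j<m. c j*x^j)"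
 unfolding ps_def by (rule suminf_split_initial_segment) (use c in "auto simp: ent_def")
 also have "(\<Sum>j. c (j + m)*x^(j + m)) = (\<Sum>j. x^m*(c (j + m)*x^j))" by (simp add: power_add mult_ac)
 also have "... = x^m*ps (%j. c (j + m)) x"
 unfolding ps_def by (rule suminf_mult) (use ent_shift[OF c] in "auto simp: ent_def")
 finally show ?thesis by simp
qed

lemma ps_tail_bound:
 assumes "ent c" obtains K where "0 <= K" "!!x. norm x <= 1 ==> norm (ps c x - (\<Sum>j<m. c j*x^j)) <= K*norm x^m"
proof -
 have "bounded (ps (%j. c (j + m)) ` cball 0 1)"
 by (intro compact_imp_bounded compact_continuous_image ps_continuous ent_shift assms) auto
 then obtain K where K: "\<forall>x\<in>cball 0 1. norm (ps (%j. c (j + m)) x) <= K" by (auto simp: bounded_iff)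
 show thesis
 proof (rule that[of "max 0 K"])
 fix x :: complex assume "norm x <= 1"
 then have "norm (ps (%j. c (j + m)) x) <= max 0 K" using K by (auto simp: le_max_iff_disj)
 then have "norm (x^m)*norm (ps (%j. c (j + m)) x) <= norm x^m*max 0 K"
 by (intro mult_mono) (auto simp: norm_power)
 then show "norm (ps c x - (\<Sum>j<m. c j*x^j)) <= max 0 K*norm x^m"
 by (subst ps_split[OF assms, of x m]) (simp add: norm_mult mult.commute)
 qed simp
qed

lemma ps_xdiffs:
 assumes "ent c"
 shows "ent (%j. of_nat j*c j)" "x*ps (diffs c) x = ps (%j. of_nat j*c j) x"
proof -
 have s: "summable (%j. of_nat (Suc j)*c (Suc j)*x^Suc j)" for x
 proof -
 have "summable (%j. diffs c j*x^j)" using ent_diffs[OF assms] by (auto simp: ent_def)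
 from summable_mult[OF this, of x] show ?thesis by (simp add: diffs_def mult_ac)
 qed
 then have "summable (%j. of_nat j*c j*x^j)" for x
 using summable_Suc_iff[of "%j. of_nat j*c j*x^j"] by simp
 then show e: "ent (%j. of_nat j*c j)" by (simp add: ent_def)
 show "x*ps (diffs c) x = ps (%j. of_nat j*c j) x"
 using ps_split[OF e, of x 1] by (simp add: diffs_def[abs_def])
qed

section \<open>The outgoing solution as a power series with a logarithm\<close>

section \<open>The Hankel function near the origin\<close>

text \<open>With \<open>x = (w/2)\<^sup>2\<close>, one has \<open>i \<pi> (w/2)\<^sup>n H\<^sub>n(w) = Q(x)\<close>, where \<open>Q(x) = U(x) - S(x) log x\<close>;
  \<open>hS n\<close> and \<open>hU n\<close> are the coefficients of \<open>S\<close> and \<open>U\<close>.\<close>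

definition hS :: "nat => nat => complex" where
 "hS n j = (if j < n then 0 else (-1)^(j - n)/(fact (j - n)*fact j))"

definition hU :: "nat => nat => complex" where
 "hU n j = (if j < n then fact (n - j - 1)/fact j
 else (\<i>*cor pi + Digamma (of_nat (j - n + 1)) + Digamma (of_nat (j + 1)))*hS n j)"

lemma ent_comparison:
 assumes "!!j. n <= j ==> norm (c j) <= 8*2^j/fact j" shows "ent c"
 unfolding ent_def
proof
 fix x :: complex
 have "summable (%j. 8*((2*norm x)^j/fact j))"
 using summable_mult[OF summable_exp[of "2*norm x"], of 8] by (simp add: divide_inverse mult_ac)
 then show "summable (%j. c j*x^j)"
 proof (rule summable_comparison_test'[where N=n])
 fix j assume "n <= j"
 then have "norm (c j)*norm x^j <= (8*2^j/fact j)*norm x^j" by (intro mult_right_mono assms) auto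
 then show "norm (c j*x^j) <= 8*((2*norm x)^j/fact j)"
 by (simp add: norm_mult norm_power power_mult_distrib)
 qed
qed

lemma norm_hS_le: "norm (hS n j) <= 1/fact j"
proof (cases "j < n")
 case False
 have "(1::real) <= fact (j - n)" by (rule fact_ge_1)
 then have "1/(fact (j - n)*fact j) <= 1/(1*fact j :: real)" by (intro divide_left_mono mult_right_mono) auto
 then show ?thesis using False by (simp add: hS_def norm_divide norm_mult norm_power)
qed (simp add: hS_def)

lemma norm_Digamma_le: "norm (Digamma (of_nat (k + 1)) :: complex) <= real k + 1"
proof -
 have "harm k <= real k" for k
 proof (induction k)
 case (Suc k)
 have "inverse (real (Suc k)) <= 1" by (simp add: inverse_le_1_iff)
 then show ?case using Suc by (simp add: harm_Suc)
 qed (simp add: harm_def)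
 moreover have "norm (harm k :: complex) = harm k"
 proof -
 have "(harm k :: complex) = cor (harm k)" by (simp add: harm_def)
 then show ?thesis using harm_nonneg[of k, where 'a=real] by simp
 qed
 moreover have "norm (euler_mascheroni :: complex) <= 1"
 proof -
 have "norm (euler_mascheroni :: complex) = norm (cor euler_mascheroni)" by simp
 also have "... = abs (euler_mascheroni)" by (rule norm_of_real)
 finally show ?thesis using euler_mascheroni_less_13_over_22 euler_mascheroni_pos by linarith
 qed
 ultimately have "norm (harm k - euler_mascheroni :: complex) <= real k + 1"
 by (intro order_trans[OF norm_triangle_ineq4] add_mono) simp_all
 then show ?thesis using Digamma_of_nat[of k, where 'a=complex] by simp
qed

lemma ent_hS: "ent (hS n)"
proof (rule ent_comparison)
 fix j
 have "(1::real) <= 2^j" by simp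
 then have "(1::real) <= 8*2^j" by linarith
 then show "norm (hS n j) <= 8*2^j/fact j"
 by (intro order_trans[OF norm_hS_le] divide_right_mono) auto
qed

lemma ent_hU: "ent (hU n)"
proof (rule ent_comparison)
 fix j assume j: "n <= j"
 have "norm (\<i>*cor pi + Digamma (of_nat (j - n + 1)) + Digamma (of_nat (j + 1)) :: complex) <= pi + (real j + 1) + (real j + 1)"
 by (intro norm_triangle_mono order_trans[OF norm_Digamma_le]) (auto simp: norm_mult)
 also have "... <= 8*2^j"
 proof -
 have "real j + 1 <= 2^j" by (induction j) auto
 moreover have "pi <= 4*2^j" using pi_less_4 one_le_power[of "2::real" j] by linarith
 ultimately show ?thesis by linarith
 qed
 finally have b: "norm (\<i>*cor pi + Digamma (of_nat (j - n + 1)) + Digamma (of_nat (j + 1)) :: complex) <= 8*2^j" .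
 have "hU n j = (\<i>*cor pi + Digamma (of_nat (j - n + 1)) + Digamma (of_nat (j + 1)))*hS n j"
 using j by (simp only: hU_def not_less[symmetric] if_False)
 then have "norm (hU n j) <= 8*2^j*(1/fact j)"
 by (simp only: norm_mult) (intro mult_mono b norm_hS_le; simp)
 then show "norm (hU n j) <= 8*2^j/fact j" by simp
qed

text \<open>Coefficient form of x S'' + (1 - n) S' + S = 0, the Bessel equation in the variable
  x.\<close>

lemma hS_recurrence: "of_nat (Suc m)*(of_nat (Suc m) - of_nat n)*hS n (Suc m) = - hS n m"
proof -
 consider "Suc m < n" | "Suc m = n" | "n <= m" by linarith
 then show ?thesis
 proof cases
 case 3
 then obtain k where m: "m = n + k" using le_iff_add by blast
 have e: "of_nat (Suc m) - of_nat n = (of_nat (Suc k) :: complex)" by (simp add: m)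
 have h: "hS n (Suc m) = (-1)^Suc k/(fact (Suc k)*fact (Suc m))" "hS n m = (-1)^k/(fact k*fact m)"
 by (simp_all add: hS_def m)
 show ?thesis
 unfolding e h unfolding fact_Suc by (simp add: field_simps del: of_nat_Suc)
 qed (auto simp: hS_def)
qed

text \<open>Coefficient form of the same equation for Q = U - S log x: differentiating the logarithm
  produces the inhomogeneous terms in S. For m >= n this is the recurrence of the digamma function;
  at m + 1 = n the finite part of the series joins the infinite one.\<close>

lemma hU_recurrence:
 assumes "1 <= n"
 shows "of_nat (Suc m)*(of_nat (Suc m) - of_nat n)*hU n (Suc m)
 = - hU n m + of_nat (Suc m)*hS n (Suc m) + (of_nat (Suc m) - of_nat n)*hS n (Suc m)"
proof -
 consider "Suc m < n" | "Suc m = n" | "n <= m" by linarith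
 then show ?thesis
 proof cases
 case 1
 then obtain k where n: "n = Suc (Suc m) + k" using less_iff_Suc_add by auto
 have e: "of_nat (Suc m) - of_nat n = (- of_nat (Suc k) :: complex)" by (simp add: n)
 show ?thesis unfolding e unfolding hU_def hS_def n by (simp add: field_simps del: of_nat_Suc)
 next
 case 2
 then have e: "of_nat (Suc m) - of_nat n = (0 :: complex)" by simp
 show ?thesis unfolding e using 2[symmetric] unfolding hU_def hS_def by (simp add: field_simps del: of_nat_Suc)
 next
 case 3
 then obtain k where m: "m = n + k" using le_iff_add by blast
 have e: "of_nat (Suc m) - of_nat n = (of_nat (Suc k) :: complex)" by (simp add: m)
 define c where "c = \<i>*cor pi + Digamma (of_nat (k + 1)) + Digamma (of_nat (m + 1) :: complex)"
 have "Digamma (of_nat (Suc k + 1)) = Digamma (of_nat (k + 1)) + 1/(of_nat (Suc k) :: complex)"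
 using Digamma_plus1[of "of_nat (k + 1) :: complex"] by (simp add: add_ac del: of_nat_Suc) (simp add: add_ac)
 moreover have "Digamma (of_nat (Suc m + 1)) = Digamma (of_nat (m + 1)) + 1/(of_nat (Suc m) :: complex)"
 using Digamma_plus1[of "of_nat (m + 1) :: complex"] by (simp add: add_ac del: of_nat_Suc) (simp add: add_ac)
 ultimately have u1: "hU n (Suc m) = (c + 1/of_nat (Suc k) + 1/of_nat (Suc m))*hS n (Suc m)"
 unfolding hU_def c_def m by (simp add: algebra_simps del: of_nat_Suc)
 have u0: "hU n m = c*hS n m" unfolding hU_def c_def m by simp
 have r: "of_nat (Suc m) * of_nat (Suc k)*hS n (Suc m) = - hS n m" using hS_recurrence[of m n] unfolding e .
 have "of_nat (Suc m) * of_nat (Suc k)*hU n (Suc m)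
 = c*(of_nat (Suc m) * of_nat (Suc k)*hS n (Suc m)) + of_nat (Suc m)*hS n (Suc m) + of_nat (Suc k)*hS n (Suc m)"
 unfolding u1 by (simp add: field_simps del: of_nat_Suc)
 then show ?thesis unfolding e r u0 by simp
 qed
qed

definition hQ :: "nat => complex => complex" where "hQ n x = ps (hU n) x - ps (hS n) x*Ln x"
definition hQ1 :: "nat => complex => complex" where
 "hQ1 n x = ps (diffs (hU n)) x - ps (diffs (hS n)) x*Ln x - ps (hS n) x/x"
text \<open>Equals x^(n+1) times the derivative of x^(-n) Q, hence up to scaling the flux of the
  exterior solution.\<close>

definition hY :: "nat => complex => complex" where "hY n x = x*hQ1 n x - of_nat n*hQ n x"

lemma hQ_derivative: "x \<notin> nonpos_Reals ==> (hQ n has_field_derivative hQ1 n x) (at x)"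
 unfolding hQ_def[abs_def] hQ1_def
 by (auto intro!: derivative_eq_intros ps_has_field_derivative ent_hS ent_hU simp: divide_inverse mult_ac)

text \<open>The operator x d/dx - n acts diagonally on coefficients.\<close>

lemma ps_euler:
 assumes "ent c"
 shows "ent (%j. (of_nat j - of_nat n)*c j)"
 "x*ps (diffs c) x - of_nat n*ps c x = ps (%j. (of_nat j - of_nat n)*c j) x"
proof -
 have eq: "(%j. (of_nat j - of_nat n)*c j) = (%j. of_nat j*c j + (- of_nat n)*c j)" by (simp add: algebra_simps)
 show "ent (%j. (of_nat j - of_nat n)*c j)" unfolding eq by (intro ent_add ps_xdiffs ent_cmult assms)
 show "x*ps (diffs c) x - of_nat n*ps c x = ps (%j. (of_nat j - of_nat n)*c j) x"
 unfolding eq ps_add[OF ps_xdiffs(1)[OF assms] ent_cmult[OF assms]] ps_cmult[OF assms] ps_xdiffs(2)[OF assms] by simp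
qed

text \<open>This is x Q'' + (1 - n) Q' + Q = 0 in first order form. The derivative of the logarithm
  meets the series \<open>t\<close>, which is divisible by x because S starts at order n >=
  1.\<close>

lemma hY_derivative:
 assumes n: "1 <= n" and x: "x \<notin> nonpos_Reals"
 shows "(hY n has_field_derivative - hQ n x) (at x)"
proof -
 define v where "v j = (of_nat j - of_nat n)*hU n j" for j
 define t where "t j = (of_nat j - of_nat n)*hS n j" for j
 define rho where "rho j = t (j + 1)" for j
 have ev: "ent v" and et: "ent t" unfolding v_def[abs_def] t_def[abs_def] by (intro ps_euler ent_hU ent_hS)+
 have erho: "ent rho" unfolding rho_def[abs_def] by (rule ent_shift[OF et])
 have x0: "x ~= 0" using x by auto
 have "hS n 0 = 0" using n by (simp add: hS_def)
 then have trho: "ps t y = y*ps rho y" for y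
 using ps_split[OF et, of y 1] by (simp add: rho_def[abs_def] t_def)
 have Y: "hY n y = ps v y - ps t y*Ln y - ps (hS n) y" if "y ~= 0" for y
 proof -
 have "hY n y = (y*ps (diffs (hU n)) y - of_nat n*ps (hU n) y) - (y*ps (diffs (hS n)) y - of_nat n*ps (hS n) y)*Ln y - ps (hS n) y"
 using that by (simp add: hY_def hQ_def hQ1_def field_simps)
 then show ?thesis unfolding ps_euler(2)[OF ent_hU] ps_euler(2)[OF ent_hS] by (simp add: v_def[abs_def] t_def[abs_def])
 qed
 have dv: "diffs v = (%j. (- 1)*hU n j + (diffs (hS n) j + rho j))"
 using hU_recurrence[OF n] by (auto simp: diffs_def v_def rho_def t_def fun_eq_iff algebra_simps)
 have dt: "diffs t = (%j. (- 1)*hS n j)"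
 using hS_recurrence[of _ n] by (auto simp: diffs_def t_def fun_eq_iff algebra_simps)
 have pv: "ps (diffs v) x = - ps (hU n) x + ps (diffs (hS n)) x + ps rho x"
 unfolding dv ps_add[OF ent_cmult[OF ent_hU] ent_add[OF ent_diffs[OF ent_hS] erho]] ps_add[OF ent_diffs[OF ent_hS] erho] ps_cmult[OF ent_hU] by simp
 have pt: "ps (diffs t) x = - ps (hS n) x" unfolding dt ps_cmult[OF ent_hS] by simp
 have "((%y. ps v y - ps t y*Ln y - ps (hS n) y) has_field_derivative
 ps (diffs v) x - (ps (diffs t) x*Ln x + ps t x*(1/x)) - ps (diffs (hS n)) x) (at x)"
 using x by (auto intro!: derivative_eq_intros ps_has_field_derivative ent_hS ev et simp: divide_inverse)
 also have "ps (diffs v) x - (ps (diffs t) x*Ln x + ps t x*(1/x)) - ps (diffs (hS n)) x = - hQ n x"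
 unfolding pv pt trho hQ_def using x0 by (simp add: algebra_simps)
 finally have D: "((%y. ps v y - ps t y*Ln y - ps (hS n) y) has_field_derivative - hQ n x) (at x)" .
 show ?thesis
 proof (rule DERIV_cong_ev[THEN iffD1, OF refl _ refl D])
 have "\<forall>\<^sub>F y in nhds x. y \<in> - {0}" using x0 by (intro eventually_nhds_in_open) auto
 then show "\<forall>\<^sub>F y in nhds x. ps v y - ps t y*Ln y - ps (hS n) y = hY n y" by eventually_elim (simp add: Y)
 qed
qed

text \<open>For Re w > 0 the logarithm \<open>log_cut\<close> is the principal one and Ln(w^2) = 2
  Ln w, so the logarithmic terms agree. The summand i pi in \<open>hU\<close> is the contribution of
  J to J + i Y.\<close>

lemma hankel1_eq_hQ:
 assumes w: "0 < Re w" and l: "l ~= 0"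
 defines "n \<equiv> nat (abs l)"
 shows "hankel1 l (2*w) = (if l < 0 then (-1)^n else 1)/(\<i>*cor pi*w^n)*hQ n (w^2)"
proof -
 have w0: "w ~= 0" using w by auto
 have n: "1 <= n" using l by (simp add: n_def)
 have Im: "abs (Im (Ln w)) < pi/2" using w w0 Re_Ln_pos_lt by blast
 have log: "log_cut w = Ln w"
 using w0 Im by (simp add: log_cut_def arg_cut_def complex_eq_iff Arg_eq_Im_Ln)
 have Ln2: "Ln (w^2) = 2*Ln w"
 proof (rule Ln_unique)
 show "exp (2*Ln w) = w^2" using w0 by (simp add: exp_double)
 qed (use Im in auto)
 have pw: "w^n*w^(n + 2 * k) = (w^2)^(n + k)" for k
 by (simp flip: power_add power_mult add: algebra_simps)
 have S: "w^n*bessel_J n (2*w) = ps (hS n) (w^2)"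
 proof -
 have sm: "summable (%k. hS n (k + n)*(w^2)^k)" using ent_shift[OF ent_hS, of n n] by (auto simp: ent_def)
 have e: "(-1)^k/(fact k*fact (n + k))*w^(n + 2 * k) = w^n*(hS n (k + n)*(w^2)^k)" for k
 by (simp add: hS_def power_add power_mult add.commute)
 have e': "(-1)^k/(fact k*fact (n + k))*(2*w/2)^(n + 2 * k) = w^n*(hS n (k + n)*(w^2)^k)" for k
 using e[of k] by simp
 have "bessel_J n (2*w) = (\<Sum>k. w^n*(hS n (k + n)*(w^2)^k))"
 unfolding bessel_J_def e' ..
 also have "... = w^n*ps (%k. hS n (k + n)) (w^2)" unfolding ps_def by (rule suminf_mult[OF sm])
 finally have "w^n*bessel_J n (2*w) = (w^2)^n*ps (%k. hS n (k + n)) (w^2)"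
 by (simp add: power2_eq_square power_mult_distrib mult.assoc)
 also have "... = ps (hS n) (w^2)" using ps_split[OF ent_hS, of n "w^2" n] by (simp add: hS_def)
 finally show ?thesis .
 qed
 define ps0 where "ps0 k = Digamma (of_nat (k + 1)) + (Digamma (of_nat (n + k + 1)) :: complex)" for k
 define Sig1 where "Sig1 = (\<Sum>k<n. fact (n - k - 1)/fact k*(2*w/2) powi (2*int k - int n))"
 define Sig2 where "Sig2 = (\<Sum>k. ps0 k*((-1)^k/(fact k*fact (n + k))*(2*w/2)^(n + 2 * k)))"
 have P: "w^n*Sig1 = (\<Sum>k<n. hU n k*(w^2)^k)"
 proof -
 have "w^n*w powi (2*int k - int n) = (w^2)^k" for k
 proof -
 have "w powi (int n)*w powi (2*int k - int n) = w powi (int (2 * k))"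
 using power_int_add[of w "int n" "2*int k - int n"] w0 by simp
 then show ?thesis by (simp only: power_int_of_nat power_mult)
 qed
 then have "w^n*(fact (n - k - 1)/fact k*w powi (2*int k - int n)) = fact (n - k - 1)/fact k*(w^2)^k" for k
 by (simp add: mult.left_commute)
 then show ?thesis unfolding Sig1_def sum_distrib_left by (intro sum.cong) (auto simp: hU_def)
 qed
 have R: "w^n*Sig2 + \<i>*cor pi*ps (hS n) (w^2) = (w^2)^n*ps (%k. hU n (k + n)) (w^2)"
 proof -
 have e: "hU n (k + n) = ps0 k*hS n (k + n) + \<i>*cor pi*hS n (k + n)" for k
 by (simp add: hU_def ps0_def algebra_simps)
 have sm1: "summable (%k. hU n (k + n)*(w^2)^k)" using ent_shift[OF ent_hU, of n n] by (auto simp: ent_def)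
 have sm2: "summable (%k. hS n (k + n)*(w^2)^k)" using ent_shift[OF ent_hS, of n n] by (auto simp: ent_def)
 have "summable (%k. hU n (k + n)*(w^2)^k - \<i>*cor pi*(hS n (k + n)*(w^2)^k))"
 by (intro summable_diff summable_mult sm1 sm2)
 then have sm3: "summable (%k. ps0 k*(hS n (k + n)*(w^2)^k))" by (simp add: e algebra_simps)
 have "Sig2 = (\<Sum>k. w^n*(ps0 k*(hS n (k + n)*(w^2)^k)))"
 unfolding Sig2_def by (intro suminf_cong) (simp add: hS_def power_add power_mult add.commute)
 also have "... = w^n*(\<Sum>k. ps0 k*(hS n (k + n)*(w^2)^k))" by (rule suminf_mult[OF sm3])
 finally have S2: "w^n*Sig2 = (w^2)^n*(\<Sum>k. ps0 k*(hS n (k + n)*(w^2)^k))"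
 by (simp add: power2_eq_square power_mult_distrib mult.assoc)
 have Sp: "ps (hS n) (w^2) = (w^2)^n*(\<Sum>k. hS n (k + n)*(w^2)^k)"
 using ps_split[OF ent_hS, of n "w^2" n] by (simp add: hS_def ps_def)
 have "ps (%k. hU n (k + n)) (w^2) = (\<Sum>k. ps0 k*(hS n (k + n)*(w^2)^k)) + \<i>*cor pi*(\<Sum>k. hS n (k + n)*(w^2)^k)"
 proof -
 have "ps (%k. hU n (k + n)) (w^2) = (\<Sum>k. ps0 k*(hS n (k + n)*(w^2)^k) + \<i>*cor pi*(hS n (k + n)*(w^2)^k))"
 unfolding ps_def e by (simp add: algebra_simps)
 also have "... = (\<Sum>k. ps0 k*(hS n (k + n)*(w^2)^k)) + (\<Sum>k. \<i>*cor pi*(hS n (k + n)*(w^2)^k))"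
 by (rule suminf_add[symmetric]) (intro sm3 summable_mult sm2)+
 also have "(\<Sum>k. \<i>*cor pi*(hS n (k + n)*(w^2)^k)) = \<i>*cor pi*(\<Sum>k. hS n (k + n)*(w^2)^k)"
 by (rule suminf_mult[OF sm2])
 finally show ?thesis .
 qed
 then show ?thesis unfolding S2 Sp by (simp add: algebra_simps)
 qed
 have pi0: "cor pi ~= 0" by simp
 have "\<i>*cor pi*w^n*(bessel_J n (2*w) + \<i>*bessel_Y n (2*w))
 = \<i>*cor pi*(w^n*bessel_J n (2*w)) - cor pi*w^n*bessel_Y n (2*w)"
 by (simp add: algebra_simps)
 also have "cor pi*w^n*bessel_Y n (2*w)
 = 2*log_cut w*(w^n*bessel_J n (2*w)) - w^n*Sig1 - w^n*Sig2"
 unfolding bessel_Y_def Sig1_def[symmetric] Sig2_def[unfolded ps0_def, symmetric]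
 using pi0 by (simp add: field_simps)
 finally have "\<i>*cor pi*w^n*(bessel_J n (2*w) + \<i>*bessel_Y n (2*w))
 = w^n*Sig1 + (w^n*Sig2 + \<i>*cor pi*ps (hS n) (w^2)) - ps (hS n) (w^2)*Ln (w^2)"
 unfolding S log Ln2 by (simp add: algebra_simps)
 also have "... = hQ n (w^2)"
 unfolding P R hQ_def using ps_split[OF ent_hU, of n "w^2" n] by simp
 finally have "bessel_J n (2*w) + \<i>*bessel_Y n (2*w) = hQ n (w^2)/(\<i>*cor pi*w^n)"
 using w0 by (simp add: field_simps)
 then show ?thesis unfolding hankel1_def Let_def n_def[symmetric] by simp
qed

section \<open>Asymptotics of Q and of its logarithmic derivative at the origin\<close>

lemma ln_abs_bound:
 assumes "0 < t" "t <= (1::real)"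
 shows "(1 + (abs (ln t) + pi))^2 <= 81/sqrt t"
proof -
 \<comment> \<open>With u = t^(1/4) one has |ln t| <= 4/u and 1 + pi <= 5/u, whence 81 =
   9^2.\<close>
 define u where "u = sqrt (sqrt t)"
 have u: "0 < u" "u <= 1" using assms by (auto simp: u_def)
 have u2: "u^2 = sqrt t" using assms by (simp add: u_def)
 have "u^4 = (u^2)^2" by (simp flip: power_mult)
 then have u4: "t = u^4" using assms by (simp add: u2)
 have "ln t = 4*ln u" using u by (simp add: u4 ln_realpow)
 moreover have "- ln u <= 1/u"
 proof -
 have "ln (1/u) <= 1/u - 1" using u by (intro ln_le_minus_one) auto
 then show ?thesis using u by (simp add: ln_div)
 qed
 moreover have "ln u <= 0" using u by simp
 ultimately have "abs (ln t) <= 4/u" by simp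
 moreover have "1 + pi <= 5/u"
 proof -
 have "5 <= 5/u" using u by (simp add: le_divide_eq)
 then show ?thesis using pi_less_4 by linarith
 qed
 ultimately have "1 + (abs (ln t) + pi) <= 9/u" by (simp add: add_divide_distrib[symmetric])
 then have "(1 + (abs (ln t) + pi))^2 <= (9/u)^2" by (intro power_mono) auto
 then show ?thesis by (simp add: power_divide u2)
qed

lemma norm_Ln_le_ln: "x ~= 0 ==> norm (Ln x) <= abs (ln (norm x)) + pi"
proof -
 assume x: "x ~= 0"
 have "norm (Ln x) <= abs (Re (Ln x)) + abs (Im (Ln x))" by (rule cmod_le)
 also have "abs (Im (Ln x)) <= pi" using mpi_less_Im_Ln[OF x] Im_Ln_le_pi[OF x] by simp
 finally show ?thesis using x by simp
qed

lemma Ln_weight_bound: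
 assumes "x ~= 0" "norm x <= 1" shows "norm x*(1 + norm (Ln x))^2 <= 81 * sqrt (norm x)"
proof -
 have "(1 + norm (Ln x))^2 <= (1 + (abs (ln (norm x)) + pi))^2" using norm_Ln_le_ln[OF assms(1)] by (intro power_mono) auto
 also have "... <= 81/sqrt (norm x)" using assms by (intro ln_abs_bound) auto
 finally have "norm x*(1 + norm (Ln x))^2 <= norm x*(81/sqrt (norm x))" by (intro mult_left_mono) auto
 also have "norm x*(81/sqrt (norm x)) = 81*(norm x/sqrt (norm x))" by simp
 also have "norm x/sqrt (norm x) = sqrt (norm x)" by (rule real_div_sqrt) simp
 finally show ?thesis .
qed

text \<open>The origin is approached through the right half plane, where \<open>Ln\<close> is
  holomorphic and where the roots x are sought.\<close>

abbreviation F0 :: "complex filter" where "F0 \<equiv> at 0 within {x. 0 < Re x}"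

lemma F0_eventuallyI: "(!!x. 0 < Re x ==> norm x < r ==> P x) ==> 0 < r ==> eventually P F0"
 unfolding eventually_at by (auto simp: dist_norm)

lemma F0_small: "\<forall>\<^sub>F x in F0. x ~= 0 & 0 < Re x & norm x <= 1"
 by (rule F0_eventuallyI[of 1]) auto

lemma tendsto_ident_F0: "((%x. x) \<longlongrightarrow> 0) F0" by (rule tendsto_ident_at)

lemma norm_tendsto_F0: "((%x. norm x) \<longlongrightarrow> 0) F0" using tendsto_norm[OF tendsto_ident_F0] by simp

lemma weight2_tendsto: "((%x. norm x*(1 + norm (Ln x))^2) \<longlongrightarrow> 0) F0"
proof (rule Lim_null_comparison)
 show "\<forall>\<^sub>F x in F0. norm (norm x*(1 + norm (Ln x))^2) <= 81 * sqrt (norm x)"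
 using F0_small by eventually_elim (auto simp: Ln_weight_bound)
 have "((%x. 81 * sqrt (norm x)) \<longlongrightarrow> 81 * sqrt 0) F0" by (intro tendsto_intros norm_tendsto_F0)
 then show "((%x. 81 * sqrt (norm x)) \<longlongrightarrow> 0) F0" by simp
qed

lemma tendsto_0_by_weight:
 fixes f :: "complex => complex"
 assumes "\<forall>\<^sub>F x in F0. norm (f x) <= K*(norm x*(1 + norm (Ln x))^2)"
 shows "(f \<longlongrightarrow> 0) F0"
proof (rule Lim_null_comparison[OF assms])
 show "((%x. K*(norm x*(1 + norm (Ln x))^2)) \<longlongrightarrow> 0) F0"
 using tendsto_mult[OF tendsto_const weight2_tendsto, of K] by simp
qed

text \<open>The logarithmic derivative x Q'(x)/Q(x). For u(s) = s^(-n) Q(x s/s0) it is the value of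
  s u'/u + n at s = s0, that is, the exterior side of the matching equation.\<close>

definition hq :: "nat => complex => complex" where "hq n x = x*hQ1 n x/hQ n x"

lemma hU_0: "1 <= n ==> hU n 0 = fact (n - 1)" by (simp add: hU_def)
lemma hU_1: "2 <= n ==> hU n 1 = fact (n - 2)" by (simp add: hU_def numeral_2_eq_2)
lemma hU_1_1: "hU 1 1 = \<i>*cor pi + 1 - 2*euler_mascheroni"
 using Digamma_of_nat[of 1, where 'a=complex] by (simp add: hU_def hS_def Digamma_1 harm_def)
lemma hS_n: "hS n n = 1/fact n" by (simp add: hS_def)

lemma series_bounds:
 assumes n: "1 <= n"
 obtains K where "0 <= K"
 "!!x. norm x <= 1 ==> norm (ps (hU n) x - hU n 0) <= K*norm x"
 "!!x. norm x <= 1 ==> norm (ps (diffs (hU n)) x - hU n 1) <= K*norm x"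
 "!!x. norm x <= 1 ==> norm (ps (hS n) x) <= K*norm x^n"
 "!!x. norm x <= 1 ==> norm (ps (hS n) x - hS n n*x^n) <= K*norm x^(n + 1)"
 "!!x. norm x <= 1 ==> norm (ps (diffs (hS n)) x - of_nat n*hS n n*x^(n - 1)) <= K*norm x^n"
 "!!x. norm x <= 1 ==> norm (ps (diffs (hS n)) x) <= K*norm x^(n - 1)"
proof -
 obtain K1 where K1: "0 <= K1" "!!x. norm x <= 1 ==> norm (ps (hU n) x - (\<Sum>j<1. hU n j*x^j)) <= K1*norm x^1"
 using ps_tail_bound[OF ent_hU] by blast
 obtain K2 where K2: "0 <= K2" "!!x. norm x <= 1 ==> norm (ps (diffs (hU n)) x - (\<Sum>j<1. diffs (hU n) j*x^j)) <= K2*norm x^1"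
 using ps_tail_bound[OF ent_diffs[OF ent_hU]] by blast
 obtain K3 where K3: "0 <= K3" "!!x. norm x <= 1 ==> norm (ps (hS n) x - (\<Sum>j<n. hS n j*x^j)) <= K3*norm x^n"
 using ps_tail_bound[OF ent_hS] by blast
 obtain K4 where K4: "0 <= K4" "!!x. norm x <= 1 ==> norm (ps (hS n) x - (\<Sum>j<n + 1. hS n j*x^j)) <= K4*norm x^(n + 1)"
 using ps_tail_bound[OF ent_hS] by blast
 obtain K5 where K5: "0 <= K5" "!!x. norm x <= 1 ==> norm (ps (diffs (hS n)) x - (\<Sum>j<n. diffs (hS n) j*x^j)) <= K5*norm x^n"
 using ps_tail_bound[OF ent_diffs[OF ent_hS]] by blast
 obtain K6 where K6: "0 <= K6" "!!x. norm x <= 1 ==> norm (ps (diffs (hS n)) x - (\<Sum>j<n - 1. diffs (hS n) j*x^j)) <= K6*norm x^(n - 1)"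
 using ps_tail_bound[OF ent_diffs[OF ent_hS]] by blast
 have s3: "(\<Sum>j<n. hS n j*x^j) = 0" for x by (intro sum.neutral) (auto simp: hS_def)
 have s6: "(\<Sum>j<n - 1. diffs (hS n) j*x^j) = 0" for x by (intro sum.neutral) (auto simp: hS_def diffs_def)
 have s5: "(\<Sum>j<n. diffs (hS n) j*x^j) = of_nat n*hS n n*x^(n - 1)" for x
 proof -
 obtain m where m: "n = Suc m" using n by (cases n) auto
 show ?thesis using s6[of x] unfolding m by (simp add: diffs_def)
 qed
 define K where "K = K1 + K2 + K3 + K4 + K5 + K6"
 have le: "K1 <= K" "K2 <= K" "K3 <= K" "K4 <= K" "K5 <= K" "K6 <= K" "0 <= K"
 using K1(1) K2(1) K3(1) K4(1) K5(1) K6(1) by (auto simp: K_def)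
 have up: "y <= K*norm x^m" if "y <= L*norm x^m" "L <= K" for y L m and x :: complex
 using that mult_right_mono[of L K "norm x^m"] by (meson norm_ge_zero order_trans zero_le_power)
 show thesis
 proof (rule that[OF le(7)])
 fix x :: complex assume x: "norm x <= 1"
 show "norm (ps (hU n) x - hU n 0) <= K*norm x" using up[OF K1(2)[OF x] le(1)] by simp
 show "norm (ps (diffs (hU n)) x - hU n 1) <= K*norm x" using up[OF K2(2)[OF x] le(2)] by (simp add: diffs_def)
 show "norm (ps (hS n) x) <= K*norm x^n" using up[OF K3(2)[OF x] le(3)] by (simp add: s3)
 show "norm (ps (hS n) x - hS n n*x^n) <= K*norm x^(n + 1)" using up[OF K4(2)[OF x] le(4)] by (simp add: s3)
 show "norm (ps (diffs (hS n)) x - of_nat n*hS n n*x^(n - 1)) <= K*norm x^n" using up[OF K5(2)[OF x] le(5)] by (simp add: s5)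
 show "norm (ps (diffs (hS n)) x) <= K*norm x^(n - 1)" using up[OF K6(2)[OF x] le(6)] unfolding s6 by simp
 qed
qed

lemma power_le_norm: "norm x <= 1 ==> 1 <= n ==> norm x^n <= norm (x::complex)"
 using power_decreasing[of 1 n "norm x"] by simp

lemma hQ_bound:
 assumes n: "1 <= n"
 obtains K where "0 <= K" "!!x. x ~= 0 ==> norm x <= 1 ==> norm (hQ n x - hU n 0) <= K*norm x*(1 + norm x^(n - 1)*(1 + norm (Ln x)))"
proof -
 obtain K where K: "0 <= K"
 "!!x. norm x <= 1 ==> norm (ps (hU n) x - hU n 0) <= K*norm x"
 "!!x. norm x <= 1 ==> norm (ps (hS n) x) <= K*norm x^n"
 using series_bounds[OF n] by metis
 show thesis
 proof (rule that[OF K(1)])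
 fix x :: complex assume x: "x ~= 0" "norm x <= 1"
 have "norm (hQ n x - hU n 0) <= norm (ps (hU n) x - hU n 0) + norm (ps (hS n) x*Ln x)"
 unfolding hQ_def using norm_triangle_ineq4[of "ps (hU n) x - hU n 0" "ps (hS n) x*Ln x"] by (simp add: algebra_simps)
 also have "... <= K*norm x + K*norm x^n*(1 + norm (Ln x))"
 unfolding norm_mult using K(1) K(2,3)[OF x(2)] by (intro add_mono mult_mono) auto
 also have "norm x^n = norm x*norm x^(n - 1)" using n by (cases n) auto
 finally show "norm (hQ n x - hU n 0) <= K*norm x*(1 + norm x^(n - 1)*(1 + norm (Ln x)))"
 by (simp add: algebra_simps)
 qed
qed

lemma hQ1_bound:
 assumes n: "2 <= n"
 obtains K where "0 <= K" "!!x. x ~= 0 ==> norm x <= 1 ==> norm (hQ1 n x - hU n 1) <= K*norm x*(1 + norm x^(n - 2)*(1 + norm (Ln x)))"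
proof -
 have n1: "1 <= n" using n by simp
 obtain K where K: "0 <= K"
 "!!x. norm x <= 1 ==> norm (ps (diffs (hU n)) x - hU n 1) <= K*norm x"
 "!!x. norm x <= 1 ==> norm (ps (hS n) x) <= K*norm x^n"
 "!!x. norm x <= 1 ==> norm (ps (diffs (hS n)) x) <= K*norm x^(n - 1)"
 using series_bounds[OF n1] by metis
 show thesis
 proof (rule that[OF K(1)])
 fix x :: complex assume x: "x ~= 0" "norm x <= 1"
 have p: "norm x^(n - 1) = norm x*norm x^(n - 2)" "norm x^n = norm x*norm x^(n - 1)"
 using n by (simp_all flip: power_Suc add: numeral_2_eq_2 Suc_diff_Suc)
 have "norm (hQ1 n x - hU n 1) <= norm (ps (diffs (hU n)) x - hU n 1) + norm (ps (diffs (hS n)) x*Ln x) + norm (ps (hS n) x/x)"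
 unfolding hQ1_def
 using norm_triangle_ineq4[of "ps (diffs (hU n)) x - hU n 1 - ps (diffs (hS n)) x*Ln x" "ps (hS n) x/x"]
 norm_triangle_ineq4[of "ps (diffs (hU n)) x - hU n 1" "ps (diffs (hS n)) x*Ln x"] by (simp add: algebra_simps)
 also have "... <= K*norm x + K*norm x^(n - 1)*norm (Ln x) + K*norm x^(n - 1)"
 proof -
 have "norm (ps (hS n) x/x) <= K*norm x^(n - 1)"
 using K(3)[OF x(2)] x(1) unfolding p(2) by (simp add: norm_divide divide_le_eq mult_ac)
 then show ?thesis unfolding norm_mult using K(2,4)[OF x(2)] K(1)
 by (intro add_mono mult_mono mult_nonneg_nonneg) auto
 qed
 finally show "norm (hQ1 n x - hU n 1) <= K*norm x*(1 + norm x^(n - 2)*(1 + norm (Ln x)))"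
 unfolding p(1) by (simp add: algebra_simps)
 qed
qed

text \<open>For n = 1 the derivative of Q is unbounded: S(x) = x + O(x^2), so Q' contains -Ln x, and
  S(x)/x contributes the -1.\<close>

lemma hQ1_bound_1:
 obtains K where "0 <= K" "!!x. x ~= 0 ==> norm x <= 1 ==> norm (hQ1 1 x - (hU 1 1 - 1 - Ln x)) <= K*norm x*(1 + norm (Ln x))"
proof -
 obtain K where K: "0 <= K"
 "!!x. norm x <= 1 ==> norm (ps (diffs (hU 1)) x - hU 1 1) <= K*norm x"
 "!!x. norm x <= 1 ==> norm (ps (hS 1) x - hS 1 1*x^1) <= K*norm x^(1 + 1)"
 "!!x. norm x <= 1 ==> norm (ps (diffs (hS 1)) x - of_nat 1*hS 1 1*x^(1 - 1)) <= K*norm x^1"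
 using series_bounds[of 1] by (metis order_refl)
 show thesis
 proof (rule that[of "2*K"])
 fix x :: complex assume x: "x ~= 0" "norm x <= 1"
 have 1: "norm (ps (diffs (hU 1)) x - hU 1 1) <= K*norm x" by (rule K(2)[OF x(2)])
 have 2: "norm (ps (diffs (hS 1)) x - 1) <= K*norm x" using K(4)[OF x(2)] by (simp add: hS_n)
 have 3: "norm (ps (hS 1) x/x - 1) <= K*norm x"
 proof -
 have "ps (hS 1) x/x - 1 = (ps (hS 1) x - x)/x" using x(1) by (simp add: field_simps)
 moreover have "norm (ps (hS 1) x - x) <= K*norm x*norm x" using K(3)[OF x(2)] by (simp add: hS_n power2_eq_square mult_ac)
 ultimately show ?thesis using x(1) by (simp add: norm_divide divide_le_eq)
 qed
 have "hQ1 1 x - (hU 1 1 - 1 - Ln x) = (ps (diffs (hU 1)) x - hU 1 1) - (ps (diffs (hS 1)) x - 1)*Ln x - (ps (hS 1) x/x - 1)"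
 by (simp add: hQ1_def algebra_simps)
 also have "norm ... <= K*norm x + K*norm x*norm (Ln x) + K*norm x"
 proof (rule order_trans[OF norm_triangle_ineq4], rule add_mono[OF order_trans[OF norm_triangle_ineq4] 3], rule add_mono[OF 1])
 show "norm ((ps (diffs (hS 1)) x - 1)*Ln x) <= K*norm x*norm (Ln x)"
 unfolding norm_mult by (rule mult_right_mono[OF 2]) simp
 qed
 also have "... <= 2*K*norm x*(1 + norm (Ln x))"
 using K(1) mult_nonneg_nonneg[of "K*norm x" "norm (Ln x)"] by (simp add: algebra_simps)
 finally show "norm (hQ1 1 x - (hU 1 1 - 1 - Ln x)) <= 2*K*norm x*(1 + norm (Ln x))" .
 qed (use K in auto)
qed

lemma weight_mono:
 assumes "x ~= 0" "norm x <= 1"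
 shows "norm x*(1 + norm x^m*(1 + norm (Ln x))) <= 2*(norm x*(1 + norm (Ln x))^2)"
proof -
 have "norm x^m*(1 + norm (Ln x)) <= 1*(1 + norm (Ln x))"
 using assms(2) by (intro mult_right_mono power_le_one) auto
 moreover have "1 + norm (Ln x) <= (1 + norm (Ln x))^2" by (simp add: power2_eq_square algebra_simps)
 moreover have "1 <= (1 + norm (Ln x))^2" by (simp add: power2_eq_square algebra_simps)
 moreover have "1 + A <= 2*q" if "A <= 1*b" "b <= q" "1 <= q" for A b q :: real using that by linarith
 ultimately have "1 + norm x^m*(1 + norm (Ln x)) <= 2*(1 + norm (Ln x))^2" by blast
 from mult_left_mono[OF this, of "norm x"] show ?thesis by (simp add: mult_ac)
qed

lemma hQ_tendsto: assumes n: "1 <= n" shows "(hQ n \<longlongrightarrow> hU n 0) F0"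
proof -
 obtain K where K: "0 <= K" "!!x. x ~= 0 ==> norm x <= 1 ==> norm (hQ n x - hU n 0) <= K*norm x*(1 + norm x^(n - 1)*(1 + norm (Ln x)))"
 using hQ_bound[OF n] by blast
 have "((%x. hQ n x - hU n 0) \<longlongrightarrow> 0) F0"
 proof (rule tendsto_0_by_weight[where K="K*2"])
 show "\<forall>\<^sub>F x in F0. norm (hQ n x - hU n 0) <= K*2*(norm x*(1 + norm (Ln x))^2)"
 using F0_small
 proof eventually_elim
 case (elim x)
 then have x: "x ~= 0" "norm x <= 1" by auto
 show ?case using K(2)[OF x] mult_left_mono[OF weight_mono[OF x, of "n - 1"] K(1)] by (simp add: mult_ac)
 qed
 qed
 then show ?thesis by (rule LIM_zero_cancel)
qed

lemma hQ1_tendsto: assumes n: "2 <= n" shows "(hQ1 n \<longlongrightarrow> hU n 1) F0"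
proof -
 obtain K where K: "0 <= K" "!!x. x ~= 0 ==> norm x <= 1 ==> norm (hQ1 n x - hU n 1) <= K*norm x*(1 + norm x^(n - 2)*(1 + norm (Ln x)))"
 using hQ1_bound[OF n] by blast
 have "((%x. hQ1 n x - hU n 1) \<longlongrightarrow> 0) F0"
 proof (rule tendsto_0_by_weight[where K="K*2"])
 show "\<forall>\<^sub>F x in F0. norm (hQ1 n x - hU n 1) <= K*2*(norm x*(1 + norm (Ln x))^2)"
 using F0_small
 proof eventually_elim
 case (elim x)
 then have x: "x ~= 0" "norm x <= 1" by auto
 show ?case using K(2)[OF x] mult_left_mono[OF weight_mono[OF x, of "n - 2"] K(1)] by (simp add: mult_ac)
 qed
 qed
 then show ?thesis by (rule LIM_zero_cancel)
qed

text \<open>The derivative of \<open>hq\<close> with the second derivative of Q eliminated by the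
  differential equation.\<close>

definition hq1 :: "nat => complex => complex" where
 "hq1 n x = ((of_nat n*hQ1 n x - hQ n x)*hQ n x - x*(hQ1 n x)^2)/(hQ n x)^2"

lemma hq_derivative:
 assumes n: "1 <= n" and x: "x \<notin> nonpos_Reals" "hQ n x ~= 0"
 shows "(hq n has_field_derivative hq1 n x) (at x)"
proof -
 have e: "hq n = (%x. (hY n x + of_nat n*hQ n x)/hQ n x)" by (auto simp: hq_def hY_def)
 have "((%x. (hY n x + of_nat n*hQ n x)/hQ n x) has_field_derivative
 ((- hQ n x + of_nat n*hQ1 n x)*hQ n x - (hY n x + of_nat n*hQ n x)*hQ1 n x)/(hQ n x*hQ n x)) (at x)"
 using x(2) by (intro DERIV_divide DERIV_add DERIV_cmult hY_derivative[OF n x(1)] hQ_derivative[OF x(1)])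
 then show ?thesis unfolding e hq1_def hY_def by (simp add: power2_eq_square algebra_simps)
qed

text \<open>For n >= 2 the derivative tends to 1/(n-1). For n = 1 it is -Ln x plus a bounded term,
  so its real part grows like -ln |x|.\<close>

lemma hq1_Re_pos: assumes n: "1 <= n" shows "\<forall>\<^sub>F x in F0. 0 < Re (hq1 n x)"
proof (cases "2 <= n")
 case True
 have u: "hU n 0 = of_nat (n - 1)*hU n 1"
 proof -
 obtain m where m: "n = Suc (Suc m)" using True by (metis add_2_eq_Suc le_Suc_ex)
 show ?thesis unfolding hU_0[OF n] hU_1[OF True] by (simp add: m)
 qed
 have u0: "hU n 0 ~= 0" by (simp add: hU_0[OF n])
 have "(hq1 n \<longlongrightarrow> ((of_nat n*hU n 1 - hU n 0)*hU n 0 - 0*(hU n 1)^2)/(hU n 0)^2) F0"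
 unfolding hq1_def[abs_def] using u0
 by (intro tendsto_intros hQ_tendsto[OF n] hQ1_tendsto[OF True] tendsto_ident_F0) simp
 also have "((of_nat n*hU n 1 - hU n 0)*hU n 0 - 0*(hU n 1)^2)/(hU n 0)^2 = cor (1/real (n - 1))"
 proof -
 have "of_nat n*hU n 1 - hU n 0 = hU n 1" using True unfolding u by (simp add: of_nat_diff algebra_simps)
 moreover have "hU n 1 ~= 0" unfolding hU_1[OF True] by simp
 moreover have "of_nat (n - 1) ~= (0::complex)" using True by simp
 moreover have "(h*(k*h) - 0*h^2)/(k*h)^2 = 1/k" if "h ~= 0" "k ~= 0" for h k :: complex
 using that by (simp add: field_simps power2_eq_square)
 ultimately have "((of_nat n*hU n 1 - hU n 0)*hU n 0 - 0*(hU n 1)^2)/(hU n 0)^2 = 1/of_nat (n - 1)"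
 unfolding u by presburger
 then show ?thesis by (simp only: of_real_divide of_real_1 of_real_of_nat_eq)
 qed
 finally have "((%x. Re (hq1 n x)) \<longlongrightarrow> 1/real (n - 1)) F0" using tendsto_Re by fastforce
 then show ?thesis using True by (intro order_tendstoD(1)) auto
next
 case False
 then have n1: "n = 1" using n by simp
 obtain K where K: "0 <= K" "!!x. x ~= 0 ==> norm x <= 1 ==> norm (hQ1 1 x - (hU 1 1 - 1 - Ln x)) <= K*norm x*(1 + norm (Ln x))"
 using hQ1_bound_1 by blast
 obtain J where J: "0 <= J" "!!x. x ~= 0 ==> norm x <= 1 ==> norm (hQ 1 x - hU 1 0) <= J*norm x*(1 + norm x^(1 - 1)*(1 + norm (Ln x)))"
 using hQ_bound[of 1] by auto
 have u0: "hU 1 0 = 1" by (simp add: hU_0)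
 have l1: "1 + norm (Ln x) <= (1 + norm (Ln x))^2" for x by (simp add: power2_eq_square algebra_simps)
 have a1: "((%x. hQ1 1 x + Ln x) \<longlongrightarrow> hU 1 1 - 1) F0"
 proof -
 have "((%x. hQ1 1 x - (hU 1 1 - 1 - Ln x)) \<longlongrightarrow> 0) F0"
 proof (rule tendsto_0_by_weight[where K="K"])
 show "\<forall>\<^sub>F x in F0. norm (hQ1 1 x - (hU 1 1 - 1 - Ln x)) <= K*(norm x*(1 + norm (Ln x))^2)"
 using F0_small
 proof eventually_elim
 case (elim x)
 have "K*norm x*(1 + norm (Ln x)) <= K*norm x*(1 + norm (Ln x))^2"
 using K(1) l1[of x] by (intro mult_left_mono) auto
 then show ?case using K(2)[of x] elim by (simp add: mult_ac)
 qed
 qed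
 from tendsto_add[OF this tendsto_const[of "hU 1 1 - 1"]] show ?thesis by (simp add: algebra_simps)
 qed
 have a2: "((%x. (hQ 1 x - 1)*Ln x) \<longlongrightarrow> 0) F0"
 proof (rule tendsto_0_by_weight[where K="J*2"])
 show "\<forall>\<^sub>F x in F0. norm ((hQ 1 x - 1)*Ln x) <= J*2*(norm x*(1 + norm (Ln x))^2)"
 using F0_small
 proof eventually_elim
 case (elim x)
 have "norm (hQ 1 x - 1) <= J*norm x*(2*(1 + norm (Ln x)))"
 using J(2)[of x] elim J(1) mult_left_mono[of "1 + (1 + norm (Ln x))" "2*(1 + norm (Ln x))" "J*norm x"] by (simp add: u0[simplified])
 then have "norm (hQ 1 x - 1)*norm (Ln x) <= J*norm x*(2*(1 + norm (Ln x)))*(1 + norm (Ln x))"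
 using J(1) by (intro mult_mono) auto
 then show ?case by (simp add: norm_mult power2_eq_square mult_ac)
 qed
 qed
 have a3: "((%x. x*(hQ1 1 x)^2) \<longlongrightarrow> 0) F0"
 proof (rule tendsto_0_by_weight[where K="(norm (hU 1 1 - 1) + 2)^2"])
 have "\<forall>\<^sub>F x in F0. norm (hQ1 1 x + Ln x) < norm (hU 1 1 - 1) + 1"
 by (rule order_tendstoD(2)[OF tendsto_norm[OF a1]]) simp
 with F0_small show "\<forall>\<^sub>F x in F0. norm (x*(hQ1 1 x)^2) <= (norm (hU 1 1 - 1) + 2)^2*(norm x*(1 + norm (Ln x))^2)"
 proof eventually_elim
 case (elim x)
 have "norm (hQ1 1 x) <= norm (hQ1 1 x + Ln x) + norm (Ln x)" using norm_triangle_ineq4[of "hQ1 1 x + Ln x" "Ln x"] by simp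
 also have "... <= (norm (hU 1 1 - 1) + 2)*(1 + norm (Ln x))"
 proof -
 have "a + b <= (c + 2)*(1 + b)" if "a < c + 1" "0 <= b" "0 <= c" for a b c :: real
 proof -
 have "(c + 2)*(1 + b) = c + 2 + c*b + 2*b" by (simp add: algebra_simps)
 moreover have "0 <= c*b" using that by simp
 ultimately show ?thesis using that by linarith
 qed
 then show ?thesis using elim by auto
 qed
 finally have "(norm (hQ1 1 x))^2 <= ((norm (hU 1 1 - 1) + 2)*(1 + norm (Ln x)))^2" by (intro power_mono) auto
 then have "norm x*(norm (hQ1 1 x))^2 <= norm x*((norm (hU 1 1 - 1) + 2)*(1 + norm (Ln x)))^2" by (intro mult_left_mono) auto
 then show ?case by (simp add: norm_mult norm_power power_mult_distrib mult_ac)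
 qed
 qed
 \<comment> \<open>The limit of hq1 + Ln x; the grouping below pairs each remaining logarithm with a
   factor that tends to 0.\<close>
 define c where "c = hU 1 1 - 1 - 1"
 have Q: "(hQ 1 \<longlongrightarrow> 1) F0" using hQ_tendsto[of 1] u0 by simp
 have "((%x. (hQ 1 x*((hQ1 1 x + Ln x) - hQ 1 x + (hQ 1 x - 1)*Ln x) - x*(hQ1 1 x)^2)/(hQ 1 x)^2)
 \<longlongrightarrow> (1*((hU 1 1 - 1) - 1 + 0) - 0)/1\<^sup>2) F0"
 by (intro tendsto_intros a1 a2 a3 Q) simp
 then have L: "((%x. (hQ 1 x*((hQ1 1 x + Ln x) - hQ 1 x + (hQ 1 x - 1)*Ln x) - x*(hQ1 1 x)^2)/(hQ 1 x)^2) \<longlongrightarrow> c) F0"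
 by (simp add: c_def)
 have "\<forall>\<^sub>F x in F0. hQ 1 x ~= 0" using tendsto_imp_eventually_ne[OF Q] by simp
 moreover have "\<forall>\<^sub>F x in F0. norm ((hQ 1 x*((hQ1 1 x + Ln x) - hQ 1 x + (hQ 1 x - 1)*Ln x) - x*(hQ1 1 x)^2)/(hQ 1 x)^2) < norm c + 1"
 by (rule order_tendstoD(2)[OF tendsto_norm[OF L]]) simp
 moreover have "\<forall>\<^sub>F x in F0. norm x < exp (- (norm c + 1))"
 by (rule order_tendstoD(2)[OF norm_tendsto_F0]) simp
 ultimately have "\<forall>\<^sub>F x in F0. 0 < Re (hq1 1 x)"
 using F0_small
 proof eventually_elim
 case (elim x)
 have "hq1 1 x + Ln x = (hQ 1 x*((hQ1 1 x + Ln x) - hQ 1 x + (hQ 1 x - 1)*Ln x) - x*(hQ1 1 x)^2)/(hQ 1 x)^2"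
 using elim(1) unfolding hq1_def by (simp add: field_simps power2_eq_square)
 then have "norm (hq1 1 x + Ln x) < norm c + 1" using elim(2) by simp
 then have "abs (Re (hq1 1 x + Ln x)) < norm c + 1" using abs_Re_le_cmod order.strict_trans1 by blast
 moreover have "ln (norm x) < - (norm c + 1)"
 using elim(3,4) ln_less_cancel_iff[of "norm x" "exp (- (norm c + 1))"] by simp
 moreover have "Re (Ln x) = ln (norm x)" using elim(4) by simp
 ultimately show ?case by (simp add: abs_less_iff)
 qed
 then show ?thesis by (simp only: n1)
qed

section \<open>Positivity of Im hq in the upper right quadrant, and expansions of hq\<close>

lemma ps_real:
 assumes "ent c" "!!j. Im (c j) = 0" shows "Im (ps c (cor x)) = 0"
proof -
 have s: "summable (%j. c j*cor x^j)" using assms(1) by (auto simp: ent_def)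
 have "Im (ps c (cor x)) = (\<Sum>j. Im (c j*cor x^j))"
 unfolding ps_def by (rule bounded_linear.suminf[OF bounded_linear_Im s])
 also have "(%j. Im (c j*cor x^j)) = (%j. 0)" using assms(2) by (auto simp flip: of_real_power)
 finally show ?thesis by simp
qed

lemma Im_hS: "Im (hS n j) = 0"
proof -
 have "hS n j = cor (if j < n then 0 else (-1)^(j - n)/(fact (j - n)*fact j))" by (simp add: hS_def)
 then show ?thesis by (simp only: Im_complex_of_real)
qed

text \<open>Removing i pi S leaves real coefficients: on the positive axis Q is a real function plus
  i pi times the real function S.\<close>

lemma Im_hU: "Im (hU n j - \<i>*cor pi*hS n j) = 0"
proof -
 have D: "(Digamma (of_nat (Suc k)) :: complex) = cor (Digamma (of_nat (Suc k)))" for k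
 unfolding Digamma_of_nat by (simp add: harm_def)
 have S: "hS n j = cor (Re (hS n j))" using Im_hS[of n j] by (simp add: complex_eq_iff)
 show ?thesis
 proof (cases "j < n")
 case True
 then have "hU n j - \<i>*cor pi*hS n j = cor (fact (n - j - 1)/fact j)" by (simp add: hU_def hS_def)
 then show ?thesis by (simp only: Im_complex_of_real)
 next
 case False
 then have "hU n j - \<i>*cor pi*hS n j = (Digamma (of_nat (Suc (j - n))) + Digamma (of_nat (Suc j)))*hS n j"
 unfolding hU_def by (simp add: algebra_simps del: of_nat_Suc)
 also have "... = cor ((Digamma (of_nat (Suc (j - n))) + Digamma (of_nat (Suc j)))*Re (hS n j))"
 by (subst D, subst D, subst S) (simp only: of_real_mult of_real_add)
 finally show ?thesis by (simp only: Im_complex_of_real)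
 qed
qed

text \<open>On the positive axis Q = R + i pi S with R and S real, so |Q|^2 Im hq is pi times x (S'
  R - R' S). The function \<open>B\<close> is x (S' R - R' S) divided by x^n; it tends to n
  (n-1)!/n! = 1.\<close>

lemma hq_Im_pos_real: assumes n: "1 <= n" shows "\<forall>\<^sub>F x in F0. Im x = 0 --> 0 < Im (hq n x)"
proof -
 obtain K where K: "0 <= K"
 "!!x. norm x <= 1 ==> norm (ps (hU n) x - hU n 0) <= K*norm x"
 "!!x. norm x <= 1 ==> norm (ps (diffs (hU n)) x - hU n 1) <= K*norm x"
 "!!x. norm x <= 1 ==> norm (ps (hS n) x) <= K*norm x^n"
 "!!x. norm x <= 1 ==> norm (ps (hS n) x - hS n n*x^n) <= K*norm x^(n + 1)"
 "!!x. norm x <= 1 ==> norm (ps (diffs (hS n)) x - of_nat n*hS n n*x^(n - 1)) <= K*norm x^n"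
 "!!x. norm x <= 1 ==> norm (ps (diffs (hS n)) x) <= K*norm x^(n - 1)"
 by (rule series_bounds[OF n]) blast
 have pn: "norm x^n = norm x*norm x^(n - 1)" for x :: complex using n by (cases n) auto
 have xn: "x^n = x*x^(n - 1)" for x :: complex using n by (cases n) auto
 have nw: "norm x <= norm x*(1 + norm (Ln x))^2" "norm x*norm (Ln x) <= norm x*(1 + norm (Ln x))^2" for x
 using mult_left_mono[of 1 "(1 + norm (Ln x))^2" "norm x"] mult_left_mono[of "norm (Ln x)" "(1 + norm (Ln x))^2" "norm x"]
 by (auto simp: power2_eq_square algebra_simps)
 have s1: "((%x. ps (hS n) x/x^n) \<longlongrightarrow> hS n n) F0"
 proof -
 have "((%x. ps (hS n) x/x^n - hS n n) \<longlongrightarrow> 0) F0"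
 proof (rule tendsto_0_by_weight[where K=K])
 show "\<forall>\<^sub>F x in F0. norm (ps (hS n) x/x^n - hS n n) <= K*(norm x*(1 + norm (Ln x))^2)"
 using F0_small
 proof eventually_elim
 case (elim x)
 have "ps (hS n) x/x^n - hS n n = (ps (hS n) x - hS n n*x^n)/x^n" using elim by (simp add: field_simps)
 then have "norm (ps (hS n) x/x^n - hS n n) <= K*norm x"
 using K(5)[of x] elim by (simp add: norm_divide norm_power divide_le_eq mult_ac)
 also have "... <= K*(norm x*(1 + norm (Ln x))^2)" using K(1) nw by (intro mult_left_mono) auto
 finally show ?case .
 qed
 qed
 then show ?thesis by (rule LIM_zero_cancel)
 qed
 have s2: "((%x. ps (diffs (hS n)) x/x^(n - 1)) \<longlongrightarrow> of_nat n*hS n n) F0"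
 proof -
 have "((%x. ps (diffs (hS n)) x/x^(n - 1) - of_nat n*hS n n) \<longlongrightarrow> 0) F0"
 proof (rule tendsto_0_by_weight[where K=K])
 show "\<forall>\<^sub>F x in F0. norm (ps (diffs (hS n)) x/x^(n - 1) - of_nat n*hS n n) <= K*(norm x*(1 + norm (Ln x))^2)"
 using F0_small
 proof eventually_elim
 case (elim x)
 have "ps (diffs (hS n)) x/x^(n - 1) - of_nat n*hS n n = (ps (diffs (hS n)) x - of_nat n*hS n n*x^(n - 1))/x^(n - 1)"
 using elim by (simp add: field_simps)
 then have "norm (ps (diffs (hS n)) x/x^(n - 1) - of_nat n*hS n n) <= K*norm x"
 using K(6)[of x] elim unfolding pn by (simp add: norm_divide norm_power divide_le_eq mult_ac)
 also have "... <= K*(norm x*(1 + norm (Ln x))^2)" using K(1) nw by (intro mult_left_mono) auto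
 finally show ?case .
 qed
 qed
 then show ?thesis by (rule LIM_zero_cancel)
 qed
 have S0: "((%x. ps (hS n) x) \<longlongrightarrow> 0) F0"
 proof (rule tendsto_0_by_weight[where K=K])
 show "\<forall>\<^sub>F x in F0. norm (ps (hS n) x) <= K*(norm x*(1 + norm (Ln x))^2)"
 using F0_small
 proof eventually_elim
 case (elim x)
 have "norm (ps (hS n) x) <= K*norm x^n" using K(4) elim by simp
 also have "... <= K*norm x" using K(1) elim n by (intro mult_left_mono power_le_norm) auto
 also have "... <= K*(norm x*(1 + norm (Ln x))^2)" using K(1) nw by (intro mult_left_mono) auto
 finally show ?case .
 qed
 qed
 have xS: "((%x. x*ps (diffs (hS n)) x*(1 + Ln x)) \<longlongrightarrow> 0) F0"
 proof (rule tendsto_0_by_weight[where K="2*K"])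
 show "\<forall>\<^sub>F x in F0. norm (x*ps (diffs (hS n)) x*(1 + Ln x)) <= 2*K*(norm x*(1 + norm (Ln x))^2)"
 using F0_small
 proof eventually_elim
 case (elim x)
 have "norm (ps (diffs (hS n)) x) <= K*norm x^(n - 1)" using K(7) elim by simp
 also have "... <= K*1" using K(1) elim by (intro mult_left_mono power_le_one) auto
 finally have "norm x*norm (ps (diffs (hS n)) x)*norm (1 + Ln x) <= norm x*(K*1)*(1 + norm (Ln x))"
 using K(1) norm_triangle_ineq[of 1 "Ln x"] by (intro mult_mono) auto
 also have "... = K*(norm x + norm x*norm (Ln x))" by (simp add: algebra_simps)
 also have "... <= K*(2*(norm x*(1 + norm (Ln x))^2))" using K(1) nw[of x] by (intro mult_left_mono) auto
 finally show ?case by (simp add: norm_mult mult_ac)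
 qed
 qed
 have xS1: "((%x. x*ps (diffs (hS n)) x) \<longlongrightarrow> 0) F0"
 proof -
 have "((%x. x*(ps (diffs (hS n)) x)) \<longlongrightarrow> 0*ps (diffs (hS n)) 0) F0"
 proof (intro tendsto_mult tendsto_ident_F0)
 have "isCont (ps (diffs (hS n))) 0"
 using ps_continuous[OF ent_diffs[OF ent_hS], of UNIV] by (simp add: continuous_on_eq_continuous_at)
 then show "(ps (diffs (hS n)) \<longlongrightarrow> ps (diffs (hS n)) 0) F0"
 unfolding isCont_def by (rule tendsto_within_subset) simp
 qed
 then show ?thesis by simp
 qed
 have xU: "((%x. x*ps (diffs (hU n)) x) \<longlongrightarrow> 0) F0"
 proof -
 have "((%x. x*(ps (diffs (hU n)) x)) \<longlongrightarrow> 0*ps (diffs (hU n)) 0) F0"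
 proof (intro tendsto_mult tendsto_ident_F0)
 have "isCont (ps (diffs (hU n))) 0"
 using ps_continuous[OF ent_diffs[OF ent_hU], of UNIV] by (simp add: continuous_on_eq_continuous_at)
 then show "(ps (diffs (hU n)) \<longlongrightarrow> ps (diffs (hU n)) 0) F0"
 unfolding isCont_def by (rule tendsto_within_subset) simp
 qed
 then show ?thesis by simp
 qed
 define B where "B x = (ps (diffs (hS n)) x/x^(n - 1))*(hQ n x - \<i>*cor pi*ps (hS n) x)
 - (x*ps (diffs (hU n)) x - \<i>*cor pi*(x*ps (diffs (hS n)) x) - (x*ps (diffs (hS n)) x*(1 + Ln x) - x*ps (diffs (hS n)) x) - ps (hS n) x)*(ps (hS n) x/x^n)" for x
 have "(B \<longlongrightarrow> (of_nat n*hS n n)*(hU n 0 - \<i>*cor pi*0) - (0 - \<i>*cor pi*0 - (0 - 0) - 0)*hS n n) F0"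
 unfolding B_def[abs_def] by (intro tendsto_intros s1 s2 S0 xS xS1 xU hQ_tendsto[OF n])
 also have "(of_nat n*hS n n)*(hU n 0 - \<i>*cor pi*0) - (0 - \<i>*cor pi*0 - (0 - 0) - 0)*hS n n = 1"
 proof -
 obtain m where m: "n = Suc m" using n by (cases n) auto
 show ?thesis by (simp add: hS_n hU_0[OF n]) (simp add: m del: of_nat_Suc)
 qed
 finally have "((%x. Re (B x)) \<longlongrightarrow> 1) F0" using tendsto_Re by fastforce
 then have "\<forall>\<^sub>F x in F0. 0 < Re (B x)" by (rule order_tendstoD(1)) simp
 moreover have "\<forall>\<^sub>F x in F0. hQ n x ~= 0" using tendsto_imp_eventually_ne[OF hQ_tendsto[OF n]] by (simp add: hU_0[OF n])
 ultimately show ?thesis using F0_small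
 proof eventually_elim
 case (elim x)
 show ?case
 proof
 assume "Im x = 0"
 define r where "r = Re x"
 have x: "x = cor r" "0 < r" using \<open>Im x = 0\<close> elim by (auto simp: r_def complex_eq_iff)
 define s where "s = Re (ps (hS n) x)"
 define s' where "s' = Re (ps (diffs (hS n)) x)"
 define Ur where "Ur j = hU n j + (- (\<i>*cor pi))*hS n j" for j
 have eUr: "ent Ur" unfolding Ur_def[abs_def] by (intro ent_add ent_cmult ent_hU ent_hS)
 have dUr: "diffs Ur = (%j. diffs (hU n) j + (- (\<i>*cor pi))*diffs (hS n) j)" by (auto simp: diffs_def Ur_def algebra_simps)
 define u where "u = Re (ps Ur x)"
 define u' where "u' = Re (ps (diffs Ur) x)"
 define L where "L = ln r"
 have S: "ps (hS n) x = cor s" unfolding s_def x by (rule complex_eqI) (simp_all add: ps_real[OF ent_hS Im_hS])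
 have "Im (ps (diffs (hS n)) (cor r)) = 0"
 by (rule ps_real[OF ent_diffs[OF ent_hS]]) (simp add: diffs_def Im_hS)
 then have S': "ps (diffs (hS n)) x = cor s'" unfolding s'_def x by (intro complex_eqI) simp_all
 have ImUr: "Im (Ur j) = 0" for j using Im_hU[of n j] by (simp add: Ur_def)
 have U0: "ps Ur x = cor u" unfolding u_def x by (rule complex_eqI) (simp_all add: ps_real[OF eUr ImUr])
 have "Im (ps (diffs Ur) (cor r)) = 0"
 by (rule ps_real[OF ent_diffs[OF eUr]]) (simp add: diffs_def ImUr)
 then have U0': "ps (diffs Ur) x = cor u'" unfolding u'_def x by (intro complex_eqI) simp_all
 have Uv: "ps (hU n) x = cor u + \<i>*cor pi*cor s"
 using U0 S unfolding Ur_def[abs_def] ps_add[OF ent_hU ent_cmult[OF ent_hS]] ps_cmult[OF ent_hS] by (simp add: algebra_simps)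
 have Uv': "ps (diffs (hU n)) x = cor u' + \<i>*cor pi*cor s'"
 using U0' S' unfolding dUr ps_add[OF ent_diffs[OF ent_hU] ent_cmult[OF ent_diffs[OF ent_hS]]] ps_cmult[OF ent_diffs[OF ent_hS]] by (simp add: algebra_simps)
 have Ln: "Ln x = cor L" using x by (simp add: L_def Ln_of_real)
 have Q: "hQ n x = cor (u - s*L) + \<i>*cor (pi * s)" unfolding hQ_def Uv S Ln by (simp add: algebra_simps)
 have xQ1: "x*hQ1 n x = cor (r*u' - r * s'*L - s) + \<i>*cor (pi*r * s')"
 unfolding hQ1_def Uv' S' S Ln unfolding x(1) using x(2) by (simp add: field_simps)
 have Bv: "B x = cor ((s'/r^(n - 1))*(u - s*L) - (r*u' - r * s'*L - s)*(s/r^n))"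
 unfolding B_def Q Uv' S' S Ln unfolding x(1) by (simp add: algebra_simps)
 have "0 < (s'/r^(n - 1))*(u - s*L) - (r*u' - r * s'*L - s)*(s/r^n)"
 using elim(1) unfolding Bv by (simp only: Re_complex_of_real)
 moreover have "r * s'*(u - s*L) - (r*u' - r * s'*L - s) * s
 = r^n*((s'/r^(n - 1))*(u - s*L) - (r*u' - r * s'*L - s)*(s/r^n))"
 proof -
 have "r^n*(s'/r^(n - 1)) = r * s'" "r^n*(s/r^n) = s" using x(2) n by (cases n; simp)+
 then show ?thesis by (metis (no_types, lifting) mult.assoc mult.left_commute right_diff_distrib)
 qed
 ultimately have pos: "0 < r * s'*(u - s*L) - (r*u' - r * s'*L - s) * s" using x(2) by simp
 have "Im (hq n x) = pi*(r * s'*(u - s*L) - (r*u' - r * s'*L - s) * s)/(norm (hQ n x))^2"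
 unfolding hq_def xQ1 by (simp add: Im_divide cmod_power2 Q algebra_simps)
 then show "0 < Im (hq n x)" using pos elim(2) by simp
 qed
 qed
qed

text \<open>Along a vertical segment the derivative of Im hq is Re hq1 > 0, so positivity spreads
  from the real axis upwards.\<close>

lemma hq_properties:
 assumes n: "1 <= n"
 obtains r where "0 < r" "r <= 1"
 "!!x. 0 < Re x ==> norm x < r ==> hQ n x ~= 0 & fact (n - 1)/2 <= norm (hQ n x)"
 "!!x. 0 < Re x ==> norm x < r ==> 0 <= Im x ==> 0 < Im (hq n x)"
proof -
 have u0: "0 < norm (hU n 0)" by (simp add: hU_0[OF n])
 have "\<forall>\<^sub>F x in F0. norm (hU n 0)/2 < norm (hQ n x)"
 using order_tendstoD(1)[OF tendsto_norm[OF hQ_tendsto[OF n]], of "norm (hU n 0)/2"] u0 by simp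
 then have "\<forall>\<^sub>F x in F0. norm (hU n 0)/2 < norm (hQ n x) & 0 < Re (hq1 n x) & (Im x = 0 --> 0 < Im (hq n x))"
 using hq1_Re_pos[OF n] hq_Im_pos_real[OF n] by eventually_elim simp
 then obtain r where r0: "0 < r" "\<forall>x\<in>{x. 0 < Re x}. x ~= 0 & dist x 0 < r -->
 norm (hU n 0)/2 < norm (hQ n x) & 0 < Re (hq1 n x) & (Im x = 0 --> 0 < Im (hq n x))"
 unfolding eventually_at by blast
 have r: "0 < r" "!!x. 0 < Re x ==> norm x < r ==>
 norm (hU n 0)/2 < norm (hQ n x) & 0 < Re (hq1 n x) & (Im x = 0 --> 0 < Im (hq n x))"
 proof -
 fix x :: complex assume "0 < Re x" "norm x < r"
 moreover from this have "x ~= 0" by auto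
 ultimately show "norm (hU n 0)/2 < norm (hQ n x) & 0 < Re (hq1 n x) & (Im x = 0 --> 0 < Im (hq n x))"
 proof -
 assume "0 < Re x" "norm x < r" "x ~= 0"
 with r0(2) have "x ~= 0 & dist x 0 < r -->
 norm (hU n 0)/2 < norm (hQ n x) & 0 < Re (hq1 n x) & (Im x = 0 --> 0 < Im (hq n x))" by blast
 then show ?thesis using \<open>norm x < r\<close> \<open>x ~= 0\<close> unfolding dist_norm diff_0_right by blast
 qed
 qed (rule r0(1))
 show thesis
 proof (rule that[of "min r 1"])
 fix x :: complex assume x: "0 < Re x" "norm x < min r 1"
 show "hQ n x ~= 0 & fact (n - 1)/2 <= norm (hQ n x)" using r(2)[of x] x u0 by (auto simp: hU_0[OF n])
 assume y: "0 <= Im x"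
 define g where "g t = Im (hq n (Complex (Re x) t))" for t
 have pt: "0 < Re (Complex (Re x) t)" "norm (Complex (Re x) t) < r" if "0 <= t" "t <= Im x" for t
 proof -
 have "norm (Complex (Re x) t) <= norm x" unfolding cmod_def using that by (auto intro!: power_mono)
 then show "norm (Complex (Re x) t) < r" using x by simp
 qed (use x in auto)
 have "g 0 <= g (Im x)"
 proof (rule DERIV_nonneg_imp_nondecreasing[OF y])
 fix t assume t: "0 <= t" "t <= Im x"
 let ?w = "Complex (Re x) t"
 have w: "?w \<notin> nonpos_Reals" using x(1) by (auto simp: complex_nonpos_Reals_iff)
 have "hQ n ?w ~= 0" using r(2)[OF pt[OF t]] u0 by auto
 from hq_derivative[OF n w this]
 have "(hq n has_derivative (%h. hq1 n ?w*h)) (at ?w)" by (simp add: has_field_derivative_def)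
 moreover have "((%t. Complex (Re x) t) has_derivative (%h. \<i>*cor h)) (at t)"
 proof -
 have "((%t. cor (Re x) + \<i>*cor t) has_derivative (%h. \<i>*cor h)) (at t)"
 by (auto intro!: derivative_eq_intros)
 moreover have "Complex (Re x) t = cor (Re x) + \<i>*cor t" for t
 by (simp add: complex_eq_iff)
 ultimately show ?thesis by presburger
 qed
 ultimately have "((%t. hq n (Complex (Re x) t)) has_derivative (%h. hq1 n ?w*(\<i>*cor h))) (at t)"
 by (rule has_derivative_compose[rotated])
 then have "(g has_derivative (%h. Im (hq1 n ?w*(\<i>*cor h)))) (at t)"
 unfolding g_def[abs_def] by (rule has_derivative_Im)
 then have "(g has_real_derivative Re (hq1 n ?w)) (at t)"
 by (simp add: has_field_derivative_def mult_commute_abs)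
 then show "\<exists>y. (g has_real_derivative y) (at t) & 0 <= y" using r(2)[OF pt[OF t]] by (intro exI[of _ "Re (hq1 n ?w)"]) auto
 qed
 moreover have "0 < g 0" using r(2)[OF pt[of 0]] y unfolding g_def by auto
 moreover have "g (Im x) = Im (hq n x)" by (simp add: g_def)
 ultimately show "0 < Im (hq n x)" by linarith
 qed (use r in auto)
qed

text \<open>Since U(0) = (n-1) U'(0), the linear coefficient U'(0)/U(0) is 1/(n-1); the logarithm
  enters only with a factor of order x^n.\<close>

lemma hq_expansion:
 assumes n: "2 <= n"
 obtains K r where "0 <= K" "0 < r" "!!x. 0 < Re x ==> norm x < r ==>
 norm (hq n x - x/of_nat (n - 1)) <= K*(norm x)^2*(1 + norm x^(n - 2)*(1 + norm (Ln x)))"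
proof -
 have n1: "1 <= n" using n by simp
 obtain r where r: "0 < r" "r <= 1" "!!x. 0 < Re x ==> norm x < r ==> hQ n x ~= 0 & fact (n - 1)/2 <= norm (hQ n x)"
 using hq_properties[OF n1] by metis
 obtain K where K: "0 <= K" "!!x. x ~= 0 ==> norm x <= 1 ==> norm (hQ n x - hU n 0) <= K*norm x*(1 + norm x^(n - 1)*(1 + norm (Ln x)))"
 using hQ_bound[OF n1] by blast
 obtain J where J: "0 <= J" "!!x. x ~= 0 ==> norm x <= 1 ==> norm (hQ1 n x - hU n 1) <= J*norm x*(1 + norm x^(n - 2)*(1 + norm (Ln x)))"
 using hQ1_bound[OF n] by blast
 define m where "m = (of_nat (n - 1) :: complex)"
 have "norm m = real (n - 1)" by (simp only: m_def norm_of_nat)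
 then have m: "m ~= 0" "1 <= norm m" using n by auto
 have u: "hU n 0 = m*hU n 1"
 proof -
 obtain k where k: "n = Suc (Suc k)" using n by (metis add_2_eq_Suc le_Suc_ex)
 show ?thesis unfolding hU_0[OF n1] hU_1[OF n] m_def by (simp add: k)
 qed
 show thesis
 proof (rule that[of "2*(norm m*J + K)" r])
 fix x :: complex assume x: "0 < Re x" "norm x < r"
 then have x0: "x ~= 0" "norm x <= 1" using r(2) by auto
 define w where "w = 1 + norm x^(n - 2)*(1 + norm (Ln x))"
 have w: "1 + norm x^(n - 1)*(1 + norm (Ln x)) <= w" unfolding w_def
 using x0 n by (intro add_left_mono mult_right_mono power_decreasing) auto
 have w0: "0 <= w" by (simp add: w_def)
 note Q = r(3)[OF x]
 have "norm (m*hQ1 n x - hQ n x) = norm (m*(hQ1 n x - hU n 1) - (hQ n x - hU n 0))" unfolding u by (simp add: algebra_simps)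
 also have "... <= norm m*(J*norm x*w) + K*norm x*w"
 proof (rule order_trans[OF norm_triangle_ineq4], rule add_mono)
 show "norm (m*(hQ1 n x - hU n 1)) <= norm m*(J*norm x*w)"
 unfolding norm_mult w_def using J(2)[OF x0] by (intro mult_left_mono) auto
 show "norm (hQ n x - hU n 0) <= K*norm x*w"
 using K(1) by (rule_tac order_trans[OF K(2)[OF x0]]) (intro mult_left_mono w; simp)
 qed
 finally have b: "norm (m*hQ1 n x - hQ n x) <= (norm m*J + K)*norm x*w" by (simp add: algebra_simps)
 have "hq n x - x/m = x*(m*hQ1 n x - hQ n x)/(m*hQ n x)"
 using m Q by (simp add: hq_def field_simps)
 then have "norm (hq n x - x/m) = norm x*norm (m*hQ1 n x - hQ n x)/(norm m*norm (hQ n x))"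
 by (simp add: norm_mult norm_divide)
 also have "... <= norm x*((norm m*J + K)*norm x*w)/(1*(1/2))"
 proof (intro frac_le mult_left_mono b mult_mono m(2))
 have "(1::real) <= fact (n - 1)" by (rule fact_ge_1)
 then show "1/2 <= norm (hQ n x)" using Q by linarith
 qed (use J(1) K(1) w0 in auto)
 finally show "norm (hq n x - x/of_nat (n - 1)) <= 2*(norm m*J + K)*(norm x)^2*(1 + norm x^(n - 2)*(1 + norm (Ln x)))"
 by (simp add: m_def w_def power2_eq_square algebra_simps)
 qed (use K J r in auto)
qed

text \<open>Here Q(0) = 1, and Q' is hU 1 1 - 1 - Ln x to leading order with hU 1 1 - 1 = i pi - 2
  gamma, so the logarithm already appears in the leading term.\<close>

lemma hq_expansion_1:
 obtains K r where "0 <= K" "0 < r" "!!x. 0 < Re x ==> norm x < r ==>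
 norm (hq 1 x - x*(\<i>*cor pi - 2*euler_mascheroni - Ln x)) <= K*(norm x)^2*(1 + norm (Ln x))^2"
proof -
 obtain r where r: "0 < r" "r <= 1" "!!x. 0 < Re x ==> norm x < r ==> hQ 1 x ~= 0 & fact (1 - 1)/2 <= norm (hQ 1 x)"
 using hq_properties[of 1] by (metis order_refl)
 obtain K where K: "0 <= K" "!!x. x ~= 0 ==> norm x <= 1 ==> norm (hQ1 1 x - (hU 1 1 - 1 - Ln x)) <= K*norm x*(1 + norm (Ln x))"
 using hQ1_bound_1 by blast
 obtain J where J: "0 <= J" "!!x. x ~= 0 ==> norm x <= 1 ==> norm (hQ 1 x - hU 1 0) <= J*norm x*(1 + norm x^(1 - 1)*(1 + norm (Ln x)))"
 using hQ_bound[of 1] by auto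
 have u0: "hU 1 0 = 1" by (simp add: hU_0)
 define b where "b = \<i>*cor pi - 2*euler_mascheroni"
 have u1: "hU 1 1 - 1 = b" unfolding hU_1_1 b_def by simp
 show thesis
 proof (rule that[of "2*(K + 2*J*(norm b + 1))" r])
 fix x :: complex assume x: "0 < Re x" "norm x < r"
 then have x0: "x ~= 0" "norm x <= 1" using r(2) by auto
 note Q = r(3)[OF x]
 define l where "l = 1 + norm (Ln x)"
 have l: "1 <= l" by (simp add: l_def)
 have 1: "norm (hQ1 1 x - (b - Ln x)) <= K*norm x*l" using K(2)[OF x0] unfolding u1 l_def .
 have 2: "norm (hQ 1 x - 1) <= 2*J*norm x*l"
 proof -
 have "norm (hQ 1 x - 1) <= J*norm x*(1 + l)" using J(2)[OF x0] unfolding u0 l_def by simp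
 also have "... <= J*norm x*(2*l)" using J(1) l by (intro mult_left_mono) auto
 finally show ?thesis by (simp add: mult_ac)
 qed
 have 3: "norm (b - Ln x) <= (norm b + 1)*l"
 proof -
 have "norm (b - Ln x) <= norm b + norm (Ln x)" by (rule norm_triangle_ineq4)
 also have "... <= norm b*l + l" using mult_left_mono[OF l, of "norm b"] by (simp add: l_def)
 finally show ?thesis by (simp add: algebra_simps)
 qed
 have "hq 1 x - x*(b - Ln x) = x*((hQ1 1 x - (b - Ln x)) - (hQ 1 x - 1)*(b - Ln x))/hQ 1 x"
 using Q by (simp add: hq_def field_simps)
 then have "norm (hq 1 x - x*(b - Ln x)) = norm x*norm ((hQ1 1 x - (b - Ln x)) - (hQ 1 x - 1)*(b - Ln x))/norm (hQ 1 x)"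
 by (simp add: norm_mult norm_divide)
 also have "... <= norm x*(K*norm x*l + 2*J*norm x*l*((norm b + 1)*l))/(1/2)"
 proof -
 have A: "norm ((hQ1 1 x - (b - Ln x)) - (hQ 1 x - 1)*(b - Ln x)) <= K*norm x*l + 2*J*norm x*l*((norm b + 1)*l)"
 proof (rule order_trans[OF norm_triangle_ineq4], rule add_mono[OF 1])
 have "0 <= 2*J*norm x*l" using J(1) l by simp
 then show "norm ((hQ 1 x - 1)*(b - Ln x)) <= 2*J*norm x*l*((norm b + 1)*l)"
 unfolding norm_mult by (rule mult_mono[OF 2 3]) simp
 qed
 have R: "0 <= norm x*(K*norm x*l + 2*J*norm x*l*((norm b + 1)*l))"
 using K(1) J(1) l by (intro mult_nonneg_nonneg add_nonneg_nonneg) auto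
 have h: "1/2 <= norm (hQ 1 x)" using Q by simp
 show ?thesis by (rule frac_le[OF R mult_left_mono[OF A] _ h]) simp_all
 qed
 also have "... <= 2*(K + 2*J*(norm b + 1))*(norm x)^2*l^2"
 proof -
 have "K*norm x*l <= K*norm x*l^2" using K(1) l by (intro mult_left_mono) (auto simp: power2_eq_square)
 then have "norm x*(K*norm x*l + 2*J*norm x*l*((norm b + 1)*l)) <= norm x*(K*norm x*l^2 + 2*J*norm x*l*((norm b + 1)*l))"
 by (intro mult_left_mono) auto
 then show ?thesis by (simp add: power2_eq_square algebra_simps)
 qed
 finally show "norm (hq 1 x - x*(\<i>*cor pi - 2*euler_mascheroni - Ln x)) <= 2*(K + 2*J*(norm b + 1))*(norm x)^2*(1 + norm (Ln x))^2"
 by (simp add: b_def l_def)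
 qed (use K J r in auto)
qed

section \<open>The branch W_(-1) on the positive axis near 0\<close>

section \<open>The Lambert function near the origin\<close>

text \<open>For y > 0 a point w of branch -1 with w exp w = y satisfies Im w + Arg w = -2 pi. With t
  = -Arg w this gives |w| = (2 pi - t)/sin t and Re w = (2 pi - t) cot t, and the modulus equation
  ln |w| + Re w = ln y becomes lam_h(t) = ln y.\<close>

definition lam_h :: "real => real" where
 "lam_h t = ln (2*pi - t) - ln (sin t) + (2*pi - t)*(cos t/sin t)"

text \<open>With A = 2 pi - u and k = cot u the derivative equals -((1 + A k)^2/A + A).\<close>

lemma lam_h_decreasing:
 assumes "0 < s" "s < t" "t < pi" shows "lam_h t < lam_h s"
proof (rule DERIV_neg_imp_decreasing[OF assms(2)])
 fix u assume u: "s <= u" "u <= t"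
 have su: "0 < sin u" using u assms by (intro sin_gt_zero) auto
 have a: "0 < 2*pi - u" using u assms pi_gt_zero by linarith
 have "(lam_h has_real_derivative (- 1/(2*pi - u) - cos u/sin u + (- (cos u/sin u) + (2*pi - u)*((- sin u * sin u - cos u*cos u)/(sin u * sin u))))) (at u)"
 unfolding lam_h_def[abs_def] using su a
 by (auto intro!: derivative_eq_intros simp: divide_inverse algebra_simps)
 moreover have "- 1/(2*pi - u) - cos u/sin u + (- (cos u/sin u) + (2*pi - u)*((- sin u * sin u - cos u*cos u)/(sin u * sin u))) < 0"
 proof -
 define A where "A = 2*pi - u"
 define k where "k = cos u/sin u"
 have "(- sin u * sin u - cos u*cos u)/(sin u * sin u) = - (1 + k^2)"
 proof -
 have "(- sig * sig - gam*gam)/(sig * sig) = - (1 + (gam/sig)^2)" if "sig ~= 0" for sig gam :: real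
 using that by (simp add: field_simps power2_eq_square)
 from this[of "sin u" "cos u"] show ?thesis using su by (simp add: k_def)
 qed
 moreover have "- 1/A - k + (- k + A*(- (1 + k^2))) = - ((1 + A * k)^2/A + A)"
 proof -
 have "A ~= 0" using a by (simp add: A_def)
 then show ?thesis by (simp add: field_simps power2_eq_square)
 qed
 moreover have "0 < (1 + A * k)^2/A + A" using a by (intro add_nonneg_pos) (auto simp: A_def)
 ultimately show ?thesis unfolding A_def[symmetric] k_def[symmetric] by simp
 qed
 ultimately show "\<exists>y. (lam_h has_real_derivative y) (at u) & y < 0" by blast
qed

text \<open>As t tends to pi the term (2 pi - t) cot t outweighs -ln(sin t) and drives
  \<open>lam_h\<close> to minus infinity; the intermediate value theorem does the rest.\<close>

lemma lam_h_surj: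
 assumes t1: "pi/2 <= t1" "t1 < pi" and y: "y < lam_h t1"
 obtains t where "t1 < t" "t < pi" "lam_h t = y"
proof -
 have s1: "0 < sin t1" using t1 pi_gt_zero by (intro sin_gt_zero) linarith+
 define L where "L = abs (ln (2*pi)) + abs y + 1"
 have L: "1 <= L" by (simp add: L_def)
 \<comment> \<open>At t2 = pi - arcsin sig the estimate is ln(2 pi) + 1/sig - 3/(2 sig) = ln(2 pi) -
   1/(2 sig) <= ln(2 pi) - L, which is below y.\<close>
 define sig where "sig = min (min (1/2) (sin t1/2)) (1/(2*L))"
 have sig: "0 < sig" "sig <= 1/2" "sig < sin t1" "sig <= 1/(2*L)"
 proof -
 show "0 < sig" "sig <= 1/(2*L)" using s1 L by (auto simp: sig_def)
 show "sig <= 1/2" unfolding sig_def by (intro min.coboundedI1 order_refl)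
 have "sig <= sin t1/2" by (simp add: sig_def)
 then show "sig < sin t1" using s1 by linarith
 qed
 define t2 where "t2 = pi - arcsin sig"
 have as: "0 < arcsin sig" "arcsin sig <= pi/2"
 using sig arcsin_less_arcsin[of 0 sig] arcsin_bounded[of sig] by auto
 have st: "sin t2 = sig" using sig by (simp add: t2_def sin_diff)
 have ct: "cos t2 = - sqrt (1 - sig\<^sup>2)" using sig by (simp add: t2_def cos_diff cos_arcsin)
 have t12: "t1 < t2"
 proof -
 have "arcsin (sin (pi - t1)) = pi - t1" using t1 by (intro arcsin_sin) auto
 moreover have "arcsin sig < arcsin (sin (pi - t1))" using sig s1 by (intro arcsin_less_arcsin) (auto simp: sin_diff)
 ultimately show ?thesis by (simp add: t2_def)
 qed
 have t2: "t2 < pi" "pi/2 <= t2" using as by (auto simp: t2_def)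
 have "lam_h t2 <= ln (2*pi) + 1/sig + - (3*(1/2)/sig)"
 proof -
 have 1: "ln (2*pi - t2) <= ln (2*pi)" using t2 pi_gt_zero by simp
 have 2: "- ln sig <= 1/sig"
 proof -
 have "ln (1/sig) <= 1/sig - 1" using sig by (intro ln_le_minus_one) auto
 then show ?thesis using sig by (simp add: ln_div)
 qed
 have "1/2 <= sqrt (1 - sig\<^sup>2)"
 proof (rule real_le_rsqrt)
 have "sig^2 <= (1/2)^2" using sig by (intro power_mono) auto
 then show "(1/2)^2 <= 1 - sig\<^sup>2" by (simp add: power2_eq_square)
 qed
 then have "3*(1/2) <= (2*pi - t2) * sqrt (1 - sig\<^sup>2)" using t2 pi_gt3 by (intro mult_mono) auto
 then have "3*(1/2)/sig <= (2*pi - t2) * sqrt (1 - sig\<^sup>2)/sig" using sig by (intro divide_right_mono) auto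
 with 1 2 show ?thesis unfolding lam_h_def st ct by simp
 qed
 also have "... = ln (2*pi) - 1/(2 * sig)" by (simp add: field_simps)
 also have "... <= ln (2*pi) - L"
 proof -
 have "2 * sig <= 1/L" using sig(4) by simp
 then have "L <= 1/(2 * sig)" using sig(1) L by (simp add: field_simps)
 then show ?thesis by simp
 qed
 also have "... < y" by (simp add: L_def)
 finally have lt: "lam_h t2 < y" .
 have "\<exists>t\<ge>t1. t <= t2 & lam_h t = y"
 proof (rule IVT2)
 show "\<forall>x. t1 <= x & x <= t2 --> isCont lam_h x"
 proof (intro allI impI)
 fix x assume x: "t1 <= x & x <= t2"
 have "0 < sin x" using x t1 t2 pi_gt_zero by (intro sin_gt_zero) linarith+
 moreover have "0 < 2*pi - x" using x t2 pi_gt_zero by linarith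
 ultimately show "isCont lam_h x" unfolding lam_h_def[abs_def] by (intro continuous_intros) auto
 qed
 qed (use t12 lt y in auto)
 then obtain t where t: "t1 <= t" "t <= t2" "lam_h t = y" by blast
 have "t ~= t1" using t(3) y by auto
 then show thesis using t t2 by (intro that[of t]) auto
qed

text \<open>The argument equation leaves an even multiple of pi, and the strip of branch -1 contains
  only -2 pi; the modulus equation then fixes t because \<open>lam_h\<close> is strictly
  decreasing.\<close>

lemma lambert_W_minus_1:
 assumes y: "0 < y" and t: "0 < t" "t < pi" "lam_h t = ln y"
 defines "W \<equiv> Complex ((2*pi - t)*(cos t/sin t)) (- (2*pi - t))"
 shows "lambert_W (-1) (cor y) = W" "W*exp W = cor y"
proof -
 have s: "0 < sin t" using t by (intro sin_gt_zero)
 define rho where "rho = (2*pi - t)/sin t"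
 have rho: "0 < rho" using s t pi_gt_zero by (simp add: rho_def)
 have W: "W = cor rho*cis (- t)" using s by (simp add: W_def rho_def complex_eq_iff)
 have W0: "W ~= 0" using rho by (simp add: W)
 have ArgW: "Arg W = - t"
 proof (rule cis_Arg_unique)
 have "norm W = rho" using rho by (simp add: W norm_mult)
 then show "sgn W = cis (- t)" using rho by (simp add: sgn_eq) (simp add: W)
 qed (use t in auto)
 have "exp W = cor (exp (Re W))*cis (Im W)" by (rule exp_eq_polar)
 also have "cis (Im W) = cis t"
 proof -
 have "Im W = t - 2*pi" by (simp add: W_def)
 then show ?thesis by (simp add: cis.ctr cos_diff sin_diff complex_eq_iff)
 qed
 finally have "W*exp W = cor (rho*exp (Re W))*(cis (- t)*cis t)" by (simp add: W)
 also have "cis (- t)*cis t = 1" by (simp add: cis_mult)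
 also have "rho*exp (Re W) = y"
 proof -
 have "ln rho + Re W = ln y" using t(3) s t pi_gt_zero by (simp add: rho_def W_def lam_h_def ln_div)
 then have "exp (ln rho + Re W) = exp (ln y)" by simp
 then show ?thesis using rho y by (simp add: exp_add)
 qed
 finally show We: "W*exp W = cor y" by simp
 have ImW: "Im W + Arg W = - 2*pi" unfolding ArgW by (simp add: W_def)
 have "W \<in> lambert_range (-1)"
 proof -
 have "of_int (2*(-1) - 1)*pi < Im W + Arg W & Im W + Arg W <= of_int (2*(-1) + 1)*pi"
 unfolding ImW using pi_gt_zero by simp
 then show ?thesis using W0 by (simp add: lambert_range_def Let_def)
 qed
 moreover have "w = W" if w: "w \<in> lambert_range (-1) & w*exp w = cor y" for w
 proof -
 \<comment> \<open>The half-line that belongs to branch -1 is mapped to negative numbers, so it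
   contains no solution for y > 0.\<close>
 have nr: "w \<notin> cor ` {..-1}"
 proof
 assume "w \<in> cor ` {..-1}"
 then obtain u where u: "w = cor u" "u <= -1" by auto
 have "cor (u*exp u) = cor y" using w by (simp add: u(1) exp_of_real)
 then have "u*exp u = y" by (simp only: of_real_eq_iff)
 moreover have "u*exp u < 0" using u(2) by (simp add: mult_less_0_iff)
 ultimately show False using y by simp
 qed
 then have w1: "w ~= 0" "of_int (2*(-1) - 1)*pi < Im w + Arg w" "Im w + Arg w <= of_int (2*(-1) + 1)*pi"
 using w by (auto simp: lambert_range_def Let_def)
 have "exp (Ln w + w) = exp (cor (ln y))"
 using w w1(1) y by (simp add: exp_add exp_of_real)
 then obtain k :: int where k: "Ln w + w = cor (ln y) + of_int (2 * k)*cor pi * \<i>"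
 unfolding exp_eq by (auto simp: mult_ac)
 have im: "Arg w + Im w = 2 * of_int k*pi" using arg_cong[OF k, of Im] w1(1) by (simp add: Arg_eq_Im_Ln)
 have re: "ln (norm w) + Re w = ln y" using arg_cong[OF k, of Re] w1(1) by simp
 have "k = -1"
 proof -
 have "- 3*pi < 2 * of_int k*pi" "2 * of_int k*pi <= - 1*pi" using w1(2,3) im by simp_all
 then have "- 3 < 2*(of_int k :: real)" "2*(of_int k :: real) <= - 1"
 using pi_gt_zero by (simp_all only: mult_less_cancel_right_pos mult_le_cancel_right_pos)
 then show ?thesis by linarith
 qed
 then have im': "Im w = - (2*pi + Arg w)" using im by simp
 define tau where "tau = - Arg w"
 have tau: "- pi <= tau" "tau < pi" using Arg_bounded[of w] by (auto simp: tau_def)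
 have pol: "Re w = norm w*cos tau" "Im w = - (norm w * sin tau)"
 using rcis_cmod_Arg[of w] by (metis Re_rcis cos_minus tau_def minus_minus, metis Im_rcis sin_minus tau_def minus_minus mult_minus_right)
 have nw: "norm w * sin tau = 2*pi - tau" using pol(2) im' by (simp add: tau_def)
 have "0 < 2*pi - tau" using tau pi_gt_zero by linarith
 then have stau: "0 < sin tau" using nw w1(1) by (metis zero_less_mult_pos zero_less_norm_iff)
 have tau0: "0 < tau"
 proof (rule ccontr)
 assume "\<not> 0 < tau"
 then have "0 <= sin (- tau)" using tau by (intro sin_ge_zero) auto
 then show False using stau by simp
 qed
 have nw': "norm w = (2*pi - tau)/sin tau" using nw stau by (simp add: field_simps)
 have "lam_h tau = ln y" using re stau tau pi_gt_zero unfolding pol(1) nw' by (simp add: lam_h_def ln_div)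
 then have "tau = t" using lam_h_decreasing[of t tau] lam_h_decreasing[of tau t] t tau tau0 by (cases tau t rule: linorder_cases) auto
 then show "w = W" using pol nw' s by (simp add: W_def complex_eq_iff)
 qed
 ultimately show "lambert_W (-1) (cor y) = W"
 unfolding lambert_W_def using We by (intro the_equality) blast+
qed

text \<open>Small y corresponds to t close to pi, where Im W = -(2 pi - t) approaches -pi and |W| =
  (2 pi - t)/sin t is large.\<close>

lemma lambert_W_small:
 assumes "0 < eta"
 obtains y1 where "0 < y1" "!!y. 0 < y ==> y < y1 ==>
 lambert_W (-1) (cor y)*exp (lambert_W (-1) (cor y)) = cor y &
 abs (Im (lambert_W (-1) (cor y)) + pi) < eta & 1/eta < norm (lambert_W (-1) (cor y))"
proof -
 define t1 where "t1 = max (pi/2) (pi - eta)"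
 have t1: "pi/2 <= t1" "t1 < pi" "pi - eta <= t1" using assms pi_gt_zero by (auto simp: t1_def)
 show thesis
 proof (rule that[of "exp (lam_h t1)"])
 fix y :: real assume y: "0 < y" "y < exp (lam_h t1)"
 then have "ln y < lam_h t1" using ln_less_cancel_iff[of y "exp (lam_h t1)"] by simp
 then obtain t where t: "t1 < t" "t < pi" "lam_h t = ln y" by (rule lam_h_surj[OF t1(1,2)])
 have t0: "0 < t" using t1 t pi_gt_zero by linarith
 note W = lambert_W_minus_1[OF y(1) t0 t(2,3)]
 have s: "0 < sin t" using t0 t by (intro sin_gt_zero)
 have sp: "sin t <= pi - t" using sin_x_le_x[of "pi - t"] t by (simp add: sin_diff)
 have im: "\<bar>- (2*pi - t) + pi\<bar> < eta" using t t1 by simp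
 have "1/eta < pi/sin t"
 proof -
 have "sin t < eta" using sp t t1 by linarith
 then have "1/eta < 1/sin t" using s by (simp add: frac_less2)
 also have "... <= pi/sin t" using s pi_gt3 by (intro divide_right_mono) auto
 finally show ?thesis .
 qed
 also have "pi/sin t <= (2*pi - t)/sin t" using s t by (intro divide_right_mono) auto
 also have "... = norm (Complex ((2*pi - t)*(cos t/sin t)) (- (2*pi - t)))"
 proof -
 have "Complex ((2*pi - t)*(cos t/sin t)) (- (2*pi - t)) = cor ((2*pi - t)/sin t)*cis (- t)"
 using s by (simp add: complex_eq_iff)
 moreover have "0 < (2*pi - t)/sin t" using s t pi_gt_zero by (intro divide_pos_pos) linarith+
 ultimately show ?thesis by (simp only: norm_mult norm_of_real norm_cis abs_of_pos mult_1_right)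
 qed
 finally show "lambert_W (-1) (cor y)*exp (lambert_W (-1) (cor y)) = cor y &
 abs (Im (lambert_W (-1) (cor y)) + pi) < eta & 1/eta < norm (lambert_W (-1) (cor y))"
 unfolding W(1) using W(2) im by simp
 qed simp
qed

section \<open>Exact roots of the matching equation by Brouwer's theorem\<close>

section \<open>Solving the matching equation\<close>

text \<open>The matching equation is \<open>hq n x = \<delta> x \<epsilon>\<close>. It is rewritten as a fixed point problem for a
  continuous map of a disc into itself. A solution cannot lie in the closed upper half plane, where
  the two sides have imaginary parts of different signs.\<close>

lemma hq_continuous_on:
 assumes "1 <= n" "!!x. x \<in> S ==> 0 < Re x" "!!x. x \<in> S ==> hQ n x ~= 0"
 shows "continuous_on S (hq n)"
proof (rule continuous_at_imp_continuous_on, rule ballI)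
 fix x assume x: "x \<in> S"
 have "x \<notin> nonpos_Reals" using assms(2)[OF x] by (auto simp: complex_nonpos_Reals_iff)
 from DERIV_isCont[OF hq_derivative[OF assms(1) this assms(3)[OF x]]] show "isCont (hq n) x" .
qed

text \<open>To leading order x/(n-1) = B eps - A x, with root a eps for a = B/c and c = 1/(n-1) + A.
  The map Phi(x) = x - (hq - delta0)/c removes the linear part, so on a disc around a eps its values
  differ from a eps only by the remainders, bounded by K eps^2 (1 + eps^(n-2) (1 + |ln eps|)). Hence
  Phi maps the disc to itself, and at the fixed point the same bound is the asserted error.\<close>

lemma matching_solution_ge_2:
 fixes delta0 :: "complex => real => complex"
 assumes n: "2 <= n" and B: "0 < B" and A: "0 <= A" and C: "0 <= C" and r: "0 < r"
 and cont: "!!eps. abs eps < r ==> continuous_on (ball 0 r) (%x. delta0 x eps)"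
 and est: "!!x eps. abs eps < r ==> norm x < r ==> norm (delta0 x eps - (cor (B*eps) - cor A*x)) <= C*(abs eps + norm x)^2"
 and sgn: "!!x eps. abs eps < r ==> norm x < r ==> 0 <= Im x ==> Im (delta0 x eps) <= 0"
 obtains a K e where "0 < a" "0 < e" "0 <= K" "!!eps. 0 < eps ==> eps < e ==>
 \<exists>x. 0 < Re x & Im x < 0 & norm x < r & hQ n x ~= 0 & hq n x = delta0 x eps &
 norm (x - cor (a*eps)) <= K*eps^2*(1 + eps^(n - 2)*(1 + abs (ln eps)))"
proof -
 have n1: "1 <= n" using n by simp
 obtain r1 where r1: "0 < r1" "r1 <= 1" "!!x. 0 < Re x ==> norm x < r1 ==> hQ n x ~= 0 & fact (n - 1)/2 <= norm (hQ n x)"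
 "!!x. 0 < Re x ==> norm x < r1 ==> 0 <= Im x ==> 0 < Im (hq n x)"
 by (rule hq_properties[OF n1]) blast
 obtain K0 r2 where r2: "0 <= K0" "0 < r2" "!!x. 0 < Re x ==> norm x < r2 ==>
 norm (hq n x - x/of_nat (n - 1)) <= K0*(norm x)^2*(1 + norm x^(n - 2)*(1 + norm (Ln x)))"
 by (rule hq_expansion[OF n]) blast
 define c where "c = 1/real (n - 1) + A"
 have c: "0 < c" using n A by (auto simp: c_def intro!: add_pos_nonneg)
 define a where "a = B/c"
 have a: "0 < a" using B c by (simp add: a_def)
 define L where "L = 1 + pi + abs (ln (a/2)) + abs (ln (2*a))"
 have L: "1 <= L" by (simp add: L_def)
 define K where "K = (C*(1 + 2*a)^2 + K0*(2*a)^2*(1 + (2*a)^(n - 2)*L))/c"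
 have K: "0 <= K" unfolding K_def using C r2(1) a c L by (intro divide_nonneg_pos add_nonneg_nonneg mult_nonneg_nonneg) auto
 \<comment> \<open>The last entry makes K eps^2 w at most the radius a eps/2, via eps w <= 162
   sqrt(eps); the others keep the disc inside the domains of the expansions.\<close>
 define e where "e = min (min 1 (r/(1 + 2*a))) (min (min r1 r2/(1 + 2*a)) ((a/(324*(K + 1)))^2))"
 have e: "0 < e" unfolding e_def using r r1 r2 a K by auto
 show thesis
 proof (rule that[OF a e K])
 fix eps :: real assume eps: "0 < eps" "eps < e"
 have eps1: "eps < 1" "eps < r/(1 + 2*a)" "eps < min r1 r2/(1 + 2*a)" "eps < (a/(324*(K + 1)))^2"
 using eps by (auto simp: e_def)
 have a2: "0 < 1 + 2*a" using a by simp
 have small: "(1 + 2*a)*eps < r" "(1 + 2*a)*eps < r1" "(1 + 2*a)*eps < r2"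
 using eps1(2,3) a2 by (auto simp: pos_less_divide_eq mult.commute)
 have epsr: "abs eps < r"     proof -
 have "0 < 2*a*eps" using a eps by simp
 then show ?thesis using small(1) eps unfolding distrib_right by linarith
 qed
 define D where "D = cball (cor (a*eps)) (a*eps/2)"
 define w where "w = 1 + eps^(n - 2)*(1 + abs (ln eps))"
 have Kw: "K*eps^2*w <= a*eps/2"
 proof -
 have "eps^(n - 2)*(1 + abs (ln eps)) <= 1*(1 + abs (ln eps))"         by (rule mult_right_mono[OF power_le_one]) (use eps eps1 abs_ge_zero[of "ln eps"] in linarith)+
 then have "w <= 1 + 1*(1 + abs (ln eps))" unfolding w_def by linarith
 then have "w <= 2*(1 + (abs (ln eps) + pi))" using pi_gt_zero abs_ge_zero[of "ln eps"] unfolding distrib_left by linarith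
 also have "... <= 2*(1 + (abs (ln eps) + pi))^2"
 proof -
 have "1*(1 + (abs (ln eps) + pi)) <= (1 + (abs (ln eps) + pi))*(1 + (abs (ln eps) + pi))" by (intro mult_right_mono) auto
 then show ?thesis by (simp add: power2_eq_square)
 qed
 also have "... <= 2*(81/sqrt eps)" using eps eps1 by (intro mult_left_mono ln_abs_bound) auto
 finally have "eps*w <= eps*(162/sqrt eps)" using eps by (intro mult_left_mono) auto
 also have "... = 162*(eps/sqrt eps)" by simp
 also have "eps/sqrt eps = sqrt eps" by (rule real_div_sqrt) (use eps in simp)
 finally have 1: "eps*w <= 162 * sqrt eps" .
 have "sqrt eps <= sqrt ((a/(324*(K + 1)))^2)" using eps1(4) by (intro real_sqrt_le_mono) simp
 also have "... = a/(324*(K + 1))" using a K by simp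
 finally have "eps*w <= 162*(a/(324*(K + 1)))" using 1 by linarith
 then have "(K + 1)*(eps*w) <= (K + 1)*(162*(a/(324*(K + 1))))" using K by (intro mult_left_mono) auto
 also have "... = a/2" using K by (simp add: field_simps)
 finally have "(K + 1)*(eps*w) <= a/2" .
 moreover have "0 <= eps*w" using eps by (simp add: w_def)
 ultimately have "K*(eps*w) <= a/2" by (simp add: distrib_right)
 then have "eps*(K*(eps*w)) <= eps*(a/2)" using eps by (intro mult_left_mono) auto
 then show ?thesis by (simp add: power2_eq_square mult_ac)
 qed
 have inD: "0 < Re x" "norm x < r" "norm x < r1" "norm x < r2" "norm x <= 2*a*eps" "a/2*eps <= norm x" if "x \<in> D" for x
 proof -
 have d: "norm (x - cor (a*eps)) <= a*eps/2" using that by (simp add: D_def dist_norm norm_minus_commute)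
 have "abs (Re (x - cor (a*eps))) <= a*eps/2" using d abs_Re_le_cmod order_trans by blast
 then have "abs (Re x - a*eps) <= a*eps/2" by simp
 then have re: "a*eps/2 <= Re x" by linarith
 moreover have "0 < a*eps/2" using a eps by simp
 ultimately show "0 < Re x" by linarith
 show "a/2*eps <= norm x" using re complex_Re_le_cmod[of x] by simp
 have "norm x <= norm (cor (a*eps)) + norm (x - cor (a*eps))" by (rule norm_triangle_sub)
 also have "norm (cor (a*eps)) = a*eps" using a eps by (simp del: of_real_mult)
 finally show le: "norm x <= 2*a*eps" using d mult_pos_pos[OF a eps(1)] by linarith
 have "2*a*eps <= (1 + 2*a)*eps" using eps by (simp add: algebra_simps)
 with le small show "norm x < r" "norm x < r1" "norm x < r2" by linarith+
 qed
 define Phi where "Phi x = x - (hq n x - delta0 x eps)/cor c" for x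
 have main: "norm (Phi x - cor (a*eps)) <= K*eps^2*w" if x: "x \<in> D" for x
 proof -
 note xD = inD[OF x]
 have x0: "x ~= 0" using xD(1) by auto
 have lnx: "1 + norm (Ln x) <= L*(1 + abs (ln eps))"
 proof -
 have "ln (a/2*eps) <= ln (norm x)" by (rule ln_mono) (use xD(6) a eps x0 in auto)
 moreover have "ln (norm x) <= ln (2*a*eps)" by (rule ln_mono) (use xD(5) a eps x0 in auto)
 moreover have "ln (a/2*eps) = ln (a/2) + ln eps" "ln (2*a*eps) = ln (2*a) + ln eps"
 by (rule ln_mult_pos; use a eps in simp)+
 ultimately have "abs (ln (norm x)) <= abs (ln (a/2)) + abs (ln (2*a)) + abs (ln eps)" by linarith
 then have "1 + norm (Ln x) <= L + abs (ln eps)" using norm_Ln_le_ln[OF x0] by (simp add: L_def)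
 also have "... <= L*(1 + abs (ln eps))" using mult_right_mono[OF L, of "abs (ln eps)"] by (simp add: algebra_simps)
 finally show ?thesis .
 qed
 have px: "norm x^(n - 2) <= (2*a)^(n - 2)*eps^(n - 2)"
 using xD(5) by (metis norm_ge_zero power_mono power_mult_distrib)
 have "norm x^(n - 2)*(1 + norm (Ln x)) <= ((2*a)^(n - 2)*eps^(n - 2))*(L*(1 + abs (ln eps)))"
 using px lnx a eps by (intro mult_mono) auto
 also have "... = (2*a)^(n - 2)*L*(eps^(n - 2)*(1 + abs (ln eps)))" by (simp add: mult_ac)
 finally have "1 + norm x^(n - 2)*(1 + norm (Ln x)) <= 1 + (2*a)^(n - 2)*L*(eps^(n - 2)*(1 + abs (ln eps)))" by simp
 also have "... <= (1 + (2*a)^(n - 2)*L)*w"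
 proof -
 have "0 <= (2*a)^(n - 2)*L" "0 <= eps^(n - 2)*(1 + abs (ln eps))" using a L eps by auto
 then show ?thesis unfolding w_def by (simp add: algebra_simps)
 qed
 finally have 1: "1 + norm x^(n - 2)*(1 + norm (Ln x)) <= (1 + (2*a)^(n - 2)*L)*w" .
 have w1: "1 <= w" using eps by (simp add: w_def)
 have "norm (hq n x - x/of_nat (n - 1)) <= K0*(2*a*eps)^2*((1 + (2*a)^(n - 2)*L)*w)"
 using r2(1) xD(5) 1 by (intro order_trans[OF r2(3)[OF xD(1,4)]] mult_mono power_mono) auto
 moreover have "norm (delta0 x eps - (cor (B*eps) - cor A*x)) <= C*(1 + 2*a)^2*eps^2*w"
 proof -
 have "norm (delta0 x eps - (cor (B*eps) - cor A*x)) <= C*((1 + 2*a)*eps)^2"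
 using C xD(5) eps by (intro order_trans[OF est[OF epsr xD(2)]] mult_left_mono power_mono) (auto simp: algebra_simps)
 also have "... <= C*((1 + 2*a)*eps)^2*w" using mult_left_mono[OF w1, of "C*((1 + 2*a)*eps)^2"] C by simp
 finally show ?thesis by (simp add: power_mult_distrib mult_ac)
 qed
 moreover have "Phi x - cor (a*eps) = ((delta0 x eps - (cor (B*eps) - cor A*x)) - (hq n x - x/of_nat (n - 1)))/cor c"
 proof -
 have cc: "cor c = 1/of_nat (n - 1) + cor A" by (simp add: c_def)
 have "cor c*cor (a*eps) = cor (B*eps)" using c by (simp add: a_def)
 then have "cor c*(Phi x - cor (a*eps)) = (delta0 x eps - (cor (B*eps) - cor A*x)) - (hq n x - x/of_nat (n - 1))"
 proof -
 assume e: "cor c*cor (a*eps) = cor (B*eps)"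
 have "cor c*((hq n x - delta0 x eps)/cor c) = hq n x - delta0 x eps" using c by simp
 then have "cor c*(Phi x - cor (a*eps)) = cor c*x - (hq n x - delta0 x eps) - cor (B*eps)"
 unfolding Phi_def right_diff_distrib e by simp
 then show ?thesis by (simp add: cc algebra_simps)
 qed
 moreover have "cor c ~= 0" using c by simp
 ultimately show ?thesis by (metis nonzero_mult_div_cancel_left)
 qed
 ultimately have "norm (Phi x - cor (a*eps)) <= (C*(1 + 2*a)^2*eps^2*w + K0*(2*a*eps)^2*((1 + (2*a)^(n - 2)*L)*w))/c"
 proof -
 assume 1: "norm (hq n x - x/of_nat (n - 1)) <= K0*(2*a*eps)^2*((1 + (2*a)^(n - 2)*L)*w)"
 and 2: "norm (delta0 x eps - (cor (B*eps) - cor A*x)) <= C*(1 + 2*a)^2*eps^2*w"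
 and 3: "Phi x - cor (a*eps) = ((delta0 x eps - (cor (B*eps) - cor A*x)) - (hq n x - x/of_nat (n - 1)))/cor c"
 show ?thesis unfolding 3 norm_divide norm_of_real abs_of_pos[OF c]
 by (rule divide_right_mono[OF order_trans[OF norm_triangle_ineq4 add_mono[OF 2 1]]]) (use c in simp)
 qed
 also have "... = K*eps^2*w" by (simp add: K_def power_mult_distrib field_simps)
 finally show ?thesis .
 qed
 have cPhi: "continuous_on D Phi"
 unfolding Phi_def[abs_def]
 proof (intro continuous_intros)
 show "continuous_on D (hq n)" by (rule hq_continuous_on[OF n1]) (use inD r1(3) in auto)
 show "continuous_on D (%x. delta0 x eps)" by (rule continuous_on_subset[OF cont[OF epsr]]) (use inD in auto)
 qed (use c in auto)
 have "Phi \<in> D \<rightarrow> D"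
 proof
 fix x assume "x \<in> D"
 then show "Phi x \<in> D" using main[of x] Kw by (simp add: D_def dist_norm norm_minus_commute)
 qed
 then obtain x where x: "x \<in> D" "Phi x = x"
 using brouwer_ball[of "a*eps/2" "cor (a*eps)" Phi] cPhi a eps unfolding D_def by auto
 then have eq: "hq n x = delta0 x eps" using c by (simp add: Phi_def)
 have "Im x < 0"
 proof (rule ccontr)
 assume "\<not> Im x < 0"
 then have "0 < Im (hq n x)" "Im (delta0 x eps) <= 0"
 using r1(4)[of x] sgn[OF epsr inD(2)[OF x(1)]] inD[OF x(1)] by auto
 then show False using eq by simp
 qed
 then show "\<exists>x. 0 < Re x & Im x < 0 & norm x < r & hQ n x ~= 0 & hq n x = delta0 x eps &
 norm (x - cor (a*eps)) <= K*eps^2*(1 + eps^(n - 2)*(1 + abs (ln eps)))"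
 using inD[OF x(1)] r1(3)[of x] eq main[OF x(1)] x(2) by (intro exI[of _ x]) (auto simp: w_def)
 qed
qed

text \<open>The leading equation x (i pi - 2 gamma - Ln x) = B eps - A x reads x (Ln x - c) = -B
  eps. Since exp c = -exp(A - 2 gamma), putting x = exp(W + c) turns it into W exp W = B eps exp(2
  gamma - A). With a correction, x = exp(W + om + c), the exact equation becomes exp(om) (1 + om/W)
  = 1 + v with v = O(eps), a fixed point problem for om in a disc of radius M eps. On branch -1 the
  imaginary part of W is near -pi and cancels Im c = pi, which puts x in the right half
  plane.\<close>

lemma matching_solution_1:
 fixes delta0 :: "complex => real => complex"
 assumes B: "0 < B" and C: "0 <= C" and r: "0 < r"
 and cont: "!!eps. abs eps < r ==> continuous_on (ball 0 r) (%x. delta0 x eps)"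
 and est: "!!x eps. abs eps < r ==> norm x < r ==> norm (delta0 x eps - (cor (B*eps) - cor A*x)) <= C*(abs eps + norm x)^2"
 and sgn: "!!x eps. abs eps < r ==> norm x < r ==> 0 <= Im x ==> Im (delta0 x eps) <= 0"
 defines "c \<equiv> Complex (A - 2*euler_mascheroni) pi"
 and "W0 \<equiv> (%eps. lambert_W (-1) (cor (B*eps*exp (2*euler_mascheroni - A))))"
 obtains K e where "0 < e" "0 <= K" "!!eps. 0 < eps ==> eps < e ==>
 \<exists>om x. norm om <= K*eps & x = exp (W0 eps + om + c) & abs (Im (W0 eps + om + c)) < pi/2 &
 0 < Re x & Im x < 0 & norm x < r & hQ 1 x ~= 0 & hq 1 x = delta0 x eps"
proof -
 obtain r1 where r1: "0 < r1" "r1 <= 1" "!!x. 0 < Re x ==> norm x < r1 ==> hQ 1 x ~= 0 & fact (1 - 1)/2 <= norm (hQ 1 x)"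
 "!!x. 0 < Re x ==> norm x < r1 ==> 0 <= Im x ==> 0 < Im (hq 1 x)"
 by (rule hq_properties[OF order_refl]) blast
 obtain K0 r2 where r2: "0 <= K0" "0 < r2" "!!x. 0 < Re x ==> norm x < r2 ==>
 norm (hq 1 x - x*(\<i>*cor pi - 2*euler_mascheroni - Ln x)) <= K0*(norm x)^2*(1 + norm (Ln x))^2"
 by (rule hq_expansion_1) blast
 define y where "y eps = B*eps*exp (2*euler_mascheroni - A)" for eps
 define D where "D = B*exp (2*euler_mascheroni - A)*exp (1 + norm c)*(3 + norm c)"
 have D: "0 < D" using B by (auto simp: D_def intro!: mult_pos_pos add_pos_nonneg)
 define K1 where "K1 = K0*D^2 + C*(1 + D)^2"
 have K1: "0 <= K1" using r2(1) C by (simp add: K1_def)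
 \<comment> \<open>Ensures |v| <= M eps/4; with |W| > 8 and |Ln(1 + z)| <= 2 |z| this keeps Phi
   inside the disc of radius M eps.\<close>
 define M where "M = 4*K1/B + 1"
 have M: "0 < M" "4*K1/B <= M" using K1 B by (auto simp: M_def add_nonneg_pos)
 obtain y1 where y1: "0 < y1" "!!y. 0 < y ==> y < y1 ==>
 lambert_W (-1) (cor y)*exp (lambert_W (-1) (cor y)) = cor y &
 abs (Im (lambert_W (-1) (cor y)) + pi) < 1/8 & 1/(1/8) < norm (lambert_W (-1) (cor y))"
 by (rule lambert_W_small[of "1/8"]) auto
 define X where "X = B*exp (2*euler_mascheroni - A)"
 have X: "0 < X" using B by (simp add: X_def)
 define e where "e = min (min (y1/X) (min (r/(1 + D)) (min r1 r2/(1 + D)))) (1/(8*M))"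
 have e: "0 < e" unfolding e_def using y1 X r r1 r2 D M by auto
 show thesis
 proof (rule that[OF e, of M])
 show "0 <= M" using M by simp
 fix eps :: real assume eps: "0 < eps" "eps < e"
 have epss: "eps < y1/X" "eps < r/(1 + D)" "eps < min r1 r2/(1 + D)" "eps < 1/(8*M)" using eps by (auto simp: e_def)
 have D1: "0 < 1 + D" using D by simp
 have small: "(1 + D)*eps < r" "(1 + D)*eps < r1" "(1 + D)*eps < r2" "X*eps < y1" "M*eps < 1/8"
 using epss D1 X M by (auto simp: pos_less_divide_eq mult_ac)
 have Deps: "D*eps < r" "D*eps < r1" "D*eps < r2" "eps < r" using small eps D mult_pos_pos[OF D eps(1)] unfolding distrib_right by linarith+
 then have epsr: "abs eps < r" using eps by simp
 have yX: "y eps = X*eps" by (simp add: y_def X_def)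
 have ypos: "0 < y eps" using X eps by (simp add: yX)
 define W where "W = W0 eps"
 have W: "W*exp W = cor (y eps)" "abs (Im W + pi) < 1/8" "8 < norm W"
 using y1(2)[OF ypos] small(4) unfolding yX[symmetric] W_def W0_def y_def by auto
 have Wn: "W ~= 0" using W(3) by auto
 define xx where "xx om = exp (W + om + c)" for om
 define U where "U = cball (0::complex) (M*eps)"
 have Uom: "norm om < 1/8" "norm om <= M*eps" if "om \<in> U" for om using that small(5) by (auto simp: U_def)
 have Imc: "Im c = pi" by (simp add: c_def)
 have im: "abs (Im (W + om + c)) < 1/4" if "om \<in> U" for om
 proof -
 have "Im (W + om + c) = (Im W + pi) + Im om" by (simp add: Imc)
 then show ?thesis using W(2) abs_Im_le_cmod[of om] Uom[OF that] by linarith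
 qed
 have imp: "abs (Im (W + om + c)) < pi/2" if "om \<in> U" for om using im[OF that] pi_gt3 by linarith
 have Lnx: "Ln (xx om) = W + om + c" if "om \<in> U" for om
 proof -
 have "- pi < Im (W + om + c)" "Im (W + om + c) <= pi" using imp[OF that] pi_gt_zero by linarith+
 then show ?thesis unfolding xx_def by (rule Ln_exp)
 qed
 have Rex: "0 < Re (xx om)" if "om \<in> U" for om
 unfolding xx_def Re_exp using imp[OF that] by (intro mult_pos_pos cos_gt_zero_pi exp_gt_zero) linarith+
 have nW: "norm W*exp (Re W) = y eps"
 using arg_cong[OF W(1), of norm] ypos by (simp add: norm_mult norm_exp_eq_Re)
 have b1: "norm (xx om)*norm W <= y eps*exp (1 + norm c)" if "om \<in> U" for om
 proof -
 have "Re om + Re c <= 1 + norm c" using complex_Re_le_cmod[of om] complex_Re_le_cmod[of c] Uom[OF that] by linarith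
 then have "exp (Re om + Re c) <= exp (1 + norm c)" by simp
 then have "(norm W*exp (Re W))*exp (Re om + Re c) <= (norm W*exp (Re W))*exp (1 + norm c)" by (intro mult_left_mono) auto
 moreover have "norm (xx om)*norm W = (norm W*exp (Re W))*exp (Re om + Re c)"
 by (simp add: xx_def norm_exp_eq_Re exp_add norm_mult)
 ultimately show ?thesis unfolding nW by simp
 qed
 \<comment> \<open>Ln x is bounded by a multiple of |W|, and |x| |W| by a multiple of |W exp W| = y,
   so no logarithm is lost: the product is of order eps.\<close>
 have b2: "norm (xx om)*(1 + norm (Ln (xx om))) <= D*eps" if "om \<in> U" for om
 proof -
 have "1 + norm (Ln (xx om)) <= 1 + (norm W + norm om + norm c)"
 unfolding Lnx[OF that] by (intro add_left_mono norm_triangle_le[OF add_right_mono] norm_triangle_ineq)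
 also have "... <= (3 + norm c)*norm W"
 proof -
 have "1 <= norm W" "norm om <= norm W" using W(3) Uom[OF that] by auto
 moreover have "norm c*1 <= norm c*norm W" using W(3) by (intro mult_left_mono) auto
 ultimately show ?thesis by (simp add: algebra_simps)
 qed
 finally have "norm (xx om)*(1 + norm (Ln (xx om))) <= norm (xx om)*((3 + norm c)*norm W)" by (intro mult_left_mono) auto
 also have "... = (norm (xx om)*norm W)*(3 + norm c)" by (simp add: mult_ac)
 also have "... <= (y eps*exp (1 + norm c))*(3 + norm c)" using b1[OF that] by (intro mult_right_mono) auto
 also have "... = D*eps" by (simp add: D_def y_def mult_ac)
 finally show ?thesis .
 qed
 have b3: "norm (xx om) <= D*eps" if "om \<in> U" for om
 proof -
 have "0 <= norm (xx om)*norm (Ln (xx om))" by simp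
 then show ?thesis using b2[OF that] unfolding distrib_left by linarith
 qed
 have nx: "norm (xx om) < r" "norm (xx om) < r1" "norm (xx om) < r2" if "om \<in> U" for om
 using b3[OF that] Deps by auto
 define rho where "rho x = (hq 1 x - x*(\<i>*cor pi - 2*euler_mascheroni - Ln x)) - (delta0 x eps - (cor (B*eps) - cor A*x))" for x
 have rhob: "norm (rho (xx om)) <= K1*eps^2" if u: "om \<in> U" for om
 proof -
 have "norm (hq 1 (xx om) - xx om*(\<i>*cor pi - 2*euler_mascheroni - Ln (xx om))) <= K0*(norm (xx om)*(1 + norm (Ln (xx om))))^2"
 using r2(3)[OF Rex[OF u] nx(3)[OF u]] by (simp add: power_mult_distrib mult_ac)
 also have "... <= K0*(D*eps)^2" using r2(1) b2[OF u] by (intro mult_left_mono power_mono) auto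
 finally have 1: "norm (hq 1 (xx om) - xx om*(\<i>*cor pi - 2*euler_mascheroni - Ln (xx om))) <= K0*(D*eps)^2" .
 have "norm (delta0 (xx om) eps - (cor (B*eps) - cor A*xx om)) <= C*(abs eps + norm (xx om))^2"
 by (rule est[OF epsr nx(1)[OF u]])
 also have "... <= C*((1 + D)*eps)^2" using C b3[OF u] eps by (intro mult_left_mono power_mono) (auto simp: algebra_simps)
 finally have 2: "norm (delta0 (xx om) eps - (cor (B*eps) - cor A*xx om)) <= C*((1 + D)*eps)^2" .
 have "norm (rho (xx om)) <= K0*(D*eps)^2 + C*((1 + D)*eps)^2"
 unfolding rho_def by (rule order_trans[OF norm_triangle_ineq4 add_mono[OF 1 2]])
 moreover have "K1*eps^2 = K0*(D*eps)^2 + C*((1 + D)*eps)^2" by (simp add: K1_def power_mult_distrib distrib_right[of "K0*D^2"] mult.assoc del: distrib_right_numeral)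
 ultimately show ?thesis by simp
 qed
 define v where "v om = - rho (xx om)/cor (B*eps)" for om
 have vb: "norm (v om) <= M*eps/4" "norm (v om) < 1/2" if u: "om \<in> U" for om
 proof -
 have "norm (v om) = norm (rho (xx om))/(B*eps)" using B eps by (simp add: v_def norm_divide norm_mult)
 also have "... <= K1*eps^2/(B*eps)" using rhob[OF u] B eps by (intro divide_right_mono) auto
 also have "... = (4*K1/B)*eps/4" using B eps by (simp add: field_simps power2_eq_square)
 also have "... <= M*eps/4" using M(2) eps by (intro divide_right_mono mult_right_mono) auto
 finally show 1: "norm (v om) <= M*eps/4" .
 then show "norm (v om) < 1/2" using small(5) by linarith
 qed
 have wb: "norm (om/W) <= M*eps/8" "norm (om/W) < 1/2" if u: "om \<in> U" for om
 proof -
 have "norm (om/W) <= M*eps/8" unfolding norm_divide using Uom(2)[OF u] W(3) M eps by (intro frac_le) auto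
 then show "norm (om/W) <= M*eps/8" "norm (om/W) < 1/2" using small(5) by linarith+
 qed
 have Re1: "0 < Re (1 + z)" if "norm z < 1/2" for z :: complex
 using abs_Re_le_cmod[of z] that by (simp add: abs_le_iff)
 define Phi where "Phi om = Ln (1 + v om) - Ln (1 + om/W)" for om
 have "continuous_on U Phi"
 proof -
 have cx: "continuous_on U xx" unfolding xx_def[abs_def] by (intro continuous_intros)
 have cLx: "continuous_on U (%om. Ln (xx om))"
 proof -
 have "continuous_on U (%om. W + om + c)" by (intro continuous_intros)
 then show ?thesis by (simp add: Lnx cong: continuous_on_cong)
 qed
 have "continuous_on (xx ` U) (hq 1)"
 by (rule hq_continuous_on) (use Rex nx r1(3) in auto)
 then have ch: "continuous_on U (%om. hq 1 (xx om))" using continuous_on_compose2[OF _ cx] by blast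
 have cd: "continuous_on U (%om. delta0 (xx om) eps)"
 by (rule continuous_on_compose2[OF cont[OF epsr] cx]) (use nx in auto)
 have cv: "continuous_on U v" unfolding v_def[abs_def] rho_def
 by (intro continuous_intros cx cLx ch cd) (use B eps in auto)
 show ?thesis unfolding Phi_def[abs_def]
 proof (intro continuous_intros cv)
 fix om assume u: "om \<in> U"
 show "1 + v om \<notin> nonpos_Reals" using Re1[OF vb(2)[OF u]] by (auto simp: complex_nonpos_Reals_iff)
 show "1 + om/W \<notin> nonpos_Reals" using Re1[OF wb(2)[OF u]] by (auto simp: complex_nonpos_Reals_iff)
 qed (use Wn in auto)
 qed
 moreover have "Phi \<in> U \<rightarrow> U"
 proof
 fix om assume u: "om \<in> U"
 have "norm (Phi om) <= norm (Ln (1 + v om)) + norm (Ln (1 + om/W))" unfolding Phi_def by (rule norm_triangle_ineq4)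
 also have "... <= 2*norm (v om) + 2*norm (om/W)" by (intro add_mono norm_Ln_le vb(2)[OF u] wb(2)[OF u])
 also have "... <= M*eps" using vb(1)[OF u] wb(1)[OF u] M(1) eps mult_pos_pos[OF M(1) eps(1)] by linarith
 finally show "Phi om \<in> U" by (simp add: U_def)
 qed
 moreover have "0 < M*eps" using M eps by simp
 ultimately obtain om where om: "om \<in> U" "Phi om = om"
 using brouwer_ball[of "M*eps" 0 Phi] unfolding U_def by blast
 define x where "x = xx om"
 have v1: "1 + v om ~= 0" "1 + om/W ~= 0"
 using Re1[OF vb(2)[OF om(1)]] Re1[OF wb(2)[OF om(1)]] by (metis zero_complex.sel(1) less_irrefl)+
 have "exp (om + Ln (1 + om/W)) = exp (Ln (1 + v om))" using om(2) by (simp add: Phi_def algebra_simps)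
 then have ex: "exp om*(1 + om/W) = 1 + v om" using v1 by (simp add: exp_add)
 have ec: "exp c*cor (y eps) = - cor (B*eps)"
 proof -
 have "exp c = - cor (exp (A - 2*euler_mascheroni))"
 unfolding exp_eq_polar[of c] by (simp add: c_def)
 then have "exp c*cor (y eps) = - cor (B*eps*(exp (A - 2*euler_mascheroni)*exp (2*euler_mascheroni - A)))"
 by (simp add: y_def)
 then show ?thesis by (simp flip: exp_add)
 qed
 have "x*(Ln x - c) = exp c*((W*exp W)*(exp om*(1 + om/W)))"
 unfolding x_def Lnx[OF om(1)] using Wn by (simp add: xx_def exp_add field_simps)
 also have "... = (exp c*cor (y eps))*(1 + v om)" unfolding W(1) ex by simp
 also have "... = - cor (B*eps) + rho x" unfolding ec v_def x_def using B eps by (simp add: field_simps)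
 finally have eqx: "x*(Ln x - c) = - cor (B*eps) + rho x" .
 have cc: "c = \<i>*cor pi - 2*euler_mascheroni + cor A"
 proof -
 have "(euler_mascheroni :: complex) = cor euler_mascheroni" by simp
 then show ?thesis unfolding c_def by (simp add: complex_eq_iff del: of_real_euler_mascheroni)
 qed
 have eq: "hq 1 x = delta0 x eps" using eqx unfolding rho_def cc by (simp add: algebra_simps)
 have "Im x < 0"
 proof (rule ccontr)
 assume "\<not> Im x < 0"
 then have "0 < Im (hq 1 x)" "Im (delta0 x eps) <= 0"
 using r1(4)[of x] sgn[OF epsr, of x] Rex[OF om(1)] nx[OF om(1)] by (auto simp: x_def)
 then show False using eq by simp
 qed
 then show "\<exists>om x. norm om <= M*eps & x = exp (W0 eps + om + c) & abs (Im (W0 eps + om + c)) < pi/2 &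
 0 < Re x & Im x < 0 & norm x < r & hQ 1 x ~= 0 & hq 1 x = delta0 x eps"
 using Uom[OF om(1)] imp[OF om(1)] Rex[OF om(1)] nx[OF om(1)] r1(3)[of x] eq
 by (intro exI[of _ om] exI[of _ x]) (auto simp: x_def xx_def W_def)
 qed
qed

section \<open>Wronskian identity and gluing across a radius\<close>

section \<open>Wronskians and gluing\<close>

lemma prim_cong':
 assumes "!!t. 0 < t ==> t <= s ==> f t = g t" "lbm f" "lbm g" shows "prim f s = prim g s"
 by (rule prim_cong) (use assms in "auto dest: lbm_measurable")

lemma reg_cnj:
 assumes "reg n G G1 p"
 shows "reg n (%s. cnj (G s)) (%s. cnj (G1 s)) (%s. cnj (p s))"
 unfolding reg_def
proof (intro conjI allI)
 show "lbm (%s. cnj (p s))" by (rule lbm_cnj[OF regD(1)[OF assms]])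
 fix s
 have e: "(%t. cor t^n*cnj (p t)) = (%t. cnj (cor t^n*p t))" by simp
 show "cnj (G1 s) = prim (%t. cor t^n*cnj (p t)) s/cor s^Suc n"
 unfolding e prim_cnj[OF regD(5)[OF assms]] regD(2)[OF assms, of s] by simp
 show "cnj (G s) = cnj (G 0) + prim (%s. cnj (G1 s)) s"
 unfolding prim_cnj[OF regD(4)[OF assms]] complex_cnj_add[symmetric] by (rule arg_cong[OF regD(3)[OF assms]])
qed

lemma prim_flux_mult:
 assumes r: "reg n H H1 r" and g: "reg n G G1 p"
 shows "prim (%t. cor t^n*r t) s*G s
 = prim (%t. cor t^n*r t*G t + cor t^Suc n*H1 t*G1 t) s"
proof -
 let ?f = "%t. cor t^n*r t"
 note l = regD(5)[OF r] regD(4)[OF g] reg_lbm[OF g] regD(4)[OF r]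
 have split: "f*x = a*f + f*b" if "x = a + b" for f x a b :: complex using that by (simp add: algebra_simps)
 have "prim ?f s*G s = G 0*prim ?f s + prim ?f s*prim G1 s"
 by (rule split[OF regD(3)[OF g]])
 also have "... = prim (%t. G 0 * ?f t + (?f t*prim G1 t + prim ?f t*G1 t)) s"
 unfolding prim_mult[OF l(1,2)]
 by (subst prim_add) (auto simp: prim_cmult intro!: lbm_add lbm_mult lbm_cmult lbm_prim l)
 also have "... = prim (%t. cor t^n*r t*G t + cor t^Suc n*H1 t*G1 t) s"
 proof (rule prim_cong')
 fix t :: real assume t: "0 < t"
 have "G 0 * ?f t + ?f t*prim G1 t = ?f t*G t" by (rule split[OF regD(3)[OF g], symmetric])
 then show "G 0 * ?f t + (?f t*prim G1 t + prim ?f t*G1 t) = cor t^n*r t*G t + cor t^Suc n*H1 t*G1 t"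
 using reg_flux[OF r t] by (simp only: add.assoc[symmetric])
 qed (intro lbm_add lbm_mult lbm_cmult lbm_prim lbm_of_real_power l regD(1)[OF r])+
 finally show ?thesis .
qed

text \<open>Subtracting the two integrations by parts of \<open>prim_flux_mult\<close> cancels the
  symmetric gradient term. The flux vanishes at the origin, so only the boundary term at s
  remains.\<close>

lemma reg_wronskian:
 assumes r: "reg n H H1 r" and g: "reg n G G1 p" and s: "0 < s"
 shows "cor s^Suc n*(H1 s*G s - H s*G1 s) = prim (%t. cor t^n*(r t*G t - p t*H t)) s"
proof -
 note l = regD(1)[OF r] regD(1)[OF g] reg_lbm[OF g] reg_lbm[OF r] regD(4)[OF r] regD(4)[OF g]
 have "cor s^Suc n*(H1 s*G s - H s*G1 s)
 = prim (%t. cor t^n*r t) s*G s - prim (%t. cor t^n*p t) s*H s"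
 unfolding reg_flux[OF r s, symmetric] reg_flux[OF g s, symmetric] by (simp add: algebra_simps)
 also have "... = prim (%t. (cor t^n*r t*G t + cor t^Suc n*H1 t*G1 t)
 - (cor t^n*p t*H t + cor t^Suc n*G1 t*H1 t)) s"
 unfolding prim_flux_mult[OF r g] prim_flux_mult[OF g r]
 by (rule prim_minus[symmetric]) (intro lbm_add lbm_mult lbm_of_real_power l)+
 also have "(%t. (cor t^n*r t*G t + cor t^Suc n*H1 t*G1 t)
 - (cor t^n*p t*H t + cor t^Suc n*G1 t*H1 t)) = (%t. cor t^n*(r t*G t - p t*H t))"
 by (simp add: fun_eq_iff algebra_simps)
 finally show ?thesis .
qed

lemma reg_flux_derivative:
 assumes r: "reg n G G1 p" and s: "0 < s" and p: "isCont p s"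
 shows "((%s. cor s^Suc n*G1 s) has_vector_derivative cor s^n*p s) (at s)"
proof -
 have "(prim (%t. cor t^n*p t) has_vector_derivative cor s^n*p s) (at s)"
 by (rule prim_has_vector_derivative[OF regD(5)[OF r] s]) (intro continuous_intros p)
 then show ?thesis
 proof (rule has_vector_derivative_transform_within_open[of _ _ _ "{0<..}"])
 show "prim (%t. cor t^n*p t) u = cor u^Suc n*G1 u" if "u \<in> {0<..}" for u
 using reg_flux[OF r, of u] that by simp
 qed (use s in auto)
qed

lemma prim_glue:
 assumes f: "lbm f" and g: "lbm (%t. if t <= s0 then f t else g t)" and s0: "0 < s0"
 and K: "continuous_on {s0..} K" "!!t. s0 < t ==> (K has_vector_derivative g t) (at t)" "K s0 = prim f s0"
 shows "prim (%t. if t <= s0 then f t else g t) s = (if s <= s0 then prim f s else K s)"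
proof (cases "s <= s0")
 case True
 have "prim (%t. if t <= s0 then f t else g t) s = prim f s" by (rule prim_cong'[OF _ g f]) (use True in simp)
 then show ?thesis using True by simp
next
 case False
 let ?h = "%t. if t <= s0 then f t else g t"
 have "prim ?h s = integral {0..s} ?h" by (rule prim_eq_integral[OF g])
 also have "... = integral {0..s0} ?h + integral {s0..s} ?h"
 by (rule Henstock_Kurzweil_Integration.integral_combine[symmetric]) (use False s0 lbm_integrable_on[OF g] in auto)
 also have "integral {0..s0} ?h = prim f s0"
 proof -
 have "prim ?h s0 = prim f s0" by (rule prim_cong'[OF _ g f]) simp
 then show ?thesis by (simp only: prim_eq_integral[OF g])
 qed
 also have "integral {s0..s} ?h = K s - K s0"
 proof (rule integral_unique, rule fundamental_theorem_of_calculus_interior)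
 show "continuous_on {s0..s} K" by (rule continuous_on_subset[OF K(1)]) auto
 qed (use False K(2) in auto)
 finally show ?thesis using False K(3) by simp
qed

lemma lbm_glue:
 assumes "lbm f" "0 < s0" "continuous_on {s0..} g"
 shows "lbm (%t. if t <= s0 then f t else g t)"
proof -
 have "continuous_on UNIV (%t. g (max s0 t))"
 by (rule continuous_on_compose2[OF assms(3)]) (auto intro!: continuous_intros)
 then have l: "lbm (%t. g (max s0 t))" by (rule lbm_continuous)
 show ?thesis
 proof (rule lbmI)
 have "(%t. if t <= s0 then f t else g (max s0 t)) \<in> borel_measurable borel"
 using lbm_measurable[OF assms(1)] lbm_measurable[OF l] by measurable
 moreover have "(%t. if t <= s0 then f t else g (max s0 t)) = (%t. if t <= s0 then f t else g t)" by auto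
 ultimately show "(%t. if t <= s0 then f t else g t) \<in> borel_measurable borel" by simp
 fix M
 obtain C where C: "0 <= C" "!!s. 0 <= s ==> s <= M ==> norm (f s) <= C" using lbm_bound[OF assms(1)] by blast
 obtain D where D: "0 <= D" "!!s. 0 <= s ==> s <= M ==> norm (g (max s0 s)) <= D" using lbm_bound[OF l] by blast
 have "norm (if s <= s0 then f s else g s) <= C + D" if "s \<in> {0..M}" for s
 using C(1) D(1) C(2)[of s] D(2)[of s] that by (cases "s <= s0") auto
 then show "\<exists>C. \<forall>s\<in>{0..M}. norm (if s <= s0 then f s else g s) <= C" by blast
 qed
qed

text \<open>Equality of value and derivative at s0 makes both G and the flux continuous there, so
  the two integral identities that define \<open>reg\<close> continue past s0 by the fundamental
  theorem of calculus.\<close>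

lemma reg_glue:
 assumes r: "reg n G G1 p" and s0: "0 < s0"
 and c: "continuous_on {s0..} H1" "continuous_on {s0..} H" "continuous_on {s0..} k"
 and d: "!!s. s0 < s ==> (H has_vector_derivative H1 s) (at s)"
 "!!s. s0 < s ==> ((%s. cor s^Suc n*H1 s) has_vector_derivative cor s^n * k s) (at s)"
 and m: "H s0 = G s0" "H1 s0 = G1 s0"
 shows "reg n (%s. if s <= s0 then G s else H s) (%s. if s <= s0 then G1 s else H1 s) (%s. if s <= s0 then p s else k s)"
 unfolding reg_def
proof (intro conjI allI)
 show lp: "lbm (%s. if s <= s0 then p s else k s)" by (rule lbm_glue[OF regD(1)[OF r] s0 c(3)])
 have l1: "lbm (%s. if s <= s0 then G1 s else H1 s)" by (rule lbm_glue[OF regD(4)[OF r] s0 c(1)])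
 fix s
 have e: "(%t. cor t^n*(if t <= s0 then p t else k t)) = (%t. if t <= s0 then cor t^n*p t else cor t^n * k t)"
 by auto
 have "prim (%t. cor t^n*(if t <= s0 then p t else k t)) s
 = (if s <= s0 then prim (%t. cor t^n*p t) s else cor s^Suc n*H1 s)"
 unfolding e
 proof (rule prim_glue[OF regD(5)[OF r] _ s0])
 show "lbm (%t. if t <= s0 then cor t^n*p t else cor t^n * k t)"
 unfolding e[symmetric] by (intro lbm_mult lbm_of_real_power lp)
 show "continuous_on {s0..} (%s. cor s^Suc n*H1 s)" by (intro continuous_intros c)
 show "cor s0^Suc n*H1 s0 = prim (%t. cor t^n*p t) s0" unfolding m by (rule reg_flux[OF r s0])
 qed (rule d)
 then show "(if s <= s0 then G1 s else H1 s) = prim (%t. cor t^n*(if t <= s0 then p t else k t)) s/cor s^Suc n"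
 using s0 regD(2)[OF r, of s] by simp
 have "prim (%s. if s <= s0 then G1 s else H1 s) s = (if s <= s0 then prim G1 s else H s - G 0)"
 proof (rule prim_glue[OF regD(4)[OF r] l1 s0])
 show "continuous_on {s0..} (%s. H s - G 0)" by (intro continuous_intros c)
 show "((%s. H s - G 0) has_vector_derivative H1 t) (at t)" if "s0 < t" for t
 using d(1)[OF that] by (auto intro!: derivative_eq_intros)
 show "H s0 - G 0 = prim G1 s0" using m(1) regD(3)[OF r, of s0] by simp
 qed
 then show "(if s <= s0 then G s else H s) = (if 0 <= s0 then G 0 else H 0) + prim (%s. if s <= s0 then G1 s else H1 s) s"
 using s0 regD(3)[OF r, of s] by auto
qed

text \<open>For a real coefficient the conjugate solves the same equation with the same value at 0;
  the average of the two is a real solution.\<close>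

lemma volterra_real_exists:
 assumes P: "lbm P" "!!s. norm (P s) <= B" "!!s. Im (P s) = 0"
 obtains G G1 where "reg n G G1 (%s. P s*G s)" "G 0 = 1" "!!s. Im (G s) = 0" "!!s. Im (G1 s) = 0"
proof -
 obtain H H1 where H: "reg n H H1 (%s. P s*H s + 0)" "H 0 = 1"
 by (rule volterra_exists[OF P(1) lbm_const[of 0] P(2), where D=0 and n=n and c=1]) simp_all
 have c: "cnj (P s) = P s" for s using P(3) by (simp add: complex_eq_iff)
 have H': "reg n H H1 (%s. P s*H s)" using H(1) by simp
 have "reg n (%s. 1/2*(H s + cnj (H s))) (%s. 1/2*(H1 s + cnj (H1 s))) (%s. 1/2*(P s*H s + cnj (P s*H s)))"
 by (intro reg_cmult reg_add reg_cnj H')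
 moreover have "(%s. 1/2*(P s*H s + cnj (P s*H s))) = (%s. P s*(1/2*(H s + cnj (H s))))"
 by (simp add: c fun_eq_iff algebra_simps)
 ultimately have "reg n (%s. 1/2*(H s + cnj (H s))) (%s. 1/2*(H1 s + cnj (H1 s))) (%s. P s*(1/2*(H s + cnj (H s))))"
 by simp
 then show thesis by (rule that) (use H(2) in auto)
qed

section \<open>Square integrability forces decay at the threshold\<close>

section \<open>Eigenfunctions and regular solutions\<close>

text \<open>A Fredholm alternative in radial form. Solve the equation with source C and y(0) = 0.
  The Wronskian of y and G at b is a multiple of the integral of t^n C G, which is zero, so the data
  of y at b are \<open>be\<close> times those of G. Then y - be G extends by 0 beyond b and is an
  admissible test function, on which the operator gives -4 zeta^n C. In effect psi pairs with radial
  tests as a multiple of G does.\<close>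

lemma kernel_orthogonal:
 assumes psi: "psi \<in> L2_loc" and V: "V \<in> Linf" "AE x in lebesgue. V x = q (sq x)" and sol: "schroedinger_solution V z psi"
 and q: "q \<in> borel_measurable borel" "!!s. abs (q s) <= M0"
 and G: "reg n G G1 (%s. (cor (q s) - z)/4*G s)" "G 0 ~= 0"
 and sig: "sig^2 = 1" and C: "smooth1 C" "!!s. s <= 0 \<or> b <= s ==> C s = 0" and b: "0 < b"
 and orth: "prim (%t. cor t^n*(C t*G t)) b = 0"
 shows "(LINT x|lebesgue. psi x*(zeta sig x^n*C (sq x))) = 0"
proof -
 let ?P = "%s. (cor (q s) - z)/4"
 have Pb: "norm (?P s) <= M0 + norm z" for s
 proof -
 have "norm (?P s) <= norm (cor (q s) - z)" by (simp add: norm_divide)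
 also have "... <= M0 + norm z" using q(2)[of s] by (intro norm_triangle_le_diff) simp
 finally show ?thesis .
 qed
 have lP: "lbm ?P"
 by (rule lbmI) (use q(1) Pb in \<open>auto intro!: exI[of _ "M0 + norm z"]\<close>)
 have lC: "lbm C" by (intro lbm_continuous smooth1_continuous_on C)
 obtain D where D: "0 <= D" "!!s. 0 <= s ==> s <= b ==> norm (C s) <= D" using lbm_bound[OF lC] by blast
 have Db: "norm (C s) <= D" for s using D C(2)[of s] by (cases "s <= 0 \<or> b <= s") auto
 obtain y y1 where y: "reg n y y1 (%s. ?P s*y s + C s)" "y 0 = 0"
 by (rule volterra_exists[OF lP lC Pb Db]) blast
 have "cor b^Suc n*(y1 b*G b - y b*G1 b) = prim (%t. cor t^n*((?P t*y t + C t)*G t - ?P t*G t*y t)) b"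
 by (rule reg_wronskian[OF y(1) G(1) b])
 also have "(%t. cor t^n*((?P t*y t + C t)*G t - ?P t*G t*y t)) = (%t. cor t^n*(C t*G t))"
 by (simp add: algebra_simps)
 also note orth
 finally have w: "y1 b*G b = y b*G1 b" using b by simp
 \<comment> \<open>G and G1 do not both vanish at b, by backward uniqueness.\<close>
 obtain be where be: "y b = be*G b" "y1 b = be*G1 b"
 proof (cases "G b = 0")
 case True
 then have "G1 b ~= 0" using volterra_backward_unique[OF G(1) lP b] G(2) by blast
 then show thesis using that[of "y1 b/G1 b"] w True by simp
 next
 case False
 then show thesis using that[of "y b/G b"] w by (simp add: field_simps)
 qed
 define v where "v s = y s + (- be)*G s" for s
 define v1 where "v1 s = y1 s + (- be)*G1 s" for s
 define p where "p s = (?P s*y s + C s) + (- be)*(?P s*G s)" for s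
 have v: "reg n v v1 p" unfolding v_def[abs_def] v1_def[abs_def] p_def[abs_def] by (intro reg_add reg_cmult y G)
 have pv: "p s = ?P s * v s + C s" for s  proof -
 have "(P*y + C) + (- be)*(P*G) = P*(y + (- be)*G) + C" for P y C G :: complex by (simp add: algebra_simps)
 then show ?thesis unfolding p_def v_def .
 qed
 have r: "reg n (%s. if s <= b then v s else 0) (%s. if s <= b then v1 s else 0) (%s. if s <= b then p s else 0)"
 by (rule reg_glue[OF v b, where H="%_. 0" and ?H1.0="%_. 0" and k="%_. 0"])
 (use be in "auto simp: v_def v1_def intro!: continuous_intros")
 have psim: "psi \<in> borel_measurable lebesgue" using psi by (simp add: L2_loc_def)
 have Vm: "V \<in> borel_measurable lebesgue" using V(1) by (simp add: Linf_def)
 have Vc: "(%x. cor (V x) - z) \<in> borel_measurable lebesgue" using Vm by measurable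
 have zm: "(%x. zeta sig x^n) \<in> borel_measurable lebesgue" by (intro smooth2_measurable smooth2_power smooth2_zeta)
 note m = comp_sq_measurable[OF lbm_measurable]
 have "0 = (LINT x|lebesgue. psi x*(zeta sig x^n*((cor (V x) - z)*(if sq x <= b then v (sq x) else 0) - 4*(if sq x <= b then p (sq x) else 0))))"
 by (rule weak_solution_test_reg[OF psi V(1) sol r sig b, symmetric]) simp
 also have "... = (LINT x|lebesgue. (- 4)*(psi x*(zeta sig x^n*C (sq x))))"
 proof (rule integral_cong_AE)
 show "(%x. psi x*(zeta sig x^n*((cor (V x) - z)*(if sq x <= b then v (sq x) else 0) - 4*(if sq x <= b then p (sq x) else 0)))) \<in> borel_measurable lebesgue"
 by (intro borel_measurable_times borel_measurable_diff psim zm Vc borel_measurable_const m[OF reg_lbm[OF r]] m[OF regD(1)[OF r]])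
 show "(%x. (- 4)*(psi x*(zeta sig x^n*C (sq x)))) \<in> borel_measurable lebesgue"
 by (intro borel_measurable_times psim zm m[OF lC] borel_measurable_const)
 show "AE x in lebesgue. psi x*(zeta sig x^n*((cor (V x) - z)*(if sq x <= b then v (sq x) else 0) - 4*(if sq x <= b then p (sq x) else 0)))
 = (- 4)*(psi x*(zeta sig x^n*C (sq x)))"
 using V(2)
 proof eventually_elim
 case (elim x)
 have "4*p (sq x) = (cor (q (sq x)) - z) * v (sq x) + 4*C (sq x)" by (simp add: pv)
 then show ?case using elim C(2)[of "sq x"] by simp
 qed
 qed
 also have "... = (- 4)*(LINT x|lebesgue. psi x*(zeta sig x^n*C (sq x)))" by (rule integral_mult_right_zero)
 finally show ?thesis by simp
qed

text \<open>U = s^n (s g' + n g) g has derivative k s^n g^2 + s^(n-1) (s g' + n g)^2 >= 0, so U >= c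
  = U(s2) > 0 from s2 on. As s^(2n) g^2 has derivative 2 s^(n-1) U, it is at least (2c/n) (s^n -
  s2^n), and for s >= 2 s2 the bracket is at least s^n/2.\<close>

lemma growth_of_regular_solution:
 fixes g g1 F :: "real => real"
 assumes n: "1 <= n" and k: "0 <= k" and s1: "0 < s1"
 and d: "!!s. s1 < s ==> (g has_real_derivative g1 s) (at s)"
 "!!s. s1 < s ==> ((%s. s^Suc n*g1 s) has_real_derivative k * s^n*g s) (at s)"
 and s2: "s1 < s2" "0 < (s2*g1 s2 + real n*g s2)*g s2"
 obtains c where "0 < c" "!!s. 2 * s2 <= s ==> c <= s^n*(g s)^2"
proof -
 define U where "U s = s^Suc n*g1 s*g s + real n * s^n*(g s)^2" for s
 have pn: "s^n = s * s^(n - 1)" for s :: real using n by (metis One_nat_def Suc_le_D diff_Suc_1 power_Suc)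
 have Ud: "(U has_real_derivative k * s^n*(g s)^2 + s^(n - 1)*(s*g1 s + real n*g s)^2) (at s)" if s: "s1 < s" for s
 proof -
 have "(U has_real_derivative (k * s^n*g s)*g s + g1 s*(s^Suc n*g1 s)
 + ((real n*(real n * s^(n - 1)))*(g s)^2 + (2*g s*g1 s)*(real n * s^n))) (at s)"
 unfolding U_def[abs_def]
 by (intro DERIV_add DERIV_mult d s) (auto intro!: derivative_eq_intros d s simp: power2_eq_square)
 then show ?thesis by (rule DERIV_cong) (simp add: pn power2_eq_square algebra_simps)
 qed
 define c where "c = U s2"
 have c: "0 < c"
 proof -
 have "U s2 = s2^n*((s2*g1 s2 + real n*g s2)*g s2)" by (simp add: U_def power2_eq_square algebra_simps)
 then show ?thesis using s1 s2 by (simp add: c_def)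
 qed
 have Uc: "c <= U s" if "s2 <= s" for s
 unfolding c_def
 proof (rule DERIV_nonneg_imp_nondecreasing[OF that])
 fix t assume t: "s2 <= t" "t <= s"
 have "0 <= k*t^n*(g t)^2 + t^(n - 1)*(t*g1 t + real n*g t)^2" using k t s1 s2 by (intro add_nonneg_nonneg mult_nonneg_nonneg) auto
 then show "\<exists>y. (U has_real_derivative y) (at t) & 0 <= y" using Ud[of t] t s2 by auto
 qed
 have Y: "s2^n * s2^n*(g s2)^2 - 2*c/n * s2^n <= s^n * s^n*(g s)^2 - 2*c/n * s^n" if s: "s2 <= s" for s
 proof (rule DERIV_nonneg_imp_nondecreasing[OF s, of "%s. s^n * s^n*(g s)^2 - 2*c/n * s^n"])
 fix t assume t: "s2 <= t" "t <= s"
 have t1: "s1 < t" "0 < t" using t s1 s2 by auto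
 have "((%s. s^n * s^n*(g s)^2 - 2*c/n * s^n) has_real_derivative
 ((real n*t^(n - 1)*t^n + real n*t^(n - 1)*t^n)*(g t)^2 + 2*g t*g1 t*(t^n*t^n)) - 2*c/n*(real n*t^(n - 1))) (at t)"
 by (auto intro!: derivative_eq_intros d t1)
 then have "((%s. s^n * s^n*(g s)^2 - 2*c/n * s^n) has_real_derivative 2*t^(n - 1)*(U t - c)) (at t)"
 proof (rule DERIV_cong)
 show "((real n*t^(n - 1)*t^n + real n*t^(n - 1)*t^n)*(g t)^2 + 2*g t*g1 t*(t^n*t^n)) - 2*c/n*(real n*t^(n - 1))
 = 2*t^(n - 1)*(U t - c)"
 using n by (simp add: U_def pn power2_eq_square) (simp add: algebra_simps)
 qed
 moreover have "0 <= 2*t^(n - 1)*(U t - c)" using Uc[of t] t t1 by simp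
 ultimately show "\<exists>y. ((%s. s^n * s^n*(g s)^2 - 2*c/n * s^n) has_real_derivative y) (at t) & 0 <= y" by blast
 qed
 show thesis
 proof (rule that[of "c/n"])
 show "0 < c/n" using c n by simp
 fix s assume s: "2 * s2 <= s"
 have sp: "0 < s" "s2 <= s" "0 < s2" using s s1 s2 by auto
 have "s2^n <= (s/2)^n" using s sp by (intro power_mono) auto
 also have "... = s^n*(1/2)^n" by (simp add: power_divide)
 also have "... <= s^n*(1/2)" using sp n power_decreasing[of 1 n "1/2::real"] by (intro mult_left_mono) auto
 finally have h: "s2^n <= s^n/2" by simp
 have "0 <= s2^n * s2^n*(g s2)^2" using sp by simp
 then have "2*c/n*(s^n - s2^n) <= s^n*(s^n*(g s)^2)"
 using Y[OF sp(2)] unfolding right_diff_distrib mult.assoc[of "s^n"] by linarith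
 moreover have "2*c/n*(s^n/2) <= 2*c/n*(s^n - s2^n)" using h c by (intro mult_left_mono) auto
 moreover have "s^n*(c/n) = 2*c/n*(s^n/2)" by simp
 ultimately have "s^n*(c/n) <= s^n*(s^n*(g s)^2)" by linarith
 then show "c/n <= s^n*(g s)^2" by (rule mult_left_le_imp_le) (use sp in simp)
 qed
qed

lemma prim_eq_of_support:
 assumes f: "lbm f" and z: "!!t. b <= t ==> f t = 0" and b: "0 <= b" "b <= s"
 shows "prim f s = prim f b"
proof -
 have "norm (prim f s - prim f b) <= 0*(s - b)" by (rule prim_diff_bound[OF f b]) (use z in auto)
 then show ?thesis by simp
qed

lemma L2_imp_L2_loc: "psi \<in> L2 ==> psi \<in> L2_loc"
proof -
 assume a: "psi \<in> L2"
 then have "integrable lebesgue (%x. (norm (psi x))^2)" by (simp add: L2_def)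
 then have "set_integrable lebesgue (cball 0 R) (%x. (norm (psi x))^2)" for R
 unfolding set_integrable_def by (intro integrable_mult_indicator) auto
 then show ?thesis using a by (simp add: L2_def L2_loc_def)
qed

lemma ring_test_integrable:
 assumes psi: "psi \<in> L2_loc" and sig: "sig^2 = 1" and C: "smooth1 C" "!!s. s <= 0 \<or> b <= s ==> C s = 0" and b: "0 < b"
 shows "integrable lebesgue (%x. psi x*(zeta sig x^n*C (sq x)))"
proof -
 have lC: "lbm C" by (intro lbm_continuous smooth1_continuous_on C)
 obtain D where D: "0 <= D" "!!s. 0 <= s ==> s <= b ==> norm (C s) <= D" using lbm_bound[OF lC] by blast
 show ?thesis
 proof (rule L2_loc_mult_integrable[OF psi])
 show "(%x. zeta sig x^n*C (sq x)) \<in> borel_measurable lebesgue"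
 by (intro smooth2_measurable smooth2_mult smooth2_power smooth2_zeta smooth2_comp_sq C)
 show "AE x in lebesgue. norm (zeta sig x^n*C (sq x)) <= sqrt b^n*D"
 proof (rule AE_I2)
 fix x show "norm (zeta sig x^n*C (sq x)) <= sqrt b^n*D"
 proof (cases "sq x <= b")
 case True
 then show ?thesis unfolding norm_mult
 using norm_zeta_power_le[OF sig True] D sq_nonneg[of x] b by (intro mult_mono zero_le_power) auto
 next
 case False
 then show ?thesis using C(2)[of "sq x"] D b by simp
 qed
 qed
 show "zeta sig x^n*C (sq x) = 0" if "b < sq x" for x using C(2)[of "sq x"] that by simp
 qed
qed

text \<open>If the sign failed, s^n g^2 would be bounded below. For a bump C on M < |x|^2 < 4M the
  pairing X of psi with zeta^n C is at most a constant times M^((n+1)/2), because psi has norm 1,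
  while the pairing T of g with t^n C is at least a constant times M^(n/2+1). The two pairings are
  proportional by \<open>kernel_orthogonal\<close>, which is impossible for large M.\<close>

lemma eigenfunction_no_growth:
 assumes psi: "psi \<in> L2" "L2_norm psi = 1" and V: "V \<in> Linf" "AE x in lebesgue. V x = q (sq x)"
 and sol: "schroedinger_solution V (cor E) psi" and ang: "has_angular_momentum l psi"
 and E: "E <= 0" and n: "n = nat (abs l)" "1 <= n"
 and q: "q \<in> borel_measurable borel" "!!s. abs (q s) <= M0" "!!s. s1 <= s ==> q s = 0" and s1: "0 < s1"
 and G: "reg n G G1 (%s. (cor (q s) - cor E)/4*G s)" "G 0 = 1"
 and re: "!!s. Im (G s) = 0" "!!s. Im (G1 s) = 0"
 and s2: "s1 < s2"
 shows "(s2*Re (G1 s2) + real n*Re (G s2))*Re (G s2) <= 0"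
proof (rule ccontr)
 assume "\<not> ?thesis"
 then have pos: "0 < (s2*Re (G1 s2) + real n*Re (G s2))*Re (G s2)" by simp
 have s2p: "0 < s2" using s1 s2 by simp
 define sig where "sig = (if 0 <= l then -1 else 1 :: real)"
 have sig: "sig^2 = 1" by (simp add: sig_def)
 have psil: "psi \<in> L2_loc" by (rule L2_imp_L2_loc[OF psi(1)])
 define k where "k = - E/4"
 have k: "0 <= k" using E by (simp add: k_def)
 have d1: "((%s. Re (G s)) has_real_derivative Re (G1 s)) (at s)"
 and d2: "((%s. s^Suc n*Re (G1 s)) has_real_derivative k * s^n*Re (G s)) (at s)" if s: "s1 < s" for s
 proof -
 have s0: "0 < s" using s s1 by simp
 show "((%s. Re (G s)) has_real_derivative Re (G1 s)) (at s)"
 using bounded_linear.has_vector_derivative[OF bounded_linear_Re reg_derivative[OF G(1) s0]]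
 by (simp add: has_real_derivative_iff_has_vector_derivative)
 have "isCont (%s. cor k*G s) s"
 using reg_continuous[OF G(1), of UNIV] by (intro continuous_intros) (auto simp: continuous_on_eq_continuous_at)
 moreover have "\<forall>\<^sub>F t in nhds s. cor k*G t = (cor (q t) - cor E)/4*G t"
 using eventually_nhds_in_open[of "{s1<..}" s] s by (auto elim!: eventually_mono simp: q(3) k_def)
 ultimately have "isCont (%s. (cor (q s) - cor E)/4*G s) s" by (rule iffD1[OF isCont_cong, rotated])
 from bounded_linear.has_vector_derivative[OF bounded_linear_Re reg_flux_derivative[OF G(1) s0 this]]
 have "((%s. Re (cor s^Suc n*G1 s)) has_real_derivative Re (cor s^n*((cor (q s) - cor E)/4*G s))) (at s)"
 by (simp only: has_real_derivative_iff_has_vector_derivative)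
 moreover have "Re (cor s^Suc n*G1 s) = s^Suc n*Re (G1 s)" for s
 proof -
 have "cor s^Suc n*G1 s = cor (s^Suc n)*G1 s" by simp
 then show ?thesis by (simp del: of_real_mult of_real_power power_Suc)
 qed
 moreover have "Re (cor s^n*((cor (q s) - cor E)/4*G s)) = k * s^n*Re (G s)" (is "Re ?x = _")
 proof -
 have "cor s^n*((cor (q s) - cor E)/4*G s) = cor (k * s^n)*G s"
 using s by (simp add: q(3) k_def)
 then have "Re ?x = Re (cor (k * s^n)*G s)" by (rule arg_cong)
 then show ?thesis by (simp del: of_real_mult of_real_power)
 qed
 ultimately show "((%s. s^Suc n*Re (G1 s)) has_real_derivative k * s^n*Re (G s)) (at s)" by (simp only:)
 qed
 obtain c0 where c0: "0 < c0" "!!s. 2 * s2 <= s ==> c0 <= s^n*(Re (G s))^2"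
 by (rule growth_of_regular_solution[where g="%s. Re (G s)" and ?g1.0="%s. Re (G1 s)", OF n(2) k s1 d1 d2 s2 pos]) auto
 define X where "X C = (LINT x|lebesgue. psi x*(zeta sig x^n*C (sq x)))" for C
 define T where "T C = prim (%t. cor t^n*(C t*G t))" for C :: "real => complex"
 have "\<exists>b C. 0 < b & smooth1 C & (\<forall>s. s <= 0 \<or> b <= s --> C s = 0) & X C ~= 0"
 proof (rule ccontr)
 assume no: "\<not> ?thesis"
 have "AE x in lebesgue. 0 < sq x & sq x < real (Suc j) --> psi x = 0" for j
 proof (rule angular_momentum_AE_eq_0[OF psil ang])
 fix C :: "real => complex" assume "smooth1 C" "!!s. s <= 0 \<or> real (Suc j) <= s ==> C s = 0"
 then have "X C = 0" using no by (metis of_nat_0_less_iff zero_less_Suc)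
 then show "(LINT x|lebesgue. psi x*(zeta (if 0 <= l then -1 else 1) x^nat (abs l)*C (sq x))) = 0"
 unfolding X_def sig_def n(1) .
 qed simp
 then have "AE x in lebesgue. \<forall>j. 0 < sq x & sq x < real (Suc j) --> psi x = 0" by (simp only: AE_all_countable) simp
 then have "AE x in lebesgue. psi x = 0" using AE_sq_pos
 proof eventually_elim
 case (elim x)
 obtain j where "sq x < real j" using reals_Archimedean2 by blast
 then have "sq x < real (Suc j)" by simp
 then show ?case using elim by blast
 qed
 then have "(LINT x|lebesgue. (norm (psi x))^2) = 0" by (intro integral_eq_zero_AE) (auto elim!: eventually_mono)
 then show False using psi(2) by (simp add: L2_norm_def)
 qed
 then obtain b C1 where b: "0 < b" and C1: "smooth1 C1" "!!s. s <= 0 \<or> b <= s ==> C1 s = 0" "X C1 ~= 0" by blast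
 have lC: "lbm (%t. cor t^n*(C t*G t))" if "smooth1 C" for C
 by (intro lbm_mult lbm_of_real_power reg_lbm[OF G(1)] lbm_continuous smooth1_continuous_on that)
 \<comment> \<open>D is the combination of C and C1 whose pairing with G vanishes, so its pairing
   with psi vanishes too.\<close>
 have lin: "T C1 b*X C = T C B*X C1" if C: "smooth1 C" "!!s. s <= 0 \<or> B <= s ==> C s = 0" and B: "b <= B" for C B
 proof -
 have T1: "T C1 B = T C1 b" unfolding T_def by (rule prim_eq_of_support[OF lC[OF C1(1)]]) (use C1(2) b B in auto)
 define D where "D s = T C1 b*C s + (- T C B)*C1 s" for s
 have D: "D s = 0" if "s <= 0 \<or> B <= s" for s
 unfolding D_def using C(2)[of s] C1(2)[of s] B that by auto
 have sD: "smooth1 D" unfolding D_def[abs_def] by (intro smooth1_add smooth1_mult smooth1_const C C1)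
 have "T D B = prim (%t. T C1 b*(cor t^n*(C t*G t)) + (- T C B)*(cor t^n*(C1 t*G t))) B"
 unfolding T_def D_def by (simp add: algebra_simps)
 also have "... = T C1 b*T C B + (- T C B)*T C1 B"
 unfolding T_def by (subst prim_add) (intro lbm_cmult lC C C1 | simp only: prim_cmult)+
 finally have "T D B = 0" using T1 by simp
 then have "X D = 0" unfolding X_def T_def
 by (intro kernel_orthogonal[OF psil V sol q(1,2) G(1) _ sig sD D]) (use G(2) b B in auto)
 moreover have "X D = T C1 b*X C + (- T C B)*X C1"
 proof -
 have "X D = (LINT x|lebesgue. T C1 b*(psi x*(zeta sig x^n*C (sq x))) + (- T C B)*(psi x*(zeta sig x^n*C1 (sq x))))"
 unfolding X_def D_def by (simp add: algebra_simps)
 also have "... = T C1 b*X C + (- T C B)*X C1"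
 unfolding X_def
 by (subst Bochner_Integration.integral_add)
 (use b B in "auto intro!: integrable_mult_right ring_test_integrable[OF psil sig C] ring_test_integrable[OF psil sig C1(1,2) b]")
 finally show ?thesis .
 qed
 ultimately show ?thesis by simp
 qed
 define a where "a = norm (X C1)"
 define d where "d = norm (T C1 b)"
 have a: "0 < a" using C1 by (simp add: a_def)
 define kap where "kap = a*(exp (-2) * sqrt c0)"
 define Lam where "Lam = d*((1 + pi*4^Suc n)/2)"
 have kap: "0 < kap" and Lam: "0 <= Lam" using a c0 by (auto simp: kap_def Lam_def d_def add_nonneg_nonneg)
 \<comment> \<open>The last entry gives sqrt(M) >= Lam/kap + 1, which contradicts kap sqrt(M) <= Lam
   at the end.\<close>
 define M where "M = max (max 1 (2 * s2)) (max b ((Lam/kap + 1)^2))"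
 have M: "1 <= M" "2 * s2 <= M" "b <= M" "(Lam/kap + 1)^2 <= M" by (auto simp: M_def)
 have M0: "0 < M" using M by simp
 define C where "C s = cor (flat (s - M))*cor (flat (4*M - s))" for s
 have sC: "smooth1 C" unfolding C_def[abs_def]
 using smooth1_affine[OF smooth1_flat, of 1 "-M"] smooth1_affine[OF smooth1_flat, of "-1" "4*M"]
 by (intro smooth1_mult) simp_all
 have Cz: "C s = 0" if "s <= M \<or> 4*M <= s" for s using that by (auto simp: C_def flat_eq_0)
 have fl: "0 <= flat u" "flat u <= 1" for u by (auto simp: flat_def)
 have C1': "norm (C s) <= 1" for s using fl by (simp add: C_def norm_mult mult_le_one)
 have eq: "d*norm (X C) = norm (T C (4*M))*a"
 proof -
 have "T C1 b*X C = T C (4*M)*X C1" by (rule lin[OF sC]) (use Cz M M0 in auto)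
 then have "norm (T C1 b*X C) = norm (T C (4*M)*X C1)" by (rule arg_cong)
 then show ?thesis by (simp only: norm_mult d_def a_def)
 qed
 define mu where "mu = sqrt (M^Suc n)"
 have mu: "0 < mu" "mu*mu = M^Suc n" using M0 by (auto simp: mu_def)
 have XC: "norm (X C) <= (1 + pi*4^Suc n)/2*mu"
 proof -
 define h where "h x = zeta sig x^n*C (sq x)" for x
 have hm: "h \<in> borel_measurable lebesgue" unfolding h_def[abs_def]
 by (intro smooth2_measurable smooth2_mult smooth2_power smooth2_zeta smooth2_comp_sq sC)
 define w where "w s = s^n*(norm (C s))^2" for s :: real
 have Cm: "C \<in> borel_measurable borel" by (intro borel_measurable_continuous_onI smooth1_continuous_on sC)
 have wm: "w \<in> borel_measurable borel" unfolding w_def[abs_def] using Cm by measurable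
 have hw: "(norm (h x))^2 = w (sq x)" for x
 proof -
 have "(norm (h x))^2 = (sqrt (sq x)^n)^2*(norm (C (sq x)))^2" by (simp add: h_def norm_mult norm_power norm_zeta[OF sig] power_mult_distrib)
 also have "(sqrt (sq x)^n)^2 = sq x^n" by (simp flip: power_mult add: mult.commute[of n 2]) (simp add: power_mult sq_nonneg)
 finally show ?thesis by (simp add: w_def)
 qed
 have wb: "indicator {0..} s *\<^sub>R w s <= indicator {0..4*M} s *\<^sub>R (4*M)^n" "0 <= indicator {0..} s *\<^sub>R w s" for s
 proof -
 show "0 <= indicator {0..} s *\<^sub>R w s" by (auto simp: indicator_def w_def)
 show "indicator {0..} s *\<^sub>R w s <= indicator {0..4*M} s *\<^sub>R (4*M)^n"
 proof (cases "0 <= s & s <= 4*M")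
 case True
 have "s^n*(norm (C s))^2 <= (4*M)^n*1" using True C1'[of s] by (intro mult_mono power_mono power_le_one) auto
 then show ?thesis using True by (simp add: w_def)
 next
 case False
 then show ?thesis using Cz[of s] by (auto simp: indicator_def w_def)
 qed
 qed
 have ib: "integrable lborel (%s. indicator {0..4*M} s *\<^sub>R (4*M)^n)"
 by (rule borel_integrable_compact) auto
 have iw: "integrable lborel (%s. indicator {0..} s *\<^sub>R w s)"
 proof (rule Bochner_Integration.integrable_bound[OF ib])
 show "(%s. indicator {0..} s *\<^sub>R w s) \<in> borel_measurable lborel" using wm by measurable
 show "AE s in lborel. norm (indicator {0..} s *\<^sub>R w s) <= norm (indicator {0..4*M} s *\<^sub>R (4*M)^n)"
 proof (rule AE_I2)
 fix s show "norm (indicator {0..} s *\<^sub>R w s) <= norm (indicator {0..4*M} s *\<^sub>R (4*M)^n)"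
 unfolding real_norm_def using wb[of s] by linarith
 qed
 qed
 have ih: "integrable lebesgue (%x. (norm (h x))^2)" unfolding hw by (simp only: integral_sq(2)[OF wm] iw)
 have Ih: "(LINT x|lebesgue. (norm (h x))^2) <= pi*(4^Suc n*(mu*mu))"
 proof -
 have "(\<integral>s. indicator {0..} s *\<^sub>R w s \<partial>lborel) <= (\<integral>s. indicator {0..4*M} s *\<^sub>R (4*M)^n \<partial>lborel)"
 by (intro integral_mono iw ib wb)
 also have "... = 4*M*(4*M)^n" using M0 by simp
 also have "... = 4^Suc n*(mu*mu)" unfolding mu(2) by (simp add: power_mult_distrib)
 finally show ?thesis unfolding hw integral_sq(1)[OF wm] by simp
 qed
 have ip: "integrable lebesgue (%x. (norm (psi x))^2)" "(LINT x|lebesgue. (norm (psi x))^2) = 1"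
 proof -
 show "integrable lebesgue (%x. (norm (psi x))^2)" using psi(1) by (simp add: L2_def)
 have "sqrt (LINT x|lebesgue. (norm (psi x))^2) = 1" using psi(2) by (simp add: L2_norm_def)
 then show "(LINT x|lebesgue. (norm (psi x))^2) = 1" by simp
 qed
 have "norm (X C) <= (LINT x|lebesgue. mu/2*(norm (psi x))^2 + 1/(2*mu)*(norm (h x))^2)"
 unfolding X_def
 proof (rule Bochner_Integration.integral_norm_bound_integral)
 show "integrable lebesgue (%x. psi x*(zeta sig x^n*C (sq x)))"
 by (rule ring_test_integrable[OF psil sig sC, of "4*M"]) (use Cz M0 in auto)
 show "integrable lebesgue (%x. mu/2*(norm (psi x))^2 + 1/(2*mu)*(norm (h x))^2)"
 by (intro Bochner_Integration.integrable_add integrable_mult_right ip ih)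
 fix x
 \<comment> \<open>Cauchy-Schwarz as a weighted square; mu balances the norm 1 of psi against the
   norm of the test function.\<close>
 have "0 <= (mu*norm (psi x) - norm (h x))^2/(2*mu)" using mu by simp
 also have "... = mu/2*(norm (psi x))^2 + 1/(2*mu)*(norm (h x))^2 - norm (psi x)*norm (h x)"
 using mu(1) by (simp add: power2_eq_square field_simps)
 finally show "norm (psi x*(zeta sig x^n*C (sq x))) <= mu/2*(norm (psi x))^2 + 1/(2*mu)*(norm (h x))^2"
 by (simp add: norm_mult h_def)
 qed
 also have "... = mu/2 + 1/(2*mu)*(LINT x|lebesgue. (norm (h x))^2)"
 by (subst Bochner_Integration.integral_add) (use ip ih in "auto simp: ip(2)")
 also have "... <= mu/2 + 1/(2*mu)*(pi*(4^Suc n*(mu*mu)))" using Ih mu by (intro add_left_mono mult_left_mono) auto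
 also have "... = (1 + pi*4^Suc n)/2*mu" using mu(1) by (simp add: field_simps)
 finally show ?thesis .
 qed
 have TC: "exp (-2)*M * sqrt (c0*M^n) <= norm (T C (4*M))"
 proof -
 define g where "g t = Re (G t)" for t
 have Gg: "G t = cor (g t)" for t using re by (simp add: g_def complex_eq_iff)
 have gc: "continuous_on S g" for S unfolding g_def[abs_def] by (intro continuous_intros reg_continuous[OF G(1)])
 have gn: "g t ~= 0" if "M <= t" for t using c0(2)[of t] c0(1) that M by (auto simp: g_def)
 \<comment> \<open>Beyond M the function g has no zero, so it keeps a sign e there and phi is
   nonnegative.\<close>
 obtain e where e: "e = 1 \<or> e = -1" "!!t. M <= t ==> 0 < e*g t"
 proof (cases "0 < g M")
 case True
 have "0 < g t" if t: "M <= t" for t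
 proof (rule ccontr)
 assume "\<not> 0 < g t"
 then have "\<exists>x\<ge>M. x <= t & g x = 0" using True t gc by (intro IVT2') auto
 then show False using gn by blast
 qed
 then show thesis using that[of 1] by simp
 next
 case False
 have "g t < 0" if t: "M <= t" for t
 proof (rule ccontr)
 assume "\<not> g t < 0"
 then have "\<exists>x\<ge>M. x <= t & g x = 0" using False t gc by (intro IVT') auto
 then show False using gn by blast
 qed
 then show thesis using that[of "-1"] by simp
 qed
 define phi where "phi t = t^n*(flat (t - M)*flat (4*M - t))*(e*g t)" for t
 have phic: "continuous_on S phi" for S
 proof -
 have "continuous_on UNIV (%t. flat t)"
 proof -
 have "continuous_on UNIV (%t. Re (cor (flat t)))" by (intro continuous_intros smooth1_continuous_on smooth1_flat)
 then show ?thesis by simp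
 qed
 then have "continuous_on S (%t. flat (f t))" if "continuous_on S f" for f using continuous_on_compose2[OF _ that, of UNIV flat] by simp
 note fc = this
 have "continuous_on S (%t. flat (t - M))" "continuous_on S (%t. flat (4*M - t))"
 by (rule fc, intro continuous_intros)+
 then show ?thesis unfolding phi_def[abs_def] by (intro continuous_intros gc)
 qed
 have e2: "cor e*cor e = (1::complex)" using e(1) by auto
 have ff: "cor t^n*(C t*G t) = cor e*cor (phi t)" for t
 proof -
 have "cor e*cor (phi t) = (cor e*cor e)*(cor t^n*(C t*G t))"
 unfolding phi_def C_def Gg by simp
 then show ?thesis unfolding e2 by simp
 qed
 have phi0: "0 <= phi t" if "0 <= t" for t
 proof (cases "M <= t")
 case True
 then show ?thesis using e(2)[OF True] fl M0 by (auto simp: phi_def)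
 next
 case False
 then have "flat (t - M) = 0" by (simp add: flat_eq_0)
 then show ?thesis by (simp add: phi_def)
 qed
 have phi1: "exp (-2) * sqrt (c0*M^n) <= phi t" if t: "2*M <= t" "t <= 3*M" for t
 proof -
 have fe: "exp (-1) <= flat u" if "M <= u" for u
 proof -
 have "1/u <= 1" "0 < u" using that M by auto
 then show ?thesis by (simp add: flat_def)
 qed
 have "exp (-1)*exp (-1) <= flat (t - M)*flat (4*M - t)" using fe[of "t-M"] fe[of "4*M-t"] t fl by (intro mult_mono) auto
 then have f2: "exp (-2) <= flat (t - M)*flat (4*M - t)" by (simp flip: exp_add)
 have "sqrt (c0*M^n) <= sqrt ((t^n*(g t)^2)*t^n)"
 using c0 t M M0 unfolding g_def by (intro real_sqrt_le_mono mult_mono power_mono) (auto intro!: mult_nonneg_nonneg)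
 also have "(t^n*(g t)^2)*t^n = (t^n*(e*g t))^2" using e(1) by (auto simp: power2_eq_square)
 also have "sqrt ... = t^n*(e*g t)"
 proof -
 have "M <= t" "0 < t" using t M0 by auto
 then have "0 <= t^n*(e*g t)" using e(2)[of t] by simp
 then show ?thesis by (rule real_sqrt_unique[OF refl])
 qed
 finally have "exp (-2) * sqrt (c0*M^n) <= (flat (t - M)*flat (4*M - t))*(t^n*(e*g t))"
 using f2 c0(1) M0 fl by (intro mult_mono mult_nonneg_nonneg) auto
 then show ?thesis by (simp add: phi_def mult_ac)
 qed
 have "exp (-2) * sqrt (c0*M^n)*M = integral {2*M..3*M} (%t. exp (-2) * sqrt (c0*M^n))"
 using M0 by simp
 also have "... <= integral {2*M..3*M} phi" by (rule integral_le) (auto intro: phi1 integrable_continuous_interval phic)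
 also have "... <= integral {0..4*M} phi"
 using M0 by (intro integral_subset_le) (auto intro: phi0 integrable_continuous_interval phic)
 finally have 1: "exp (-2)*M * sqrt (c0*M^n) <= integral {0..4*M} phi" by (simp add: mult_ac)
 have "T C (4*M) = integral {0..4*M} (%t. cor e*cor (phi t))"
 unfolding T_def prim_eq_integral[OF lC[OF sC]] by (simp only: ff)
 also have "... = cor e*integral {0..4*M} (%t. cor (phi t))" by simp
 also have "integral {0..4*M} (%t. cor (phi t)) = cor (integral {0..4*M} phi)"
 proof -
 have "integral {0..4*M} (cor \<circ> phi) = cor (integral {0..4*M} phi)"
 by (rule integral_linear[OF integrable_continuous_interval[OF phic] bounded_linear_of_real])
 then show ?thesis by (simp add: o_def)
 qed
 finally have "norm (T C (4*M)) = abs (integral {0..4*M} phi)" using e(1) by (auto simp: norm_mult)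
 then show ?thesis using 1 by linarith
 qed
 have "kap * sqrt M*mu <= Lam*mu"
 proof -
 have "sqrt (c0*M^n)*M = sqrt c0*(sqrt M*mu)"
 proof -
 have "sqrt M*mu = M * sqrt (M^n)" unfolding mu_def using M0
 by (simp add: real_sqrt_mult)
 then show ?thesis by (simp add: real_sqrt_mult)
 qed
 then have "a*exp (-2)*(sqrt (c0*M^n)*M) = a*exp (-2)*(sqrt c0*(sqrt M*mu))" by (rule arg_cong)
 then have "kap * sqrt M*mu = a*(exp (-2)*M * sqrt (c0*M^n))" by (simp only: kap_def mult_ac)
 also have "... <= a*norm (T C (4*M))" using TC a by (intro mult_left_mono) auto
 also have "... = d*norm (X C)" using eq by simp
 also have "... <= d*((1 + pi*4^Suc n)/2*mu)" using XC by (intro mult_left_mono) (auto simp: d_def)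
 finally show ?thesis by (simp add: Lam_def)
 qed
 then have "kap * sqrt M <= Lam" using mu by simp
 moreover have "Lam/kap + 1 <= sqrt M" using M(4) by (rule real_le_rsqrt)
 then have "kap*(Lam/kap + 1) <= kap * sqrt M" using kap by (intro mult_left_mono) auto
 moreover have "kap*(Lam/kap + 1) = Lam + kap" using kap by (simp add: distrib_left)
 ultimately show False using kap by linarith
qed

text \<open>Beyond s1 both F = s^(n+1) G' and Z = s G' + n G are constant, so n G = Z - F s^(-n).
  The sign condition multiplied by n s^n reads s^n Z^2 <= Z F, which fails for large s unless Z =
  0.\<close>

lemma zero_energy_boundary_condition:
 assumes r: "reg n G G1 p" and n: "1 <= n" and s1: "0 < s1" and p: "!!s. s1 <= s ==> p s = 0"
 and re: "!!s. Im (G s) = 0" "!!s. Im (G1 s) = 0"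
 and le: "!!s. s1 < s ==> (s*Re (G1 s) + real n*Re (G s))*Re (G s) <= 0"
 and s: "s1 <= s"
 shows "cor s*G1 s = - of_nat n*G s"
proof -
 define F where "F = cor s1^Suc n*G1 s1"
 have F: "cor s^Suc n*G1 s = F" if "s1 <= s" for s
 proof -
 have "0 < s" using that s1 by simp
 then have "cor s^Suc n*G1 s = prim (%t. cor t^n*p t) s" by (rule reg_flux[OF r])
 also have "... = prim (%t. cor t^n*p t) s1"
 by (rule prim_eq_of_support[OF regD(5)[OF r]]) (use p s1 that in auto)
 also have "... = F" unfolding F_def by (rule reg_flux[OF r s1, symmetric])
 finally show ?thesis .
 qed
 define Z where "Z = cor s1*G1 s1 + of_nat n*G s1"
 have Z: "cor s*G1 s + of_nat n*G s = Z" if s: "s1 <= s" for s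
 proof -
 define k where "k s = F/cor s^n + of_nat n*G s" for s
 have keq: "cor s*G1 s + of_nat n*G s = k s" if "s1 <= s" for s
 using F[OF that] that s1 by (simp add: k_def field_simps)
 have "(k has_vector_derivative 0) (at t within {s1..s})" if t: "t \<in> {s1..s}" for t
 proof -
 have t0: "0 < t" using t s1 by simp
 have "((%s. F*inverse (cor s)^n) has_vector_derivative F*(of_nat n*inverse (cor t)^(n - 1)*(- (inverse (cor t))\<^sup>2))) (at t)"
 proof -
 have "((%s. F*inverse s^n) has_field_derivative F*(of_nat n*inverse (cor t)^(n - 1)*(- (inverse (cor t))\<^sup>2))) (at (cor t))"
 using t0 by (auto intro!: derivative_eq_intros simp: power2_eq_square)
 from has_vector_derivative_real_field[OF this] show ?thesis .
 qed
 from has_vector_derivative_add[OF this has_vector_derivative_mult_right[OF reg_derivative[OF r t0], of "of_nat n"]]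
 have "((%s. F*inverse (cor s)^n + of_nat n*G s) has_vector_derivative
 F*(of_nat n*inverse (cor t)^(n - 1)*(- (inverse (cor t))\<^sup>2)) + of_nat n*G1 t) (at t)" .
 moreover have "F*(of_nat n*inverse (cor t)^(n - 1)*(- (inverse (cor t))\<^sup>2)) + of_nat n*G1 t = 0"
 proof -
 have "cor t^Suc n*G1 t = F" using F t by simp
 then have "G1 t = F*inverse (cor t)^Suc n" using t0 by (simp add: field_simps)
 moreover have "inverse (cor t)^(n - 1)*(inverse (cor t))^2 = inverse (cor t)^Suc n"
 using n by (simp flip: power_add del: power_Suc)
 ultimately show ?thesis by (simp add: mult_ac del: power_Suc)
 qed
 moreover have "(%s. F*inverse (cor s)^n + of_nat n*G s) = k" by (simp add: k_def fun_eq_iff field_simps power_inverse)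
 ultimately show ?thesis by (auto intro: has_vector_derivative_at_within)
 qed
 then obtain c where "!!t. t \<in> {s1..s} ==> k t = c" using has_vector_derivative_zero_constant[of "{s1..s}" k] by auto
 then have "k s = k s1" using s by simp
 then show ?thesis unfolding keq[OF s] Z_def using keq[of s1] by simp
 qed
 have ineq: "s^n*(Re Z)^2 <= Re Z*Re F" if s: "s1 < s" for s
 proof -
 have sp: "0 < s" using s s1 by simp
 have z: "Re Z = s*Re (G1 s) + real n*Re (G s)" using arg_cong[OF Z[of s], of Re] s re by simp
 have f: "Re F = s^Suc n*Re (G1 s)"
 proof -
 have "cor s^Suc n*G1 s = cor (s^Suc n)*G1 s" by simp
 then have "F = cor (s^Suc n)*G1 s" using F[of s] s by (simp only: less_imp_le)
 then show ?thesis by (simp del: of_real_mult of_real_power power_Suc)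
 qed
 have "s^n*(real n*(Re Z*Re (G s))) <= 0" using le[OF s] sp unfolding z by (simp add: mult_nonneg_nonpos)
 moreover have "s^n*(real n*(Re Z*Re (G s))) = s^n*(Re Z)^2 - Re Z*Re F"
 unfolding f by (simp add: z power2_eq_square algebra_simps)
 ultimately show ?thesis by simp
 qed
 have "Re Z = 0"
 proof (rule ccontr)
 assume "Re Z ~= 0"
 then have z: "0 < (Re Z)^2" by simp
 define s where "s = max (s1 + 1) (max 1 (abs (Re Z*Re F)/(Re Z)^2 + 1))"
 have s: "s1 < s" "abs (Re Z*Re F)/(Re Z)^2 + 1 <= s" "1 <= s"
 unfolding s_def by (intro less_le_trans[OF _ max.cobounded1] order_trans[OF max.cobounded1 max.cobounded2] max.coboundedI2 max.cobounded2 less_add_one max.coboundedI1 order_refl; simp)+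
 have "s <= s^n" using s(3) n self_le_power[of s n] by simp
 then have "(abs (Re Z*Re F)/(Re Z)^2 + 1)*(Re Z)^2 <= s^n*(Re Z)^2" using s(2) by (intro mult_right_mono) auto
 moreover have "(abs (Re Z*Re F)/(Re Z)^2 + 1)*(Re Z)^2 = abs (Re Z*Re F) + (Re Z)^2" using z by (simp add: distrib_right)
 ultimately show False using ineq[OF s(1)] z by linarith
 qed
 moreover have "Im Z = 0" unfolding Z_def using re by simp
 ultimately have "Z = 0" by (simp add: complex_eq_iff)
 then show ?thesis using Z[OF s] by (simp add: eq_neg_iff_add_eq_0)
qed

text \<open>The difference H - G solves the equation with coefficient Q, source (Q - P) G and value
  0 at the origin, so \<open>volterra_bound\<close> makes it linear in eta; the flux bound then
  controls its derivative.\<close>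

lemma volterra_perturbation:
 assumes g: "reg n G G1 (%s. P s*G s)" "norm (G 0) <= 1" and h: "reg n H H1 (%s. Q s*H s)" "H 0 = G 0"
 and B: "0 <= B" "!!s. 0 < s ==> s <= S ==> norm (P s) <= B" "!!s. 0 < s ==> s <= S ==> norm (Q s) <= B"
 and eta: "0 <= eta" "!!s. 0 < s ==> s <= S ==> norm (Q s - P s) <= eta"
 and s: "0 < s" "s <= S"
 defines "Ga \<equiv> 2*exp ((2*B + 1)*S)"
 shows "norm (G s) <= Ga" "norm (H s - G s) <= S*Ga^2*eta" "norm (H1 s - G1 s) <= (B*(S*Ga^2) + Ga)*eta"
proof -
 have S: "0 < S" using s by simp
 have gb: "norm (G t) <= Ga" if t: "0 <= t" "t <= S" for t
 proof -
 have "norm (G t) <= 2*(norm (G 0) + 0*S)*exp ((2*B + 1)*t)"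
 by (rule volterra_bound[where P=P and g="%_. 0"]) (use g B t in auto)
 also have "... <= 2*1*exp ((2*B + 1)*S)" using g(2) B t by (intro mult_mono) auto
 finally show ?thesis by (simp add: Ga_def)
 qed
 show "norm (G s) <= Ga" using gb[of s] s by simp
 have Ga: "0 <= Ga" by (simp add: Ga_def)
 define v where "v s = H s + (-1)*G s" for s
 define v1 where "v1 s = H1 s + (-1)*G1 s" for s
 have v: "reg n v v1 (%s. Q s * v s + (Q s - P s)*G s)"
 proof -
 have "reg n v v1 (%s. Q s*H s + (-1)*(P s*G s))" unfolding v_def[abs_def] v1_def[abs_def] by (intro reg_add reg_cmult g h)
 moreover have "(%s. Q s*H s + (-1)*(P s*G s)) = (%s. Q s * v s + (Q s - P s)*G s)" by (simp add: fun_eq_iff v_def algebra_simps)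
 ultimately show ?thesis by simp
 qed
 have v0: "v 0 = 0" by (simp add: v_def h)
 have gd: "norm ((Q t - P t)*G t) <= eta*Ga" if "0 < t" "t <= S" for t
 unfolding norm_mult using eta gb that by (intro mult_mono) auto
 have vb: "norm (v t) <= S*Ga^2*eta" if t: "0 < t" "t <= S" for t
 proof -
 have "norm (v t) <= 2*(norm (v 0) + (eta*Ga)*S)*exp ((2*B + 1)*t)"
 by (rule volterra_bound[OF v]) (use B eta Ga gd t in auto)
 also have "... <= 2*((eta*Ga)*S)*exp ((2*B + 1)*S)" using v0 B t eta Ga S by (intro mult_mono) auto
 also have "... = S*Ga^2*eta" by (simp add: Ga_def power2_eq_square)
 finally show ?thesis .
 qed
 show "norm (H s - G s) <= S*Ga^2*eta" using vb[OF s] by (simp add: v_def)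
 have "norm (v1 s) <= (B*(S*Ga^2) + Ga)*eta"
 proof (rule reg_flux_bound[OF v _ s(1)])
 fix t assume t: "0 < t" "t <= s"
 have "norm (Q t * v t) <= B*(S*Ga^2*eta)" unfolding norm_mult using B vb t s by (intro mult_mono) auto
 then show "norm (Q t * v t + (Q t - P t)*G t) <= (B*(S*Ga^2) + Ga)*eta"
 using gd[of t] t s norm_triangle_ineq[of "Q t * v t" "(Q t - P t)*G t"] by (simp add: algebra_simps)
 qed
 then show "norm (H1 s - G1 s) <= (B*(S*Ga^2) + Ga)*eta" by (simp add: v1_def)
qed

section \<open>First order expansion of the interior logarithmic derivative\<close>

section \<open>The matching function\<close>

lemma prim_Re_nonneg:
 assumes f: "lbm f" and nn: "!!t. 0 <= t ==> t <= s ==> 0 <= Re (f t)"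
 shows "0 <= Re (prim f s)"
proof -
 have i: "f integrable_on {0..s}" by (rule lbm_integrable_on[OF f]) simp
 have "Re (prim f s) = integral {0..s} (Re \<circ> f)"
 unfolding prim_eq_integral[OF f] by (rule integral_linear[OF i bounded_linear_Re, symmetric])
 also have "0 <= ..." by (rule integral_nonneg[OF integrable_linear[OF i bounded_linear_Re]]) (use nn in auto)
 finally show ?thesis .
qed

lemma prim_Im_nonpos:
 assumes f: "lbm f" and nn: "!!t. 0 <= t ==> t <= s ==> Im (f t) <= 0"
 shows "Im (prim f s) <= 0"
proof -
 have "0 <= Re (prim (%t. \<i>*f t) s)" by (rule prim_Re_nonneg[OF lbm_cmult[OF f]]) (use nn in auto)
 then show ?thesis by (simp add: prim_cmult)
qed

text \<open>The flux times the conjugate of G is the integral of t^n P |G|^2 + t^(n+1) |G1|^2; its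
  imaginary part is nonpositive because that of P is.\<close>

lemma reg_Im_logarithmic_derivative:
 assumes r: "reg n G G1 (%s. P s*G s)" and P: "lbm P" "!!t. 0 <= t ==> t <= s ==> Im (P t) <= 0" and s: "0 < s"
 shows "Im (G1 s/G s) <= 0"
proof -
 have l: "lbm (%t. cor t^n*(P t*G t)*cnj (G t) + cor t^Suc n*G1 t*cnj (G1 t))"
 by (intro lbm_add lbm_mult lbm_of_real_power P lbm_cnj reg_lbm[OF r] regD(4)[OF r])
 have "cor s^Suc n*G1 s*cnj (G s)
 = prim (%t. cor t^n*(P t*G t)*cnj (G t) + cor t^Suc n*G1 t*cnj (G1 t)) s"
 unfolding reg_flux[OF r s] by (rule prim_flux_mult[OF r reg_cnj[OF r]])
 moreover have "Im (prim (%t. cor t^n*(P t*G t)*cnj (G t) + cor t^Suc n*G1 t*cnj (G1 t)) s) <= 0"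
 proof (rule prim_Im_nonpos[OF l])
 fix t assume t: "0 <= t" "t <= s"
 have "cor t^n*(P t*G t)*cnj (G t) + cor t^Suc n*G1 t*cnj (G1 t)
 = cor (t^n*(norm (G t))^2)*P t + cor (t^Suc n*(norm (G1 t))^2)"
 proof -
 have "g*cnj g = cor ((norm g)^2)" for g by (rule complex_norm_square[symmetric])
 moreover have "cor t^n*(P t*G t)*cnj (G t) + cor t^Suc n*G1 t*cnj (G1 t)
 = cor (t^n)*(G t*cnj (G t))*P t + cor (t^Suc n)*(G1 t*cnj (G1 t))" by (simp add: mult_ac)
 ultimately show ?thesis by simp
 qed
 then have "Im (cor t^n*(P t*G t)*cnj (G t) + cor t^Suc n*G1 t*cnj (G1 t)) = t^n*(norm (G t))^2*Im (P t)"
 by (simp del: of_real_mult of_real_power)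
 also have "... <= 0" using P(2)[OF t] t by (intro mult_nonneg_nonpos) auto
 finally show "Im (cor t^n*(P t*G t)*cnj (G t) + cor t^Suc n*G1 t*cnj (G1 t)) <= 0" .
 qed
 ultimately have "Im (cor (s^Suc n)*(G1 s*cnj (G s))) <= 0" by (simp add: mult.assoc)
 then have "s^Suc n*Im (G1 s*cnj (G s)) <= 0" by (simp del: of_real_power power_Suc)
 then have i: "Im (G1 s*cnj (G s)) <= 0" using zero_less_power[OF s, of "Suc n"] by (simp only: mult_le_0_iff) linarith
 have "Im (G1 s/G s) = Im (G1 s*cnj (G s))/(norm (G s))^2"
 by (subst complex_div_cnj) (simp flip: of_real_power)
 then show ?thesis using i by (simp add: divide_nonpos_nonneg)
qed

text \<open>At x = eps = 0 the quantity s0 G1/G + n vanishes by \<open>bc\<close>. The Wronskian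
  with the threshold solution G0 writes it as T divided by c gam G(s0), where T integrates t^n (P -
  P0) G G0 with P0 the threshold coefficient. As P - P0 is of first order in (x, eps), replacing G
  by G0 costs a second order error and leaves B eps - A x: A is a multiple of the integral of t^n
  G0^2, and B is a multiple of b1.\<close>

lemma matching_function:
 fixes q :: "real => real => real" and M0 C1 C2 e1 s0 b1 :: real
 assumes n: "1 <= n" and s0: "0 < s0" and e1: "0 < e1"
 and q: "!!eps. abs eps < e1 ==> q eps \<in> borel_measurable borel" "!!eps s. abs eps < e1 ==> abs (q eps s) <= M0"
 "!!eps s. abs eps < e1 ==> abs (q eps s - q 0 s) <= C1*abs eps" and C1: "0 <= C1"
 and G0: "reg n G0 G01 (%s. cor (q 0 s)/4*G0 s)" "G0 0 = 1" "!!s. Im (G0 s) = 0"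
 and bc: "cor s0*G01 s0 = - of_nat n*G0 s0"
 and b1: "0 < b1" "0 <= C2" "!!eps. abs eps < e1 ==>
 norm (prim (%t. cor t^n*(cor (q eps t - q 0 t)*(G0 t*G0 t))) s0 - cor (b1*eps)) <= C2*eps^2"
 obtains r A B C G G1 where "0 < r" "r <= e1" "0 <= A" "0 < B" "0 <= C"
 "!!x eps. abs eps < r ==> norm x < r ==> reg n (G x eps) (G1 x eps) (%s. (cor (q eps s) - 4*x/cor s0)/4*G x eps s)"
 "!!x eps. abs eps < r ==> norm x < r ==> G x eps 0 = 1" "!!x eps. abs eps < r ==> norm x < r ==> G x eps s0 ~= 0"
 "!!eps. abs eps < r ==> continuous_on (ball 0 r) (%x. cor s0*(G1 x eps s0/G x eps s0) + of_nat n)"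
 "!!x eps. abs eps < r ==> norm x < r ==>
 norm (cor s0*(G1 x eps s0/G x eps s0) + of_nat n - (cor (B*eps) - cor A*x)) <= C*(abs eps + norm x)^2"
 "!!x eps. abs eps < r ==> norm x < r ==> 0 <= Im x ==> Im (cor s0*(G1 x eps s0/G x eps s0) + of_nat n) <= 0"
proof -
 define P where "P x eps s = (cor (q eps s) - 4*x/cor s0)/4" for x :: complex and eps s
 have M0: "0 <= M0" using q(2)[of 0 0] e1 by simp
 have Pn: "norm (P x eps s) <= M0/4 + norm x/s0" if "abs eps < e1" for x eps s
 proof -
 have "norm (cor (q eps s) - 4*x/cor s0) <= M0 + 4*norm x/s0"
 using q(2)[OF that, of s] s0 by (intro norm_triangle_le_diff add_mono) (auto simp: norm_divide norm_mult)
 then have "norm (cor (q eps s) - 4*x/cor s0)/4 <= (M0 + 4*norm x/s0)/4" by simp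
 also have "... = M0/4 + norm x/s0" by (simp add: add_divide_distrib)
 finally show ?thesis unfolding P_def norm_divide by simp
 qed
 have lP: "lbm (P x eps)" if e: "abs eps < e1" for x eps
 proof (rule lbmI)
 show "P x eps \<in> borel_measurable borel" using q(1)[OF e] unfolding P_def[abs_def] by measurable
 qed (use Pn[OF e] in blast)
 have "\<exists>G. \<exists>G1. abs eps < e1 --> reg n G G1 (%s. P x eps s*G s) & G 0 = 1" for x eps
 proof (cases "abs eps < e1")
 case True
 obtain G G1 where "reg n G G1 (%s. P x eps s*G s + 0)" "G 0 = 1"
 by (rule volterra_exists[OF lP[OF True] lbm_const[of 0] Pn[OF True], where D=0 and n=n and c=1]) simp_all
 then show ?thesis by (intro exI[of _ G] exI[of _ G1]) simp
 qed auto
 then obtain G where "\<forall>x eps. \<exists>G1. abs eps < e1 --> reg n (G x eps) G1 (%s. P x eps s*G x eps s) & G x eps 0 = 1" by moura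
 then obtain G1 where GG: "\<forall>x eps. abs eps < e1 --> reg n (G x eps) (G1 x eps) (%s. P x eps s*G x eps s) & G x eps 0 = 1" by moura
 have G: "reg n (G x eps) (G1 x eps) (%s. P x eps s*G x eps s)" "G x eps 0 = 1" if "abs eps < e1" for x eps using GG that by blast+
 have P0: "P 0 0 = (%s. cor (q 0 s)/4)" by (simp add: P_def fun_eq_iff)
 have G0': "reg n G0 G01 (%s. P 0 0 s*G0 s)" using G0(1) by (simp add: P0)
 \<comment> \<open>Otherwise \<open>bc\<close> makes the derivative vanish as well, against backward
   uniqueness.\<close>
 have g0: "G0 s0 ~= 0"
 proof
 assume z: "G0 s0 = 0"
 then have "G01 s0 = 0" using bc s0 by simp
 then show False using volterra_backward_unique[OF G0' lP s0 z] G0(2) e1 by simp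
 qed
 define gam where "gam = Re (G0 s0)"
 have gam: "G0 s0 = cor gam" "gam ~= 0" using g0 G0(3)[of s0] by (auto simp: gam_def complex_eq_iff)
 define b where "b = M0/4 + 1"
 have b: "0 <= b" using M0 by (simp add: b_def)
 have Pb: "norm (P x eps s) <= b" if "abs eps < e1" "norm x < s0" for x eps s
 using Pn[OF that(1), of x s] that(2) s0 by (simp add: b_def) (smt (verit) divide_le_eq_1_pos)
 define Ga where "Ga = 2*exp ((2*b + 1) * s0)"
 have Ga: "0 < Ga" by (simp add: Ga_def)
 define K where "K = s0*Ga^2"
 have K: "0 < K" using s0 Ga by (simp add: K_def)
 define k where "k = C1/4 + 1/s0"
 have k: "0 < k" using C1 s0 by (simp add: k_def add_nonneg_pos)
 \<comment> \<open>The last entry keeps |G(s0)| >= |gam|/2 through the Lipschitz bound on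
   solutions.\<close>
 define r where "r = min (min e1 s0) (abs gam/(4*(K * k)))"
 have r: "0 < r" "r <= e1" "r <= s0" using e1 s0 gam(2) K k by (auto simp: r_def)
 have rK: "K*(k*(abs eps + norm x)) <= abs gam/2" if "abs eps < r" "norm x < r" for eps and x :: complex
 proof -
 have "K * k*(abs eps + norm x) <= K * k*(2*(abs gam/(4*(K * k))))" using that K k by (intro mult_left_mono) (auto simp: r_def)
 also have "... = abs gam/2" using K k by simp
 finally show ?thesis by (simp add: mult_ac)
 qed
 define eta where "eta x eps = k*(abs eps + norm x)" for x :: complex and eps :: real
 have dP: "P x eps s - P 0 0 s = cor (q eps s - q 0 s)/4 - x/cor s0" for x eps s
 by (simp add: P_def field_simps)
 have dPn: "norm (P x eps s - P 0 0 s) <= eta x eps" if "abs eps < e1" for x eps s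
 proof -
 have "norm (P x eps s - P 0 0 s) <= abs (q eps s - q 0 s)/4 + norm x/s0"
 unfolding dP using s0 by (intro norm_triangle_le_diff add_mono) (auto simp: norm_divide simp flip: of_real_diff)
 also have "... <= C1*abs eps/4 + norm x/s0" using q(3)[OF that, of s] by simp
 also have "... <= eta x eps"
 proof -
 have "0 <= C1*norm x/4" "0 <= abs eps/s0" using C1 s0 by auto
 moreover have "eta x eps = C1*abs eps/4 + C1*norm x/4 + abs eps/s0 + norm x/s0" by (simp add: eta_def k_def algebra_simps)
 ultimately show ?thesis by linarith
 qed
 finally show ?thesis .
 qed
 have eta0: "0 <= eta x eps" for x eps using k by (simp add: eta_def)
 have est: "norm (G0 s) <= Ga" "norm (G x eps s - G0 s) <= K*eta x eps" if "abs eps < r" "norm x < r" "0 < s" "s <= s0" for x eps s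
 proof -
 have e: "abs eps < e1" "norm x < s0" using that r by auto
 note pert = volterra_perturbation[OF G0' _ G(1)[OF e(1)] _ b _ _ eta0 _ that(3,4), folded Ga_def K_def]
 show "norm (G0 s) <= Ga" by (rule pert(1)) (use G0(2) G(2)[OF e(1)] Pb[OF e] Pb[of 0 0] e1 s0 dPn[OF e(1)] in auto)
 show "norm (G x eps s - G0 s) <= K*eta x eps" by (rule pert(2)) (use G0(2) G(2)[OF e(1)] Pb[OF e] Pb[of 0 0] e1 s0 dPn[OF e(1)] in auto)
 qed
 have gl: "abs gam/2 <= norm (G x eps s0)" if "abs eps < r" "norm x < r" for x eps
 proof -
 have "norm (G x eps s0 - G0 s0) <= abs gam/2" using est(2)[OF that s0 order_refl] rK[OF that] by (simp add: eta_def)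
 then show ?thesis using norm_triangle_ineq2[of "G0 s0" "G x eps s0"] gam(1) by (simp add: norm_minus_commute)
 qed
 have gn: "G x eps s0 ~= 0" if "abs eps < r" "norm x < r" for x eps using gl[OF that] gam(2) by auto
 define c where "c = s0^n"
 have c: "0 < c" using s0 by (simp add: c_def)
 \<comment> \<open>T is the exact Wronskian integral; T0 is its approximation with G replaced by
   G0.\<close>
 define T where "T x eps = prim (%t. cor t^n*((P x eps t - P 0 0 t)*(G x eps t*G0 t))) s0" for x eps
 define T0 where "T0 x eps = prim (%t. cor t^n*((P x eps t - P 0 0 t)*(G0 t*G0 t))) s0" for x eps
 have e10: "\<bar>0::real\<bar> < e1" using e1 by simp
 have lT0: "lbm (%t. cor t^n*((P x eps t - P 0 0 t)*(G0 t*G0 t)))" if "abs eps < r" for x eps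
 by (intro lbm_mult lbm_of_real_power lbm_diff lP reg_lbm[OF G0']) (use that r e1 in auto)
 have lT: "lbm (%t. cor t^n*((P x eps t - P 0 0 t)*(G x eps t*G0 t)))" if "abs eps < r" for x eps
 by (intro lbm_mult lbm_of_real_power lbm_diff lP reg_lbm[OF G0'] reg_lbm[OF G(1)]) (use that r e1 in auto)
 have delta0T: "cor s0*(G1 x eps s0/G x eps s0) + of_nat n = T x eps/(cor (c*gam)*G x eps s0)" if a: "abs eps < r" "norm x < r" for x eps
 proof -
 have e: "abs eps < e1" using a r by simp
 have "cor s0^Suc n*(G1 x eps s0*G0 s0 - G x eps s0*G01 s0) = prim (%t. cor t^n*(P x eps t*G x eps t*G0 t - P 0 0 t*G0 t*G x eps t)) s0"
 by (rule reg_wronskian[OF G(1)[OF e] G0' s0])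
 also have "(%t. cor t^n*(P x eps t*G x eps t*G0 t - P 0 0 t*G0 t*G x eps t)) = (%t. cor t^n*((P x eps t - P 0 0 t)*(G x eps t*G0 t)))"
 by (simp add: fun_eq_iff algebra_simps)
 finally have "T x eps = cor c*(cor s0*G1 x eps s0*G0 s0 - G x eps s0*(cor s0*G01 s0))"
 by (simp add: T_def c_def algebra_simps)
 also have "... = cor (c*gam)*(cor s0*G1 x eps s0 + of_nat n*G x eps s0)" unfolding bc gam(1) by (simp add: algebra_simps)
 finally have "T x eps = cor (c*gam)*(cor s0*G1 x eps s0 + of_nat n*G x eps s0)" .
 then show ?thesis using gn[OF a] c gam(2) by (simp add: field_simps)
 qed
 have R: "norm (T x eps - T0 x eps) <= (c*Ga*K * s0)*(eta x eps)^2" "norm (T0 x eps) <= (c*Ga^2 * s0)*eta x eps" if a: "abs eps < r" "norm x < r" for x eps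
 proof -
 have e: "abs eps < e1" using a r by simp
 have "T x eps - T0 x eps = prim (%t. cor t^n*((P x eps t - P 0 0 t)*(G x eps t*G0 t)) - cor t^n*((P x eps t - P 0 0 t)*(G0 t*G0 t))) s0"
 unfolding T_def T0_def by (rule prim_minus[symmetric, OF lT[OF a(1)] lT0[OF a(1)]])
 also have "norm ... <= (c*(eta x eps*((K*eta x eps)*Ga))) * s0"
 proof (rule norm_prim_le_const[OF lbm_diff[OF lT[OF a(1)] lT0[OF a(1)]]])
 fix t assume t: "0 < t" "t <= s0"
 have "cor t^n*((P x eps t - P 0 0 t)*(G x eps t*G0 t)) - cor t^n*((P x eps t - P 0 0 t)*(G0 t*G0 t))
 = cor t^n*((P x eps t - P 0 0 t)*((G x eps t - G0 t)*G0 t))" by (simp add: algebra_simps)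
 also have "norm ... <= c*(eta x eps*((K*eta x eps)*Ga))"
 unfolding norm_mult norm_power norm_of_real c_def
 by (intro mult_mono power_mono est[OF a t] dPn[OF e] mult_nonneg_nonneg zero_le_power) (use t Ga K s0 eta0 in auto)
 finally show "norm (cor t^n*((P x eps t - P 0 0 t)*(G x eps t*G0 t)) - cor t^n*((P x eps t - P 0 0 t)*(G0 t*G0 t))) <= c*(eta x eps*((K*eta x eps)*Ga))" .
 qed (use s0 in simp)
 finally show "norm (T x eps - T0 x eps) <= (c*Ga*K * s0)*(eta x eps)^2" by (simp add: power2_eq_square mult_ac)
 have "norm (T0 x eps) <= (c*(eta x eps*(Ga*Ga))) * s0" unfolding T0_def
 proof (rule norm_prim_le_const[OF lT0[OF a(1)]])
 fix t assume t: "0 < t" "t <= s0"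
 show "norm (cor t^n*((P x eps t - P 0 0 t)*(G0 t*G0 t))) <= c*(eta x eps*(Ga*Ga))"
 unfolding norm_mult norm_power norm_of_real c_def
 by (intro mult_mono power_mono est[OF a t] dPn[OF e] mult_nonneg_nonneg zero_le_power) (use t Ga K s0 eta0 in auto)
 qed (use s0 in simp)
 then show "norm (T0 x eps) <= (c*Ga^2 * s0)*eta x eps" by (simp add: power2_eq_square mult_ac)
 qed
 define a where "a = Re (prim (%t. cor t^n*(G0 t*G0 t)) s0)"
 have la: "lbm (%t. cor t^n*(G0 t*G0 t))" by (intro lbm_mult lbm_of_real_power reg_lbm[OF G0'])
 have cG0: "cnj (G0 t) = G0 t" for t using G0(3) by (simp add: complex_eq_iff)
 have "cnj (prim (%t. cor t^n*(G0 t*G0 t)) s0) = prim (%t. cor t^n*(G0 t*G0 t)) s0"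
 using prim_cnj[OF la, of s0] by (simp add: cG0)
 then have aeq: "prim (%t. cor t^n*(G0 t*G0 t)) s0 = cor a" by (simp add: a_def complex_eq_iff)
 have a0: "0 <= a" unfolding a_def
 proof (rule prim_Re_nonneg[OF la])
 fix t :: real assume t: "0 <= t"
 have "cor t^n*(G0 t*G0 t) = cor (t^n*(Re (G0 t))^2)"
 using G0(3)[of t] by (simp add: complex_eq_iff power2_eq_square)
 then show "0 <= Re (cor t^n*(G0 t*G0 t))" using t by (simp del: of_real_mult of_real_power)
 qed
 define A where "A = a/(s0*c*gam^2)"
 define B where "B = b1/(4*c*gam^2)"
 have A: "0 <= A" using a0 s0 c by (simp add: A_def)
 have B: "0 < B" using b1(1) c gam(2) by (simp add: B_def)
 define C where "C = (c*Ga*K * s0*abs gam + c*Ga^2 * s0*K)*2/(c*abs gam^3) * k^2 + C2/(4*c*gam^2)"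
 have C: "0 <= C" using c Ga K s0 b1(2) by (auto simp: C_def intro!: add_nonneg_nonneg mult_nonneg_nonneg divide_nonneg_nonneg)
 have T0e: "norm (T0 x eps/cor (c*gam^2) - (cor (B*eps) - cor A*x)) <= C2/(4*c*gam^2)*eps^2" if a: "abs eps < r" "norm x < r" for x eps
 proof -
 have e: "abs eps < e1" using a r by simp
 let ?I = "prim (%t. cor t^n*(cor (q eps t - q 0 t)*(G0 t*G0 t))) s0"
 have dq: "cor (q eps t - q 0 t) = 4*(P x eps t - P 0 0 t + x/cor s0)" for t by (simp add: dP)
 have l1: "lbm (%t. cor t^n*(cor (q eps t - q 0 t)*(G0 t*G0 t)))"
 unfolding dq by (intro lbm_mult lbm_of_real_power lbm_cmult lbm_add lbm_const lbm_diff lP reg_lbm[OF G0'] e e10)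
 have "T0 x eps = prim (%t. (1/4)*(cor t^n*(cor (q eps t - q 0 t)*(G0 t*G0 t))) - (x/cor s0)*(cor t^n*(G0 t*G0 t))) s0"
 proof -
 have "cor t^n*((P x eps t - P 0 0 t)*(G0 t*G0 t)) = (1/4)*(cor t^n*(cor (q eps t - q 0 t)*(G0 t*G0 t))) - (x/cor s0)*(cor t^n*(G0 t*G0 t))" for t
 proof -
 have "u*((d/4 - y)*g) = (1/4)*(u*(d*g)) - y*(u*g)" for u d y g :: complex by (simp add: field_simps)
 then show ?thesis unfolding dP .
 qed
 then show ?thesis unfolding T0_def by (simp only:)
 qed
 also have "... = (1/4) * ?I - (x/cor s0)*cor a"
 unfolding aeq[symmetric] prim_cmult[symmetric] by (rule prim_minus) (intro lbm_cmult l1 la)+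
 finally have "T0 x eps/cor (c*gam^2) - (cor (B*eps) - cor A*x) = (?I - cor (b1*eps))/cor (4*c*gam^2)"
 using c s0 gam(2) by (simp add: A_def B_def field_simps)
 also have "norm ... <= C2*eps^2/(4*c*gam^2)"
 unfolding norm_divide norm_of_real using b1(3)[OF e] c by (simp add: divide_right_mono)
 finally show ?thesis by simp
 qed
 have main: "norm (cor s0*(G1 x eps s0/G x eps s0) + of_nat n - (cor (B*eps) - cor A*x)) <= C*(abs eps + norm x)^2"
 if a: "abs eps < r" "norm x < r" for x eps
 proof -
 let ?g = "G x eps s0"
 have "T x eps/(cor (c*gam) * ?g) - T0 x eps/cor (c*gam^2) = ((T x eps - T0 x eps)*cor gam + T0 x eps*(G0 s0 - ?g))/(cor (c*gam^2) * ?g)"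
 unfolding gam(1) using gn[OF a] c gam(2) by (simp add: field_simps power2_eq_square)
 also have "norm ... <= ((c*Ga*K * s0)*(eta x eps)^2*abs gam + (c*Ga^2 * s0)*eta x eps*(K*eta x eps))/(c*gam^2*(abs gam/2))"
 unfolding norm_divide
 proof (rule frac_le)
 show "norm ((T x eps - T0 x eps)*cor gam + T0 x eps*(G0 s0 - ?g)) <= (c*Ga*K * s0)*(eta x eps)^2*abs gam + (c*Ga^2 * s0)*eta x eps*(K*eta x eps)"
 using R[OF a] est(2)[OF a s0 order_refl] c Ga s0 eta0[of x eps]
 by (intro norm_triangle_le add_mono) (auto simp: norm_mult norm_minus_commute intro!: mult_mono mult_right_mono)
 show "c*gam^2*(abs gam/2) <= norm (cor (c*gam^2) * ?g)"
 unfolding norm_mult[of _ ?g] norm_of_real using gl[OF a] c by (intro mult_mono) auto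
 qed (use c gam(2) Ga K s0 eta0[of x eps] in auto)
 also have "... = (c*Ga*K * s0*abs gam + c*Ga^2 * s0*K)*2/(c*abs gam^3)*(eta x eps)^2"
 proof -
 have "abs gam^3 = \<bar>gam\<bar>\<^sup>2*abs gam" by (simp add: power3_eq_cube power2_eq_square)
 then have "gam^2*abs gam = abs gam^3" by (simp only: power2_abs)
 moreover have "(X*h^2*g + Y*h*(Z*h))/(d*w*(g/2)) = (X*g + Y*Z)*2/(d*(w*g))*h^2"
 for X h g Y Z d w :: real by (simp add: power2_eq_square field_simps add_divide_distrib)
 ultimately show ?thesis by simp
 qed
 also have "... = (c*Ga*K * s0*abs gam + c*Ga^2 * s0*K)*2/(c*abs gam^3) * k^2*(abs eps + norm x)^2" by (simp add: eta_def power_mult_distrib)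
 finally have 1: "norm (T x eps/(cor (c*gam) * ?g) - T0 x eps/cor (c*gam^2))
 <= (c*Ga*K * s0*abs gam + c*Ga^2 * s0*K)*2/(c*abs gam^3) * k^2*(abs eps + norm x)^2" .
 have "eps^2 <= (abs eps + norm x)^2" unfolding power2_abs[of eps, symmetric] by (intro power_mono) auto
 then have 2: "C2/(4*c*gam^2)*eps^2 <= C2/(4*c*gam^2)*(abs eps + norm x)^2" using b1(2) c by (intro mult_left_mono) auto
 have "norm ((T x eps/(cor (c*gam) * ?g) - T0 x eps/cor (c*gam^2)) + (T0 x eps/cor (c*gam^2) - (cor (B*eps) - cor A*x)))
 <= C*(abs eps + norm x)^2"
 using order_trans[OF norm_triangle_ineq add_mono[OF 1 order_trans[OF T0e[OF a] 2]]]
 by (simp only: C_def distrib_right[of _ "C2/(4*c*gam^2)"])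
 moreover have "(X - Y) + (Y - Z) = X - Z" for X Y Z :: complex by simp
 ultimately show ?thesis unfolding delta0T[OF a] by (simp only:)
 qed
 \<comment> \<open>The coefficient is affine in x, so the value and derivative at s0 are Lipschitz
   in x by \<open>volterra_perturbation\<close>.\<close>
 have cont: "continuous_on (ball 0 r) (%x. cor s0*(G1 x eps s0/G x eps s0) + of_nat n)" if e: "abs eps < r" for eps
 proof -
 have ee: "abs eps < e1" using e r by simp
 have lip: "norm (G y eps s0 - G x eps s0) <= K/s0*norm (y - x)" "norm (G1 y eps s0 - G1 x eps s0) <= (b*K + Ga)/s0*norm (y - x)"
 if xy: "norm x < r" "norm y < r" for x y
 proof -
 have xs: "norm x < s0" "norm y < s0" using xy r by auto
 have dd: "norm (P y eps s - P x eps s) <= norm (y - x)/s0" for s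
 proof -
 have "(u - 4*y/v)/4 - (u - 4*x/v)/4 = - ((y - x)/v)" for u v :: complex
 by (simp add: diff_divide_distrib)
 then have "P y eps s - P x eps s = - ((y - x)/cor s0)" unfolding P_def .
 then show ?thesis using s0 by (simp add: norm_divide)
 qed
 have d0: "0 <= norm (y - x)/s0" using s0 by simp
 note pert = volterra_perturbation[OF G(1)[OF ee, of x] _ G(1)[OF ee, of y] _ b _ _ d0 _ s0 order_refl, folded Ga_def K_def]
 have "norm (G y eps s0 - G x eps s0) <= K*(norm (y - x)/s0)"
 by (rule pert(2)) (use G(2)[OF ee] Pb[OF ee] xs dd in auto)
 then show "norm (G y eps s0 - G x eps s0) <= K/s0*norm (y - x)" by simp
 have "norm (G1 y eps s0 - G1 x eps s0) <= (b*K + Ga)*(norm (y - x)/s0)"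
 by (rule pert(3)) (use G(2)[OF ee] Pb[OF ee] xs dd in auto)
 then show "norm (G1 y eps s0 - G1 x eps s0) <= (b*K + Ga)/s0*norm (y - x)" by simp
 qed
 have lc: "continuous_on (ball 0 r) f" if "0 <= L" "!!x y. norm x < r ==> norm y < r ==> norm (f y - f x) <= L*norm (y - x)" for f :: "complex => complex" and L
 by (rule lipschitz_on_continuous_on[of L]) (use that in "auto simp: lipschitz_on_def dist_norm")
 show ?thesis
 by (intro continuous_intros lc[OF _ lip(1)] lc[OF _ lip(2)]) (use gn[OF e] K s0 b Ga in "auto intro!: divide_nonneg_pos add_nonneg_nonneg")
 qed
 have sgn: "Im (cor s0*(G1 x eps s0/G x eps s0) + of_nat n) <= 0" if a: "abs eps < r" "norm x < r" "0 <= Im x" for x eps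
 proof -
 have e: "abs eps < e1" using a r by simp
 have "Im (P x eps t) <= 0" for t using a(3) s0 by (simp add: P_def)
 then have "Im (G1 x eps s0/G x eps s0) <= 0" by (intro reg_Im_logarithmic_derivative[OF G(1)[OF e] lP[OF e] _ s0])
 then have "s0*Im (G1 x eps s0/G x eps s0) <= 0" using s0 by (simp add: mult_le_0_iff)
 moreover have "Im (cor s0*(G1 x eps s0/G x eps s0) + of_nat n) = s0*Im (G1 x eps s0/G x eps s0)"
 by (simp del: times_divide_eq_right)
 ultimately show ?thesis by simp
 qed
 have Greg: "reg n (G x eps) (G1 x eps) (%s. (cor (q eps s) - 4*x/cor s0)/4*G x eps s)" "G x eps 0 = 1" if "abs eps < r" for x eps
 using G[of eps x] that r unfolding P_def by auto
 show thesis
 by (rule that[OF r(1,2) A B C Greg gn cont main sgn])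
qed

section \<open>Partial waves, their independence, and resonant states\<close>

section \<open>Partial waves\<close>

text \<open>In polar coordinates this is r^|l| exp(i l theta) H(r^2).\<close>

definition partial_wave :: "int => (real => complex) => real^2 => complex" where
 "partial_wave l H x = zeta (if 0 <= l then 1 else -1) x^nat (abs l)*H (sq x)"

lemma zeta_polar:
 "zeta (if 0 <= l then 1 else -1) x^nat (abs l) = cor (norm x)^nat (abs l)*cis (of_int l*polar_angle x)"
proof -
 define w where "w = Complex (x $ 1) (x $ 2)"
 have nw: "norm w = norm x"
 by (simp add: w_def cmod_def norm_vec_def L2_set_def sum_2)
 have w: "w = cor (norm x)*cis (polar_angle x)"
 using rcis_cmod_Arg[of w] unfolding rcis_def nw polar_angle_def w_def[symmetric] by (rule sym)
 have cp: "cis a^nat k = cis (of_int k*a)" if "0 <= k" for a k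
 using that cis_power_int[of a k] by (simp only: power_int_def if_True)
 show ?thesis
 proof (cases "0 <= l")
 case True
 have "zeta 1 x = w" by (simp add: zeta_def w_def complex_eq_iff)
 then show ?thesis using True unfolding w by (simp only: power_mult_distrib cp if_True abs_of_nonneg)
 next
 case False
 have "zeta (-1) x = cnj w" by (simp add: zeta_def w_def complex_eq_iff)
 also have "... = cor (norm x)*cis (- polar_angle x)" unfolding w by (simp add: cis_cnj)
 finally have "zeta (-1) x^nat (- l) = cor (norm x)^nat (- l)*cis (of_int (- l)*(- polar_angle x))"
 using False by (simp only: power_mult_distrib cp)
 then show ?thesis using False by simp
 qed
qed

lemma partial_wave_polar:
 "partial_wave l H x = cor (norm x)^nat (abs l)*H ((norm x)^2)*cis (of_int l*polar_angle x)"
 unfolding partial_wave_def zeta_polar sq_eq_norm by (simp add: mult_ac)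

lemma continuous_partial_wave:
 assumes "continuous_on UNIV H" shows "continuous_on UNIV (partial_wave l H)"
proof -
 have "continuous_on UNIV sq" unfolding sq_def[abs_def] by (intro continuous_intros)
 then have "continuous_on UNIV (%x. H (sq x))" using continuous_on_compose2[OF assms] by blast
 then show ?thesis unfolding partial_wave_def[abs_def] by (intro continuous_on_mult continuous_on_power smooth2_continuous_on[OF smooth2_zeta])
qed

lemma continuous_imp_L2_loc:
 fixes u :: "real^2 => complex"
 assumes "continuous_on UNIV u" shows "u \<in> L2_loc"
proof -
 have "u \<in> borel_measurable lebesgue"
 using borel_measurable_continuous_onI[OF assms] by (intro measurable_completion) simp
 moreover have "set_integrable lebesgue (cball 0 R) (%x. (norm (u x))^2)" for R
 proof -
 have c: "continuous_on (cball 0 R) (%x. (norm (u x))^2)" by (intro continuous_intros continuous_on_subset[OF assms]) auto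
 have "integrable lborel (%x. indicator (cball 0 R) x *\<^sub>R (norm (u x))\<^sup>2)"
 by (rule borel_integrable_compact[OF compact_cball c])
 then show ?thesis unfolding set_integrable_def by (subst integrable_completion) auto
 qed
 ultimately show ?thesis by (simp add: L2_loc_def)
qed

text \<open>\<open>weak_laplacian_reg\<close> moves the Laplacian from the test function to the
  wave, where the radial equation cancels it against the potential term.\<close>

lemma schroedinger_solution_partial_wave:
 assumes V: "V \<in> Linf" "AE x in lebesgue. V x = q (sq x)"
 and r: "reg (nat (abs l)) H H1 (%s. (cor (q s) - z)/4*H s)"
 shows "schroedinger_solution V z (partial_wave l H)"
 unfolding schroedinger_solution_def
proof (intro conjI ballI)
 define sig where "sig = (if 0 <= l then 1 else -1 :: real)"
 have sig: "sig^2 = 1" by (simp add: sig_def)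
 define n where "n = nat (abs l)"
 have u: "partial_wave l H = (%x. zeta sig x^n*H (sq x))" by (simp add: partial_wave_def fun_eq_iff sig_def n_def)
 show L: "partial_wave l H \<in> L2_loc"
 by (intro continuous_imp_L2_loc continuous_partial_wave reg_continuous[OF r])
 fix phi assume phi: "phi \<in> test_functions"
 obtain R where f: "smooth2 phi" "0 <= R" "!!x. norm x > R ==> phi x = 0" using test_functionsD[OF phi] by blast
 obtain C where C: "AE x in lebesgue. abs (V x) <= C" and Vm: "V \<in> borel_measurable lebesgue" using V(1) by (auto simp: Linf_def)
 have out: "phi x = 0" "laplacian phi x = 0" if "R^2 < sq x" for x
 proof -
 have "R^2 < (norm x)^2" using that by (simp add: sq_eq_norm)
 then have "R < norm x" using power2_less_imp_less by fastforce
 then show "phi x = 0" "laplacian phi x = 0"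
 using f(3) partial_outside[OF partial_outside[OF f(3)]] by (auto simp: laplacian_alt)
 qed
 have bounded: "\<exists>B. \<forall>x. norm (g x) <= B" if "continuous_on UNIV g" "!!x. R\<^sup>2 < sq x ==> g x = 0" for g :: "real^2 => complex"
 proof -
 have "bounded (g ` cball 0 R)" by (intro compact_imp_bounded compact_continuous_image continuous_on_subset[OF that(1)]) auto
 then obtain B where "\<forall>y\<in>g ` cball 0 R. norm y <= B" unfolding bounded_iff by blast
 then have B: "!!x. norm x <= R ==> norm (g x) <= B" by auto
 have "norm (g x) <= max B 0" for x
 proof (cases "norm x <= R")
 case False
 then have "R^2 < sq x" using f(2) by (simp add: sq_eq_norm power_strict_mono)
 then show ?thesis using that(2) by simp
 qed (use B[of x] in auto)
 then show ?thesis by blast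
 qed
 have cl: "continuous_on UNIV (laplacian phi)" unfolding laplacian_alt[abs_def]
 by (intro continuous_intros smooth2_continuous_on smooth2_partial f(1))
 have cphi: "continuous_on UNIV phi" by (intro smooth2_continuous_on f(1))
 obtain B1 where B1: "!!x. norm (laplacian phi x) <= B1" using bounded[OF cl out(2)] by blast
 obtain B2 where B2: "!!x. norm (phi x) <= B2" using bounded[OF cphi out(1)] by blast
 have B20: "0 <= B2" using B2[of 0] norm_ge_zero order_trans by blast
 have lm: "laplacian phi \<in> borel_measurable lebesgue"
 using borel_measurable_continuous_onI[OF cl] by (intro measurable_completion) simp
 have phim: "phi \<in> borel_measurable lebesgue" by (rule smooth2_measurable[OF f(1)])
 have Vc: "(%x. cor (V x) - z) \<in> borel_measurable lebesgue" using Vm by measurable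
 have i1: "integrable lebesgue (%x. partial_wave l H x*laplacian phi x)"
 by (rule L2_loc_mult_integrable[OF L lm]) (use B1 out in auto)
 have i2: "integrable lebesgue (%x. partial_wave l H x*((cor (V x) - z)*phi x))"
 proof (rule L2_loc_mult_integrable[OF L])
 show "(%x. (cor (V x) - z)*phi x) \<in> borel_measurable lebesgue" by (intro borel_measurable_times Vc phim)
 show "AE x in lebesgue. norm ((cor (V x) - z)*phi x) <= (abs C + norm z)*B2"
 using C
 proof eventually_elim
 case (elim x)
 have "norm (cor (V x) - z) <= abs C + norm z" using elim by (intro norm_triangle_le_diff) auto
 then show ?case unfolding norm_mult using B2[of x] by (intro mult_mono) auto
 qed
 qed (use out in auto)
 have "(LINT x|lebesgue. partial_wave l H x*(- laplacian phi x + (cor (V x) - z)*phi x))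
 = (LINT x|lebesgue. partial_wave l H x*((cor (V x) - z)*phi x) - partial_wave l H x*laplacian phi x)"
 by (simp add: algebra_simps)
 also have "... = (LINT x|lebesgue. partial_wave l H x*((cor (V x) - z)*phi x)) - (LINT x|lebesgue. partial_wave l H x*laplacian phi x)"
 by (rule Bochner_Integration.integral_diff[OF i2 i1])
 also have "(LINT x|lebesgue. partial_wave l H x*laplacian phi x) = (LINT x|lebesgue. 4*(zeta sig x^n*((cor (q (sq x)) - z)/4*H (sq x)))*phi x)"
 unfolding u by (rule weak_laplacian_reg[OF r[folded n_def] sig phi])
 also have "... = (LINT x|lebesgue. partial_wave l H x*((cor (V x) - z)*phi x))"
 proof (rule integral_cong_AE)
 have zm: "(%x. zeta sig x^n) \<in> borel_measurable lebesgue" by (intro smooth2_measurable smooth2_power smooth2_zeta)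
 have pm: "(%x. (cor (q (sq x)) - z)/4*H (sq x)) \<in> borel_measurable lebesgue"
 by (rule comp_sq_measurable[OF lbm_measurable[OF regD(1)[OF r]]])
 show "(%x. 4*(zeta sig x^n*((cor (q (sq x)) - z)/4*H (sq x)))*phi x) \<in> borel_measurable lebesgue"
 by (intro borel_measurable_times borel_measurable_const zm pm phim)
 show "AE x in lebesgue. 4*(zeta sig x^n*((cor (q (sq x)) - z)/4*H (sq x)))*phi x = partial_wave l H x*((cor (V x) - z)*phi x)"
 using V(2) by eventually_elim (simp add: u)
 qed (use i2 in auto)
 finally show "(LINT x|lebesgue. partial_wave l H x*(- laplacian phi x + (cor (V x) - z)*phi x)) = 0" by simp
qed

text \<open>A shift of the exponents by N turns the trigonometric sum into a polynomial in cis t; it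
  has infinitely many zeros on the circle, so every coefficient is 0.\<close>

lemma cis_independent:
 fixes b :: "int => complex"
 assumes L: "finite L" and z: "!!t. (\<Sum>l\<in>L. b l*cis (of_int l*t)) = 0" and l: "l \<in> L"
 shows "b l = 0"
proof -
 obtain N :: int where N: "!!k. k \<in> L ==> 0 <= k + N"
 proof -
 have "\<forall>k\<in>L. 0 <= k + (\<Sum>j\<in>L. abs j)"
 proof
 fix k assume "k \<in> L"
 then have "abs k <= (\<Sum>j\<in>L. abs j)" using L by (intro member_le_sum) auto
 then show "0 <= k + (\<Sum>j\<in>L. abs j)" by linarith
 qed
 then show thesis using that by blast
 qed
 define p where "p = (\<Sum>k\<in>L. monom (b k) (nat (k + N)))"
 have "poly p (cis t) = 0" for t
 proof -
 have "poly p (cis t) = (\<Sum>k\<in>L. cis (of_int N*t)*(b k*cis (of_int k*t)))"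
 unfolding p_def poly_sum poly_monom
 proof (rule sum.cong[OF refl])
 fix k assume "k \<in> L"
 then have "real (nat (k + N)) = of_int k + of_int N" using N by simp
 then have "cis t^nat (k + N) = cis (of_int k*t)*cis (of_int N*t)"
 proof -
 have "cis t^nat (k + N) = cis (real (nat (k + N))*t)" by (rule Complex.DeMoivre)
 also have "real (nat (k + N))*t = of_int k*t + of_int N*t" using \<open>real (nat (k + N)) = _\<close> by (simp add: distrib_right)
 finally show ?thesis by (simp only: cis_mult)
 qed
 then show "b k*cis t^nat (k + N) = cis (of_int N*t)*(b k*cis (of_int k*t))" by (simp only: mult_ac)
 qed
 also have "... = cis (of_int N*t)*(\<Sum>k\<in>L. b k*cis (of_int k*t))" by (rule sum_distrib_left[symmetric])
 finally show ?thesis using z by simp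
 qed
 then have "cis ` {0<..<1} \<subseteq> {w. poly p w = 0}" by auto
 moreover have "infinite (cis ` {0<..<1::real})"
 proof -
 have "inj_on cis {0<..<1}"
 proof (rule inj_onI)
 fix x y :: real assume xy: "x \<in> {0<..<1}" "y \<in> {0<..<1}" "cis x = cis y"
 then have "cos x = cos y" by (metis cis.sel(1))
 moreover have "0 <= x" "x <= pi" "0 <= y" "y <= pi" using xy(1,2) pi_gt3 unfolding greaterThanLessThan_iff by linarith+
 ultimately show "x = y" using cos_inj_pi[of x y] by simp
 qed
 moreover have "infinite {0<..<1::real}" by (rule infinite_Ioo) simp
 ultimately show ?thesis using finite_imageD[of cis "{0<..<1}"] by fast
 qed
 ultimately have "infinite {w. poly p w = 0}" by (rule infinite_super)
 then have "p = 0" using poly_roots_finite[of p] by (rule contrapos_np)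
 then have "coeff p (nat (l + N)) = 0" by simp
 also have "coeff p (nat (l + N)) = (\<Sum>k\<in>L. if k = l then b k else 0)"
 unfolding p_def coeff_sum coeff_monom
 proof (rule sum.cong[OF refl])
 fix k assume "k \<in> L"
 then have "nat (k + N) = nat (l + N) \<longleftrightarrow> k = l" using N l by (auto simp: eq_nat_nat_iff)
 then show "(if nat (k + N) = nat (l + N) then b k else 0) = (if k = l then b k else 0)" by simp
 qed
 finally show ?thesis using L l by simp
qed

lemma continuous_AE_eq_0:
 fixes u :: "real^2 => complex"
 assumes c: "continuous_on UNIV u" and z: "AE x in lebesgue. u x = 0"
 shows "u x = 0"
proof (rule ccontr)
 assume "u x ~= 0"
 have "open (u -` (- {0}))" using c by (intro open_vimage) (auto simp: continuous_on_eq_continuous_at)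
 moreover have "negligible (u -` (- {0}))"
 proof -
 have "AE x in lebesgue. x \<notin> u -` (- {0})" using z by eventually_elim simp
 then show ?thesis using AE_iff_null_sets[of "u -` (- {0})" lebesgue] \<open>open _\<close> by (simp add: negligible_iff_null_sets borel_open)
 qed
 ultimately show False using open_not_negligible \<open>u x ~= 0\<close> by blast
qed

text \<open>On a circle of small radius r the combination is a trigonometric sum whose coefficient
  at l is a_l r^|l| H_l(r^2), and H_l(r^2) is nonzero because H_l(0) = 1 and H_l is
  continuous.\<close>

lemma partial_waves_independent:
 assumes L: "finite L" and c: "!!l. l \<in> L ==> continuous_on UNIV (H l)" and 1: "!!l. l \<in> L ==> H l 0 = 1"
 and z: "AE x in lebesgue. (\<Sum>l\<in>L. a l*partial_wave l (H l) x) = 0" and l: "l \<in> L"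
 shows "a l = (0::complex)"
proof -
 have cu: "continuous_on UNIV (%x. \<Sum>l\<in>L. a l*partial_wave l (H l) x)"
 by (intro continuous_intros continuous_partial_wave c)
 have z0: "(\<Sum>l\<in>L. a l*partial_wave l (H l) x) = 0" for x by (rule continuous_AE_eq_0[OF cu z])
 have "isCont (H l) 0" using c[OF l] by (simp add: continuous_on_eq_continuous_at)
 then have "\<forall>\<^sub>F s in nhds 0. H l s ~= 0"
 unfolding isCont_def tendsto_at_iff_tendsto_nhds using 1[OF l] tendsto_imp_eventually_ne[of "H l" 1 _ 0] by simp
 then obtain d where d: "0 < d" "!!s. abs s < d ==> H l s ~= 0" unfolding eventually_nhds_metric by (auto simp: dist_real_def)
 define r where "r = sqrt (d/2)"
 have r: "0 < r" "r^2 = d/2" using d by (auto simp: r_def)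
 have "a l*(cor r^nat (abs l)*H l (r^2)) = 0"
 proof (rule cis_independent[OF L _ l, of "%l. a l*(cor r^nat (abs l)*H l (r^2))"])
 fix t :: real
 define x where "x = vec2 (r*cos t) (r * sin t)"
 have xx: "x $ 1 = r*cos t" "x $ 2 = r * sin t" by (auto simp: x_def vec2_def)
 have cx: "Complex (x $ 1) (x $ 2) = cor r*cis t" by (simp add: xx complex_eq_iff)
 have nx: "norm x = r"
 proof -
 have "(norm x)^2 = r^2*((cos t)^2 + (sin t)^2)" unfolding sq_eq_norm[symmetric] sq_def xx by (simp only: power_mult_distrib distrib_left)
 then have "(norm x)^2 = r^2" by (simp only: sin_cos_squared_add2 mult_1_right)
 then show ?thesis by (rule power2_eq_imp_eq) (use r in auto)
 qed
 have "cis (polar_angle x) = cis t"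
 proof -
 have "Complex (x $ 1) (x $ 2) ~= 0" using r unfolding cx by simp
 then have "cis (polar_angle x) = sgn (Complex (x $ 1) (x $ 2))" unfolding polar_angle_def by (rule cis_Arg)
 also have "... = cis t" unfolding cx using r by (simp add: sgn_mult sgn_of_real)
 finally show ?thesis .
 qed
 then have "cis (of_int k*polar_angle x) = cis (of_int k*t)" for k :: int
 by (simp only: cis_power_int[symmetric])
 then have "(\<Sum>l\<in>L. a l*partial_wave l (H l) x) = (\<Sum>l\<in>L. a l*(cor r^nat (abs l)*H l (r^2))*cis (of_int l*t))"
 unfolding partial_wave_polar nx by (simp add: mult.assoc)
 then show "(\<Sum>l\<in>L. a l*(cor r^nat (abs l)*H l (r^2))*cis (of_int l*t)) = 0" using z0 by simp
 qed
 moreover have "H l (r^2) ~= 0" using d r by auto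
 ultimately show ?thesis using r by simp
qed

text \<open>The normalisation at 0 excludes the zero function and makes states with distinct l
  independent.\<close>

definition resonant_state :: "(real^2 => real) => complex => int => (real => complex) => bool" where
 "resonant_state V lam l H \<longleftrightarrow> continuous_on UNIV H & H 0 = 1 &
 schroedinger_solution V (lam^2) (partial_wave l H) & outgoing lam (partial_wave l H)"

lemma resonant_state_imp_resonance:
 assumes "resonant_state V lam l H" "lam ~= 0" shows "is_resonance V lam"
proof -
 have "\<not> (AE x in lebesgue. partial_wave l H x = 0)"
 proof
 assume "AE x in lebesgue. partial_wave l H x = 0"
 then have "(1::complex) = 0"
 using assms(1) by (intro partial_waves_independent[of "{l}" "%_. H" "%_. 1" l]) (auto simp: resonant_state_def)
 then show False by simp
 qed
 then show ?thesis using assms unfolding is_resonance_def resonant_state_def by blast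
qed

text \<open>The angular momenta sharing a resonance m contribute one partial wave each, and these
  are independent, so the space of outgoing solutions at m has at least that dimension.\<close>

lemma resonant_states_multiplicity:
 assumes "!!l. l \<in> L ==> \<exists>H. resonant_state V (res l) l H"
 shows "resonances_with_multiplicity V L res"
 unfolding resonances_with_multiplicity_def
proof (intro allI impI)
 fix m F assume F: "finite F" "F \<subseteq> {l \<in> L. res l = m}"
 then have "\<forall>l\<in>F. \<exists>H. resonant_state V m l H" using assms by auto
 then obtain H where H: "!!l. l \<in> F ==> resonant_state V m l (H l)" by metis
 obtain f where f: "bij_betw f {0..<card F} F" using ex_bij_betw_nat_finite[OF F(1)] by blast
 have f': "bij_betw f {..<card F} F" using f by (simp add: atLeast0LessThan)
 define u where "u k = partial_wave (f k) (H (f k))" for k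
 have fF: "f k \<in> F" if "k < card F" for k using f' that by (auto simp: bij_betw_def)
 have "(\<forall>k<card F. schroedinger_solution V (m^2) (u k) & outgoing m (u k)) &
 (\<forall>a :: nat => complex. (AE x in lebesgue. (\<Sum>k<card F. a k*u k x) = 0) --> (\<forall>k<card F. a k = 0))"
 proof (intro conjI allI impI)
 fix k assume "k < card F"
 then show "schroedinger_solution V (m^2) (u k)" "outgoing m (u k)" using H[OF fF] by (auto simp: u_def resonant_state_def)
 next
 fix a :: "nat => complex" and k
 assume z: "AE x in lebesgue. (\<Sum>k<card F. a k*u k x) = 0" and k: "k < card F"
 define g where "g = inv_into {..<card F} f"
 have gf: "g (f j) = j" if "j < card F" for j unfolding g_def using f' that by (simp add: bij_betw_def inv_into_f_f)
 have "(\<Sum>k<card F. a k*u k x) = (\<Sum>l\<in>F. a (g l)*partial_wave l (H l) x)" for x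
 proof -
 have "(\<Sum>k<card F. a k*u k x) = (\<Sum>k<card F. a (g (f k))*partial_wave (f k) (H (f k)) x)"
 by (rule sum.cong[OF refl]) (simp add: gf u_def)
 also have "... = (\<Sum>l\<in>F. a (g l)*partial_wave l (H l) x)"
 by (rule sum.reindex_bij_betw[OF f', of "%l. a (g l)*partial_wave l (H l) x"])
 finally show ?thesis .
 qed
 then have "AE x in lebesgue. (\<Sum>l\<in>F. a (g l)*partial_wave l (H l) x) = 0" using z by simp
 then have "a (g (f k)) = 0"
 using H fF[OF k] by (intro partial_waves_independent[OF F(1), where H=H and a="%l. a (g l)"]) (auto simp: resonant_state_def)
 then show "a k = 0" using gf[OF k] by simp
 qed
 then show "enat (card F) <= resonance_multiplicity V m"
 unfolding resonance_multiplicity_def by (intro Sup_upper) blast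
qed

lemma has_sum_single_term:
 fixes f :: "int => complex"
 assumes "!!j. j ~= l ==> f j = 0" shows "(f has_sum f l) UNIV"
proof -
 have "(f has_sum sum f {l}) {l}" by (rule has_sum_finite) simp
 moreover have "(f has_sum f l) {l} \<longleftrightarrow> (f has_sum f l) UNIV"
 by (rule has_sum_cong_neutral) (use assms in auto)
 ultimately show ?thesis by simp
qed

text \<open>Beyond s0 take be s^(-n) Q(x s/s0). It is a Hankel wave because lam^2 = 4x/s0 makes (lam
  r/2)^2 = x s/s0. The factor be equates the values at s0, the matching equation equates the
  logarithmic derivatives, and \<open>reg_glue\<close> joins both pieces.\<close>

lemma resonant_state_exists:
 assumes V: "V \<in> Linf" "AE x in lebesgue. V x = q (sq x)" and q: "!!s. s0 <= s ==> q s = 0" and s0: "0 < s0" and l: "l ~= 0"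
 and G: "reg (nat (abs l)) G G1 (%s. (cor (q s) - 4*x/cor s0)/4*G s)" "G 0 = 1" "G s0 ~= 0"
 and x: "0 < Re x" "hQ (nat (abs l)) x ~= 0" "hq (nat (abs l)) x = cor s0*(G1 s0/G s0) + of_nat (nat (abs l))"
 and lam: "lam^2 = 4*x/cor s0" "0 < Re lam"
 shows "\<exists>H. resonant_state V lam l H"
proof -
 define n where "n = nat (abs l)"
 have n: "1 <= n" using l by (simp add: n_def)
 define y where "y s = x*cor (s/s0)" for s
 define N where "N s = hQ n (y s)*inverse (cor s)^n" for s
 define N1 where "N1 s = hY n (y s)*inverse (cor s)^Suc n" for s
 define be where "be = G s0/N s0"
 have y0: "y s0 = x" using s0 by (simp add: y_def)
 have yn: "y s \<notin> nonpos_Reals" if "0 < s" for s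
 proof -
 have "0 < Re (y s)" using x(1) s0 that by (simp add: y_def)
 then show ?thesis by (auto simp: complex_nonpos_Reals_iff)
 qed
 have N0: "N s0 ~= 0" using x(2) s0 by (simp add: N_def y0 n_def)
 have dy: "((%s. x*(s/cor s0)) has_field_derivative x/cor s0) (at (cor s))" for s
 using s0 by (auto intro!: derivative_eq_intros)
 have hQd: "((%s. hQ n (y s)) has_vector_derivative hQ1 n (y s)*(x/cor s0)) (at s)" if "0 < s" for s
 proof -
 have "((%u. hQ n (x*(u/cor s0))) has_field_derivative hQ1 n (x*(cor s/cor s0))*(x/cor s0)) (at (cor s))"
 by (rule DERIV_chain2[OF _ dy]) (use hQ_derivative yn[OF that] in "simp add: y_def")
 from has_vector_derivative_real_field[OF this] show ?thesis by (simp add: y_def)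
 qed
 have hYd: "((%s. hY n (y s)) has_vector_derivative - hQ n (y s)*(x/cor s0)) (at s)" if "0 < s" for s
 proof -
 have "((%u. hY n (x*(u/cor s0))) has_field_derivative - hQ n (x*(cor s/cor s0))*(x/cor s0)) (at (cor s))"
 by (rule DERIV_chain2[OF _ dy]) (use hY_derivative[OF n] yn[OF that] in "simp add: y_def")
 from has_vector_derivative_real_field[OF this] show ?thesis by (simp add: y_def)
 qed
 have Nd: "(N has_vector_derivative N1 s) (at s)" if s: "0 < s" for s
 proof -
 have "((%u::complex. inverse u^n) has_field_derivative of_nat n*inverse (cor s)^(n - 1)*(- (inverse (cor s))\<^sup>2)) (at (cor s))"
 using s by (auto intro!: derivative_eq_intros simp: power2_eq_square)
 note has_vector_derivative_mult[OF hQd[OF s] has_vector_derivative_real_field[OF this]]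
 moreover have "hQ n (y s)*(of_nat n*inverse (cor s)^(n - 1)*(- (inverse (cor s))\<^sup>2)) + hQ1 n (y s)*(x/cor s0)*inverse (cor s)^n = N1 s"
 proof -
 have a: "inverse (cor s)^(n - 1)*(inverse (cor s))^2 = inverse (cor s)^Suc n"
 using n by (simp flip: power_add del: power_Suc)
 have b: "x/cor s0*inverse (cor s)^n = y s*inverse (cor s)^Suc n" using s s0 by (simp add: y_def)
 have "hQ n (y s)*(of_nat n*inverse (cor s)^(n - 1)*(- (inverse (cor s))\<^sup>2)) + hQ1 n (y s)*(x/cor s0)*inverse (cor s)^n
 = hQ1 n (y s)*(x/cor s0*inverse (cor s)^n) - of_nat n*hQ n (y s)*(inverse (cor s)^(n - 1)*(inverse (cor s))^2)"
 by (simp add: algebra_simps)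
 also have "... = N1 s" unfolding a b N1_def hY_def by (simp add: algebra_simps)
 finally show ?thesis .
 qed
 ultimately show ?thesis unfolding N_def[abs_def] by simp
 qed
 have Nf: "cor s^Suc n*(be*N1 s) = be*hY n (y s)" if "0 < s" for s
 using that by (simp add: N1_def power_inverse del: power_Suc)
 have vc: "continuous_on {s0..} f" if "!!s. 0 < s ==> (f has_vector_derivative f' s) (at s)" for f f' :: "real => complex"
 proof (rule continuous_at_imp_continuous_on, rule ballI)
 fix t assume "t \<in> {s0..}"
 then have "0 < t" using s0 by simp
 from has_vector_derivative_continuous[OF that[OF this]] show "isCont f t" .
 qed
 have cN: "continuous_on {s0..} N" by (rule vc[OF Nd])
 have cN1: "continuous_on {s0..} N1" unfolding N1_def[abs_def] by (intro continuous_intros vc[OF hYd]) (use s0 in auto)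
 define H where "H s = (if s <= s0 then G s else be*N s)" for s
 define H1 where "H1 s = (if s <= s0 then G1 s else be*N1 s)" for s
 have "reg n (%s. if s <= s0 then G s else be*N s) (%s. if s <= s0 then G1 s else be*N1 s)
 (%s. if s <= s0 then (cor (q s) - 4*x/cor s0)/4*G s else - (x/cor s0)*(be*N s))"
 proof (rule reg_glue[OF G(1)[folded n_def] s0])
 show "continuous_on {s0..} (%s. be*N1 s)" "continuous_on {s0..} (%s. be*N s)" "continuous_on {s0..} (%s. - (x/cor s0)*(be*N s))"
 by (intro continuous_intros cN cN1)+
 show "((%s. be*N s) has_vector_derivative be*N1 s) (at s)" if "s0 < s" for s
 by (rule has_vector_derivative_mult_right[OF Nd]) (use that s0 in simp)
 show "((%s. cor s^Suc n*(be*N1 s)) has_vector_derivative cor s^n*(- (x/cor s0)*(be*N s))) (at s)" if "s0 < s" for s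
 proof (rule has_vector_derivative_transform_within_open[of _ _ _ "{0<..}"])
 have s: "0 < s" using that s0 by simp
 have "((%s. be*hY n (y s)) has_vector_derivative be*(- hQ n (y s)*(x/cor s0))) (at s)"
 by (rule has_vector_derivative_mult_right[OF hYd[OF s]])
 moreover have "be*(- hQ n (y s)*(x/cor s0)) = cor s^n*(- (x/cor s0)*(be*N s))"
 using s by (simp add: N_def power_inverse)
 ultimately show "((%s. be*hY n (y s)) has_vector_derivative cor s^n*(- (x/cor s0)*(be*N s))) (at s)" by (simp only:)
 show "be*hY n (y t) = cor t^Suc n*(be*N1 t)" if "t \<in> {0<..}" for t using Nf[of t] that by (simp only: greaterThan_iff)
 qed (use that s0 in auto)
 show bm: "be*N s0 = G s0" using N0 by (simp add: be_def)
 show "be*N1 s0 = G1 s0"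
 proof -
 have "be = G s0*cor s0^n/hQ n x" using s0 by (simp add: be_def N_def y0 power_inverse field_simps)
 moreover have "hY n x = hQ n x*(cor s0*(G1 s0/G s0))"
 using x(2,3) unfolding n_def[symmetric] hq_def hY_def by (simp add: field_simps)
 moreover have "hQ n x ~= 0" using x(2) by (simp add: n_def)
 ultimately have "be*N1 s0 = (G s0*cor s0^n)*(cor s0*(G1 s0/G s0))*inverse (cor s0)^Suc n"
 unfolding N1_def y0 by simp
 also have "... = G1 s0" using s0 G(3) by (simp add: power_inverse field_simps)
 finally show ?thesis .
 qed
 qed
 moreover have "(%s. if s <= s0 then (cor (q s) - 4*x/cor s0)/4*G s else - (x/cor s0)*(be*N s))
 = (%s. (cor (q s) - 4*x/cor s0)/4*(if s <= s0 then G s else be*N s))"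
 using q by (auto simp: fun_eq_iff)
 ultimately have r: "reg n H H1 (%s. (cor (q s) - lam\<^sup>2)/4*H s)" unfolding lam(1) H_def[abs_def] H1_def[abs_def] by simp
 have "outgoing lam (partial_wave l H)"
 proof -
 define sg where "sg = (if l < 0 then (-1)^n else 1 :: complex)"
 have sg: "sg * sg = 1" by (simp add: sg_def flip: power_mult_distrib)
 \<comment> \<open>Undoes the factor 1/(i pi w^n) of \<open>hankel1_eq_hQ\<close> with w = lam r/2;
   \<open>sg\<close> is the sign in H_(-n) = (-1)^n H_n and squares to 1.\<close>
 define C where "C = be * sg*(\<i>*cor pi*(lam/2)^n)"
 define c where "c j = (if j = l then C else 0)" for j
 have "((%j. c j*hankel1 j (lam*cor (norm v))*cis (of_int j*polar_angle v)) has_sum partial_wave l H v) UNIV"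
 if v: "sqrt s0 < norm v" for v
 proof -
 have nv: "0 < norm v" using v real_sqrt_gt_zero[OF s0] by linarith
 have "(sqrt s0)^2 < (norm v)^2" by (rule power_strict_mono[OF v]) (use s0 in auto)
 then have s0v: "s0 < (norm v)^2" using s0 by simp
 define w where "w = lam/2*cor (norm v)"
 have w: "0 < Re w" using lam(2) nv by (simp add: w_def)
 have w2: "w^2 = y ((norm v)^2)"
 unfolding w_def power_mult_distrib power_divide lam(1) y_def by simp
 have lam0: "lam ~= 0" using lam(2) by auto
 have hk: "hankel1 l (lam*cor (norm v)) = sg/(\<i>*cor pi*w^n)*hQ n (y ((norm v)^2))"
 using hankel1_eq_hQ[OF w l] unfolding n_def[symmetric] w2 sg_def by (simp add: w_def)
 have "C*hankel1 l (lam*cor (norm v)) = be*(sg * sg)*(hQ n (y ((norm v)^2))*inverse (cor (norm v))^n)"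
 unfolding hk C_def w_def power_mult_distrib using lam0 nv by (simp add: power_inverse field_simps)
 also have "... = cor (norm v)^n*H ((norm v)^2)"
 proof -
 have "inverse (cor (norm v))^n = cor (norm v)^n*inverse (cor ((norm v)^2))^n"
 proof -
 have "cor (norm v)*inverse (cor ((norm v)^2)) = inverse (cor (norm v))"
 using nv by (simp add: power2_eq_square)
 then show ?thesis by (simp only: power_mult_distrib[symmetric])
 qed
 then show ?thesis using s0v by (simp add: sg H_def N_def mult_ac)
 qed
 finally have eq: "C*hankel1 l (lam*cor (norm v)) = cor (norm v)^n*H ((norm v)^2)" .
 have "partial_wave l H v = c l*hankel1 l (lam*cor (norm v))*cis (of_int l*polar_angle v)"
 unfolding partial_wave_polar n_def[symmetric] using eq by (simp add: c_def)
 then show ?thesis using has_sum_single_term[of l "%j. c j*hankel1 j (lam*cor (norm v))*cis (of_int j*polar_angle v)"]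
 by (simp add: c_def)
 qed
 then show ?thesis unfolding outgoing_def by blast
 qed
 moreover have "schroedinger_solution V (lam^2) (partial_wave l H)"
 by (rule schroedinger_solution_partial_wave[OF V r[unfolded n_def]])
 moreover have "H 0 = 1" using s0 G(2) by (simp add: H_def)
 ultimately show ?thesis using reg_continuous[OF r, of UNIV] unfolding resonant_state_def by blast
qed

text \<open>Beyond s1 the flux is constant, and by \<open>bc\<close> it equals -n s^n G. So the wave
  is C r^(-|l|) exp(i l theta) with C nonzero; its only coefficient sits at the index l, which
  decides between the two cases.\<close>

lemma zero_energy_states:
 assumes V: "V \<in> Linf" "AE x in lebesgue. V x = q (sq x)" and q: "!!s. s1 <= s ==> q s = 0" and s1: "0 < s1" and l: "l ~= 0"
 and G: "reg (nat (abs l)) G G1 (%s. cor (q s)/4*G s)" "G 0 = 1" "G s1 ~= 0"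
 and bc: "!!s. s1 <= s ==> cor s*G1 s = - of_nat (nat (abs l))*G s"
 shows "1 < abs l ==> has_zero_eigenvalue (V)" "abs l = 1 ==> has_p_resonance V"
proof -
 define n where "n = nat (abs l)"
 have n: "1 <= n" using l by (simp add: n_def)
 note r = G(1)[folded n_def]
 have const: "cor s^n*G s = cor s1^n*G s1" if s: "s1 <= s" for s
 proof -
 have F: "cor t^Suc n*G1 t = - of_nat n*(cor t^n*G t)" if "s1 <= t" for t
 using bc[OF that] unfolding n_def[symmetric] power_Suc2 mult.assoc by simp
 have "cor s^Suc n*G1 s = prim (%t. cor t^n*(cor (q t)/4*G t)) s" by (rule reg_flux[OF r]) (use s s1 in simp)
 also have "... = prim (%t. cor t^n*(cor (q t)/4*G t)) s1"
 by (rule prim_eq_of_support[OF regD(5)[OF r]]) (use q s s1 in auto)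
 also have "... = cor s1^Suc n*G1 s1" by (rule reg_flux[OF r s1, symmetric])
 finally show ?thesis unfolding F[OF s] F[OF order_refl] using n by simp
 qed
 define C where "C = cor s1^n*G s1"
 have C: "C ~= 0" using G(3) s1 by (simp add: C_def)
 define c where "c j = (if j = l then C else 0)" for j
 have "((%j. c j*cor (norm v powi (- abs j))*cis (of_int j*polar_angle v)) has_sum partial_wave l G v) UNIV"
 if v: "sqrt s1 < norm v" for v
 proof -
 have nv: "0 < norm v" using v real_sqrt_gt_zero[OF s1] by linarith
 have sv: "s1 <= (norm v)^2" by (rule sqrt_le_D[OF less_imp_le[OF v]])
 have p: "norm v powi (- abs l) = inverse (norm v)^n"
 using power_int_minus[of "norm v" "abs l"] by (simp add: n_def power_int_def power_inverse)
 have "cor (norm v)^n*G ((norm v)^2) = inverse (cor (norm v))^n*(cor ((norm v)^2)^n*G ((norm v)^2))"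
 using nv by (simp add: power2_eq_square power_mult_distrib power_inverse field_simps)
 also have "... = C*cor (norm v powi (- abs l))" unfolding const[OF sv] C_def[symmetric] p by (simp add: mult.commute)
 finally have "partial_wave l G v = c l*cor (norm v powi (- abs l))*cis (of_int l*polar_angle v)"
 unfolding partial_wave_polar n_def[symmetric] by (simp add: c_def)
 then show ?thesis using has_sum_single_term[of l "%j. c j*cor (norm v powi (- abs j))*cis (of_int j*polar_angle v)"]
 by (simp add: c_def)
 qed
 then have out: "outgoing_at_zero c (partial_wave l G)" unfolding outgoing_at_zero_def by blast
 have sol: "schroedinger_solution V 0 (partial_wave l G)"
 by (rule schroedinger_solution_partial_wave[OF V]) (use G(1) in simp)
 have nz: "\<not> (AE x in lebesgue. partial_wave l G x = 0)"
 proof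
 assume "AE x in lebesgue. partial_wave l G x = 0"
 then have "(1::complex) = 0"
 using G(2) reg_continuous[OF G(1)] by (intro partial_waves_independent[of "{l}" "%_. G" "%_. 1" l]) auto
 then show False by simp
 qed
 show "has_zero_eigenvalue V" if "1 < abs l"
 unfolding has_zero_eigenvalue_def using sol out nz that by (intro exI[of _ "partial_wave l G"] exI[of _ c]) (auto simp: c_def)
 show "has_p_resonance V" if "abs l = 1"
 proof -
 have "l = 1 \<or> l = -1" using that by auto
 then have "c 0 = 0" "norm (c 1) + norm (c (-1)) > 0" using C by (auto simp: c_def)
 then show ?thesis unfolding has_p_resonance_def using sol out by blast
 qed
qed

section \<open>The family of potentials: threshold states and resonance asymptotics\<close>

section \<open>Radial families of potentials\<close>

text \<open>The profiles q eps are normalised so that the bounds hold for every s and the zero set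
  beyond s1 is common to all |eps| < e1; the radial equation can then be estimated
  pointwise.\<close>

locale radial_family =
 fixes I :: "real set" and V :: "real => real^2 => real" and V' :: "real^2 => real"
 and q :: "real => real => real" and M0 C1 e1 s1 :: real
 assumes I: "open I" "0 \<in> I" and smooth: "Linf_smooth_on I V" and deriv: "Linf_has_derivative_at V V' 0"
 and V'_nonneg: "AE x in lebesgue. 0 <= V' x" and V'_nonzero: "\<not> (AE x in lebesgue. V' x = 0)"
 and VL: "!!eps. eps \<in> I ==> V eps \<in> Linf"
 and e1: "0 < e1" "!!eps. abs eps < e1 ==> eps \<in> I" and C1: "0 <= C1" and s1: "0 < s1"
 and q_measurable: "!!eps. abs eps < e1 ==> q eps \<in> borel_measurable borel"
 and q_bounded: "!!eps s. abs eps < e1 ==> abs (q eps s) <= M0"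
 and q_lipschitz: "!!eps s. abs eps < e1 ==> abs (q eps s - q 0 s) <= C1*abs eps"
 and q_support: "!!eps s. abs eps < e1 ==> s1 <= s ==> q eps s = 0"
 and V_eq: "!!eps. abs eps < e1 ==> AE x in lebesgue. V eps x = q eps (sq x)"
begin

text \<open>The difference quotients of the family vanish there, and they approximate V' uniformly
  up to null sets.\<close>

lemma V'_outside: "AE x in lebesgue. s1 <= sq x --> V' x = 0"
proof -
 have "AE x in lebesgue. s1 <= sq x --> abs (V' x) <= inverse (real (Suc k))" for k
 proof -
 have k: "0 < inverse (real (Suc k))" by simp
 obtain d where d: "0 < d" "!!h. h ~= 0 ==> abs h < d ==> AE x in lebesgue. abs (V (0 + h) x - V 0 x - h*V' x) <= inverse (real (Suc k))*abs h"
 using Linf_has_derivative_atD[OF deriv k] by blast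
 define h where "h = min d e1/2"
 have h: "0 < h" "h < d" "h < e1" using d(1) e1(1) by (auto simp: h_def)
 have he: "abs h < e1" "\<bar>0::real\<bar> < e1" "h ~= 0" "abs h < d" using h by auto
 from d(2)[OF he(3,4)] V_eq[OF he(1)] V_eq[OF he(2)] show ?thesis
 proof eventually_elim
 case (elim x)
 show ?case
 proof
 assume "s1 <= sq x"
 then have "V h x = 0" "V 0 x = 0" using elim(2,3) q_support[OF he(1)] q_support[OF he(2)] by auto
 then have "h*abs (V' x) <= h*inverse (real (Suc k))" using elim(1) h by (simp add: abs_mult mult.commute)
 then show "abs (V' x) <= inverse (real (Suc k))" using h(1) by (rule mult_left_le_imp_le)
 qed
 qed
 qed
 then have "AE x in lebesgue. \<forall>k. s1 <= sq x --> abs (V' x) <= inverse (real (Suc k))" by (simp only: AE_all_countable) simp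
 then show ?thesis
 proof eventually_elim
 case (elim x)
 show ?case
 proof
 assume s: "s1 <= sq x"
 show "V' x = 0"
 proof (rule ccontr)
 assume "V' x ~= 0"
 then obtain k where "inverse (real (Suc k)) < abs (V' x)" using reals_Archimedean[of "abs (V' x)"] by auto
 then show False using elim s by (meson not_le)
 qed
 qed
 qed
qed

text \<open>At an accumulation point y > 0 of zeros both G and G1 would vanish, which backward
  uniqueness excludes; so the positive zeros are isolated.\<close>

lemma regular_zeros_countable:
 assumes r: "reg n G G1 (%s. P s*G s)" and P: "lbm P" and G: "G 0 ~= 0" "!!s. Im (G s) = 0" "!!s. Im (G1 s) = 0"
 shows "countable {s. 0 < s & Re (G s) = 0}"
proof -
 let ?Z = "{s. 0 < s & Re (G s) = 0}"
 have "\<not> y islimpt ?Z" if y: "0 < y" for y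
 proof
 assume "y islimpt ?Z"
 then obtain f where f: "!!k. f k \<in> ?Z - {y}" "f \<longlonglongrightarrow> y" unfolding islimpt_sequential by blast
 have d: "((%s. Re (G s)) has_real_derivative Re (G1 y)) (at y)"
 using bounded_linear.has_vector_derivative[OF bounded_linear_Re reg_derivative[OF r y]]
 by (simp add: has_real_derivative_iff_has_vector_derivative)
 have fy: "filterlim f (at y) sequentially" using f by (auto simp: filterlim_at)
 have "(%k. Re (G (f k))) \<longlonglongrightarrow> Re (G y)" by (rule isCont_tendsto_compose[OF DERIV_isCont[OF d] f(2)])
 moreover have "(%k. Re (G (f k))) = (%k. 0)" using f(1) by auto
 ultimately have g0: "Re (G y) = 0" using LIMSEQ_unique[of "%k. 0::real" 0 "Re (G y)"] by auto
 have "((%s. (Re (G s) - Re (G y))/(s - y)) \<longlongrightarrow> Re (G1 y)) (at y)" using d by (simp add: has_field_derivative_iff)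
 from filterlim_compose[OF this fy] have "(%k. (Re (G (f k)) - Re (G y))/(f k - y)) \<longlonglongrightarrow> Re (G1 y)" .
 moreover have "(%k. (Re (G (f k)) - Re (G y))/(f k - y)) = (%k. 0)" using f(1) g0 by auto
 ultimately have "Re (G1 y) = 0" using LIMSEQ_unique[of "%k. 0::real" 0 "Re (G1 y)"] by auto
 then have "G y = 0" "G1 y = 0" using g0 G by (auto simp: complex_eq_iff)
 then show False using volterra_backward_unique[OF r P y] G(1) by blast
 qed
 then have "?Z sparse_in {0<..}" unfolding sparse_in_def by (intro ballI exI[of _ "{0<..}"]) auto
 then have "countable ({0<..} \<inter> ?Z)" by (intro sparse_imp_countable) auto
 then show ?thesis by (rule countable_subset[rotated]) auto
qed

lemma potential_bound:
 assumes "abs eps < e1"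
 shows "lbm (%s. (cor (q eps s) - z)/4)" "norm ((cor (q eps s) - z)/4) <= (M0 + norm z)/4"
proof -
 have b: "norm ((cor (q eps s) - z)/4) <= (M0 + norm z)/4" for s
 proof -
 have "norm (cor (q eps s) - z) <= M0 + norm z" using q_bounded[OF assms, of s] by (intro norm_triangle_le_diff) simp
 then show ?thesis by (simp add: norm_divide)
 qed
 then show "norm ((cor (q eps s) - z)/4) <= (M0 + norm z)/4" .
 show "lbm (%s. (cor (q eps s) - z)/4)"
 proof (rule lbmI)
 show "(%s. (cor (q eps s) - z)/4) \<in> borel_measurable borel" using q_measurable[OF assms] by measurable
 qed (use b in blast)
qed

lemma M0_nonneg: "0 <= M0" using q_bounded[of 0 0] e1(1) by simp

text \<open>For small eps < 0 the eigenfunction gives (s G' + n G) G <= 0 beyond s1. The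
  coefficients (q eps - E)/4 converge uniformly to q 0/4, so the inequality passes to the threshold
  solution, and \<open>zero_energy_boundary_condition\<close> sharpens it to an equality.\<close>

lemma boundary_state:
 assumes ev: "has_eigenvalue_rising_to_zero I V l" and l: "l ~= 0"
 obtains G0 G01 where "reg (nat (abs l)) G0 G01 (%s. cor (q 0 s)/4*G0 s)" "G0 0 = 1"
 "!!s. Im (G0 s) = 0" "!!s. Im (G01 s) = 0" "!!s. s1 <= s ==> cor s*G01 s = - of_nat (nat (abs l))*G0 s"
proof -
 define n where "n = nat (abs l)"
 have n: "1 <= n" using l by (simp add: n_def)
 obtain ps0 E where ps0: "!!eps. eps \<in> I ==> eps < 0 ==> ps0 eps \<in> L2 & L2_norm (ps0 eps) = 1 &
 schroedinger_solution (V eps) (cor (E eps)) (ps0 eps) & has_angular_momentum l (ps0 eps)"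
 and E: "filterlim E (at_left 0) (at_left (0::real))"
 using ev unfolding has_eigenvalue_rising_to_zero_def by blast
 have z: "\<bar>0::real\<bar> < e1" using e1 by simp
 let ?P = "%eps s. (cor (q eps s) - cor (E eps))/4"
 obtain G0 G01 where G0: "reg n G0 G01 (%s. (cor (q 0 s) - cor 0)/4*G0 s)" "G0 0 = 1" "!!s. Im (G0 s) = 0" "!!s. Im (G01 s) = 0"
 by (rule volterra_real_exists[OF potential_bound[OF z, where z="cor 0"], of n]) auto
 have "\<exists>G G1. reg n G G1 (%s. ?P eps s*G s) & G 0 = 1 & (\<forall>s. Im (G s) = 0) & (\<forall>s. Im (G1 s) = 0)" if "abs eps < e1" for eps
 by (rule volterra_real_exists[OF potential_bound[OF that, where z="cor (E eps)"], of n]) auto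
 then have "\<forall>eps. \<exists>G. \<exists>G1. abs eps < e1 --> reg n G G1 (%s. ?P eps s*G s) & G 0 = 1 & (\<forall>s. Im (G s) = 0) & (\<forall>s. Im (G1 s) = 0)" by blast
 then obtain G where "\<forall>eps. \<exists>G1. abs eps < e1 --> reg n (G eps) G1 (%s. ?P eps s*G eps s) & G eps 0 = 1 & (\<forall>s. Im (G eps s) = 0) & (\<forall>s. Im (G1 s) = 0)"
 by (rule choice[THEN exE])
 then obtain G1 where "\<forall>eps. abs eps < e1 --> reg n (G eps) (G1 eps) (%s. ?P eps s*G eps s) & G eps 0 = 1 & (\<forall>s. Im (G eps s) = 0) & (\<forall>s. Im (G1 eps s) = 0)"
 by (rule choice[THEN exE])
 then have G: "reg n (G eps) (G1 eps) (%s. ?P eps s*G eps s)" "G eps 0 = 1" "!!s. Im (G eps s) = 0" "!!s. Im (G1 eps s) = 0" if "abs eps < e1" for eps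
 using that by blast+
 have E0: "(E \<longlongrightarrow> 0) (at_left 0)" "\<forall>\<^sub>F eps in at_left 0. E eps < 0"
 proof -
 have "(\<forall>\<^sub>F eps in at_left 0. E eps \<in> {..<0} & E eps ~= 0) & (E \<longlongrightarrow> 0) (at_left 0)" using E by (simp only: filterlim_at)
 then show "(E \<longlongrightarrow> 0) (at_left 0)" "\<forall>\<^sub>F eps in at_left 0. E eps < 0" by (auto elim!: eventually_mono simp del: eventually_conj_iff)
 qed
 have ev1: "\<forall>\<^sub>F eps in at_left 0. - e1 < eps & eps < 0" using eventually_at_left_real[of "- e1" 0] e1(1) by (auto elim!: eventually_mono)
 have ev2: "\<forall>\<^sub>F eps in at_left 0. abs (E eps) < 1" using tendstoD[OF E0(1), of 1] by (simp add: dist_real_def)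
 have le: "(s2*Re (G01 s2) + real n*Re (G0 s2))*Re (G0 s2) <= 0" if s2: "s1 < s2" for s2
 proof (rule tendsto_upperbound)
 have s20: "0 < s2" using s2 s1 by simp
 define b where "b = (M0 + 1)/4"
 have b: "0 <= b" using M0_nonneg by (simp add: b_def)
 define eta where "eta eps = (C1*abs eps + abs (E eps))/4" for eps
 have eta: "(eta \<longlongrightarrow> 0) (at_left 0)" unfolding eta_def[abs_def]
 using E0(1) by (auto intro!: tendsto_eq_intros simp: tendsto_ident_at)
 define Ga where "Ga = 2*exp ((2*b + 1) * s2)"
 have est: "\<forall>\<^sub>F eps in at_left 0. norm (G eps s2 - G0 s2) <= s2*Ga^2*eta eps & norm (G1 eps s2 - G01 s2) <= (b*(s2*Ga^2) + Ga)*eta eps"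
 using ev1 ev2
 proof eventually_elim
 case (elim eps)
 then have e: "abs eps < e1" by simp
 have eta0: "0 <= eta eps" using C1 by (simp add: eta_def)
 have b1: "norm ((cor (q 0 s) - cor 0)/4) <= b" for s
 using potential_bound(2)[OF z, of s "cor 0"] by (simp add: b_def)
 have b2: "norm (?P eps s) <= b" for s
 using potential_bound(2)[OF e, of s "cor (E eps)"] elim by (simp add: b_def)
 have d: "norm (?P eps s - (cor (q 0 s) - cor 0)/4) <= eta eps" for s
 proof -
 have "?P eps s - (cor (q 0 s) - cor 0)/4 = cor ((q eps s - q 0 s - E eps)/4)" by simp
 then have "norm (?P eps s - (cor (q 0 s) - cor 0)/4) = abs (q eps s - q 0 s - E eps)/4" by (simp only: norm_of_real abs_divide abs_numeral)
 also have "... <= eta eps"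
 unfolding eta_def by (rule divide_right_mono) (use q_lipschitz[OF e, of s] in linarith, simp)
 finally show ?thesis .
 qed
 note pert = volterra_perturbation[OF G0(1) _ G(1)[OF e] _ b _ _ eta0 _ s20 order_refl, folded Ga_def]
 show ?case
 by (intro conjI pert) (use G0(2) G(2)[OF e] b1 b2 d in auto)
 qed
 have lG: "((%eps. G eps s2) \<longlongrightarrow> G0 s2) (at_left 0)"
 proof (rule LIM_zero_cancel, rule Lim_null_comparison)
 show "\<forall>\<^sub>F eps in at_left 0. norm (G eps s2 - G0 s2) <= s2*Ga^2*eta eps" using est by eventually_elim blast
 show "((%eps. s2*Ga^2*eta eps) \<longlongrightarrow> 0) (at_left 0)" by (rule tendsto_mult_right_zero[OF eta])
 qed
 have lG1: "((%eps. G1 eps s2) \<longlongrightarrow> G01 s2) (at_left 0)"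
 proof (rule LIM_zero_cancel, rule Lim_null_comparison)
 show "\<forall>\<^sub>F eps in at_left 0. norm (G1 eps s2 - G01 s2) <= (b*(s2*Ga^2) + Ga)*eta eps" using est by eventually_elim blast
 show "((%eps. (b*(s2*Ga^2) + Ga)*eta eps) \<longlongrightarrow> 0) (at_left 0)" by (rule tendsto_mult_right_zero[OF eta])
 qed
 show "((%eps. (s2*Re (G1 eps s2) + real n*Re (G eps s2))*Re (G eps s2)) \<longlongrightarrow> (s2*Re (G01 s2) + real n*Re (G0 s2))*Re (G0 s2)) (at_left 0)"
 by (intro tendsto_intros lG lG1)
 show "\<forall>\<^sub>F eps in at_left 0. (s2*Re (G1 eps s2) + real n*Re (G eps s2))*Re (G eps s2) <= 0"
 using ev1 E0(2)
 proof eventually_elim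
 case (elim eps)
 then have e: "abs eps < e1" by simp
 have "eps \<in> I" by (rule e1(2)[OF e])
 with ps0[of eps] elim have p: "ps0 eps \<in> L2" "L2_norm (ps0 eps) = 1" "schroedinger_solution (V eps) (cor (E eps)) (ps0 eps)" "has_angular_momentum l (ps0 eps)"
 by auto
 have El: "E eps <= 0" using elim by simp
 show ?case
 by (rule eigenfunction_no_growth[OF p(1,2) VL[OF \<open>eps \<in> I\<close>] V_eq[OF e] p(3,4) El n_def n q_measurable[OF e] q_bounded[OF e] q_support[OF e] s1 G[OF e] s2])
 qed
 qed auto
 show thesis
 proof (rule that)
 show r: "reg (nat (abs l)) G0 G01 (%s. cor (q 0 s)/4*G0 s)" using G0(1) by (simp add: n_def)
 show "G0 0 = 1" "!!s. Im (G0 s) = 0" "!!s. Im (G01 s) = 0" by (fact G0)+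
 show "cor s*G01 s = - of_nat (nat (abs l))*G0 s" if "s1 <= s" for s
 unfolding n_def[symmetric]
 by (rule zero_energy_boundary_condition[OF r[folded n_def] n s1 _ G0(3,4) le that]) (use q_support[OF z] in auto)
 qed
qed

text \<open>The radial integral is 1/pi times the pairing of V eps - V 0 with the planar weight w(x)
  = |x|^(2n) G0(|x|^2)^2 cut off at |x|^2 = s1, so Taylor's formula for such pairings applies. The
  slope is positive: V' is nonnegative, not zero and concentrated in that disc, where w vanishes
  only on a null set since G0 has countably many positive zeros.\<close>

lemma integral_expansion:
 assumes G0: "reg n G0 G01 (%s. cor (q 0 s)/4*G0 s)" "G0 0 = 1" "!!s. Im (G0 s) = 0" "!!s. Im (G01 s) = 0"
 obtains b1 C2 e2 where "0 < b1" "0 <= C2" "0 < e2" "e2 <= e1" "!!eps. abs eps < e2 ==>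
 norm (prim (%t. cor t^n*(cor (q eps t - q 0 t)*(G0 t*G0 t))) s1 - cor (b1*eps)) <= C2*eps^2"
proof -
 have z: "\<bar>0::real\<bar> < e1" using e1 by simp
 define om where "om s = indicator {0..s1} s *\<^sub>R (s^n*(Re (G0 s))^2)" for s :: real
 have G0c: "continuous_on S (%s. Re (G0 s))" for S by (intro continuous_intros reg_continuous[OF G0(1)])
 have G0m: "(%s. Re (G0 s)) \<in> borel_measurable borel" by (intro borel_measurable_continuous_onI G0c)
 have omm: "om \<in> borel_measurable borel" unfolding om_def[abs_def] using G0m by measurable
 have omi: "integrable lborel om" unfolding om_def[abs_def]
 by (rule borel_integrable_compact) (auto intro!: continuous_intros G0c)
 have omi': "integrable lborel (%s. indicator {0..} s *\<^sub>R om s)"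
 by (rule Bochner_Integration.integrable_bound[OF omi]) (use omm in "auto simp: indicator_def")
 define w where "w x = om (sq x)" for x :: "real^2"
 have wi: "integrable lebesgue w" unfolding w_def[abs_def] integral_sq(2)[OF omm] by (rule omi')
 have w0: "0 <= w x" for x unfolding w_def om_def by (simp add: indicator_def)
 have Vint: "(LINT x|lebesgue. V eps x*w x) = pi*(\<integral>s. q eps s * om s \<partial>lborel)" "integrable lborel (%s. q eps s * om s)" if e: "abs eps < e1" for eps
 proof -
 note qm = q_measurable[OF e]
 have qom: "(%s. q eps s * om s) \<in> borel_measurable borel" using qm omm by measurable
 have "(LINT x|lebesgue. V eps x*w x) = (LINT x|lebesgue. q eps (sq x) * om (sq x))"
 proof (rule integral_cong_AE)
 show "(%x. V eps x*w x) \<in> borel_measurable lebesgue"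
 using Linf_integrable_mult[OF VL[OF e1(2)[OF e]] wi] by blast
 show "(%x. q eps (sq x) * om (sq x)) \<in> borel_measurable lebesgue"
 by (rule measurable_compose[OF measurable_sq_lebesgue qom])
 show "AE x in lebesgue. V eps x*w x = q eps (sq x) * om (sq x)" using V_eq[OF e] by eventually_elim (simp add: w_def)
 qed
 also have "... = pi *\<^sub>R (\<integral>s. indicator {0..} s *\<^sub>R (q eps s * om s) \<partial>lborel)" by (rule integral_sq(1)[OF qom])
 also have "(%s. indicator {0..} s *\<^sub>R (q eps s * om s)) = (%s. q eps s * om s)" by (auto simp: fun_eq_iff om_def indicator_def)
 finally show "(LINT x|lebesgue. V eps x*w x) = pi*(\<integral>s. q eps s * om s \<partial>lborel)" by simp
 show "integrable lborel (%s. q eps s * om s)"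
 proof (rule Bochner_Integration.integrable_bound)
 show "integrable lborel (%s. M0 * om s)" using omi by simp
 show "AE s in lborel. norm (q eps s * om s) <= norm (M0 * om s)"
 using q_bounded[OF e] M0_nonneg by (auto simp: abs_mult intro!: mult_right_mono)
 qed (use qom in simp)
 qed
 have pr: "prim (%t. cor t^n*(cor (q eps t - q 0 t)*(G0 t*G0 t))) s1
 = cor (((LINT x|lebesgue. V eps x*w x) - (LINT x|lebesgue. V 0 x*w x))/pi)" if e: "abs eps < e1" for eps
 proof -
 have "prim (%t. cor t^n*(cor (q eps t - q 0 t)*(G0 t*G0 t))) s1
 = (\<integral>t. cor (q eps t * om t - q 0 t * om t) \<partial>lborel)"
 unfolding prim_def set_lebesgue_integral_def
 proof (rule Bochner_Integration.integral_cong[OF refl])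
 fix t :: real
 have "G0 t = cor (Re (G0 t))" using G0(3)[of t] by (simp add: complex_eq_iff)
 then have "G0 t*G0 t = cor ((Re (G0 t))^2)" by (metis of_real_mult power2_eq_square)
 then show "indicat_real {0..s1} t *\<^sub>R (cor t^n*(cor (q eps t - q 0 t)*(G0 t*G0 t))) = cor (q eps t * om t - q 0 t * om t)"
 by (simp add: om_def indicator_def algebra_simps)
 qed
 also have "... = cor (\<integral>t. q eps t * om t - q 0 t * om t \<partial>lborel)" by (rule integral_complex_of_real)
 also have "(\<integral>t. q eps t * om t - q 0 t * om t \<partial>lborel) = ((LINT x|lebesgue. V eps x*w x) - (LINT x|lebesgue. V 0 x*w x))/pi"
 unfolding Vint(1)[OF e] Vint(1)[OF z] Bochner_Integration.integral_diff[OF Vint(2)[OF e] Vint(2)[OF z]]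
 by (simp add: diff_divide_distrib)
 finally show ?thesis .
 qed
 define b1 where "b1 = (LINT x|lebesgue. V' x*w x)/pi"
 obtain C r where C: "0 < r" "!!t. abs t < r ==> \<bar>(LINT x|lebesgue. V t x*w x) - (LINT x|lebesgue. V 0 x*w x) - t*(LINT x|lebesgue. V' x*w x)\<bar> <= C*t^2"
 using Linf_smooth_integral_second_order[OF I smooth deriv wi] by blast
 have V'L: "V' \<in> Linf" using deriv by (simp add: Linf_has_derivative_at_def)
 have V'wi: "integrable lebesgue (%x. V' x*w x)" by (rule Linf_integrable_mult[OF V'L wi])
 have V'w0: "AE x in lebesgue. 0 <= V' x*w x" using V'_nonneg by eventually_elim (simp add: w0)
 have "0 < (LINT x|lebesgue. V' x*w x)"
 proof (rule ccontr)
 assume "\<not> 0 < (LINT x|lebesgue. V' x*w x)"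
 then have "(LINT x|lebesgue. V' x*w x) = 0" using integral_nonneg_AE[OF V'w0] by linarith
 then have a: "AE x in lebesgue. V' x*w x = 0" using integral_nonneg_eq_0_iff_AE[OF V'wi V'w0] by simp
 let ?Z = "{s. 0 < s & Re (G0 s) = 0}"
 have lP: "lbm (%s. cor (q 0 s)/4)" using potential_bound(1)[OF z, of 0] by simp
 have cZ: "countable ?Z" by (rule regular_zeros_countable[OF G0(1) lP]) (use G0 in auto)
 have "AE s in lborel. s \<notin> ?Z"
 by (rule AE_not_in) (use countable_imp_null_set_lborel[OF cZ] in simp)
 then have "AE s in lborel. 0 <= s --> \<not> (0 < s & Re (G0 s) = 0)" by eventually_elim blast
 then have "AE x in lebesgue. \<not> (0 < sq x & Re (G0 (sq x)) = 0)"
 by (subst AE_sq_iff[of "%s. \<not> (0 < s & Re (G0 s) = 0)"]) (use G0m in measurable)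
 with a V'_outside AE_sq_pos have "AE x in lebesgue. V' x = 0"
 proof eventually_elim
 case (elim x)
 show ?case
 proof (cases "s1 <= sq x")
 case False
 moreover have "Re (G0 (sq x)) ~= 0" "0 < sq x" using elim by blast+
 moreover have "0 < sq x^n" by (rule zero_less_power[OF \<open>0 < sq x\<close>])
 ultimately have "0 < sq x^n*(Re (G0 (sq x)))^2" by (intro mult_pos_pos) auto
 moreover have "w x = sq x^n*(Re (G0 (sq x)))^2" using False by (simp add: w_def om_def)
 ultimately have "w x ~= 0" by linarith
 then show ?thesis using elim by simp
 qed (use elim in simp)
 qed
 then show False using V'_nonzero by blast
 qed
 then have b1: "0 < b1" by (simp add: b1_def)
 show thesis
 proof (rule that[OF b1, of "abs C/pi" "min e1 r"])
 fix eps assume e: "abs eps < min e1 r"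
 have "norm (prim (%t. cor t^n*(cor (q eps t - q 0 t)*(G0 t*G0 t))) s1 - cor (b1*eps))
 = \<bar>((LINT x|lebesgue. V eps x*w x) - (LINT x|lebesgue. V 0 x*w x) - eps*(LINT x|lebesgue. V' x*w x))/pi\<bar>"
 by (subst pr) (use e in "auto simp: b1_def diff_divide_distrib mult.commute simp flip: of_real_diff of_real_mult of_real_divide")
 also have "... <= C*eps^2/pi" using C(2)[of eps] e by (simp add: abs_divide divide_right_mono)
 also have "... <= abs C/pi*eps^2" by (simp add: divide_right_mono mult_right_mono)
 finally show "norm (prim (%t. cor t^n*(cor (q eps t - q 0 t)*(G0 t*G0 t))) s1 - cor (b1*eps)) <= abs C/pi*eps^2" .
 qed (use C(1) e1 in auto)
qed

lemma threshold_states: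
 assumes ev: "has_eigenvalue_rising_to_zero I V l"
 shows "1 < abs l ==> has_zero_eigenvalue (V 0)" "abs l = 1 ==> has_p_resonance (V 0)"
proof -
 have z: "\<bar>0::real\<bar> < e1" using e1 by simp
 have *: "(1 < abs l --> has_zero_eigenvalue (V 0)) & (abs l = 1 --> has_p_resonance (V 0))" if l: "l ~= 0"
 proof -
 obtain G0 G01 where G0: "reg (nat (abs l)) G0 G01 (%s. cor (q 0 s)/4*G0 s)" "G0 0 = 1"
 "!!s. Im (G0 s) = 0" "!!s. Im (G01 s) = 0" "!!s. s1 <= s ==> cor s*G01 s = - of_nat (nat (abs l))*G0 s"
 using boundary_state[OF ev l] by blast
 have lP: "lbm (%s. cor (q 0 s)/4)" using potential_bound(1)[OF z, of 0] by simp
 have "G0 s1 ~= 0"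
 proof
 assume g: "G0 s1 = 0"
 then have "G01 s1 = 0" using G0(5)[of s1] s1 by simp
 then show False using volterra_backward_unique[OF G0(1) lP s1 g] G0(2) by simp
 qed
 then show ?thesis using zero_energy_states[OF VL[OF I(2)] V_eq[OF z] q_support[OF z] s1 l G0(1,2) _ G0(5)] by blast
 qed
 show "1 < abs l ==> has_zero_eigenvalue (V 0)" using*by fastforce
 show "abs l = 1 ==> has_p_resonance (V 0)" using*by fastforce
qed

text \<open>One eigenvalue branch with angular momentum l yields resonant states for every k with
  |k| = |l|, because the radial equation involves only the absolute value.\<close>

lemma matching_branch:
 assumes ev: "has_eigenvalue_rising_to_zero I V l" and l: "l ~= 0" and n: "n = nat (abs l)"
 obtains r A B C delta0 where "0 < r" "r <= e1" "0 <= A" "0 < B" "0 <= C"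
 "!!eps. abs eps < r ==> continuous_on (ball 0 r) (%x. delta0 x eps)"
 "!!x eps. abs eps < r ==> norm x < r ==> norm (delta0 x eps - (cor (B*eps) - cor A*x)) <= C*(abs eps + norm x)^2"
 "!!x eps. abs eps < r ==> norm x < r ==> 0 <= Im x ==> Im (delta0 x eps) <= 0"
 "!!x eps lam k. abs eps < r ==> norm x < r ==> nat (abs k) = n ==> 0 < Re x ==> hQ n x ~= 0 ==> hq n x = delta0 x eps ==>
 lam\<^sup>2 = 4*x/cor s1 ==> 0 < Re lam ==> \<exists>H. resonant_state (V eps) lam k H"
proof -
 have n1: "1 <= n" using l by (simp add: n)
 obtain G0 G01 where G0: "reg n G0 G01 (%s. cor (q 0 s)/4*G0 s)" "G0 0 = 1"
 "!!s. Im (G0 s) = 0" "!!s. Im (G01 s) = 0" "!!s. s1 <= s ==> cor s*G01 s = - of_nat n*G0 s"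
 using boundary_state[OF ev l] unfolding n by blast
 obtain b1 C2 e2 where b: "0 < b1" "0 <= C2" "0 < e2" "e2 <= e1" "!!eps. abs eps < e2 ==>
 norm (prim (%t. cor t^n*(cor (q eps t - q 0 t)*(G0 t*G0 t))) s1 - cor (b1*eps)) <= C2*eps^2"
 using integral_expansion[OF G0(1-4)] by blast
 have ee: "abs eps < e2 ==> abs eps < e1" for eps using b(4) by simp
 show thesis
 proof (rule matching_function[OF n1 s1 b(3) q_measurable[OF ee] q_bounded[OF ee] q_lipschitz[OF ee] C1 G0(1-3) G0(5)[OF order_refl] b(1,2,5)])
 fix r A B C G G1
 assume m: "0 < r" "r <= e2" "0 <= A" "0 < B" "0 <= C"
 "!!x eps. abs eps < r ==> norm x < r ==> reg n (G x eps) (G1 x eps) (%s. (cor (q eps s) - 4*x/cor s1)/4*G x eps s)"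
 "!!x eps. abs eps < r ==> norm x < r ==> G x eps 0 = 1" "!!x eps. abs eps < r ==> norm x < r ==> G x eps s1 ~= 0"
 "!!eps. abs eps < r ==> continuous_on (ball 0 r) (%x. cor s1*(G1 x eps s1/G x eps s1) + of_nat n)"
 "!!x eps. abs eps < r ==> norm x < r ==>
 norm (cor s1*(G1 x eps s1/G x eps s1) + of_nat n - (cor (B*eps) - cor A*x)) <= C*(abs eps + norm x)^2"
 "!!x eps. abs eps < r ==> norm x < r ==> 0 <= Im x ==> Im (cor s1*(G1 x eps s1/G x eps s1) + of_nat n) <= 0"
 show thesis
 proof (rule that[OF m(1) _ m(3,4,5) m(9,10,11)])
 show "r <= e1" using m(2) b(4) by simp
 fix x lam :: complex and eps :: real and k :: int
 assume a: "abs eps < r" "norm x < r" "nat (abs k) = n" "0 < Re x" "hQ n x ~= 0"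
 "hq n x = cor s1*(G1 x eps s1/G x eps s1) + of_nat n" "lam^2 = 4*x/cor s1" "0 < Re lam"
 have e: "abs eps < e1" using a(1) m(2) b(4) by simp
 have k: "k ~= 0" using a(3) n1 by auto
 show "\<exists>H. resonant_state (V eps) lam k H"
 by (rule resonant_state_exists[OF VL[OF e1(2)[OF e]] V_eq[OF e] q_support[OF e] s1 k])
 (use m(6,7,8)[OF a(1,2)] a in auto)
 qed
 qed
qed

lemma fourth_quadrant_of_square:
 assumes "Im (lam^2) < 0" "0 <= Re lam" shows "in_fourth_quadrant lam"
proof -
 have "Re lam*Im lam < 0" using assms(1) by (simp add: power2_eq_square mult.commute)
 then show ?thesis using assms(2) by (auto simp: in_fourth_quadrant_def mult_less_0_iff)
qed

text \<open>With lam^2 = 4x/s1 and al = 4a/s1 the difference lam^2 - al eps is of order eps^2 up to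
  the logarithmic factor. Dividing by lam + sqrt(al eps), whose real part is at least sqrt(al eps),
  gives the order eps^(3/2).\<close>

lemma resonances_ge_2:
 assumes ev: "has_eigenvalue_rising_to_zero I V l" and l: "1 < abs l"
 obtains al e lam where "0 < al" "0 < e" "{0<..<e} \<subseteq> I"
 "!!eps. 0 < eps ==> eps < e ==> in_fourth_quadrant (lam eps) & (\<exists>H. resonant_state (V eps) (lam eps) l H)"
 "(%eps. lam eps - cor (sqrt (al*eps))) \<in> O[at_right 0](%eps. cor
 (eps powr (3/2)*(1 + (if (abs l) = 2 then 1 else 0)*ln eps)))"
proof -
 define n where "n = nat (abs l)"
 have n: "2 <= n" using l by (simp add: n_def)
 have l0: "l ~= 0" using l by auto
 obtain r A B C delta0 where m: "0 < r" "r <= e1" "0 <= A" "0 < B" "0 <= C"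
 "!!eps. abs eps < r ==> continuous_on (ball 0 r) (%x. delta0 x eps)"
 "!!x eps. abs eps < r ==> norm x < r ==> norm (delta0 x eps - (cor (B*eps) - cor A*x)) <= C*(abs eps + norm x)^2"
 "!!x eps. abs eps < r ==> norm x < r ==> 0 <= Im x ==> Im (delta0 x eps) <= 0"
 "!!x eps lam k. abs eps < r ==> norm x < r ==> nat (abs k) = n ==> 0 < Re x ==> hQ n x ~= 0 ==> hq n x = delta0 x eps ==>
 lam\<^sup>2 = 4*x/cor s1 ==> 0 < Re lam ==> \<exists>H. resonant_state (V eps) lam k H"
 by (rule matching_branch[OF ev l0 n_def]) blast
 obtain a K e where s: "0 < a" "0 < e" "0 <= K" "!!eps. 0 < eps ==> eps < e ==>
 \<exists>x. 0 < Re x & Im x < 0 & norm x < r & hQ n x ~= 0 & hq n x = delta0 x eps &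
 norm (x - cor (a*eps)) <= K*eps^2*(1 + eps^(n - 2)*(1 + abs (ln eps)))"
 by (rule matching_solution_ge_2[OF n m(4,3,5,1,6,7,8)]) (assumption | (rule that; assumption))+
 from s(4) have "\<forall>eps. \<exists>x. 0 < eps & eps < e --> 0 < Re x & Im x < 0 & norm x < r & hQ n x ~= 0 & hq n x = delta0 x eps &
 norm (x - cor (a*eps)) <= K*eps^2*(1 + eps^(n - 2)*(1 + abs (ln eps)))" by blast
 then obtain x where x: "\<forall>eps. 0 < eps & eps < e --> 0 < Re (x eps) & Im (x eps) < 0 & norm (x eps) < r & hQ n (x eps) ~= 0 & hq n (x eps) = delta0 (x eps) eps &
 norm (x eps - cor (a*eps)) <= K*eps^2*(1 + eps^(n - 2)*(1 + abs (ln eps)))" by (rule choice[THEN exE])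
 define lam where "lam eps = csqrt (4*x eps/cor s1)" for eps
 define al where "al = 4*a/s1"
 have al: "0 < al" using s(1) s1 by (simp add: al_def)
 \<comment> \<open>Below exp(-4) one has ln eps < -4, so |1 + ln eps| stays away from 0 and controls
   2 + |ln eps| up to a factor 4, as needed for |l| = 2.\<close>
 define e' where "e' = min e (min r (exp (-4)))"
 have e': "0 < e'" "e' <= e" "e' <= r" "e' <= exp (-4)" using s(2) m(1) by (auto simp: e'_def)
 have lam2: "(lam eps)^2 = 4*x eps/cor s1" for eps by (simp add: lam_def)
 have q4: "in_fourth_quadrant (lam eps)" if "0 < eps" "eps < e'" for eps
 proof (rule fourth_quadrant_of_square)
 have "Im (x eps) < 0" using x that e' by simp
 then show "Im ((lam eps)^2) < 0" unfolding lam2 using s1 by (simp add: divide_neg_pos)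
 show "0 <= Re (lam eps)" using csqrt_principal[of "4*x eps/cor s1"] by (auto simp: lam_def)
 qed
 have bound: "norm (lam eps - cor (sqrt (al*eps))) <= (4*K/(s1 * sqrt al))*(eps * sqrt eps*(1 + eps^(n - 2)*(1 + abs (ln eps))))"
 if e: "0 < eps" "eps < e'" for eps
 proof -
 have R: "0 < Re (lam eps)" using q4[OF e] by (simp add: in_fourth_quadrant_def)
 let ?t = "sqrt (al*eps)"
 have t: "0 < ?t" using al e by simp
 have d: "?t <= norm (lam eps + cor ?t)"
 using complex_Re_le_cmod[of "lam eps + cor ?t"] R by simp
 have "(lam eps - cor ?t)*(lam eps + cor ?t) = (lam eps)^2 - cor (?t\<^sup>2)" by (simp add: power2_eq_square algebra_simps flip: of_real_mult)
 also have "?t\<^sup>2 = 4*a*eps/s1" using mult_pos_pos[OF al e(1)] by (simp add: al_def)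
 also have "(lam eps)^2 - cor (4*a*eps/s1) = cor (4/s1)*(x eps - cor (a*eps))"
 unfolding lam2 using s1 by (simp add: field_simps)
 finally have "norm ((lam eps - cor ?t)*(lam eps + cor ?t)) = norm (cor (4/s1)*(x eps - cor (a*eps)))" by (rule arg_cong)
 then have "norm (lam eps - cor ?t)*norm (lam eps + cor ?t) = 4/s1*norm (x eps - cor (a*eps))"
 unfolding norm_mult norm_of_real using s1 by simp
 also have "... <= 4/s1*(K*eps^2*(1 + eps^(n - 2)*(1 + abs (ln eps))))" using x e e' s1 by (intro mult_left_mono) auto
 finally have "norm (lam eps - cor ?t) * ?t <= 4/s1*(K*eps^2*(1 + eps^(n - 2)*(1 + abs (ln eps))))"
 using mult_left_mono[OF d norm_ge_zero, of "lam eps - cor ?t"] by linarith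
 then have "norm (lam eps - cor ?t) <= 4/s1*(K*eps^2*(1 + eps^(n - 2)*(1 + abs (ln eps)))) / ?t"
 by (simp only: pos_le_divide_eq[OF t])
 also have "... = (4*K/(s1 * sqrt al))*(eps^2/sqrt eps*(1 + eps^(n - 2)*(1 + abs (ln eps))))" by (simp add: real_sqrt_mult mult_ac)
 also have "eps^2/sqrt eps = eps * sqrt eps" using e real_div_sqrt[of eps] unfolding power2_eq_square times_divide_eq_right[symmetric] by simp
 finally show ?thesis .
 qed
 \<comment> \<open>For |l| > 2 the factor eps^(n-2) absorbs the logarithm; for |l| = 2 it equals
   1.\<close>
 have wt: "1 + eps^(n - 2)*(1 + \<bar>ln eps\<bar>) <= 4 * \<bar>1 + (if (abs l) = 2 then 1 else 0)*ln eps\<bar>" if e: "0 < eps" "eps < e'" for eps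
 proof -
 have e4: "eps < exp (-4)" using e e' by simp
 have "exp (-4::real) < 1" by simp
 then have e1': "eps < 1" using e4 by linarith
 have ln4: "ln eps < - 4" using e4 e(1) by (metis exp_gt_zero ln_exp ln_less_cancel_iff)
 show ?thesis
 proof (cases "abs l = 2")
 case True
 then have "n = 2" by (simp add: n_def)
 then show ?thesis using True ln4 by simp
 next
 case False
 then have "3 <= n" using n l by (simp add: n_def)
 then have "eps^(n - 2) <= eps^1" using e e1' by (intro power_decreasing) auto
 then have "eps^(n - 2)*(1 + abs (ln eps)) <= eps*(1 + abs (ln eps))" by (intro mult_right_mono) auto
 also have "... <= 2"
 proof -
 have "ln (1/eps) <= 1/eps - 1" using e by (intro ln_le_minus_one) simp
 then have "abs (ln eps) <= 1/eps" using e ln4 by (simp add: ln_div)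
 then have "eps*abs (ln eps) <= eps*(1/eps)" using e by (intro mult_left_mono) auto
 moreover have "eps*(1/eps) = 1" using e by simp
 ultimately show ?thesis using e e1' unfolding distrib_left by linarith
 qed
 finally show ?thesis using False by simp
 qed
 qed
 show thesis
 proof (rule that[OF al e'(1)])
 show "{0<..<e'} \<subseteq> I" using e1(2) m(2) e' by force
 show "in_fourth_quadrant (lam eps) & (\<exists>H. resonant_state (V eps) (lam eps) l H)" if e: "0 < eps" "eps < e'" for eps
 proof
 show "in_fourth_quadrant (lam eps)" by (rule q4[OF e])
 then have "0 < Re (lam eps)" by (simp add: in_fourth_quadrant_def)
 then show "\<exists>H. resonant_state (V eps) (lam eps) l H"
 using x e e' by (intro m(9)[OF _ _ n_def[symmetric] _ _ _ lam2]) auto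
 qed
 show "(%eps. lam eps - cor (sqrt (al*eps))) \<in> O[at_right 0](%eps. cor
 (eps powr (3/2)*(1 + (if (abs l) = 2 then 1 else 0)*ln eps)))"
 proof (rule bigoI[where c="4*K/(s1 * sqrt al)*4"])
 have "\<forall>\<^sub>F eps in at_right 0. eps \<in> {0<..<e'}" by (rule eventually_at_right_real[OF e'(1)])
 then show "\<forall>\<^sub>F eps in at_right 0. norm (lam eps - cor (sqrt (al*eps))) <= 4*K/(s1 * sqrt al)*4 *
 norm (cor (eps powr (3/2)*(1 + (if (abs l) = 2 then 1 else 0)*ln eps)))"
 proof eventually_elim
 case (elim eps)
 then have e: "0 < eps" "eps < e'" by auto
 have p: "eps powr (3/2) = eps * sqrt eps"
 using e powr_add[of eps 1 "1/2"] by (simp add: powr_half_sqrt)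
 have "norm (lam eps - cor (sqrt (al*eps))) <= (4*K/(s1 * sqrt al))*(eps * sqrt eps*(1 + eps^(n - 2)*(1 + abs (ln eps))))"
 by (rule bound[OF e])
 also have "... <= (4*K/(s1 * sqrt al))*(eps * sqrt eps*(4 * \<bar>1 + (if (abs l) = 2 then 1 else 0)*ln eps\<bar>))"
 using wt[OF e] s(3) s1 al e by (intro mult_left_mono) auto
 also have "... = 4*K/(s1 * sqrt al)*4*norm (cor (eps powr (3/2)*(1 + (if (abs l) = 2 then 1 else 0)*ln eps)))"
 unfolding p norm_of_real abs_mult using e by simp
 finally show ?case .
 qed
 qed
 qed
qed

lemma norm_exp_minus_1_le:
 fixes z :: complex assumes "norm z <= 1" shows "norm (exp z - 1) <= exp 1*norm z"
proof -
 have "norm (exp z - exp 0) <= exp 1*norm (z - 0)"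
 proof (rule field_differentiable_bound[of "cball 0 1" exp exp])
 show "norm (exp w) <= exp 1" if "w \<in> cball 0 1" for w :: complex
 using that complex_Re_le_cmod[of w] by simp
 qed (use assms in "auto intro!: derivative_eq_intros")
 then show ?thesis by simp
qed

text \<open>From lam^2 = 4x/s1 and x = exp(W + om + c) one gets lam = exp(b + W/2) exp(om/2) with b
  = (c - ln(s1/4))/2. The last factor is 1 + O(eps), and Im c = pi gives Im b = pi/2. The same
  function \<open>lam\<close> serves both signs of the angular momentum.\<close>

lemma resonances_1:
 assumes ev: "has_eigenvalue_rising_to_zero I V l" and l: "abs l = 1"
 obtains al b e lam where "0 < al" "Im b = pi/2" "0 < e" "{0<..<e} \<subseteq> I"
 "!!eps k. 0 < eps ==> eps < e ==> abs k = 1 ==> in_fourth_quadrant (lam eps) & (\<exists>H. resonant_state (V eps) (lam eps) k H)"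
 "(%eps. lam eps/exp (b + 1/2*lambert_W (-1) (cor (2*eps*al*exp (- 2*Re b)))) - 1)
 \<in> O[at_right 0](%eps. cor eps)"
proof -
 have l0: "l ~= 0" and n: "1 = nat (abs l)" using l by auto
 obtain r A B C delta0 where m: "0 < r" "r <= e1" "0 <= A" "0 < B" "0 <= C"
 "!!eps. abs eps < r ==> continuous_on (ball 0 r) (%x. delta0 x eps)"
 "!!x eps. abs eps < r ==> norm x < r ==> norm (delta0 x eps - (cor (B*eps) - cor A*x)) <= C*(abs eps + norm x)^2"
 "!!x eps. abs eps < r ==> norm x < r ==> 0 <= Im x ==> Im (delta0 x eps) <= 0"
 "!!x eps lam k. abs eps < r ==> norm x < r ==> nat (abs k) = 1 ==> 0 < Re x ==> hQ 1 x ~= 0 ==> hq 1 x = delta0 x eps ==>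
 lam\<^sup>2 = 4*x/cor s1 ==> 0 < Re lam ==> \<exists>H. resonant_state (V eps) lam k H"
 by (rule matching_branch[OF ev l0 n]) blast
 define c where "c = Complex (A - 2*euler_mascheroni) pi"
 define W0 where "W0 eps = lambert_W (-1) (cor (B*eps*exp (2*euler_mascheroni - A)))" for eps
 obtain K e where s: "0 < e" "0 <= K" "!!eps. 0 < eps ==> eps < e ==>
 \<exists>om x. norm om <= K*eps & x = exp (W0 eps + om + c) & abs (Im (W0 eps + om + c)) < pi/2 &
 0 < Re x & Im x < 0 & norm x < r & hQ 1 x ~= 0 & hq 1 x = delta0 x eps"
 by (rule matching_solution_1[OF m(4,5,1,6,7,8), folded c_def W0_def]) (assumption | (rule that; assumption))+
 from s(3) have "\<forall>eps. \<exists>om. 0 < eps & eps < e --> norm om <= K*eps & abs (Im (W0 eps + om + c)) < pi/2 &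
 0 < Re (exp (W0 eps + om + c)) & Im (exp (W0 eps + om + c)) < 0 & norm (exp (W0 eps + om + c)) < r & hQ 1 (exp (W0 eps + om + c)) ~= 0 &
 hq 1 (exp (W0 eps + om + c)) = delta0 (exp (W0 eps + om + c)) eps" (is "\<forall>eps. \<exists>om. ?R eps om")
 proof (intro allI)
 fix eps show "\<exists>om. ?R eps om"
 proof (cases "0 < eps & eps < e")
 case True
 then obtain om x where "norm om <= K*eps & x = exp (W0 eps + om + c) & abs (Im (W0 eps + om + c)) < pi/2 &
 0 < Re x & Im x < 0 & norm x < r & hQ 1 x ~= 0 & hq 1 x = delta0 x eps" using s(3)[of eps] by blast
 then have "?R eps om" by (elim conjE, hypsubst) (intro impI conjI; assumption)
 then show ?thesis by (rule exI)
 qed (simp only: simp_thms)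
 qed
 then obtain om where om: "\<forall>eps. 0 < eps & eps < e --> norm (om eps) <= K*eps & abs (Im (W0 eps + om eps + c)) < pi/2 &
 0 < Re (exp (W0 eps + om eps + c)) & Im (exp (W0 eps + om eps + c)) < 0 & norm (exp (W0 eps + om eps + c)) < r & hQ 1 (exp (W0 eps + om eps + c)) ~= 0 &
 hq 1 (exp (W0 eps + om eps + c)) = delta0 (exp (W0 eps + om eps + c)) eps" by (rule choice[THEN exE])
 define b where "b = (c - cor (ln (s1/4)))/2"
 \<comment> \<open>Chosen so that 2 al exp(-2 Re b) = B exp(2 gamma - A), the factor of eps in the
   argument of W.\<close>
 define al where "al = 2*B/s1"
 have al: "0 < al" using m(4) s1 by (simp add: al_def)
 define lam where "lam eps = exp (b + (W0 eps + om eps)/2)" for eps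
 have lam2: "(lam eps)^2 = 4*exp (W0 eps + om eps + c)/cor s1" for eps
 proof -
 have "(lam eps)^2 = exp (2*(b + (W0 eps + om eps)/2))" unfolding lam_def by (rule exp_double[symmetric])
 also have "2*(b + (W0 eps + om eps)/2) = (W0 eps + om eps + c) - cor (ln (s1/4))" by (simp add: b_def field_simps)
 also have "exp ... = exp (W0 eps + om eps + c)/cor (s1/4)" using s1 by (simp add: exp_diff exp_of_real del: of_real_divide)
 finally show ?thesis by simp
 qed
 have arg: "B*eps*exp (2*euler_mascheroni - A) = 2*eps*al*exp (- 2*Re b)" for eps
 proof -
 have "- 2*Re b = (2*euler_mascheroni - A) + ln (s1/4)" by (simp add: b_def c_def)
 then have "exp (- 2*Re b) = exp (2*euler_mascheroni - A)*(s1/4)" using s1 by (simp only: exp_add) simp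
 then have "2*eps*al*exp (- 2*Re b) = 2*eps*(2*B/s1)*(exp (2*euler_mascheroni - A)*(s1/4))" by (simp only: al_def)
 also have "... = B*eps*exp (2*euler_mascheroni - A)" using s1 by simp
 finally show ?thesis by (rule sym)
 qed
 define e' where "e' = min e (min r (1/(K + 1)))"
 have e': "0 < e'" "e' <= e" "e' <= r" "e' <= 1/(K + 1)" using s(1,2) m(1) by (auto simp: e'_def)
 have q4: "in_fourth_quadrant (lam eps)" if "0 < eps" "eps < e'" for eps
 proof (rule fourth_quadrant_of_square)
 have w: "abs (Im (W0 eps + om eps + c)) < pi/2" "Im (exp (W0 eps + om eps + c)) < 0" using om that e' by auto
 show "Im ((lam eps)^2) < 0" unfolding lam2 using w(2) s1 by (simp add: divide_neg_pos del: Im_exp)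
 have "Im (b + (W0 eps + om eps)/2) = Im (W0 eps + om eps + c)/2" by (simp add: b_def)
 then have "abs (Im (b + (W0 eps + om eps)/2)) < pi/2" using w(1) by linarith
 then have "- (pi/2) <= Im (b + (W0 eps + om eps)/2)" "Im (b + (W0 eps + om eps)/2) <= pi/2" by linarith+
 then show "0 <= Re (lam eps)" unfolding lam_def Re_exp by (intro mult_nonneg_nonneg cos_ge_zero exp_ge_zero)
 qed
 show thesis
 proof (rule that[OF al _ e'(1)])
 show "Im b = pi/2" by (simp add: b_def c_def)
 show "{0<..<e'} \<subseteq> I" using e1(2) m(2) e' by force
 show "in_fourth_quadrant (lam eps) & (\<exists>H. resonant_state (V eps) (lam eps) k H)" if e: "0 < eps" "eps < e'" and k: "abs k = 1" for eps k
 proof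
 show "in_fourth_quadrant (lam eps)" by (rule q4[OF e])
 then have p: "0 < Re (lam eps)" by (simp add: in_fourth_quadrant_def)
 have w: "0 < Re (exp (W0 eps + om eps + c))" "norm (exp (W0 eps + om eps + c)) < r" "hQ 1 (exp (W0 eps + om eps + c)) ~= 0"
 "hq 1 (exp (W0 eps + om eps + c)) = delta0 (exp (W0 eps + om eps + c)) eps" using om e e' by (simp_all del: Re_exp norm_exp_eq_Re)
 have "abs eps < r" "nat (abs k) = 1" using e e' k by auto
 then show "\<exists>H. resonant_state (V eps) (lam eps) k H" by (rule m(9)[OF _ w(2) _ w(1,3,4) lam2 p])
 qed
 show "(%eps. lam eps/exp (b + 1/2*lambert_W (-1) (cor (2*eps*al*exp (- 2*Re b)))) - 1)
 \<in> O[at_right 0](%eps. cor eps)"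
 proof (rule bigoI[where c="exp 1*K"])
 have "\<forall>\<^sub>F eps in at_right 0. eps \<in> {0<..<e'}" by (rule eventually_at_right_real[OF e'(1)])
 then show "\<forall>\<^sub>F eps in at_right 0. norm (lam eps/exp (b + 1/2*lambert_W (-1) (cor (2*eps*al*exp (- 2*Re b)))) - 1)
 <= exp 1*K*norm (cor eps)"
 proof eventually_elim
 case (elim eps)
 then have e: "0 < eps" "eps < e'" by auto
 have w: "norm (om eps) <= K*eps" using om e e' by simp
 have "K*eps <= (K + 1)*(1/(K + 1))" using e e' s(2) by (intro mult_mono) auto
 then have "norm (om eps/2) <= 1" using w s(2) by (simp add: norm_divide)
 note B = norm_exp_minus_1_le[OF this]
 have "lam eps/exp (b + 1/2*lambert_W (-1) (cor (2*eps*al*exp (- 2*Re b)))) = exp (om eps/2)"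
 proof -
 have "lam eps = exp (b + 1/2*W0 eps)*exp (om eps/2)" by (simp add: lam_def exp_add[symmetric] add_divide_distrib add.assoc)
 then show ?thesis unfolding arg[symmetric] W0_def by simp
 qed
 then have "norm (lam eps/exp (b + 1/2*lambert_W (-1) (cor (2*eps*al*exp (- 2*Re b)))) - 1) <= exp 1*norm (om eps/2)"
 using B by simp
 also have "norm (om eps/2) <= K*eps"
 proof -
 have "norm (om eps/2) = norm (om eps)/2" by (simp add: norm_divide)
 then show ?thesis using w norm_ge_zero[of "om eps"] by linarith
 qed
 then have "exp 1*norm (om eps/2) <= exp 1*(K*eps)" by (intro mult_left_mono) auto
 finally show ?case using e by simp
 qed
 qed
 qed
qed

end

section \<open>Pointwise normalisation of the profiles and conclusion\<close>

text \<open>Profiles from \<open>radial_borel_representative\<close> obey the bounds only almost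
  everywhere. Truncation by max and min enforces them for every s; since V itself satisfies them
  almost everywhere, the truncated profiles still represent the same potentials.\<close>

lemma radial_family_exists:
 assumes I: "open I" "0 \<in> I" and VL: "!!eps. eps \<in> I ==> V eps \<in> Linf" and rad: "!!eps. eps \<in> I ==> is_radial (V eps)"
 and supp: "\<exists>R. \<forall>\<^sub>F eps in nhds 0. supported_in_radius R (V eps)"
 and smooth: "Linf_smooth_on I V" and deriv: "Linf_has_derivative_at V V' 0"
 and V': "AE x in lebesgue. V' x \<ge> 0" "\<not> (AE x in lebesgue. V' x = 0)"
 obtains q M0 C1 e1 s1 where "radial_family I V V' q M0 C1 e1 s1"
proof -
 obtain R d0 where R: "0 < d0" "!!eps. abs eps < d0 ==> supported_in_radius R (V eps)"
 using supp unfolding eventually_nhds_metric by (auto simp: dist_real_def)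
 obtain d1 where d1: "0 < d1" "!!eps. abs eps < d1 ==> eps \<in> I"
 using I unfolding open_dist by (auto simp: dist_real_def)
 obtain d2 where d2: "0 < d2" "!!h. h ~= 0 ==> abs h < d2 ==> AE x in lebesgue. abs (V (0 + h) x - V 0 x - h*V' x) <= 1*abs h"
 using Linf_has_derivative_atD[OF deriv, of 1] by auto
 define e1 where "e1 = min d0 (min d1 d2)"
 have e1: "0 < e1" using R d1 d2 by (simp add: e1_def)
 have V'L: "V' \<in> Linf" using deriv by (simp add: Linf_has_derivative_at_def)
 obtain D where D: "AE x in lebesgue. abs (V' x) <= D" using V'L by (auto simp: Linf_def)
 obtain M where M: "AE x in lebesgue. abs (V 0 x) <= M" using VL[OF I(2)] by (auto simp: Linf_def)
 \<comment> \<open>Near 0 the difference quotient of the family is within 1 of V', and |V'| <=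
   D.\<close>
 define C1 where "C1 = abs D + 1"
 have C1: "0 <= C1" by (simp add: C1_def)
 define s1 where "s1 = R^2 + 1"
 have s1: "0 < s1" by (simp add: s1_def add_nonneg_pos)
 have "\<exists>p. p \<in> borel_measurable borel & (AE x in lebesgue. V eps x = p (sq x))" if "eps \<in> I" for eps
 using radial_borel_representative[of "V eps"] VL[OF that] rad[OF that] unfolding Linf_def by blast
 then have "\<forall>eps. \<exists>p. eps \<in> I --> p \<in> borel_measurable borel & (AE x in lebesgue. V eps x = p (sq x))" by blast
 then obtain p where "\<forall>eps. eps \<in> I --> p eps \<in> borel_measurable borel & (AE x in lebesgue. V eps x = p eps (sq x))" by (rule choice[THEN exE])
 then have p: "p eps \<in> borel_measurable borel" "AE x in lebesgue. V eps x = p eps (sq x)" if "eps \<in> I" for eps using that by auto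
 define q0 where "q0 s = (if s1 <= s then 0 else max (- abs M) (min (abs M) (p 0 s)))" for s
 define q where "q eps s = (if s1 <= s then 0 else max (q0 s - C1*abs eps) (min (q0 s + C1*abs eps) (p eps s)))" for eps s
 have q0: "q 0 = q0" by (auto simp: q_def q0_def fun_eq_iff)
 have q0b: "abs (q0 s) <= abs M" for s by (auto simp: q0_def)
 have lip: "abs (q eps s - q0 s) <= C1*abs eps" for eps s
 proof -
 have "0 <= C1*abs eps" using C1 by simp
 then have "\<bar>max (u - C1*abs eps) (min (u + C1*abs eps) v) - u\<bar> <= C1*abs eps" for u v by (auto simp: max_def min_def abs_le_iff)
 moreover have "q0 s = 0" if "s1 <= s" using that by (simp add: q0_def)
 ultimately show ?thesis using \<open>0 <= C1*abs eps\<close> by (simp add: q_def)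
 qed
 have q0m: "q0 \<in> borel_measurable borel" unfolding q0_def[abs_def] using p(1)[OF I(2)] by measurable
 have out: "AE x in lebesgue. s1 <= sq x --> V eps x = 0" if "abs eps < e1" for eps
 proof -
 have "AE x in lebesgue. norm x > R --> V eps x = 0" using R(2)[of eps] that by (simp add: e1_def supported_in_radius_def)
 then show ?thesis
 proof eventually_elim
 case (elim x)
 show ?case
 proof
 assume "s1 <= sq x"
 then have "R^2 < (norm x)^2" by (simp add: s1_def sq_eq_norm)
 then have "R < norm x" using power2_less_imp_less by fastforce
 then show "V eps x = 0" using elim by simp
 qed
 qed
 qed
 have V0: "AE x in lebesgue. V 0 x = q0 (sq x)"
 using p(2)[OF I(2)] M out[of 0, unfolded abs_zero, OF e1]
 by eventually_elim (auto simp: q0_def)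
 have Ve: "AE x in lebesgue. V eps x = q eps (sq x)" if e: "abs eps < e1" for eps
 proof (cases "eps = 0")
 case True
 then show ?thesis using V0 by (simp add: q0)
 next
 case False
 have e2: "abs eps < d2" "eps \<in> I" using e d1(2) by (auto simp: e1_def)
 have "AE x in lebesgue. abs (V (0 + eps) x - V 0 x - eps*V' x) <= 1*abs eps" by (rule d2(2)[OF False e2(1)])
 then show ?thesis using p(2)[OF e2(2)] V0 out[OF e] D
 proof eventually_elim
 case (elim x)
 have "abs (eps*V' x) <= abs eps*abs D" unfolding abs_mult using elim by (intro mult_left_mono) auto
 then have "abs (V eps x - q0 (sq x)) <= C1*abs eps" using elim by (simp add: C1_def algebra_simps)
 then show ?case using elim by (auto simp: q_def)
 qed
 qed
 have "radial_family I V V' q (abs M + C1*e1) C1 e1 s1"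
 proof
 fix eps s assume e: "abs eps < e1"
 have "abs (q eps s) <= abs M + C1*abs eps" using lip[of eps s] q0b[of s] by linarith
 also have "... <= abs M + C1*e1" using e C1 by (intro add_left_mono mult_left_mono) auto
 finally show "abs (q eps s) <= abs M + C1*e1" .
 show "abs (q eps s - q 0 s) <= C1*abs eps" unfolding q0 by (rule lip)
 show "q eps \<in> borel_measurable borel" unfolding q_def[abs_def] using p(1)[of eps] d1(2)[of eps] e q0m by (simp add: e1_def)
 show "eps \<in> I" using e d1(2) by (simp add: e1_def)
 show "s1 <= s ==> q eps s = 0" by (simp add: q_def)
 show "AE x in lebesgue. V eps x = q eps (sq x)" by (rule Ve[OF e])
 qed (use I VL smooth deriv V' e1 C1 s1 in auto)
 then show thesis by (rule that)
qed

theorem theorem1p2: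
  fixes I :: "real set"
    and V :: "real \<Rightarrow> real^2 \<Rightarrow> real"
    and V' :: "real^2 \<Rightarrow> real"
  assumes "open I" and "is_interval I" and "0 \<in> I"
    and "\<And>\<epsilon>. \<epsilon> \<in> I \<Longrightarrow> V \<epsilon> \<in> Linf"
    and "\<And>\<epsilon>. \<epsilon> \<in> I \<Longrightarrow> is_radial (V \<epsilon>)"
    and "\<And>\<epsilon>. \<epsilon> \<in> I \<Longrightarrow> \<exists>R. supported_in_radius R (V \<epsilon>)"
    and "\<exists>R. \<forall>\<^sub>F \<epsilon> in nhds 0. supported_in_radius R (V \<epsilon>)"
    and "Linf_smooth_on I V"
    and "Linf_has_derivative_at V V' 0"
    and "AE x in lebesgue. V' x \<ge> 0"
    and "\<not> (AE x in lebesgue. V' x = 0)"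
  shows
    "((\<exists>l. \<bar>l\<bar> > 1 \<and> has_eigenvalue_rising_to_zero I V l) \<longrightarrow> has_zero_eigenvalue (V 0)) \<and>
     (\<exists>(\<alpha>\<^sub>0 :: int \<Rightarrow> real) (\<epsilon>\<^sub>0 :: int \<Rightarrow> real) (res :: int \<Rightarrow> real \<Rightarrow> complex).
        (\<forall>l. \<bar>l\<bar> > 1 \<longrightarrow> has_eigenvalue_rising_to_zero I V l \<longrightarrow>
           \<alpha>\<^sub>0 l > 0 \<and> \<epsilon>\<^sub>0 l > 0 \<and> {0<..<\<epsilon>\<^sub>0 l} \<subseteq> I \<and>
           (\<forall>\<epsilon>\<in>{0<..<\<epsilon>\<^sub>0 l}.
              is_resonance (V \<epsilon>) (res l \<epsilon>) \<and> in_fourth_quadrant (res l \<epsilon>)) \<and>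
           (\<lambda>\<epsilon>. res l \<epsilon> - complex_of_real (sqrt (\<alpha>\<^sub>0 l * \<epsilon>)))
             \<in> O[at_right 0](\<lambda>\<epsilon>. complex_of_real
                  (\<epsilon> powr (3/2) * (1 + (if \<bar>l\<bar> = 2 then 1 else 0) * ln \<epsilon>)))) \<and>
        (\<forall>\<epsilon>>0. resonances_with_multiplicity (V \<epsilon>)
           {l. \<bar>l\<bar> > 1 \<and> has_eigenvalue_rising_to_zero I V l \<and> \<epsilon> < \<epsilon>\<^sub>0 l}
           (\<lambda>l. res l \<epsilon>))) \<and>
     ((\<exists>l. \<bar>l\<bar> = 1 \<and> has_eigenvalue_rising_to_zero I V l) \<longrightarrow>
        has_p_resonance (V 0) \<and>
        (\<exists>(\<alpha>\<^sub>0 :: real) (b :: complex) (\<epsilon>\<^sub>0 :: real) (res :: int \<Rightarrow> real \<Rightarrow> complex).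
           \<alpha>\<^sub>0 > 0 \<and> Im b = pi / 2 \<and> \<epsilon>\<^sub>0 > 0 \<and> {0<..<\<epsilon>\<^sub>0} \<subseteq> I \<and>
           (\<forall>l. \<bar>l\<bar> = 1 \<longrightarrow> has_eigenvalue_rising_to_zero I V l \<longrightarrow>
              (\<forall>\<epsilon>\<in>{0<..<\<epsilon>\<^sub>0}.
                 is_resonance (V \<epsilon>) (res l \<epsilon>) \<and> in_fourth_quadrant (res l \<epsilon>)) \<and>
              (\<lambda>\<epsilon>. res l \<epsilon> /
                     exp (b + 1/2 * lambert_W (-1)
                            (complex_of_real (2 * \<epsilon> * \<alpha>\<^sub>0 * exp (- 2 * Re b)))) - 1)
                \<in> O[at_right 0](\<lambda>\<epsilon>. complex_of_real \<epsilon>)) \<and>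
           (\<forall>\<epsilon>\<in>{0<..<\<epsilon>\<^sub>0}. resonances_with_multiplicity (V \<epsilon>)
              {l. \<bar>l\<bar> = 1 \<and> has_eigenvalue_rising_to_zero I V l}
              (\<lambda>l. res l \<epsilon>))))"
proof -
 obtain q M0 C1 e1 s1 where "radial_family I V V' q M0 C1 e1 s1"
 by (rule radial_family_exists[OF assms(1,3,4,5,7-11)])
 then interpret radial_family I V V' q M0 C1 e1 s1 .
 let ?ev = "has_eigenvalue_rising_to_zero I V"
 \<comment> \<open>For |l| > 1 the constant, the range of eps and the branch are chosen separately
   for each l, even for l and -l.\<close>
 have "\<forall>l. \<exists>(al :: real) (e :: real) (lam :: real => complex). abs l > 1 & ?ev l -->
 0 < al & 0 < e & {0<..<e} \<subseteq> I &
 (\<forall>eps. 0 < eps --> eps < e --> in_fourth_quadrant (lam eps) & (\<exists>H. resonant_state (V eps) (lam eps) l H)) &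
 (%eps. lam eps - cor (sqrt (al*eps))) \<in> O[at_right 0](%eps. cor
 (eps powr (3/2)*(1 + (if (abs l) = 2 then 1 else 0)*ln eps)))"
 (is "\<forall>l. \<exists>al e lam. ?Q l al e lam")
 proof
 fix l :: int
 show "\<exists>al e lam. ?Q l al e lam"
 proof (cases "abs l > 1 & ?ev l")
 case True
 obtain al e lam where "0 < al" "0 < e" "{0<..<e} \<subseteq> I"
 "!!eps. 0 < eps ==> eps < e ==> in_fourth_quadrant (lam eps) & (\<exists>H. resonant_state (V eps) (lam eps) l H)"
 "(%eps. lam eps - cor (sqrt (al*eps))) \<in> O[at_right 0](%eps. cor
 (eps powr (3/2)*(1 + (if (abs l) = 2 then 1 else 0)*ln eps)))"
 by (rule resonances_ge_2[OF conjunct2[OF True] conjunct1[OF True]]) (rule that; assumption)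
 then have "?Q l al e lam" by (intro impI conjI allI) blast+
 then show ?thesis by blast
 qed blast
 qed
 then obtain al0 where "\<forall>l. \<exists>e lam. ?Q l (al0 l) e lam" by (rule choice[THEN exE])
 then obtain eps0 where "\<forall>l. \<exists>lam. ?Q l (al0 l) (eps0 l) lam" by (rule choice[THEN exE])
 then obtain res where res: "\<forall>l. ?Q l (al0 l) (eps0 l) (res l)" by (rule choice[THEN exE])
 have nonzero: "in_fourth_quadrant z ==> z ~= 0" for z by (auto simp: in_fourth_quadrant_def)
 show ?thesis
 proof (intro conjI impI, goal_cases)
 case 1
 then show ?case using threshold_states(1) by blast
 next
 case 2
 show ?case
 proof (rule exI[of _ al0], rule exI[of _ eps0], rule exI[of _ res], intro conjI allI impI ballI)
 fix l :: int assume l: "abs l > 1" "?ev l"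
 note r = res[rule_format, OF conjI[OF l]]
 show "al0 l > 0" "eps0 l > 0" "{0<..<eps0 l} \<subseteq> I" using r by blast+
 show "(%eps. res l eps - cor (sqrt (al0 l*eps))) \<in> O[at_right 0](%eps. cor
 (eps powr (3/2)*(1 + (if (abs l) = 2 then 1 else 0)*ln eps)))" using r by blast
 fix eps assume "eps \<in> {0<..<eps0 l}"
 then have "in_fourth_quadrant (res l eps)" "\<exists>H. resonant_state (V eps) (res l eps) l H" using r by auto
 then show "in_fourth_quadrant (res l eps)" "is_resonance (V eps) (res l eps)"
 using resonant_state_imp_resonance nonzero by blast+
 next
 fix eps :: real assume e: "0 < eps"
 show "resonances_with_multiplicity (V eps) {l. abs l > 1 & ?ev l & eps < eps0 l} (%l. res l eps)"
 proof (rule resonant_states_multiplicity)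
 fix l assume "l \<in> {l. abs l > 1 & ?ev l & eps < eps0 l}"
 then have l: "abs l > 1" "?ev l" "eps < eps0 l" by auto
 show "\<exists>H. resonant_state (V eps) (res l eps) l H" using res[rule_format, OF conjI[OF l(1,2)]] e l(3) by blast
 qed
 qed
 next
 case 3
 then show ?case using threshold_states(2) by blast
 next
 case 4
 then obtain l0 where l0: "abs l0 = 1" "?ev l0" by blast
 obtain al b e lam where a: "0 < al" "Im b = pi/2" "0 < e" "{0<..<e} \<subseteq> I"
 "!!eps k. 0 < eps ==> eps < e ==> abs k = 1 ==> in_fourth_quadrant (lam eps) & (\<exists>H. resonant_state (V eps) (lam eps) k H)"
 "(%eps. lam eps/exp (b + 1/2*lambert_W (-1) (cor (2*eps*al*exp (- 2*Re b)))) - 1)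
 \<in> O[at_right 0](%eps. cor eps)"
 by (rule resonances_1[OF l0(2,1)]) blast
 \<comment> \<open>One branch serves l = 1 and l = -1. If both occur, their common value is counted
   twice, and the two independent partial waves provide the multiplicity.\<close>
 show ?case
 proof (rule exI[of _ al], rule exI[of _ b], rule exI[of _ e], rule exI[of _ "%_. lam"], intro conjI allI impI ballI a(1-4,6))
 fix l :: int and eps assume "abs l = 1" "eps \<in> {0<..<e}"
 then have "in_fourth_quadrant (lam eps)" "\<exists>H. resonant_state (V eps) (lam eps) l H" using a(5) by auto
 then show "in_fourth_quadrant (lam eps)" "is_resonance (V eps) (lam eps)"
 using resonant_state_imp_resonance nonzero by blast+
 next
 fix eps assume e: "eps \<in> {0<..<e}"
 show "resonances_with_multiplicity (V eps) {l. abs l = 1 & ?ev l} (%l. lam eps)"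
 by (rule resonant_states_multiplicity) (use a(5) e in auto)
 qed
 qed
qed

end
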